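(* Let $(b,\beta,\sigma,K)$ be admissible parameters and suppose there exist $p\ge2$ and $\eta\in(0,1)$ such that $[K]_{\eta,p,T}<\infty$ for each $T>0$. Then: (a) For each $\mu\in\mathcal{M}_{lf}^-$ there exists a unique solution $\psi(\cdot,\mu)\in L^2_{loc}(\mathbb{R}_+;\mathbb{C}_-^m)$ of $$\psi(t,\mu)=\int_{[0,t)}K(t-s)\mu(ds)+\int_0^tK(t-s)R(\psi(s,\mu))ds,\qquad t\ge0 .$$ (b) For each $T>0$ and $q\in[1,p]$ this unique solution satisfies $$\|\psi(\cdot,\mu)\|_{L^q([0,T])}\le2|\mu|([0,T])\|E_{\beta^\top}\|_{L^q([0,T])}+\left(\sum_{i=1}^m\frac{\sigma_i^2}{2}\right)|\mu|([0,T])^2\|E_{\beta^\top}\|_{L^q([0,T])}\|E_{\beta^\top}\|^2_{L^2([0,T])},$$ and if $\mathrm{Im}(\mu)=0$, then even $$\|\psi(\cdot,\mu)\|_{L^q([0,T])}\le|\mu|([0,T])\|E_{\beta^\top}\|_{L^q([0,T])}.$$ Finally, there exists a constant $C$ independent of $\mu$ such that $$\|\psi(\cdot,\mu)\|_{W^{\eta,p}([0,T])}\le\|\psi(\cdot,\mu)\|_{L^p([0,T])}+C(1+[K]_{\eta,p,T})\left(1+|\mu|([0,T])+\|\psi(\cdot,\mu)\|^2_{L^2([0,T])}\right).$$ (c) If $p\ge3$, then the function $\psi(\cdot,\mu)$ is continuous at each $t_0\ge0$ at which the convolution $K*\mu$ is continuous.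
   Context: Fix $m\in\mathbb{N}$, $\mathbb{R}_+=[0,\infty)$, $\mathbb{C}_-^m=\{u\in\mathbb{C}^m:\mathrm{Re}(u)\le0\}$ (componentwise), $\langle z,w\rangle=\sum_{i=1}^mz_iw_i$ (no conjugation). Admissible parameters: $(b,\beta,\sigma,K)$ is admissible if (i) $b\in\mathbb{R}_+^m$; (ii) $\beta=(\beta_{ij})\in\mathbb{R}^{m\times m}$ with $\beta_{ij}\ge0$ for $i\ne j$; (iii) $\sigma=(\sigma_1,\dots,\sigma_m)^\top\in\mathbb{R}_+^m$; (iv) $K=\mathrm{diag}(K_1,\dots,K_m)$ with scalar kernels $K_i\in L^2_{loc}(\mathbb{R}_+,\mathbb{R})$; (v) there are $\gamma\in(0,2]$, $C_1>0$ with $\int_0^h|K_i(r)|^2dr\le C_1h^\gamma$ for $h\in[0,1]$ and all $i$, and for each $T>0$ there is $C_2(T)>0$ with $\int_0^T|K_i(r+h)-K_i(r)|^2dr\le C_2(T)h^\gamma$ for $h\in[0,1]$ and all $i$; (vi) for each $i$ and $h\in[0,1]$ the shifted kernel $t\mapsto K_i(t+h)$ is nonnegative, not identically zero, nonincreasing and continuous on $(0,\infty)$, and its resolvent of the first kind $L$ (the measure of locally bounded variation on $\mathbb{R}_+$ whose convolution with the shifted kernel equals $1$) is nonnegative and $s\mapsto L([s,s+t])$ is nonincreasing for all $t\ge0$. $R_i(u)=\langle u,\beta^i\rangle+\frac{\sigma_i^2}{2}u_i^2$ with $\beta^i$ the $i$-th column of $\beta$, $R=(R_1,\dots,R_m)^\top$.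 $\mathcal{M}_{lf}$ is the set of $\mathbb{C}^m$-valued set functions $\mu$ on $\mathbb{R}_+$ whose restriction to $[0,T]$ is a finite $\mathbb{C}^m$-valued measure for every $T>0$; $|\mu|$ is the total variation; $\mathcal{M}_{lf}^-$ is the subset with $\mathrm{Re}(\mu)\le0$. $K*\mu(t)=\int_{[0,t)}K(t-s)\mu(ds)$. Resolvents: $f*g(t)=\int_0^tf(t-s)g(s)ds$; for $B\in\mathbb{R}^{m\times m}$ and $K_B(t)=-K(t)B$, $R_B\in L^1_{loc}$ is defined by $R_B*K_B=K_B*R_B=K_B-R_B$ and $E_B=K-R_B*K$; here $B=\beta^\top$. Norms: $\|\cdot\|_2$ is the operator norm on matrices (used in $L^q$ norms of matrix functions); $\|g\|_{W^{\eta,p}([0,T])}=\left(\int_0^T|g(t)|^pdt+\int_0^T\int_0^T\frac{|g(t)-g(s)|^p}{|t-s|^{1+\eta p}}ds\,dt\right)^{1/p}$; $[K]_{\eta,p,T}=\left(\int_0^Tt^{-\eta p}\|K(t)\|_2^pdt+\int_0^T\int_0^T\frac{\|K(t)-K(s)\|_2^p}{|t-s|^{1+\eta p}}ds\,dt\right)^{1/p}$. *)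

theory Defs
  imports "HOL-Analysis.Analysis" "HOL-Library.Disjoint_Sets"
begin

section \<open>Locally finite vector-valued measures on the half-line\<close>

text \<open>
  A locally finite vector-valued measure on \<open>[0,\<infinity>)\<close> need not have a value on unbounded sets. It is
  encoded as a set function of which only the values on bounded Borel subsets of \<open>[0,\<infinity>)\<close> matter.
  The condition below also gives the value 0 on the empty set (take every \<open>A n\<close> empty).
\<close>

definition bdd_borel :: "real set set" where
  "bdd_borel = {A \<in> sets borel. bounded A \<and> A \<subseteq> {0..}}"

definition lf_measure :: "(real set \<Rightarrow> 'a::real_normed_vector) \<Rightarrow> bool" where
  "lf_measure \<mu> \<longleftrightarrow>
     (\<forall>T>0. \<forall>A :: nat \<Rightarrow> real set.
        (\<forall>n. A n \<in> sets borel \<and> A n \<subseteq> {0..T}) \<and> disjoint_family A \<longrightarrow>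
        (\<lambda>n. \<mu> (A n)) sums \<mu> (\<Union>n. A n))"

definition lf_measure_nonpos_Re :: "(real set \<Rightarrow> complex ^ 'm) \<Rightarrow> bool" where
  "lf_measure_nonpos_Re \<mu> \<longleftrightarrow> lf_measure \<mu> \<and> (\<forall>A\<in>bdd_borel. \<forall>i. Re (\<mu> A $ i) \<le> 0)"

definition Im_measure_zero :: "(real set \<Rightarrow> complex ^ 'm) \<Rightarrow> bool" where
  "Im_measure_zero \<mu> \<longleftrightarrow> (\<forall>A\<in>bdd_borel. \<forall>i. Im (\<mu> A $ i) = 0)"

definition total_variation :: "(real set \<Rightarrow> 'a::real_normed_vector) \<Rightarrow> real set \<Rightarrow> ennreal" where
  "total_variation \<mu> A =
     (SUP P \<in> {P. finite P \<and> partition_on A P \<and> P \<subseteq> sets borel}. \<Sum>B\<in>P. ennreal (norm (\<mu> B)))"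

text \<open>
  Integrals against signed and complex measures go through the Jordan decomposition: the positive
  part of \<open>\<nu>\<close> is \<open>A \<mapsto> sup {\<nu> B | B \<subseteq> A}\<close>, and the negative part of \<open>\<nu>\<close> is the positive part of \<open>-\<nu>\<close>.
  (\<open>ennreal\<close> sends negative reals to 0, which is harmless because of \<open>B = {}\<close>.)
\<close>

definition jordan_pos :: "(real set \<Rightarrow> real) \<Rightarrow> real measure" where
  "jordan_pos \<nu> =
     measure_of UNIV (sets borel) (\<lambda>A. SUP B \<in> {B \<in> bdd_borel. B \<subseteq> A}. ennreal (\<nu> B))"

definition jordan_neg :: "(real set \<Rightarrow> real) \<Rightarrow> real measure" where
  "jordan_neg \<nu> = jordan_pos (\<lambda>A. - \<nu> A)"

definition signed_integrable :: "(real set \<Rightarrow> real) \<Rightarrow> real set \<Rightarrow> (real \<Rightarrow> real) \<Rightarrow> bool" where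
  "signed_integrable \<nu> A f \<longleftrightarrow>
     set_integrable (jordan_pos \<nu>) A f \<and> set_integrable (jordan_neg \<nu>) A f"

definition signed_integral :: "(real set \<Rightarrow> real) \<Rightarrow> real set \<Rightarrow> (real \<Rightarrow> real) \<Rightarrow> real" where
  "signed_integral \<nu> A f = (LINT s:A|jordan_pos \<nu>. f s) - (LINT s:A|jordan_neg \<nu>. f s)"

definition complex_integrable :: "(real set \<Rightarrow> complex) \<Rightarrow> real set \<Rightarrow> (real \<Rightarrow> real) \<Rightarrow> bool" where
  "complex_integrable \<nu> A f \<longleftrightarrow>
     signed_integrable (\<lambda>B. Re (\<nu> B)) A f \<and> signed_integrable (\<lambda>B. Im (\<nu> B)) A f"

definition complex_integral :: "(real set \<Rightarrow> complex) \<Rightarrow> real set \<Rightarrow> (real \<Rightarrow> real) \<Rightarrow> complex" where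
  "complex_integral \<nu> A f =
     Complex (signed_integral (\<lambda>B. Re (\<nu> B)) A f) (signed_integral (\<lambda>B. Im (\<nu> B)) A f)"


section \<open>Local Lebesgue spaces and convolutions\<close>

text \<open>Elements of \<open>L\<^sup>q\<^sub>l\<^sub>o\<^sub>c([0,\<infinity>))\<close> are represented by Borel functions; values at negative arguments
  are irrelevant.\<close>

definition Lq_loc :: "real \<Rightarrow> (real \<Rightarrow> 'a::{banach, second_countable_topology}) \<Rightarrow> bool" where
  "Lq_loc q f \<longleftrightarrow>
     set_borel_measurable lborel {0..} f \<and>
     (\<forall>T>0. set_integrable lborel {0..T} (\<lambda>t. norm (f t) powr q))"

text \<open>\<open>(f * g)(t) = \<integral>\<^sub>0\<^sup>t f(t-s) \<odot> g(s) ds\<close> for a product \<open>\<odot>\<close>.\<close>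

definition conv ::
  "('a \<Rightarrow> 'b \<Rightarrow> 'c::{banach, second_countable_topology}) \<Rightarrow> (real \<Rightarrow> 'a) \<Rightarrow> (real \<Rightarrow> 'b) \<Rightarrow> real \<Rightarrow> 'c"
where
  "conv prd f g t = (LINT s:{0..t}|lborel. prd (f (t - s)) (g s))"

definition conv_exists ::
  "('a \<Rightarrow> 'b \<Rightarrow> 'c::{banach, second_countable_topology}) \<Rightarrow> (real \<Rightarrow> 'a) \<Rightarrow> (real \<Rightarrow> 'b) \<Rightarrow> real \<Rightarrow> bool"
where
  "conv_exists prd f g t \<longleftrightarrow> set_integrable lborel {0..t} (\<lambda>s. prd (f (t - s)) (g s))"

definition cmat_vec :: "real ^ 'n ^ 'm \<Rightarrow> complex ^ 'n \<Rightarrow> complex ^ 'm" where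
  "cmat_vec A u = map_matrix complex_of_real A *v u"

definition conv_measure ::
  "(real \<Rightarrow> real ^ 'm ^ 'm) \<Rightarrow> (real set \<Rightarrow> complex ^ 'm) \<Rightarrow> real \<Rightarrow> complex ^ 'm"
where
  "conv_measure K \<mu> t =
     (\<chi> i. \<Sum>j\<in>UNIV. complex_integral (\<lambda>A. \<mu> A $ j) {0..<t} (\<lambda>s. K (t - s) $ i $ j))"

definition conv_measure_exists ::
  "(real \<Rightarrow> real ^ 'm ^ 'm) \<Rightarrow> (real set \<Rightarrow> complex ^ 'm) \<Rightarrow> real \<Rightarrow> bool"
where
  "conv_measure_exists K \<mu> t \<longleftrightarrow>
     (\<forall>i j. complex_integrable (\<lambda>A. \<mu> A $ j) {0..<t} (\<lambda>s. K (t - s) $ i $ j))"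


section \<open>Resolvents\<close>

text \<open>The equation \<open>k * L = 1\<close> is required for almost every \<open>t \<ge> 0\<close>: since \<open>k * L\<close> is an integral over
  \<open>[0,t)\<close>, it vanishes at \<open>t = 0\<close>.\<close>

definition is_resolvent_first_kind :: "(real \<Rightarrow> real) \<Rightarrow> (real set \<Rightarrow> real) \<Rightarrow> bool" where
  "is_resolvent_first_kind k L \<longleftrightarrow>
     lf_measure L \<and>
     (AE t in lborel. 0 \<le> t \<longrightarrow>
        signed_integrable L {0..<t} (\<lambda>s. k (t - s)) \<and>
        signed_integral L {0..<t} (\<lambda>s. k (t - s)) = 1)"

definition kernel_times :: "(real \<Rightarrow> real ^ 'm ^ 'm) \<Rightarrow> real ^ 'm ^ 'm \<Rightarrow> real \<Rightarrow> real ^ 'm ^ 'm" where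
  "kernel_times K B t = - (K t ** B)"

definition is_resolvent :: "(real \<Rightarrow> real ^ 'm ^ 'm) \<Rightarrow> (real \<Rightarrow> real ^ 'm ^ 'm) \<Rightarrow> bool" where
  "is_resolvent k r \<longleftrightarrow>
     Lq_loc 1 r \<and>
     (AE t in lborel. 0 \<le> t \<longrightarrow>
        conv_exists (**) r k t \<and> conv_exists (**) k r t \<and>
        conv (**) r k t = k t - r t \<and> conv (**) k r t = k t - r t)"

text \<open>The resolvent of a locally integrable kernel exists and is unique up to null sets, and
  only its equivalence class enters below.\<close>

definition resolvent_R :: "(real \<Rightarrow> real ^ 'm ^ 'm) \<Rightarrow> real ^ 'm ^ 'm \<Rightarrow> real \<Rightarrow> real ^ 'm ^ 'm" where
  "resolvent_R K B = (SOME r. is_resolvent (kernel_times K B) r)"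

definition resolvent_E :: "(real \<Rightarrow> real ^ 'm ^ 'm) \<Rightarrow> real ^ 'm ^ 'm \<Rightarrow> real \<Rightarrow> real ^ 'm ^ 'm" where
  "resolvent_E K B t = K t - conv (**) (resolvent_R K B) K t"


section \<open>Admissible parameters\<close>

definition kernel_regularity :: "(real \<Rightarrow> real ^ 'm ^ 'm) \<Rightarrow> bool" where
  "kernel_regularity K \<longleftrightarrow>
     (\<exists>\<gamma> C1. 0 < \<gamma> \<and> \<gamma> \<le> 2 \<and> 0 < C1 \<and>
        (\<forall>h\<in>{0..1}. \<forall>i. (LINT r:{0..h}|lborel. \<bar>K r $ i $ i\<bar>\<^sup>2) \<le> C1 * h powr \<gamma>) \<and>
        (\<forall>T>0. \<exists>C2>0. \<forall>h\<in>{0..1}. \<forall>i.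
           (LINT r:{0..T}|lborel. \<bar>K (r + h) $ i $ i - K r $ i $ i\<bar>\<^sup>2) \<le> C2 * h powr \<gamma>))"

definition kernel_shift_condition :: "(real \<Rightarrow> real) \<Rightarrow> bool" where
  "kernel_shift_condition k \<longleftrightarrow>
     (\<forall>t>0. 0 \<le> k t) \<and> (\<exists>t>0. k t \<noteq> 0) \<and> antimono_on {0<..} k \<and> continuous_on {0<..} k \<and>
     (\<exists>L. is_resolvent_first_kind k L \<and> (\<forall>A\<in>bdd_borel. 0 \<le> L A) \<and>
          (\<forall>t\<ge>0. antimono_on {0..} (\<lambda>s. L {s..s + t})))"

definition admissible ::
  "real ^ 'm \<Rightarrow> real ^ 'm ^ 'm \<Rightarrow> real ^ 'm \<Rightarrow> (real \<Rightarrow> real ^ 'm ^ 'm) \<Rightarrow> bool"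
where
  "admissible b \<beta> \<sigma> K \<longleftrightarrow>
     (\<forall>i. 0 \<le> b $ i) \<and>
     (\<forall>i j. i \<noteq> j \<longrightarrow> 0 \<le> \<beta> $ i $ j) \<and>
     (\<forall>i. 0 \<le> \<sigma> $ i) \<and>
     (\<forall>t\<ge>0. \<forall>i j. i \<noteq> j \<longrightarrow> K t $ i $ j = 0) \<and>
     (\<forall>i. Lq_loc 2 (\<lambda>t. K t $ i $ i)) \<and>
     kernel_regularity K \<and>
     (\<forall>i. \<forall>h\<in>{0..1}. kernel_shift_condition (\<lambda>t. K (t + h) $ i $ i))"


section \<open>The Riccati--Volterra equation\<close>

definition pairing :: "complex ^ 'm \<Rightarrow> complex ^ 'm \<Rightarrow> complex" where
  "pairing z w = (\<Sum>i\<in>UNIV. z $ i * w $ i)"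

definition riccati_R :: "real ^ 'm ^ 'm \<Rightarrow> real ^ 'm \<Rightarrow> complex ^ 'm \<Rightarrow> complex ^ 'm" where
  "riccati_R \<beta> \<sigma> u =
     (\<chi> i. pairing u (\<chi> j. complex_of_real (column i \<beta> $ j))
           + complex_of_real ((\<sigma> $ i)\<^sup>2 / 2) * (u $ i)\<^sup>2)"

text \<open>
  A solution is an element of \<open>L\<^sup>2\<^sub>l\<^sub>o\<^sub>c\<close> with values in the left half-space (both up to null sets). The
  integrals on the right-hand side converge absolutely for almost every \<open>t \<ge> 0\<close>; with the library
  convention that a divergent integral has the value 0, the right-hand side is defined for every
  \<open>t \<ge> 0\<close> and depends only on the equivalence class of \<open>\<psi>\<close>. Requiring the equation at every \<open>t \<ge> 0\<close>
  therefore just selects one representative in each class that solves the equation almost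
  everywhere. Pointwise continuity of \<open>\<psi>\<close> refers to this representative.
\<close>

definition riccati_solution ::
  "real ^ 'm ^ 'm \<Rightarrow> real ^ 'm \<Rightarrow> (real \<Rightarrow> real ^ 'm ^ 'm) \<Rightarrow> (real set \<Rightarrow> complex ^ 'm) \<Rightarrow>
     (real \<Rightarrow> complex ^ 'm) \<Rightarrow> bool"
where
  "riccati_solution \<beta> \<sigma> K \<mu> \<psi> \<longleftrightarrow>
     Lq_loc 2 \<psi> \<and>
     (AE t in lborel. 0 \<le> t \<longrightarrow> (\<forall>i. Re (\<psi> t $ i) \<le> 0)) \<and>
     (AE t in lborel. 0 \<le> t \<longrightarrow>
        conv_measure_exists K \<mu> t \<and> conv_exists cmat_vec K (\<lambda>s. riccati_R \<beta> \<sigma> (\<psi> s)) t) \<and>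
     (\<forall>t\<ge>0. \<psi> t = conv_measure K \<mu> t + conv cmat_vec K (\<lambda>s. riccati_R \<beta> \<sigma> (\<psi> s)) t)"


section \<open>Norms\<close>

definition ennroot :: "real \<Rightarrow> ennreal \<Rightarrow> ennreal" where
  "ennroot p x = (if x = \<infinity> then \<infinity> else ennreal (enn2real x powr (1 / p)))"

definition op_norm :: "real ^ 'n ^ 'm \<Rightarrow> real" where
  "op_norm A = onorm ((*v) A)"

text \<open>The \<open>p\<close>-th power of the \<open>L\<^sup>p([0,T])\<close> norm of a function with pointwise norm \<open>\<phi>\<close>, and the \<open>p\<close>-th
  power of the Gagliardo seminorm of a function \<open>g\<close> with \<open>d t s\<close> the norm of \<open>g t - g s\<close>.\<close>

definition Lp_power :: "real \<Rightarrow> real \<Rightarrow> (real \<Rightarrow> real) \<Rightarrow> ennreal" where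
  "Lp_power p T \<phi> = (\<integral>\<^sup>+t\<in>{0..T}. ennreal (\<phi> t powr p) \<partial>lborel)"

definition gagliardo_power :: "real \<Rightarrow> real \<Rightarrow> real \<Rightarrow> (real \<Rightarrow> real \<Rightarrow> real) \<Rightarrow> ennreal" where
  "gagliardo_power \<eta> p T d =
     (\<integral>\<^sup>+t\<in>{0..T}. (\<integral>\<^sup>+s\<in>{0..T}. ennreal (d t s powr p / \<bar>t - s\<bar> powr (1 + \<eta> * p)) \<partial>lborel) \<partial>lborel)"

definition Lp_norm :: "real \<Rightarrow> real \<Rightarrow> (real \<Rightarrow> complex ^ 'm) \<Rightarrow> ennreal" where
  "Lp_norm p T g = ennroot p (Lp_power p T (\<lambda>t. norm (g t)))"

definition Lp_norm_mat :: "real \<Rightarrow> real \<Rightarrow> (real \<Rightarrow> real ^ 'm ^ 'm) \<Rightarrow> ennreal" where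
  "Lp_norm_mat p T G = ennroot p (Lp_power p T (\<lambda>t. op_norm (G t)))"

definition W_norm :: "real \<Rightarrow> real \<Rightarrow> real \<Rightarrow> (real \<Rightarrow> complex ^ 'm) \<Rightarrow> ennreal" where
  "W_norm \<eta> p T g =
     ennroot p (Lp_power p T (\<lambda>t. norm (g t)) + gagliardo_power \<eta> p T (\<lambda>t s. norm (g t - g s)))"

definition kernel_norm :: "real \<Rightarrow> real \<Rightarrow> real \<Rightarrow> (real \<Rightarrow> real ^ 'm ^ 'm) \<Rightarrow> ennreal" where
  "kernel_norm \<eta> p T K =
     ennroot p ((\<integral>\<^sup>+t\<in>{0..T}. ennreal (t powr (- \<eta> * p) * op_norm (K t) powr p) \<partial>lborel)
                + gagliardo_power \<eta> p T (\<lambda>t s. op_norm (K t - K s)))"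

end

theory Submission
 imports Defs "HOL-Real_Asymp.Real_Asymp"
begin

text \<open>
Everything is reduced to scalar real convolutions. The measure \<open>\<mu>\<close>, split into real and imaginary
parts by the Jordan decomposition, and Lebesgue measure on the half-line all have densities with respect to
one positive measure \<open>M\<close> (\<open>measure_densities_exist\<close>). Since \<open>K\<close> is diagonal, the Riccati equation becomes a
system of real equations \<open>v_i = k_i * (n_i M) + k_i * g_i\<close> for the real parts \<open>a\<close> and imaginary parts \<open>c\<close> of \<open>\<psi>\<close>.

The heart of the proof is a comparison principle (\<open>Volterra_comparison\<close>): a solution with nonnegative source
\<open>n_i\<close> and with \<open>g_i\<close> bounded below by a multiple of the negative parts, wherever \<open>v_i\<close> is not positive, is
nonnegative. It needs that the resolvent of every multiple of \<open>k_i\<close> is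
nonnegative, and this is exactly what the monotonicity of the resolvent of the first kind gives
(\<open>nonneg_rconv_Lipschitz\<close>, \<open>scalar_resolvent_nonneg\<close>). Let \<open>y\<close> and \<open>z\<close> solve the linear equations with sources
\<open>\<bar>Im \<mu>\<bar>\<close> and \<open>- Re \<mu> + \<sigma>\<^sup>2 y\<^sup>2 / 2\<close>. Comparison gives \<open>- z \<le> a \<le> 0\<close> and \<open>\<bar>c\<bar> \<le> y\<close> (\<open>riccati_bounds\<close>), and it
does so also if the quadratic nonlinearity is clipped to these ranges. The clipped equation has a Lipschitz
nonlinearity and is solved by Picard iteration (\<open>Volterra_existence\<close>); by the bounds the clipping
is inactive, so its solution solves the Riccati equation. Uniqueness is a Gronwall argument
(\<open>Volterra_Gronwall\<close>) in which the Lipschitz factor is only locally square integrable.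

The norm estimate holds because \<open>y\<close> and \<open>z\<close> are convolutions of their sources with \<open>E\<close> for \<open>B = \<beta>\<^sup>T\<close>
(\<open>linear_Volterra_resolvent\<close>) and Young's inequality bounds convolutions with measures. For the
Sobolev--Slobodeckij norm, increments of \<open>\<psi>\<close> are convolutions of increments of the kernel, extended by 0 to
the negative half-line, with the measure \<open>\<mu> + R(\<psi>) dt\<close>; Jensen's inequality and Fubini's theorem reduce the
estimate to the seminorm of the extended kernel, where the jump at 0 costs the weight \<open>t powr (- \<eta> p)\<close>. For
\<open>p \<ge> 3\<close> the same representation puts \<open>\<psi>\<close> in \<open>L\<^sup>3\<close>, hence \<open>R(\<psi>)\<close> in \<open>L\<^sup>3\<^sup>/\<^sup>2\<close>, and convolutions of \<open>L\<^sup>3\<close> with its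
dual space are continuous.
\<close>

section \<open>Locally integrable causal functions and their convolutions\<close>

abbreviation lborel_nn_integral :: "(real => ennreal) => ennreal" (binder "NN " 10) where
 "lborel_nn_integral f \<equiv> nn_integral lborel f"

abbreviation lborel_AE :: "(real => bool) => bool" (binder "AL " 10) where
 "lborel_AE P == AE t in lborel. P t"

text \<open>The integral over \<open>[0,T]\<close> of the positive part of \<open>f\<close>.\<close>
abbreviation nnI :: "real measure => real => (real => real) => ennreal" where
 "nnI M T f \<equiv> (\<integral>\<^sup>+s. ennreal (f s) * indicator {0..T} s \<partial>M)"

text \<open>Functions vanish on the negative half-line. Then a convolution over \<open>[0,t]\<close> is an integral over
the whole line, and its integrand is supported in \<open>[0,t]\<close>.\<close>
definition Lp :: "real measure => real => (real => real) => bool" where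
 "Lp M r f \<longleftrightarrow> f \<in> borel_measurable borel & (\<forall>s<0. f s = 0) & (\<forall>T. nnI M T (%s. \<bar>f s\<bar> powr r) < \<infinity>)"

lemma LpD:
 assumes "Lp M r f"
 shows "f \<in> borel_measurable borel" "s < 0 ==> f s = 0" "nnI M T (%s. \<bar>f s\<bar> powr r) < \<infinity>"
 using assms by (auto simp: Lp_def)

lemma Lp_add:
 assumes f: "Lp M r f" and g: "Lp M r g" and r: "0 <= r" and [measurable_cong]: "sets M = sets borel"
 shows "Lp M r (%s. f s + g s)"
 unfolding Lp_def
proof (intro conjI allI impI)
 note [measurable] = LpD(1)[OF f] LpD(1)[OF g]
 show "(%s. f s + g s) \<in> borel_measurable borel" by measurable
 show "f s + g s = 0" if "s < 0" for s using LpD(2)[OF f that] LpD(2)[OF g that] by simp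
 fix T
 have le: "\<bar>x + y\<bar> powr r <= 2 powr r * (\<bar>x\<bar> powr r + \<bar>y\<bar> powr r)" for x y :: real
 proof -
  have "\<bar>x + y\<bar> powr r <= (2 * max \<bar>x\<bar> \<bar>y\<bar>) powr r" using r by (intro powr_mono2) auto
  also have "... = 2 powr r * max \<bar>x\<bar> \<bar>y\<bar> powr r" by (simp add: powr_mult)
  also have "... <= 2 powr r * (\<bar>x\<bar> powr r + \<bar>y\<bar> powr r)" by (intro mult_left_mono) (auto simp: max_def)
  finally show ?thesis .
 qed
 have "nnI M T (%s. \<bar>f s + g s\<bar> powr r)
   <= (\<integral>\<^sup>+s. ennreal (2 powr r) * (ennreal (\<bar>f s\<bar> powr r) * indicator {0..T} s + ennreal (\<bar>g s\<bar> powr r) * indicator {0..T} s) \<partial>M)"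
 proof (intro nn_integral_mono)
  fix s
  have "ennreal (\<bar>f s + g s\<bar> powr r) <= ennreal (2 powr r * (\<bar>f s\<bar> powr r + \<bar>g s\<bar> powr r))" by (rule ennreal_leI[OF le])
  also have "... = ennreal (2 powr r) * (ennreal (\<bar>f s\<bar> powr r) + ennreal (\<bar>g s\<bar> powr r))" by (simp add: ennreal_mult)
  finally show "ennreal (\<bar>f s + g s\<bar> powr r) * indicator {0..T} s <= ennreal (2 powr r) * (ennreal (\<bar>f s\<bar> powr r) * indicator {0..T} s + ennreal (\<bar>g s\<bar> powr r) * indicator {0..T} s)"
   by (auto split: split_indicator)
 qed
 also have "... = ennreal (2 powr r) * (nnI M T (%s. \<bar>f s\<bar> powr r) + nnI M T (%s. \<bar>g s\<bar> powr r))"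
  by (subst nn_integral_cmult, measurable, subst nn_integral_add, measurable)
 also have "... < \<infinity>" using LpD(3)[OF f, of T] LpD(3)[OF g, of T] by (simp add: ennreal_mult_less_top)
 finally show "nnI M T (%s. \<bar>f s + g s\<bar> powr r) < \<infinity>" .
qed

lemma Lp_bound_AE:
 assumes g: "Lp M r g" and f: "f \<in> borel_measurable borel" "!!s. s < 0 ==> f s = 0" and r: "0 <= r"
  and b: "AE s in M. \<bar>f s\<bar> <= \<bar>g s\<bar>"
 shows "Lp M r f"
proof -
 have "nnI M T (%s. \<bar>f s\<bar> powr r) <= nnI M T (%s. \<bar>g s\<bar> powr r)" for T
  by (rule nn_integral_mono_AE, use b in eventually_elim) (use r in \<open>auto intro!: mult_right_mono ennreal_leI powr_mono2\<close>)
 then show ?thesis using f order_le_less_trans[OF _ LpD(3)[OF g]] by (auto simp: Lp_def)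
qed

lemma Lp_cmult:
 assumes f: "Lp M r f" and [measurable_cong]: "sets M = sets borel"
 shows "Lp M r (%s. c * f s)"
proof -
 note [measurable] = LpD(1)[OF f]
 have "nnI M T (%s. \<bar>c * f s\<bar> powr r) = ennreal (\<bar>c\<bar> powr r) * nnI M T (%s. \<bar>f s\<bar> powr r)" for T
  by (subst nn_integral_cmult[symmetric], measurable) (simp add: abs_mult powr_mult ennreal_mult mult.assoc)
 then show ?thesis using f by (auto simp: Lp_def ennreal_mult_less_top)
qed

lemma Lp_abs: "Lp M r f ==> Lp M r (%s. \<bar>f s\<bar>)" by (auto simp: Lp_def)

lemma Lp_zero: "Lp M r (%s. 0)" by (simp add: Lp_def)

lemma Lp_sum: "(!!i. i \<in> I ==> Lp M r (f i)) ==> 0 <= r ==> sets M = sets borel ==> Lp M r (%s. \<Sum>i\<in>I. f i s)"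
 by (induction I rule: infinite_finite_induct) (auto intro: Lp_add Lp_zero)

lemma Lp_indicator: "Lp lborel r (indicator {0..})"
proof -
 have "nnI lborel T (%s. \<bar>indicator {0..} s\<bar> powr r) = (NN s. indicator {0..T} s)" for T
  by (intro nn_integral_cong) (auto split: split_indicator)
 then show ?thesis by (auto simp: Lp_def emeasure_lborel_Icc_eq)
qed

text \<open>These are the densities of locally finite measures \<open>n M\<close> on the half-line. The measure
\<open>M\<close> carries both \<open>\<mu>\<close> and Lebesgue measure later.\<close>
definition Lloc :: "real measure => (real => real) => bool" where
 "Lloc M n \<longleftrightarrow> n \<in> borel_measurable borel & (\<forall>s<0. n s = 0) \<and>
   (\<forall>T. nnI M T (%s. \<bar>n s\<bar>) < \<infinity>)"

text \<open>The convolution of \<open>f\<close> with the measure \<open>n M\<close>. For \<open>M = lborel\<close> it is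
the convolution of two functions.\<close>
definition rconv :: "(real => real) => real measure => (real => real) => real => real" where
 "rconv f M n t = (LINT s|M. f (t - s) * n s)"

locale borel_sigma_finite = sigma_finite_measure M for M :: "real measure" +
 assumes sets_eq_borel [measurable_cong, simp]: "sets M = sets borel"

interpretation lborel: borel_sigma_finite lborel
 by unfold_locales simp

lemma Lloc_iff: "Lloc M n \<longleftrightarrow> Lp M 1 n"
 by (simp add: Lloc_def Lp_def)

lemma LlocD:
 assumes "Lloc M n"
 shows "n \<in> borel_measurable borel" "s < 0 ==> n s = 0"
  "nnI M T (%s. \<bar>n s\<bar>) < \<infinity>"
 using assms by (auto simp: Lloc_def)

lemma nn_integral_translate_reflect:
 fixes f :: "real => ennreal"
 assumes [measurable]: "f \<in> borel_measurable borel"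
 shows "(NN t. f (t - s)) = (NN t. f t)"
  "(NN t. f (s - t)) = (NN t. f t)"
 using nn_integral_real_affine[of f 1 "-s"] nn_integral_real_affine[of f "-1" s]
 by (simp_all add: algebra_simps)

lemma AE_all_upto:
 assumes "!!T::real. AE t in M. t <= T --> P t"
 shows "AE t in M. P t"
proof -
 have "AE t in M. \<forall>n::nat. t <= real n --> P t"
  using assms by (subst AE_all_countable) auto
 then show ?thesis
  by eventually_elim (metis real_arch_simple)
qed

context borel_sigma_finite begin

text \<open>Tonelli: on \<open>[0,T]\<close> only the values of \<open>f\<close> and \<open>n\<close> on
\<open>[0,T]\<close> matter, because both vanish on the negative half-line.\<close>
lemma nn_conv_le:
 fixes f n :: "real => ennreal"
 assumes [measurable]: "f \<in> borel_measurable borel" "n \<in> borel_measurable borel"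
  and f0: "!!u. u < 0 ==> f u = 0" and n0: "!!u. u < 0 ==> n u = 0"
 shows "(NN t. (\<integral>\<^sup>+s. f (t - s) * n s \<partial>M) * indicator {..T} t)
   <= (NN u. f u * indicator {0..T} u) * (\<integral>\<^sup>+s. n s * indicator {0..T} s \<partial>M)"
proof -
 let ?f = "%u. f u * indicator {0..T} u" and ?n = "%s. n s * indicator {0..T} s"
 interpret P: pair_sigma_finite lborel M ..
 have "(NN t. (\<integral>\<^sup>+s. f (t - s) * n s \<partial>M) * indicator {..T} t)
   = (NN t. (\<integral>\<^sup>+s. f (t - s) * n s * indicator {..T} t \<partial>M))"
  by (intro nn_integral_cong) (simp add: nn_integral_multc)
 also have "... <= (NN t. (\<integral>\<^sup>+s. ?f (t - s) * ?n s \<partial>M))"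
 proof (intro nn_integral_mono)
  fix t s
  have "t <= T & 0 <= s & s <= t \<or> T < t \<or> n s = 0 \<or> f (t - s) = 0"
   using f0[of "t - s"] n0[of s] by linarith
  then show "f (t - s) * n s * indicator {..T} t <= ?f (t - s) * ?n s"
   by (auto simp: mult_ac)
 qed
 also have "... = (\<integral>\<^sup>+s. (NN t. ?f (t - s) * ?n s) \<partial>M)"
  by (rule P.Fubini'[symmetric]) measurable
 also have "... = (\<integral>\<^sup>+s. (NN t. ?f (t - s)) * ?n s \<partial>M)"
  by (intro nn_integral_cong nn_integral_multc) measurable
 also have "... = (\<integral>\<^sup>+s. (NN t. ?f t) * ?n s \<partial>M)"
  by (subst nn_integral_translate_reflect) simp_all
 also have "... = (NN t. ?f t) * (\<integral>\<^sup>+s. ?n s \<partial>M)"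
  by (rule nn_integral_cmult) measurable
 finally show ?thesis .
qed

lemma AE_nn_conv_finite:
 fixes f n :: "real => ennreal"
 assumes [measurable]: "f \<in> borel_measurable borel" "n \<in> borel_measurable borel"
  and f0: "!!u. u < 0 ==> f u = 0" and n0: "!!u. u < 0 ==> n u = 0"
  and "!!T. (NN u. f u * indicator {0..T} u) < \<infinity>"
  and "!!T. (\<integral>\<^sup>+s. n s * indicator {0..T} s \<partial>M) < \<infinity>"
 shows "AL t. (\<integral>\<^sup>+s. f (t - s) * n s \<partial>M) < \<infinity>"
proof (rule AE_all_upto)
 let ?F = "%f t n. \<integral>\<^sup>+(s::real). f (t - s) * n s \<partial>M"
 fix T :: real
 have "(NN t. (?F f t n) * indicator {..T} t) < \<infinity>"
  by (rule order_le_less_trans[OF nn_conv_le[OF assms(1-2) f0 n0]])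
   (use assms(5,6)[of T] in \<open>auto simp: ennreal_mult_less_top\<close>)
 then have "AL t. (?F f t n) * indicator {..T} t ~= \<infinity>"
  by (intro nn_integral_PInf_AE) (auto)
 then show "AL t. t <= T --> (?F f t n) < \<infinity>"
  by eventually_elim (auto simp: less_top)
qed

lemma rconv_measurable [measurable (raw)]:
 assumes [measurable]: "f \<in> borel_measurable borel" "n \<in> borel_measurable borel"
 shows "rconv f M n \<in> borel_measurable borel"
 unfolding rconv_def by measurable

lemma rconv_negative:
 assumes "!!u. u < 0 ==> f u = 0" "!!u. u < 0 ==> n u = 0" "t < 0"
 shows "rconv f M n t = 0"
proof -
 have "(%s. f (t - s) * n s) = (%s. 0)"
 proof
  show "f (t - s) * n s = 0" for s
   using assms by (cases "s < 0") auto
 qed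
 then show ?thesis by (simp add: rconv_def)
qed

lemma AE_rconv_finite:
 assumes "Lloc lborel f" "Lloc M n"
 shows "AL t. (\<integral>\<^sup>+s. ennreal (\<bar>f (t - s)\<bar> * \<bar>n s\<bar>) \<partial>M) < \<infinity>"
 using AE_nn_conv_finite[of "%u. ennreal \<bar>f u\<bar>" "%u. ennreal \<bar>n u\<bar>"] LlocD[OF assms(1)] LlocD[OF assms(2)]
 by (simp add: ennreal_mult)

lemma AE_rconv_integrable:
 assumes "Lloc lborel f" "Lloc M n"
 shows "AL t. integrable M (%s. f (t - s) * n s)"
 using AE_rconv_finite[OF assms]
proof eventually_elim
 case (elim t)
 note [measurable] = LlocD(1)[OF assms(1)] LlocD(1)[OF assms(2)]
 show ?case
  using elim by (intro integrableI_bounded) (auto simp: abs_mult)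
qed

lemma abs_rconv_le:
 "ennreal \<bar>rconv f M n t\<bar> <= (\<integral>\<^sup>+s. ennreal (\<bar>f (t - s)\<bar> * \<bar>n s\<bar>) \<partial>M)"
proof (cases "integrable M (%s. f (t - s) * n s)")
 case True
 show ?thesis
  unfolding rconv_def using integral_norm_bound_ennreal[OF True] by (simp add: abs_mult)
qed (simp add: rconv_def not_integrable_integral_eq)

lemma Lloc_rconv:
 assumes f: "Lloc lborel f" and n: "Lloc M n"
 shows "Lloc lborel (rconv f M n)"
 unfolding Lloc_def
proof (intro conjI allI impI)
 note [measurable] = LlocD(1)[OF f] LlocD(1)[OF n]
 show "rconv f M n \<in> borel_measurable borel" by measurable
 show "rconv f M n s = 0" if "s < 0" for s
  using that rconv_negative[of f n] LlocD(2)[OF f] LlocD(2)[OF n] by auto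
 fix T
 have "nnI lborel T (%t. \<bar>rconv f M n t\<bar>)
   <= (NN t. (\<integral>\<^sup>+s. ennreal \<bar>f (t - s)\<bar> * ennreal \<bar>n s\<bar> \<partial>M) * indicator {..T} t)"
  using abs_rconv_le[of f n]
  by (intro nn_integral_mono) (auto split: split_indicator simp: ennreal_mult)
 also have "... <= nnI lborel T (%u. \<bar>f u\<bar>) * nnI M T (%s. \<bar>n s\<bar>)"
  by (rule nn_conv_le) (use LlocD(2)[OF f] LlocD(2)[OF n] in auto)
 also have "... < \<infinity>"
  using LlocD(3)[OF f] LlocD(3)[OF n] by (simp add: ennreal_mult_less_top)
 finally show "nnI lborel T (%t. \<bar>rconv f M n t\<bar>) < \<infinity>" .
qed

text \<open>Fubini at a single point \<open>t\<close>. The almost everywhere version and the version for bounded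
\<open>f\<close>, valid at every \<open>t\<close>, both come from it.\<close>
lemma rconv_assoc_at:
 assumes [measurable]: "f \<in> borel_measurable borel" "g \<in> borel_measurable borel" "n \<in> borel_measurable borel"
  and fin: "(NN s. (\<integral>\<^sup>+u. ennreal (\<bar>f (t - s)\<bar> * \<bar>g (s - u)\<bar> * \<bar>n u\<bar>) \<partial>M)) < \<infinity>"
 shows "rconv f lborel (rconv g M n) t = rconv (rconv f lborel g) M n t"
proof -
 let ?F = "lborel \<Otimes>\<^sub>M M"
 interpret P: pair_sigma_finite lborel M ..
 let ?h = "%(s,u). f (t - s) * (g (s - u) * n u)"
 have int: "integrable ?F ?h"
 proof (rule integrableI_bounded)
  show "?h \<in> borel_measurable ?F" by measurable
  have "(\<integral>\<^sup>+x. ennreal (norm (?h x)) \<partial>?F) = (NN s. (\<integral>\<^sup>+u. ennreal (norm (?h (s,u))) \<partial>M))"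
   by (rule nn_integral_fst[symmetric]) measurable
  also have "... < \<infinity>" using fin by (simp add: abs_mult mult.assoc)
  finally show "(\<integral>\<^sup>+x. ennreal (norm (?h x)) \<partial>?F) < \<infinity>" .
 qed
 have "rconv f lborel (rconv g M n) t = (\<integral>s. (\<integral>u. ?h (s,u) \<partial>M) \<partial>lborel)"
  by (simp add: rconv_def)
 also have "... = (\<integral>u. (\<integral>s. ?h (s,u) \<partial>lborel) \<partial>M)"
  using P.Fubini_integral[of "%s u. ?h (s,u)"] int by simp
 also have "... = (\<integral>u. (\<integral>s. f (t - s) * g (s - u) \<partial>lborel) * n u \<partial>M)"
  by (intro Bochner_Integration.integral_cong refl)
    (simp flip: integral_mult_left_zero add: mult.assoc)
 also have "... = (\<integral>u. (\<integral>s. f (t - u - s) * g s \<partial>lborel) * n u \<partial>M)"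
 proof -
  have "(\<integral>s. f (t - s) * g (s - u) \<partial>lborel) = (\<integral>s. f (t - u - s) * g s \<partial>lborel)" for u
   by (subst lborel_integral_real_affine[of 1 _ u]) (auto simp: algebra_simps)
  then show ?thesis by simp
 qed
 finally show ?thesis by (simp add: rconv_def)
qed

lemma AE_rconv_assoc:
 assumes f: "Lloc lborel f" and g: "Lloc lborel g" and n: "Lloc M n"
 shows "AL t. rconv f lborel (rconv g M n) t = rconv (rconv f lborel g) M n t"
proof -
 let ?F = "%t. NN s. (\<integral>\<^sup>+u. ennreal (\<bar>f (t - s)\<bar> * \<bar>g (s - u)\<bar> * \<bar>n u\<bar>) \<partial>M)"
 note [measurable] = LlocD(1)[OF f] LlocD(1)[OF g] LlocD(1)[OF n]
 define G where "G s = (\<integral>\<^sup>+u. ennreal \<bar>g (s - u)\<bar> * ennreal \<bar>n u\<bar> \<partial>M)" for s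
 have [measurable]: "G \<in> borel_measurable borel" unfolding G_def by measurable
 have G0: "G u = 0" if "u < 0" for u
 proof -
  have "(%s. ennreal \<bar>g (u - s)\<bar> * ennreal \<bar>n s\<bar>) = (%s. 0)"
  proof
   show "ennreal \<bar>g (u - s)\<bar> * ennreal \<bar>n s\<bar> = 0" for s
    using that LlocD(2)[OF g] LlocD(2)[OF n] by (cases "s < 0") auto
  qed
  then show ?thesis unfolding G_def by simp
 qed
 have Gfin: "(NN s. G s * indicator {0..T} s) < \<infinity>" for T
 proof -
  have "(NN s. G s * indicator {0..T} s) <= (NN s. G s * indicator {..T} s)"
   by (intro nn_integral_mono) (auto split: split_indicator)
  also have "... <= nnI lborel T (%u. \<bar>g u\<bar>) * nnI M T (%s. \<bar>n s\<bar>)"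
   unfolding G_def by (rule nn_conv_le) (use LlocD(2)[OF g] LlocD(2)[OF n] in auto)
  also have "... < \<infinity>"
   using LlocD(3)[OF g] LlocD(3)[OF n] by (simp add: ennreal_mult_less_top)
  finally show ?thesis .
 qed
 have "AL t. (NN s. ennreal \<bar>f (t - s)\<bar> * G s) < \<infinity>"
  using LlocD(2,3)[OF f] G0 Gfin by (intro lborel.AE_nn_conv_finite) auto
 then show ?thesis
 proof eventually_elim
  case (elim t)
  show ?case
  proof (rule rconv_assoc_at)
   have "(?F t)
     = (NN s. ennreal \<bar>f (t - s)\<bar> * G s)"
    unfolding G_def
    by (intro nn_integral_cong) (simp add: ennreal_mult mult.assoc nn_integral_cmult)
   then show "(?F t) < \<infinity>"
    using elim by simp
  qed measurable
 qed
qed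

text \<open>A Lebesgue null set remains one under translation and reflection, so by Fubini almost every \<open>t\<close>
sees it only through an \<open>M\<close>-null set. Changing \<open>f\<close> on a null set therefore changes
\<open>rconv f M n\<close> on a null set, even if \<open>M\<close> has atoms.\<close>
lemma AE_conv_transfer:
 assumes "AL u. P u"
 shows "AL t. AE s in M. P (t - s)"
proof -
 interpret P: pair_sigma_finite lborel M ..
 from assms obtain N where "{u \<in> space lborel. \<not> P u} \<subseteq> N" "emeasure lborel N = 0" "N \<in> sets lborel"
  by (rule AE_E)
 then have N: "N \<in> null_sets lborel" "{u. \<not> P u} \<subseteq> N"
  by auto
 have [measurable]: "N \<in> sets borel" using N by auto
 have "(NN t. (\<integral>\<^sup>+s. (indicator N (t - s) :: ennreal) \<partial>M)) = (\<integral>\<^sup>+s. (NN t. (indicator N (t - s) :: ennreal)) \<partial>M)"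
  by (rule P.Fubini'[symmetric]) measurable
 also have "... = 0"
  using N by (subst nn_integral_translate_reflect) auto
 finally have "AL t. (\<integral>\<^sup>+s. (indicator N (t - s) :: ennreal) \<partial>M) = 0"
  by (subst (asm) nn_integral_0_iff_AE) auto
 then show ?thesis
 proof eventually_elim
  case (elim t)
  then have "AE s in M. (indicator N (t - s) :: ennreal) = 0"
   by (subst (asm) nn_integral_0_iff_AE) auto
  then show ?case
   by eventually_elim (use N in \<open>auto split: split_indicator_asm\<close>)
 qed
qed

lemma AE_rconv_cong:
 assumes "AL u. f u = f' u"
  and [measurable]: "f \<in> borel_measurable borel" "f' \<in> borel_measurable borel" "n \<in> borel_measurable borel"
 shows "AL t. rconv f M n t = rconv f' M n t"
 using AE_conv_transfer[OF assms(1)]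
proof eventually_elim
 case (elim t)
 show ?case unfolding rconv_def
  by (rule integral_cong_AE) (use elim in auto)
qed

lemma rconv_cong_right:
 assumes "AE u in M. n u = n' u"
  and [measurable]: "f \<in> borel_measurable borel" "n \<in> borel_measurable borel" "n' \<in> borel_measurable borel"
 shows "rconv f M n t = rconv f M n' t"
 unfolding rconv_def by (rule integral_cong_AE) (use assms(1) in auto)

lemma AE_rconv_add:
 assumes "Lloc lborel f" "Lloc M n" "Lloc M n'"
 shows "AL t. rconv f M (%s. n s + n' s) t = rconv f M n t + rconv f M n' t"
 using AE_rconv_integrable[OF assms(1,2)] AE_rconv_integrable[OF assms(1,3)]
 by eventually_elim (simp add: rconv_def distrib_left)

lemma AE_rconv_add_left:
 assumes "Lloc lborel f" "Lloc lborel f'" "Lloc M n"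
 shows "AL t. rconv (%s. f s + f' s) M n t = rconv f M n t + rconv f' M n t"
 using AE_rconv_integrable[OF assms(1,3)] AE_rconv_integrable[OF assms(2,3)]
 by eventually_elim (simp add: rconv_def distrib_right)

lemma rconv_cmult: "rconv f M (%s. c * n s) t = c * rconv f M n t"
 "rconv (%s. c * f s) M n t = c * rconv f M n t"
 by (simp_all add: rconv_def mult.assoc mult.left_commute)

lemma AE_rconv_nonneg:
 assumes "AL u. 0 <= f u" "AE s in M. 0 <= n s"
 shows "AL t. 0 <= rconv f M n t"
 using AE_conv_transfer[OF assms(1)]
proof eventually_elim
 case (elim t)
 show ?case unfolding rconv_def
  by (rule integral_nonneg_AE) (use elim assms(2) in \<open>eventually_elim, auto\<close>)
qed

lemma AE_rconv_mono_right:
 assumes "Lloc lborel f" "Lloc M n" "Lloc M n'" "AL u. 0 <= f u" "AE s in M. n s <= n' s"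
 shows "AL t. rconv f M n t <= rconv f M n' t"
 using AE_rconv_integrable[OF assms(1,2)] AE_rconv_integrable[OF assms(1,3)] AE_conv_transfer[OF assms(4)]
proof eventually_elim
 case (elim t)
 show ?case unfolding rconv_def
  by (rule integral_mono_AE) (use elim assms(5) in \<open>auto elim: eventually_elim2 intro: mult_left_mono\<close>)
qed

end

lemma Lloc_add: "Lloc M n ==> Lloc M n' ==> sets M = sets borel ==> Lloc M (%s. n s + n' s)"
 unfolding Lloc_iff by (rule Lp_add) auto

lemma Lloc_bound:
 assumes "Lloc M n" "n' \<in> borel_measurable borel" and b: "!!s. \<bar>n' s\<bar> <= \<bar>n s\<bar>"
 shows "Lloc M n'"
proof -
 have neg: "n' s = 0" if "s < 0" for s using b[of s] LlocD(2)[OF assms(1) that] by simp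
 show ?thesis unfolding Lloc_iff
  by (rule Lp_bound_AE[of M 1 n]) (use assms neg in \<open>auto simp: Lloc_iff\<close>)
qed

lemma Lloc_cmult: "Lloc M n ==> sets M = sets borel ==> Lloc M (%s. c * n s)"
 unfolding Lloc_iff by (rule Lp_cmult)

lemma Lloc_minus: "Lloc M n ==> Lloc M (%s. - n s)"
 by (rule Lloc_bound) (auto simp: Lloc_def)

lemma Lloc_diff: "Lloc M n ==> Lloc M n' ==> sets M = sets borel ==> Lloc M (%s. n s - n' s)"
 using Lloc_add[of M n "%s. - n' s"] Lloc_minus[of M n'] by simp

lemma Lloc_abs: "Lloc M n ==> Lloc M (%s. \<bar>n s\<bar>)"
 by (rule Lloc_bound) (auto simp: Lloc_def)

lemma Lloc_zero: "Lloc M (%s. 0)"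
 by (auto simp: Lloc_def)

lemma Lloc_sum: "(!!i. i \<in> I ==> Lloc M (n i)) ==> sets M = sets borel ==> Lloc M (%s. \<Sum>i\<in>I. n i s)"
 by (induction I rule: infinite_finite_induct) (auto intro: Lloc_zero Lloc_add)

lemma (in borel_sigma_finite) AE_rconv_diff:
 assumes "Lloc lborel f" "Lloc M n" "Lloc M n'"
 shows "AL t. rconv f M (%s. n s - n' s) t = rconv f M n t - rconv f M n' t"
 using AE_rconv_integrable[OF assms(1,2)] AE_rconv_integrable[OF assms(1,3)]
 by eventually_elim (simp add: rconv_def right_diff_distrib)

lemma (in borel_sigma_finite) AE_rconv_diff_left:
 assumes "Lloc lborel f" "Lloc lborel f'" "Lloc M n"
 shows "AL t. rconv (%s. f s - f' s) M n t = rconv f M n t - rconv f' M n t"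
 using AE_rconv_integrable[OF assms(1,3)] AE_rconv_integrable[OF assms(2,3)]
 by eventually_elim (simp add: rconv_def left_diff_distrib)

lemma (in borel_sigma_finite) AE_rconv_sum:
 assumes "Lloc lborel f" "finite I" "!!i. i \<in> I ==> Lloc M (n i)"
 shows "AL t. rconv f M (%s. \<Sum>i\<in>I. n i s) t = (\<Sum>i\<in>I. rconv f M (n i) t)"
proof -
 have "AL t. \<forall>i\<in>I. integrable M (%s. f (t - s) * n i s)"
  using assms AE_rconv_integrable by (intro AE_finite_allI) auto
 then show ?thesis
  by eventually_elim (simp add: rconv_def sum_distrib_left)
qed

lemma (in borel_sigma_finite) AE_rconv_sum_left:
 assumes "Lloc M n" "finite I" "!!i. i \<in> I ==> Lloc lborel (f i)"
 shows "AL t. rconv (%s. \<Sum>i\<in>I. f i s) M n t = (\<Sum>i\<in>I. rconv (f i) M n t)"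
proof -
 have "AL t. \<forall>i\<in>I. integrable M (%s. f i (t - s) * n s)"
  using assms AE_rconv_integrable by (intro AE_finite_allI) auto
 then show ?thesis
  by eventually_elim (simp add: rconv_def sum_distrib_right)
qed

lemma rconv_commute: "rconv f lborel g t = rconv g lborel f t"
 unfolding rconv_def
 by (subst lborel_integral_real_affine[of "-1" _ t]) (auto simp: mult.commute)

section \<open>Square integrable kernels, uniqueness and existence for Volterra equations\<close>

definition L2loc :: "(real => real) => bool" where
 "L2loc f \<longleftrightarrow> f \<in> borel_measurable borel & (\<forall>s<0. f s = 0) \<and>
   (\<forall>T. (nnI lborel T (%s. (f s)\<^sup>2)) < \<infinity>)"

lemma L2loc_iff: "L2loc f \<longleftrightarrow> Lp lborel 2 f"
 by (simp add: L2loc_def Lp_def)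

lemma L2locD:
 assumes "L2loc f"
 shows "f \<in> borel_measurable borel" "s < 0 ==> f s = 0"
  "nnI lborel T (%s. (f s)\<^sup>2) < \<infinity>"
 using assms by (auto simp: L2loc_def)

lemma L2loc_bound_AE:
 assumes "L2loc g" "f \<in> borel_measurable borel" "!!s. s < 0 ==> f s = 0" "AL s. \<bar>f s\<bar> <= \<bar>g s\<bar>"
 shows "L2loc f"
 unfolding L2loc_iff by (rule Lp_bound_AE[of lborel 2 g]) (use assms in \<open>auto simp: L2loc_iff\<close>)

lemma L2loc_add: "L2loc f ==> L2loc g ==> L2loc (%s. f s + g s)"
 unfolding L2loc_iff by (rule Lp_add) auto

lemma L2loc_zero: "L2loc (%s. 0)"
 by (auto simp: L2loc_def)

lemma L2loc_abs: "L2loc f ==> L2loc (%s. \<bar>f s\<bar>)"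
 by (auto simp: L2loc_def)

lemma L2loc_minus: "L2loc f ==> L2loc (%s. - f s)"
 by (auto simp: L2loc_def)

lemma L2loc_cmult: "L2loc f ==> L2loc (%s. c * f s)"
 unfolding L2loc_iff by (rule Lp_cmult) auto

lemma L2loc_diff: "L2loc f ==> L2loc g ==> L2loc (%s. f s - g s)"
 using L2loc_add[of f "%s. - g s"] L2loc_minus[of g] by simp

lemma L2loc_sum: "(!!i. i \<in> I ==> L2loc (n i)) ==> L2loc (%s. \<Sum>i\<in>I. n i s)"
 by (induction I rule: infinite_finite_induct) (auto intro: L2loc_zero L2loc_add)

lemma L2loc_one: "L2loc (%s. indicator {0..} s)"
 unfolding L2loc_iff by (rule Lp_indicator)

lemma Lloc_mult_L2loc:
 assumes f: "L2loc f" and g: "L2loc g"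
 shows "Lloc lborel (%s. f s * g s)"
proof -
 note [measurable] = L2locD(1)[OF f] L2locD(1)[OF g]
 have "nnI lborel T (%s. \<bar>f s * g s\<bar>) < \<infinity>" for T
 proof -
  have "nnI lborel T (%s. \<bar>f s * g s\<bar>)
    <= (NN s. ennreal ((f s)\<^sup>2) * indicator {0..T} s + ennreal ((g s)\<^sup>2) * indicator {0..T} s)"
  proof (intro nn_integral_mono)
   fix s
   have "\<bar>f s * g s\<bar> <= (f s)\<^sup>2 + (g s)\<^sup>2"
   proof -
    have "2 * (\<bar>f s\<bar> * \<bar>g s\<bar>) <= (f s)\<^sup>2 + (g s)\<^sup>2"
     using sum_squares_bound[of "\<bar>f s\<bar>" "\<bar>g s\<bar>"] by (simp add: mult.assoc)
    moreover have "0 <= \<bar>f s\<bar> * \<bar>g s\<bar>" by simp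
    ultimately show ?thesis unfolding abs_mult by linarith
   qed
   then show "ennreal \<bar>f s * g s\<bar> * indicator {0..T} s <= ennreal ((f s)\<^sup>2) * indicator {0..T} s + ennreal ((g s)\<^sup>2) * indicator {0..T} s"
    by (auto split: split_indicator simp flip: ennreal_plus intro!: ennreal_leI)
  qed
  also have "... = nnI lborel T (%s. (f s)\<^sup>2) + nnI lborel T (%s. (g s)\<^sup>2)"
   by (subst nn_integral_add) (auto)
  also have "... < \<infinity>"
   using L2locD(3)[OF f, of T] L2locD(3)[OF g, of T] by simp
  finally show ?thesis .
 qed
 then show ?thesis using f g by (auto simp: L2loc_def Lloc_def)
qed

lemma Lloc_L2loc:
 assumes "L2loc f" shows "Lloc lborel f"
proof -
 have "(%s. f s * indicator {0..} s) = f"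
  using L2locD(2)[OF assms] by (auto simp: fun_eq_iff split: split_indicator)
 then show ?thesis using Lloc_mult_L2loc[OF assms L2loc_one] by simp
qed

text \<open>Jensen for the measure \<open>n M\<close> of mass \<open>C\<close>, proved by integrating the tangent line
of \<open>x powr q\<close> at the point \<open>a\<close> for which the resulting bound is optimal. The
tangent inequality is Young\'s inequality.\<close>
lemma Jensen_nn_integral_powr:
 fixes q C \<phi> :: real and h n :: "'a => real"
 assumes [measurable]: "h \<in> borel_measurable M" "n \<in> borel_measurable M"
  and pos: "!!s. 0 <= h s" "!!s. 0 <= n s" "0 <= \<phi>" "0 <= C" "1 <= q"
  and C: "(\<integral>\<^sup>+s. ennreal (n s) \<partial>M) = ennreal C"
  and \<phi>: "ennreal \<phi> <= (\<integral>\<^sup>+s. ennreal (h s * n s) \<partial>M)"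
 shows "ennreal (\<phi> powr q) <= ennreal (C powr (q - 1)) * (\<integral>\<^sup>+s. ennreal (h s powr q * n s) \<partial>M)"
proof -
 let ?F = "%a q. a powr (1 - q) / q"
 let ?Q = "\<integral>\<^sup>+s. ennreal (h s powr q * n s) \<partial>M"
 have zero: ?thesis if "AE s in M. h s * n s = 0"
 proof -
  have "(\<integral>\<^sup>+s. ennreal (h s * n s) \<partial>M) = (\<integral>\<^sup>+s. 0 \<partial>M)"
   using that by (intro nn_integral_cong_AE) auto
  then have "\<phi> = 0" using \<phi> pos by simp
  then show ?thesis by simp
 qed
 consider "C = 0" | "C > 0" "?Q = \<infinity>" | "C > 0" "?Q = 0" | Q where "C > 0" "?Q = ennreal Q" "Q > 0"
  using pos(4) by (cases ?Q) (auto simp: less_le)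
 then show ?thesis
 proof cases
  case 1
  then have "(\<integral>\<^sup>+s. ennreal (n s) \<partial>M) = 0" using C by simp
  then have "AE s in M. ennreal (n s) = 0"
   by (subst (asm) nn_integral_0_iff_AE) auto
  then have "AE s in M. n s = 0"
   by eventually_elim (use pos(2) in \<open>auto simp: order.antisym\<close>)
  then show ?thesis by (intro zero) auto
 next
  case 2
  then show ?thesis by (simp add: ennreal_mult_top)
 next
  case 3
  then have "AE s in M. ennreal (h s powr q * n s) = 0"
   by (subst (asm) nn_integral_0_iff_AE) auto
  then have "AE s in M. h s * n s = 0"
  proof eventually_elim
   case (elim s)
   then have "h s powr q * n s <= 0" using ennreal_eq_0_iff by blast
   moreover have "0 <= h s powr q * n s" using pos by simp
   ultimately have "h s powr q * n s = 0" by linarith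
   then show ?case by auto
  qed
  then show ?thesis by (rule zero)
 next
  case (4 Q)
  define a where "a = (Q / C) powr (1 / q)"
  have a: "a > 0" "a powr q = Q / C" using 4 pos by (auto simp: a_def powr_powr)
  have tangent: "x <= x powr q * (?F a q) + (1 - 1 / q) * a" if "0 <= x" for x
  proof (cases "q = 1")
   case True then show ?thesis using that a 4 by simp
  next
   case False
   then have q: "q > 1" using pos by simp
   have "x * a powr (q - 1) <= x powr q / q + (a powr (q - 1)) powr (q / (q - 1)) / (q / (q - 1))"
    by (rule Youngs_inequality) (use q that in \<open>auto simp: field_simps\<close>)
   also have "(a powr (q - 1)) powr (q / (q - 1)) = a powr q"
    using q by (simp add: powr_powr)
   finally have le: "x * a powr (q - 1) * a powr (1 - q) <= (x powr q / q + a powr q / (q / (q - 1))) * a powr (1 - q)"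
    using a by (intro mult_right_mono) auto
   have e: "a powr (q - 1) * a powr (1 - q) = 1" "a powr q * a powr (1 - q) = a"
    using a(1) by (simp_all flip: powr_add)
   have "x = x * a powr (q - 1) * a powr (1 - q)" by (simp add: e mult.assoc)
   also note le
   also have "(x powr q / q + a powr q / (q / (q - 1))) * a powr (1 - q)
     = x powr q * (?F a q) + (a powr q * a powr (1 - q)) * ((q - 1) / q)"
    using q by (simp add: divide_simps) (simp add: algebra_simps)
   also have "... = x powr q * (?F a q) + (1 - 1 / q) * a"
    unfolding e using q by (simp add: field_simps)
   finally show ?thesis .
  qed
  have "ennreal \<phi> <= (\<integral>\<^sup>+s. ennreal (h s * n s) \<partial>M)" by (rule \<phi>)
  also have "... <= (\<integral>\<^sup>+s. ennreal (?F a q) * ennreal (h s powr q * n s) + ennreal ((1 - 1 / q) * a) * ennreal (n s) \<partial>M)"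
  proof (intro nn_integral_mono)
   fix s
   have "h s * n s <= (h s powr q * (?F a q) + (1 - 1 / q) * a) * n s"
    using tangent[OF pos(1)] pos(2) by (intro mult_right_mono) auto
   also have "... = (?F a q) * (h s powr q * n s) + ((1 - 1 / q) * a) * n s"
    by (simp add: algebra_simps)
   finally have "ennreal (h s * n s) <= ennreal ((?F a q) * (h s powr q * n s) + ((1 - 1 / q) * a) * n s)"
    by (rule ennreal_leI)
   also have "... = ennreal (?F a q) * ennreal (h s powr q * n s) + ennreal ((1 - 1 / q) * a) * ennreal (n s)"
   proof -
    have nn: "0 <= a powr (1 - q) / q" "0 <= (1 - 1 / q) * a" "0 <= h s powr q * n s"
     using pos a by auto
    show ?thesis
     by (simp only: ennreal_plus[OF mult_nonneg_nonneg[OF nn(1,3)] mult_nonneg_nonneg[OF nn(2) pos(2)]]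
       ennreal_mult[OF nn(1,3)] ennreal_mult[OF nn(2) pos(2)])
   qed
   finally show "ennreal (h s * n s) <= ennreal (?F a q) * ennreal (h s powr q * n s) + ennreal ((1 - 1 / q) * a) * ennreal (n s)" .
  qed
  also have "... = ennreal (?F a q) * ?Q + ennreal ((1 - 1 / q) * a) * ennreal C"
   by (subst nn_integral_add) (auto simp: nn_integral_cmult C)
  also have "... = ennreal (a powr (1 - q) / q * Q + (1 - 1 / q) * a * C)"
  proof -
   have nn: "0 <= a powr (1 - q) / q" "0 <= (1 - 1 / q) * a" "0 <= Q"
    using pos a 4 by auto
   show ?thesis
    by (simp only: 4 ennreal_plus[OF mult_nonneg_nonneg[OF nn(1,3)] mult_nonneg_nonneg[OF nn(2) pos(4)]]
      ennreal_mult[OF nn(1,3)] ennreal_mult[OF nn(2) pos(4)])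
  qed
  also have "a powr (1 - q) / q * Q + (1 - 1 / q) * a * C = C * a"
  proof -
   have "Q = C * a powr q" using a 4 by simp
   then have "a powr (1 - q) * Q = C * (a powr (1 - q) * a powr q)" by simp
   also have "a powr (1 - q) * a powr q = a" using a(1) by (simp flip: powr_add)
   finally show ?thesis using pos by (simp add: field_simps)
  qed
  finally have "\<phi> <= C * a" using 4 a by (simp add: ennreal_le_iff)
  then have "\<phi> powr q <= (C * a) powr q" using pos by (intro powr_mono2) auto
  also have "... = C powr q * (Q / C)" using 4 a by (simp add: powr_mult)
  also have "... = C powr (q - 1) * Q" using 4 by (simp add: powr_diff)
  finally show ?thesis using 4 by (simp flip: ennreal_mult)
 qed
qed

context borel_sigma_finite begin

text \<open>Young's inequality \<open>\<parallel>e * \<nu>\<parallel>\<^sub>q \<le> \<bar>\<nu>\<bar> \<parallel>e\<parallel>\<^sub>q\<close>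
on \<open>[0,T]\<close> for a measure \<open>\<nu>\<close>, stated for any function dominated by such a
convolution.\<close>
lemma Young_conv_powr:
 fixes e n \<phi> :: "real => real"
 assumes [measurable]: "e \<in> borel_measurable borel" and e0: "!!u. 0 <= e u"
  and eneg: "!!u. u < 0 ==> e u = 0"
  and n: "Lloc M n" "!!s. 0 <= n s"
  and \<phi>: "!!t. 0 <= \<phi> t" "AL t. 0 <= t --> t <= T --> ennreal (\<phi> t) <= (\<integral>\<^sup>+s. ennreal (e (t - s) * n s) \<partial>M)"
  and q: "1 <= q"
  and C: "nnI M T n = ennreal C" "0 <= C"
 shows "nnI lborel T (%t. \<phi> t powr q)
   <= ennreal (C powr q) * nnI lborel T (%u. e u powr q)"
proof -
 note [measurable] = LlocD(1)[OF n(1)]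
 let ?n = "%s. n s * indicator {0..T} s"
 have "nnI lborel T (%t. \<phi> t powr q)
   <= (NN t. ennreal (C powr (q - 1)) * ((\<integral>\<^sup>+s. ennreal (e (t - s) powr q) * ennreal (?n s) \<partial>M) * indicator {..T} t))"
 proof (rule nn_integral_mono_AE, use \<phi>(2) in eventually_elim)
  case (elim t)
  show ?case
  proof (cases "0 <= t & t <= T")
   case True
   have "ennreal (\<phi> t) <= (\<integral>\<^sup>+s. ennreal (e (t - s) * n s) \<partial>M)" using elim True by simp
   also have "... = (\<integral>\<^sup>+s. ennreal (e (t - s) * ?n s) \<partial>M)"
   proof (intro nn_integral_cong arg_cong[where f=ennreal])
    fix s
    show "e (t - s) * n s = e (t - s) * ?n s"
     using True eneg[of "t - s"] LlocD(2)[OF n(1), of s] by (cases "s < 0"; cases "s <= t") auto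
   qed
   finally have *: "ennreal (\<phi> t) <= (\<integral>\<^sup>+s. ennreal (e (t - s) * ?n s) \<partial>M)" .
   have "ennreal (\<phi> t powr q) <= ennreal (C powr (q - 1)) * (\<integral>\<^sup>+s. ennreal (e (t - s) powr q * ?n s) \<partial>M)"
   proof (rule Jensen_nn_integral_powr[OF _ _ _ _ _ _ q _ *])
    have "(\<integral>\<^sup>+s. ennreal (?n s) \<partial>M) = nnI M T n"
     by (intro nn_integral_cong) (auto split: split_indicator)
    then show "(\<integral>\<^sup>+s. ennreal (?n s) \<partial>M) = ennreal C" using C by simp
   qed (use e0 n \<phi>(1) C in auto)
   also have "(\<integral>\<^sup>+s. ennreal (e (t - s) powr q * ?n s) \<partial>M) = (\<integral>\<^sup>+s. ennreal (e (t - s) powr q) * ennreal (?n s) \<partial>M)"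
    using n by (intro nn_integral_cong ennreal_mult) auto
   finally show ?thesis using True by simp
  qed auto
 qed
 also have "... = ennreal (C powr (q - 1)) * (NN t. ((\<integral>\<^sup>+s. ennreal (e (t - s) powr q) * ennreal (?n s) \<partial>M) * indicator {..T} t))"
  by (rule nn_integral_cmult) measurable
 also have "... <= ennreal (C powr (q - 1)) * (nnI lborel T (%u. e u powr q) * nnI M T (%s. ?n s))"
  by (intro mult_left_mono nn_conv_le) (use eneg q LlocD(2)[OF n(1)] in auto)
 also have "nnI M T (%s. ?n s) = ennreal C"
  unfolding C(1)[symmetric] by (intro nn_integral_cong) (auto split: split_indicator)
 also have "ennreal (C powr (q - 1)) * (nnI lborel T (%u. e u powr q) * ennreal C)
   = ennreal (C powr (q - 1) * C) * nnI lborel T (%u. e u powr q)"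
  using C(2) by (simp add: ennreal_mult mult_ac)
 also have "C powr (q - 1) * C = C powr q"
  using C(2) by (cases "C = 0") (auto simp: powr_diff)
 finally show ?thesis .
qed

lemma L2loc_rconv:
 assumes f: "L2loc f" and n: "Lloc M n"
 shows "L2loc (rconv f M n)"
 unfolding L2loc_def
proof (intro conjI allI impI)
 note [measurable] = L2locD(1)[OF f] LlocD(1)[OF n]
 show "rconv f M n \<in> borel_measurable borel" by measurable
 show "rconv f M n s = 0" if "s < 0" for s
  using that rconv_negative[of f n] L2locD(2)[OF f] LlocD(2)[OF n] by auto
 fix T
 obtain C where C: "nnI M T (%s. \<bar>n s\<bar>) = ennreal C" "0 <= C"
  using LlocD(3)[OF n, of T] by (cases "nnI M T (%s. \<bar>n s\<bar>)") auto
 have sq: "x powr 2 = x\<^sup>2" if "0 <= x" for x :: real using that by simp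
 have "nnI lborel T (%t. \<bar>rconv f M n t\<bar> powr 2)
   <= ennreal (C powr 2) * nnI lborel T (%u. \<bar>f u\<bar> powr 2)"
  by (rule Young_conv_powr[OF _ _ _ Lloc_abs[OF n] _ _ _ _ C])
   (use abs_rconv_le[of f n] L2locD(2)[OF f] in auto)
 also have "... < \<infinity>" using L2locD(3)[OF f, of T] by (simp add: sq ennreal_mult_less_top)
 finally show "nnI lborel T (%s. (rconv f M n s)\<^sup>2) < \<infinity>" by (simp add: sq)
qed

end

text \<open>The weight \<open>exp (- w t)\<close> is multiplicative along a convolution, so it can be moved to
\<open>\<kappa>\<close> and to \<open>v\<close>; the factor \<open>l\<close> is split off by the
Cauchy--Schwarz inequality.\<close>
lemma weighted_L2_conv_le:
 fixes v :: "real => ennreal" and \<kappa> l :: "real => real"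
 assumes [measurable]: "v \<in> borel_measurable borel" and \<kappa>: "L2loc \<kappa>" and l: "L2loc l"
 shows "(NN t. (ennreal (exp (- w * t)) * (NN s. ennreal (\<bar>\<kappa> (t - s)\<bar> * \<bar>l s\<bar>) * v s))\<^sup>2 * indicator {0..T} t)
  <= nnI lborel T (%u. (exp (- w * u) * \<kappa> u)\<^sup>2)
   * nnI lborel T (%s. (l s)\<^sup>2)
   * (NN s. (ennreal (exp (- w * s)) * v s)\<^sup>2 * indicator {0..T} s)"
proof -
 note [measurable] = L2locD(1)[OF \<kappa>] L2locD(1)[OF l]
 let ?L = "nnI lborel T (%s. (l s)\<^sup>2)"
 let ?k = "%u. ennreal ((exp (- w * u) * \<kappa> u)\<^sup>2)"
 let ?v = "%s. (ennreal (exp (- w * s)) * v s)\<^sup>2 * indicator {0..T} s"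
 have "(NN t. (ennreal (exp (- w * t)) * (NN s. ennreal (\<bar>\<kappa> (t - s)\<bar> * \<bar>l s\<bar>) * v s))\<^sup>2 * indicator {0..T} t)
   <= (NN t. ?L * ((NN s. ?k (t - s) * ?v s) * indicator {..T} t))"
 proof (intro nn_integral_mono)
  fix t
  show "(ennreal (exp (- w * t)) * (NN s. ennreal (\<bar>\<kappa> (t - s)\<bar> * \<bar>l s\<bar>) * v s))\<^sup>2 * indicator {0..T} t
   <= ?L * ((NN s. ?k (t - s) * ?v s) * indicator {..T} t)"
  proof (cases "0 <= t & t <= T")
   case True
   let ?a = "%s. ennreal (exp (- w * (t - s)) * \<bar>\<kappa> (t - s)\<bar>) * (ennreal (exp (- w * s)) * v s) * indicator {0..T} s"
   let ?b = "%s. ennreal \<bar>l s\<bar> * indicator {0..T} s"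
   have "ennreal (exp (- w * t)) * (NN s. ennreal (\<bar>\<kappa> (t - s)\<bar> * \<bar>l s\<bar>) * v s)
     = (NN s. ennreal (exp (- w * t)) * (ennreal (\<bar>\<kappa> (t - s)\<bar> * \<bar>l s\<bar>) * v s))"
    by (rule nn_integral_cmult[symmetric]) measurable
   also have "... = (NN s. ?a s * ?b s)"
   proof (intro nn_integral_cong)
    fix s
    have e: "exp (- w * t) = exp (- w * (t - s)) * exp (- w * s)"
     by (simp add: algebra_simps flip: exp_add)
    show "ennreal (exp (- w * t)) * (ennreal (\<bar>\<kappa> (t - s)\<bar> * \<bar>l s\<bar>) * v s) = ?a s * ?b s"
    proof (cases "0 <= s & s <= t")
     case True2: True
     then have ind: "indicator {0..T} s = (1::ennreal)" using True by auto
     have "ennreal (exp (- w * t)) = ennreal (exp (- w * (t - s))) * ennreal (exp (- w * s))"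
      unfolding e by (rule ennreal_mult) auto
     then show ?thesis
      by (simp only: ennreal_mult[OF exp_ge_zero abs_ge_zero] ennreal_mult[OF abs_ge_zero abs_ge_zero] ennreal_mult[OF abs_ge_zero exp_ge_zero]
        mult_1_right mult_1_left mult_ac ind)
    next
     case False
     then show ?thesis using L2locD(2)[OF \<kappa>, of "t - s"] L2locD(2)[OF l, of s] by (auto simp: not_le)
    qed
   qed
   finally have "(ennreal (exp (- w * t)) * (NN s. ennreal (\<bar>\<kappa> (t - s)\<bar> * \<bar>l s\<bar>) * v s))\<^sup>2
     = (NN s. ?a s * ?b s)\<^sup>2" by simp
   also have "... <= (NN s. (?a s)\<^sup>2) * (NN s. (?b s)\<^sup>2)"
    by (rule Cauchy_Schwarz_nn_integral) measurable
   also have "(NN s. (?b s)\<^sup>2) = ?L"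
    by (intro nn_integral_cong) (auto simp: ennreal_power split: split_indicator)
   also have "(NN s. (?a s)\<^sup>2) = (NN s. ?k (t - s) * ?v s)"
    by (intro nn_integral_cong)
     (auto simp: ennreal_power power_mult_distrib ennreal_mult split: split_indicator)
   finally show ?thesis using True by (simp add: mult.commute)
  qed auto
 qed
 also have "... = ?L * (NN t. ((NN s. ?k (t - s) * ?v s) * indicator {..T} t))"
  by (rule nn_integral_cmult) measurable
 also have "... <= ?L * ((NN u. ?k u * indicator {0..T} u) * (NN s. ?v s * indicator {0..T} s))"
  by (intro mult_left_mono lborel.nn_conv_le) (use L2locD(2)[OF \<kappa>] in auto)
 also have "(NN s. ?v s * indicator {0..T} s) = (NN s. ?v s)"
  by (intro nn_integral_cong) (auto split: split_indicator)
 finally show ?thesis by (simp add: mult_ac)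
qed

text \<open>A large weight makes the kernel small, so that \<open>v \<mapsto> \<kappa> * (l v)\<close> is a contraction
in the weighted norm.\<close>
lemma weighted_kernel_small:
 assumes \<kappa>: "L2loc \<kappa>" and l: "L2loc l" and \<epsilon>: "(\<epsilon>::real) > 0"
 shows "\<exists>w\<ge>0. (nnI lborel T (%u. (exp (- w * u) * \<kappa> u)\<^sup>2))
   * nnI lborel T (%s. (l s)\<^sup>2) <= ennreal \<epsilon>"
proof -
 let ?F = "%n u. (exp (- real n * u) * \<kappa> u)\<^sup>2"
 note [measurable] = L2locD(1)[OF \<kappa>] L2locD(1)[OF l]
 let ?I = "%w. nnI lborel T (%u. (exp (- w * u) * \<kappa> u)\<^sup>2)"
 have "(%n. ?I (real n)) \<longlonglongrightarrow> (NN u. 0)"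
 proof (rule nn_integral_dominated_convergence[where w="%u. ennreal ((\<kappa> u)\<^sup>2) * indicator {0..T} u"])
  show "nnI lborel T (%u. (\<kappa> u)\<^sup>2) < \<infinity>" by (rule L2locD(3)[OF \<kappa>])
  show "AL u. ennreal (?F n u) * indicator {0..T} u <= ennreal ((\<kappa> u)\<^sup>2) * indicator {0..T} u" for n
  proof (intro AE_I2)
   fix u
   show "ennreal (?F n u) * indicator {0..T} u <= ennreal ((\<kappa> u)\<^sup>2) * indicator {0..T} u"
    by (auto split: split_indicator simp: power_mult_distrib intro!: ennreal_leI mult_left_le_one_le power_le_one)
  qed
  show "AL u. (%n. ennreal (?F n u) * indicator {0..T} u) \<longlonglongrightarrow> 0"
   using AE_lborel_singleton[of 0]
  proof eventually_elim
   case (elim u)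
   show ?case
   proof (cases "u > 0")
    case True
    have "(%n. exp (- u) ^ n) \<longlonglongrightarrow> 0" using True by (intro LIMSEQ_realpow_zero) auto
    then have "(%n. exp (- real n * u)) \<longlonglongrightarrow> 0"
     by (simp flip: exp_of_nat_mult)
    then have "(%n. (exp (- real n * u) * \<kappa> u)\<^sup>2) \<longlonglongrightarrow> (0 * \<kappa> u)\<^sup>2"
     by (intro tendsto_intros)
    then have "(%n. ennreal (?F n u)) \<longlonglongrightarrow> ennreal 0"
     by (intro tendsto_ennrealI) simp
    then show ?thesis by (auto split: split_indicator)
   qed (use elim in \<open>auto split: split_indicator\<close>)
  qed
 qed auto
 then have lim: "(%n. ?I (real n)) \<longlonglongrightarrow> 0" by simp
 obtain L where L: "nnI lborel T (%s. (l s)\<^sup>2) = ennreal L" "0 <= L"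
  using L2locD(3)[OF l, of T] by (cases "nnI lborel T (%s. (l s)\<^sup>2)") auto
 have "\<forall>\<^sub>F n in sequentially. ?I (real n) < ennreal (\<epsilon> / (L + 1))"
  using lim \<epsilon> L by (intro order_tendstoD) (auto simp: ennreal_less_zero_iff)
 then obtain n where n: "?I (real n) < ennreal (\<epsilon> / (L + 1))"
  by (auto simp: eventually_sequentially)
 then have "?I (real n) * ennreal L <= ennreal (\<epsilon> / (L + 1)) * ennreal L"
  by (intro mult_right_mono) auto
 also have "... = ennreal (\<epsilon> / (L + 1) * L)" using L \<epsilon> by (subst ennreal_mult) auto
 also have "... <= ennreal \<epsilon>" using L \<epsilon> by (intro ennreal_leI) (simp add: field_simps)
 finally show ?thesis unfolding L(1) by (intro exI[of _ "real n"]) auto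
qed

text \<open>The square of the weighted norm of \<open>U\<close> is finite and at most half of itself.\<close>
lemma Volterra_Gronwall:
 assumes U: "L2loc U" and \<kappa>: "L2loc \<kappa>" and l: "L2loc l"
  and le: "AL t. ennreal \<bar>U t\<bar> <= (NN s. ennreal (\<bar>\<kappa> (t - s)\<bar> * \<bar>l s\<bar>) * ennreal \<bar>U s\<bar>)"
 shows "AL t. U t = 0"
proof (rule AE_all_upto)
 fix T
 note [measurable] = L2locD(1)[OF \<kappa>] L2locD(1)[OF l] L2locD(1)[OF U]
 let ?L = "nnI lborel T (%s. (l s)\<^sup>2)"
 obtain w where w: "w \<ge> 0" "nnI lborel T (%u. (exp (- w * u) * \<kappa> u)\<^sup>2) * ?L <= ennreal (1/2)"
  using weighted_kernel_small[OF \<kappa> l, of "1/2" T] by auto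
 define W where "W = (NN t. (ennreal (exp (- w * t)) * ennreal \<bar>U t\<bar>)\<^sup>2 * indicator {0..T} t)"
 have "W <= (NN t. (ennreal (exp (- w * t)) * (NN s. ennreal (\<bar>\<kappa> (t - s)\<bar> * \<bar>l s\<bar>) * ennreal \<bar>U s\<bar>))\<^sup>2 * indicator {0..T} t)"
  unfolding W_def
  by (rule nn_integral_mono_AE, use le in eventually_elim) (auto intro!: mult_mono power_mono_ennreal)
 also have "... <= nnI lborel T (%u. (exp (- w * u) * \<kappa> u)\<^sup>2) * ?L * W"
  unfolding W_def by (rule weighted_L2_conv_le) (use \<kappa> l in auto)
 also have "... <= ennreal (1/2) * W" by (intro mult_right_mono w) auto
 finally have 1: "W <= ennreal (1/2) * W" .
 have "W <= nnI lborel T (%t. (U t)\<^sup>2)"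
  unfolding W_def
 proof (rule nn_integral_mono)
  fix t
  have "(ennreal (exp (- w * t)) * ennreal \<bar>U t\<bar>)\<^sup>2 = ennreal ((exp (- w * t))\<^sup>2 * (U t)\<^sup>2)"
   by (simp add: ennreal_power power_mult_distrib flip: ennreal_mult)
  also have "... <= ennreal ((U t)\<^sup>2)" if "0 <= t"
   using that w by (intro ennreal_leI mult_left_le_one_le power_le_one) auto
  finally show "(ennreal (exp (- w * t)) * ennreal \<bar>U t\<bar>)\<^sup>2 * indicator {0..T} t <= ennreal ((U t)\<^sup>2) * indicator {0..T} t"
   by (auto split: split_indicator)
 qed
 then have "W < \<infinity>" by (rule order_le_less_trans[OF _ L2locD(3)[OF U]])
 then obtain c where c: "W = ennreal c" "0 <= c" by (cases W) auto
 with 1 have "ennreal c <= ennreal (1/2 * c)" by (subst ennreal_mult) auto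
 then have "c = 0" using c by (simp add: ennreal_le_iff)
 then have "W = 0" using c by simp
 then have "AL t. (ennreal (exp (- w * t)) * ennreal \<bar>U t\<bar>)\<^sup>2 * indicator {0..T} t = 0"
  unfolding W_def by (subst (asm) nn_integral_0_iff_AE) auto
 then show "AL t. t <= T --> U t = 0"
 proof eventually_elim
  case (elim t)
  show ?case using elim L2locD(2)[OF U, of t] by (cases "t < 0") (auto simp: split: split_indicator_asm)
 qed
qed

text \<open>The Cauchy--Schwarz inequality for \<open>a n = 2 powr (- n / 2) \<cdot> (2 powr (n / 2) a n)\<close>. It
turns square integrable increments with geometric decay into a square integrable sum.\<close>
lemma geometric_series_square_le:
 fixes a :: "nat => ennreal"
 shows "(\<Sum>n. a n)\<^sup>2 <= 2 * (\<Sum>n. 2 ^ n * (a n)\<^sup>2)"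
proof -
 let ?r = "%n. ennreal (sqrt 2 ^ n)" and ?i = "%n. ennreal (1 / sqrt 2 ^ n)"
 have one: "?i n * ?r n = 1" for n
  by (subst ennreal_mult[symmetric]) auto
 have "(\<Sum>n. a n) = (\<integral>\<^sup>+n. ?i n * (?r n * a n) \<partial>count_space UNIV)"
  using one by (simp add: nn_integral_count_space_nat flip: mult.assoc)
 then have "(\<Sum>n. a n)\<^sup>2 <= (\<integral>\<^sup>+n. (?i n)\<^sup>2 \<partial>count_space UNIV) * (\<integral>\<^sup>+n. (?r n * a n)\<^sup>2 \<partial>count_space UNIV)"
  using Cauchy_Schwarz_nn_integral[of ?i "count_space UNIV" "%n. ?r n * a n"] by simp
 also have "(\<integral>\<^sup>+n. (?i n)\<^sup>2 \<partial>count_space UNIV) = (\<Sum>n. ennreal ((1 / 2) ^ n))"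
 proof (subst nn_integral_count_space_nat, intro suminf_cong)
  fix n
  have "(1 / sqrt 2 ^ n)\<^sup>2 = (1 / 2 :: real) ^ n"
   by (simp add: power_divide power2_eq_square flip: power_mult_distrib)
  then show "(?i n)\<^sup>2 = ennreal ((1 / 2) ^ n)" by (simp add: ennreal_power)
 qed
 also have "... = ennreal (\<Sum>n. (1 / 2) ^ n)"
  by (rule suminf_ennreal2) (auto intro: summable_geometric)
 also have "... = 2" by (simp add: suminf_geometric)
 also have "(\<integral>\<^sup>+n. (?r n * a n)\<^sup>2 \<partial>count_space UNIV) = (\<Sum>n. 2 ^ n * (a n)\<^sup>2)"
 proof (subst nn_integral_count_space_nat, intro suminf_cong)
  fix n
  have "(sqrt 2 ^ n)\<^sup>2 = (2 :: real) ^ n"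
   by (simp add: power2_eq_square flip: power_mult_distrib)
  then have "(?r n)\<^sup>2 = ennreal (2 ^ n)" by (simp add: ennreal_power)
  then show "(?r n * a n)\<^sup>2 = 2 ^ n * (a n)\<^sup>2"
   by (simp add: power_mult_distrib flip: ennreal_power)
 qed
 finally show ?thesis .
qed

text \<open>Picard iteration. The increments of the iterates satisfy \<open>D (n + 1) \<le> \<kappa> * (l D n)\<close>,
which contracts the square of a weighted \<open>L\<^sup>2\<close> norm by the factor \<open>1/4\<close>;
their sum is the square integrable majorant used to pass to the limit. The Lipschitz factor \<open>l\<close>
may be unbounded, which is what the quadratic nonlinearity requires.\<close>
theorem Volterra_existence:
 fixes k F :: "'k::finite => real => real" and f :: "real => ('k => real) => 'k => real"
 assumes k: "!!i. L2loc (k i)" and F: "!!i. L2loc (F i)" and l: "L2loc l"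
  and meas: "!!x i. (!!j. x j \<in> borel_measurable borel) ==> (%s. f s (%j. x j s) i) \<in> borel_measurable borel"
  and lip: "!!s x y i. \<bar>f s x i - f s y i\<bar> <= l s * (\<Sum>j\<in>UNIV. \<bar>x j - y j\<bar>)"
  and f0: "!!s i. f s (%_. 0) i = 0"
 shows "\<exists>x. (\<forall>i. L2loc (x i)) \<and>
   (\<forall>i. AL t. x i t = F i t + rconv (k i) lborel (%s. f s (%j. x j s) i) t)"
proof -
 let ?H = "%\<kappa> t s. \<bar>\<kappa> (t - s)\<bar> * \<bar>l s\<bar>"
 let ?G = "%X n s. %j. X n j s"
 let ?F = "%f x i. %s. f s (%j. x j s) i"
 note [measurable] = L2locD(1)[OF k] L2locD(1)[OF F] L2locD(1)[OF l]
 have l0: "0 <= l s" for s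
 proof -
  have "0 <= l s * real CARD('k)"
   using lip[of s "%_. 1" undefined "%_. 0"] by (auto intro: order_trans[OF abs_ge_zero])
  then show ?thesis by (simp add: zero_le_mult_iff)
 qed
 have fle: "\<bar>f s x i\<bar> <= l s * (\<Sum>j\<in>UNIV. \<bar>x j\<bar>)" for s x i
  using lip[of s x i "%_. 0"] f0 by simp
 have fL: "Lloc lborel (?F f x i)" if x: "!!j. L2loc (x j)" for x i
 proof (rule Lloc_bound[OF Lloc_mult_L2loc[OF l L2loc_sum]])
  show "L2loc (%s. \<bar>x j s\<bar>)" if "j \<in> UNIV" for j using x by (rule L2loc_abs)
  show "(?F f x i) \<in> borel_measurable borel"
   using L2locD(1)[OF x] by (rule meas)
  show "\<bar>f s (%j. x j s) i\<bar> <= \<bar>l s * (\<Sum>j\<in>UNIV. \<bar>x j s\<bar>)\<bar>" for s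
   using fle[of s "%j. x j s" i] by simp
 qed
 define \<kappa> where "\<kappa> = (%t. \<Sum>i\<in>UNIV. \<bar>k i t\<bar>)"
 have \<kappa>: "L2loc \<kappa>" unfolding \<kappa>_def by (intro L2loc_sum L2loc_abs k)
 note [measurable] = L2locD(1)[OF \<kappa>]
 have k\<kappa>: "\<bar>k i t\<bar> <= \<kappa> t" for i t
  unfolding \<kappa>_def by (rule member_le_sum) auto
 have \<kappa>0: "0 <= \<kappa> t" for t unfolding \<kappa>_def by (rule sum_nonneg) auto
 define X where "X n = ((%x i t. F i t + rconv (k i) lborel (?F f x i) t) ^^ n) (%i t. 0)" for n
 have X0: "X 0 i t = 0" for i t by (simp add: X_def)
 have XS: "X (Suc n) i t = F i t + rconv (k i) lborel (%s. f s (?G X n s) i) t" for n i t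
  by (simp add: X_def)
 have XL: "L2loc (X n i)" for n i
 proof (induction n arbitrary: i)
  case 0
  have "X 0 i = (%_. 0)" by (simp add: fun_eq_iff X0)
  then show ?case using L2loc_zero by simp
 next
  case (Suc n)
  have "L2loc (%t. F i t + rconv (k i) lborel (%s. f s (?G X n s) i) t)"
   by (intro L2loc_add F lborel.L2loc_rconv k fL Suc)
  moreover have "X (Suc n) i = (%t. F i t + rconv (k i) lborel (%s. f s (?G X n s) i) t)"
   by (simp add: fun_eq_iff XS)
  ultimately show ?case by simp
 qed
 note [measurable] = L2locD(1)[OF XL]
 define D where "D n t = (\<Sum>i\<in>UNIV. \<bar>X (Suc n) i t - X n i t\<bar>)" for n t
 have DL: "L2loc (D n)" for n unfolding D_def by (intro L2loc_sum L2loc_abs L2loc_diff XL)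
 note [measurable] = L2locD(1)[OF DL]
 have D0: "0 <= D n t" for n t unfolding D_def by (rule sum_nonneg) auto
 have Dstep: "AL t. ennreal (D (Suc n) t) <= (NN s. ennreal (?H \<kappa> t s) * ennreal (D n s))" for n
 proof -
  have "AL t. \<forall>i. integrable lborel (%s. k i (t - s) * f s (%j. X (Suc n) j s) i) & integrable lborel (%s. k i (t - s) * f s (?G X n s) i)"
   unfolding AE_all_countable
   by (intro allI AE_conjI lborel.AE_rconv_integrable Lloc_L2loc k fL XL)
  then show ?thesis
  proof eventually_elim
   case (elim t)
   have "ennreal (D (Suc n) t) = (\<Sum>i\<in>UNIV. ennreal \<bar>X (Suc (Suc n)) i t - X (Suc n) i t\<bar>)"
    unfolding D_def by (rule sum_ennreal[symmetric]) auto
   also have "... <= (\<Sum>i\<in>UNIV. NN s. ennreal (\<bar>k i (t - s)\<bar> * (l s * D n s)))"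
   proof (rule sum_mono)
    fix i :: 'k
    let ?g = "%s. f s (%j. X (Suc n) j s) i - f s (?G X n s) i"
    have "X (Suc (Suc n)) i t - X (Suc n) i t = (\<integral>s. k i (t - s) * ?g s \<partial>lborel)"
     using elim unfolding XS[of "Suc n"] XS[of n i t] by (simp add: rconv_def right_diff_distrib)
    then have "ennreal \<bar>X (Suc (Suc n)) i t - X (Suc n) i t\<bar> <= (NN s. ennreal \<bar>k i (t - s) * ?g s\<bar>)"
     using lborel.abs_rconv_le[of "k i" ?g t] by (simp add: rconv_def abs_mult)
    also have "... <= (NN s. ennreal (\<bar>k i (t - s)\<bar> * (l s * D n s)))"
     by (intro nn_integral_mono ennreal_leI) (auto simp: abs_mult D_def intro!: mult_left_mono lip)
    finally show "ennreal \<bar>X (Suc (Suc n)) i t - X (Suc n) i t\<bar> <= (NN s. ennreal (\<bar>k i (t - s)\<bar> * (l s * D n s)))" .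
   qed
   also have "... = (NN s. (\<Sum>i\<in>UNIV. ennreal (\<bar>k i (t - s)\<bar> * (l s * D n s))))"
    by (rule nn_integral_sum[symmetric]) measurable
   also have "... = (NN s. ennreal (?H \<kappa> t s) * ennreal (D n s))"
   proof (intro nn_integral_cong)
    fix s
    have "(\<Sum>i\<in>UNIV. ennreal (\<bar>k i (t - s)\<bar> * (l s * D n s))) = ennreal (\<Sum>i\<in>UNIV. \<bar>k i (t - s)\<bar> * (l s * D n s))"
     using l0 D0 by (intro sum_ennreal) auto
    also have "(\<Sum>i\<in>UNIV. \<bar>k i (t - s)\<bar> * (l s * D n s)) = \<kappa> (t - s) * l s * D n s"
     by (simp add: \<kappa>_def sum_distrib_right mult.assoc)
    finally show "(\<Sum>i\<in>UNIV. ennreal (\<bar>k i (t - s)\<bar> * (l s * D n s))) = ennreal (?H \<kappa> t s) * ennreal (D n s)"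
     using l0 \<kappa>0 D0 by (simp add: ennreal_mult)
   qed
   finally show ?case .
  qed
 qed
 define S where "S t = (\<Sum>n. ennreal (D n t))" for t
 have [measurable]: "S \<in> borel_measurable borel" unfolding S_def by measurable
 have SL: "(NN t. (S t)\<^sup>2 * indicator {0..T} t) < \<infinity>" for T
 proof -
  let ?L = "nnI lborel T (%s. (l s)\<^sup>2)"
  obtain w where w: "w \<ge> 0" "nnI lborel T (%u. (exp (- w * u) * \<kappa> u)\<^sup>2) * ?L <= ennreal (1/4)"
   using weighted_kernel_small[OF \<kappa> l, of "1/4" T] by auto
  define W where "W n = (NN t. (ennreal (exp (- w * t)) * ennreal (D n t))\<^sup>2 * indicator {0..T} t)" for n
  have WS: "W (Suc n) <= ennreal (1/4) * W n" for n
  proof -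
   have "W (Suc n) <= (NN t. (ennreal (exp (- w * t)) * (NN s. ennreal (?H \<kappa> t s) * ennreal (D n s)))\<^sup>2 * indicator {0..T} t)"
    unfolding W_def
    by (rule nn_integral_mono_AE, use Dstep[of n] in eventually_elim) (auto intro!: mult_mono power_mono_ennreal)
   also have "... <= nnI lborel T (%u. (exp (- w * u) * \<kappa> u)\<^sup>2) * ?L * W n"
    unfolding W_def by (rule weighted_L2_conv_le) (use \<kappa> l in auto)
   also have "... <= ennreal (1/4) * W n" by (intro mult_right_mono w) auto
   finally show ?thesis .
  qed
  have W0: "W 0 < \<infinity>"
  proof -
   have "W 0 <= nnI lborel T (%t. (D 0 t)\<^sup>2)"
    unfolding W_def
   proof (rule nn_integral_mono)
    fix t
    have "(ennreal (exp (- w * t)) * ennreal (D 0 t))\<^sup>2 = ennreal ((exp (- w * t))\<^sup>2 * (D 0 t)\<^sup>2)"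
     using D0 by (simp add: ennreal_power power_mult_distrib flip: ennreal_mult)
    also have "... <= ennreal ((D 0 t)\<^sup>2)" if "0 <= t"
     using that w by (intro ennreal_leI mult_left_le_one_le power_le_one) auto
    finally show "(ennreal (exp (- w * t)) * ennreal (D 0 t))\<^sup>2 * indicator {0..T} t <= ennreal ((D 0 t)\<^sup>2) * indicator {0..T} t"
     by (auto split: split_indicator)
   qed
   then show ?thesis by (rule order_le_less_trans[OF _ L2locD(3)[OF DL]])
  qed
  then obtain c where c: "W 0 = ennreal c" "0 <= c" by (cases "W 0") auto
  have Wn: "W n <= ennreal (c * (1/4) ^ n)" for n
  proof (induction n)
   case (Suc n)
   have "W (Suc n) <= ennreal (1/4) * ennreal (c * (1/4) ^ n)"
    using WS[of n] Suc by (meson mult_left_mono order_trans zero_le)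
   also have "... = ennreal (c * (1/4) ^ Suc n)" using c by (subst ennreal_mult[symmetric]) (auto simp: mult_ac)
   finally show ?case .
  qed (simp add: c)
  have "ennreal (exp (- 2 * w * T)) * (NN t. (S t)\<^sup>2 * indicator {0..T} t)
    = (NN t. ennreal (exp (- 2 * w * T)) * ((S t)\<^sup>2 * indicator {0..T} t))"
   by (rule nn_integral_cmult[symmetric]) measurable
  also have "... <= (NN t. 2 * (\<Sum>n. 2 ^ n * ((ennreal (exp (- w * t)) * ennreal (D n t))\<^sup>2 * indicator {0..T} t)))"
  proof (intro nn_integral_mono)
   fix t
   show "ennreal (exp (- 2 * w * T)) * ((S t)\<^sup>2 * indicator {0..T} t)
    <= 2 * (\<Sum>n. 2 ^ n * ((ennreal (exp (- w * t)) * ennreal (D n t))\<^sup>2 * indicator {0..T} t))"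
   proof (cases "0 <= t & t <= T")
    case True
    have "exp (- 2 * w * T) <= (exp (- w * t))\<^sup>2"
     using True w by (simp add: exp_double[symmetric] mult_left_mono)
    then have "ennreal (exp (- 2 * w * T)) * (S t)\<^sup>2 <= ennreal ((exp (- w * t))\<^sup>2) * (S t)\<^sup>2"
     by (intro mult_right_mono ennreal_leI) auto
    also have "... = (\<Sum>n. ennreal (exp (- w * t)) * ennreal (D n t))\<^sup>2"
     by (simp add: S_def power_mult_distrib flip: ennreal_power)
    also have "... <= 2 * (\<Sum>n. 2 ^ n * (ennreal (exp (- w * t)) * ennreal (D n t))\<^sup>2)"
     by (rule geometric_series_square_le)
    finally show ?thesis using True by simp
   qed auto
  qed
  also have "... = 2 * (NN t. (\<Sum>n. 2 ^ n * ((ennreal (exp (- w * t)) * ennreal (D n t))\<^sup>2 * indicator {0..T} t)))"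
   by (rule nn_integral_cmult) measurable
  also have "... = 2 * (\<Sum>n. 2 ^ n * W n)"
   unfolding W_def by (subst nn_integral_suminf) (auto simp: nn_integral_cmult)
  also have "... <= 2 * (\<Sum>n. ennreal (c * (1/2) ^ n))"
  proof (intro mult_left_mono suminf_le)
   fix n
   have "2 ^ n * W n <= ennreal (2 ^ n) * ennreal (c * (1/4) ^ n)"
    using Wn[of n] by (auto intro!: mult_mono simp flip: ennreal_power)
   also have "... = ennreal (c * (1/2) ^ n)"
    using c by (subst ennreal_mult[symmetric]) (auto simp: mult_ac power_mult_distrib[symmetric])
   finally show "2 ^ n * W n <= ennreal (c * (1/2) ^ n)" .
  qed auto
  also have "(\<Sum>n. ennreal (c * (1/2) ^ n)) = ennreal (\<Sum>n. c * (1/2) ^ n)"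
   using c by (intro suminf_ennreal2 summable_mult summable_geometric) auto
  also have "2 * ... < \<infinity>" by (simp add: ennreal_mult_less_top)
  finally have "ennreal (exp (- 2 * w * T)) * (NN t. (S t)\<^sup>2 * indicator {0..T} t) < \<infinity>" .
  then show ?thesis by (auto simp: ennreal_mult_less_top)
 qed
 have Sfin: "AL t. S t < \<infinity>"
 proof (rule AE_all_upto)
  fix T
  have "AL t. (S t)\<^sup>2 * indicator {0..T} t ~= \<infinity>"
   using SL[of T] by (intro nn_integral_PInf_AE) auto
  then show "AL t. t <= T --> S t < \<infinity>"
  proof eventually_elim
   case (elim t)
   show ?case
   proof (cases "t < 0")
    case True
    then show ?thesis using L2locD(2)[OF DL] by (simp add: S_def)
   qed (use elim in \<open>auto simp: less_top power2_eq_square ennreal_mult_eq_top_iff split: split_indicator_asm\<close>)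
  qed
 qed
 define S' where "S' t = enn2real (S t)" for t
 have S'0: "0 <= S' t" for t by (simp add: S'_def)
 have SS': "AL t. S t = ennreal (S' t)"
  using Sfin by eventually_elim (auto simp: S'_def)
 have S'L: "L2loc S'"
  unfolding L2loc_def
 proof (intro conjI allI impI)
  show "S' \<in> borel_measurable borel" unfolding S'_def by measurable
  show "S' s = 0" if "s < 0" for s using that L2locD(2)[OF DL] by (simp add: S'_def S_def)
  fix T
  have "nnI lborel T (%s. (S' s)\<^sup>2) = (NN t. (S t)\<^sup>2 * indicator {0..T} t)"
   by (rule nn_integral_cong_AE, use SS' in eventually_elim) (simp add: ennreal_power S'0)
  then show "nnI lborel T (%s. (S' s)\<^sup>2) < \<infinity>" using SL[of T] by simp
 qed
 note [measurable] = L2locD(1)[OF S'L]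
 define x where "x i t = lim (%n. X n i t)" for i t
 have [measurable]: "x i \<in> borel_measurable borel" for i
  unfolding x_def by measurable
 have Xconv: "AL t. (\<forall>i. (%n. X n i t) \<longlonglongrightarrow> x i t) & (\<forall>n. (\<Sum>i\<in>UNIV. \<bar>X n i t\<bar>) <= S' t)"
  using SS'
 proof eventually_elim
  case (elim t)
  have sm: "summable (%n. D n t)"
   using elim D0 unfolding S_def by (intro summable_suminf_not_top) auto
  have DS: "(\<Sum>n. D n t) = S' t"
   using elim D0 sm S'0 unfolding S_def by (subst (asm) suminf_ennreal2) (auto simp: suminf_nonneg)
  have conv: "convergent (%n. X n i t)" for i
  proof -
   have "summable (%n. X (Suc n) i t - X n i t)"
   proof (rule summable_comparison_test'[OF sm])
    show "norm (X (Suc n) i t - X n i t) <= D n t" for n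
     unfolding D_def real_norm_def by (rule member_le_sum) auto
   qed
   then have "convergent (%n. \<Sum>m<n. X (Suc m) i t - X m i t)" by (simp add: summable_iff_convergent)
   then show ?thesis
    using sum_lessThan_telescope[of "%m. X m i t"] by (simp add: X0)
  qed
  have "(\<Sum>i\<in>UNIV. \<bar>X n i t\<bar>) <= (\<Sum>m<n. D m t)" for n
  proof (induction n)
   case (Suc n)
   have "(\<Sum>i\<in>UNIV. \<bar>X (Suc n) i t\<bar>) <= (\<Sum>i\<in>UNIV. \<bar>X n i t\<bar> + \<bar>X (Suc n) i t - X n i t\<bar>)"
    by (rule sum_mono) auto
   then show ?case using Suc by (simp add: sum.distrib D_def)
  qed (simp add: X0)
  moreover have "(\<Sum>m<n. D m t) <= S' t" for n
   using sm D0 DS by (metis sum_le_suminf finite_lessThan)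
  ultimately show ?case using conv unfolding x_def convergent_LIMSEQ_iff by (meson order_trans)
 qed
 have xle: "AL t. \<forall>i. \<bar>x i t\<bar> <= \<bar>S' t\<bar>"
  using Xconv
 proof eventually_elim
  case (elim t)
  show ?case
  proof
   fix i
   have "\<bar>X n i t\<bar> <= S' t" for n
    using elim member_le_sum[of i UNIV "%i. \<bar>X n i t\<bar>"] by (force intro: order_trans)
   then have "\<bar>x i t\<bar> <= S' t"
   proof (intro LIMSEQ_le_const2)
    show "(%n. \<bar>X n i t\<bar>) \<longlonglongrightarrow> \<bar>x i t\<bar>" using elim by (intro tendsto_rabs) auto
   qed auto
   then show "\<bar>x i t\<bar> <= \<bar>S' t\<bar>" by simp
  qed
 qed
 have xL: "L2loc (x i)" for i
 proof (rule L2loc_bound_AE[OF S'L])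
  show "x i s = 0" if "s < 0" for s
   using that L2locD(2)[OF XL] by (simp add: x_def)
  show "AL s. \<bar>x i s\<bar> <= \<bar>S' s\<bar>" using xle by eventually_elim auto
 qed auto
 have "AL t. x i t = F i t + rconv (k i) lborel (?F f x i) t" for i
  using lborel.AE_rconv_integrable[OF Lloc_L2loc[OF L2loc_abs[OF k]] Lloc_mult_L2loc[OF l S'L], of i] Xconv
 proof eventually_elim
  case (elim t)
  have [measurable]: "(?F f x i) \<in> borel_measurable borel" by (rule meas) measurable
  have [measurable]: "(%s. f s (?G X n s) i) \<in> borel_measurable borel" for n by (rule meas) measurable
  have "(%n. rconv (k i) lborel (%s. f s (?G X n s) i) t) \<longlonglongrightarrow> rconv (k i) lborel (?F f x i) t"
   unfolding rconv_def
  proof (rule integral_dominated_convergence)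
   show "integrable lborel (%s. \<bar>k i (t - s)\<bar> * (l s * S' s))" using elim by simp
   show "AL s. norm (k i (t - s) * f s (?G X n s) i) <= \<bar>k i (t - s)\<bar> * (l s * S' s)" for n
    using Xconv
   proof eventually_elim
    case (elim s)
    have "\<bar>f s (?G X n s) i\<bar> <= l s * S' s"
     using elim l0 by (intro order_trans[OF fle] mult_left_mono) auto
    then show ?case by (simp add: abs_mult mult_left_mono)
   qed
   show "AL s. (%n. k i (t - s) * f s (?G X n s) i) \<longlonglongrightarrow> k i (t - s) * f s (%j. x j s) i"
    using Xconv
   proof eventually_elim
    case (elim s)
    have "(%n. f s (?G X n s) i - f s (%j. x j s) i) \<longlonglongrightarrow> 0"
    proof (rule Lim_null_comparison)
     show "\<forall>\<^sub>F n in sequentially. norm (f s (?G X n s) i - f s (%j. x j s) i) <= l s * (\<Sum>j\<in>UNIV. \<bar>X n j s - x j s\<bar>)"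
      using lip by simp
     have "(%n. l s * (\<Sum>j\<in>UNIV. \<bar>X n j s - x j s\<bar>)) \<longlonglongrightarrow> l s * (\<Sum>j\<in>UNIV. \<bar>x j s - x j s\<bar>)"
      using elim by (intro tendsto_intros) auto
     then show "(%n. l s * (\<Sum>j\<in>UNIV. \<bar>X n j s - x j s\<bar>)) \<longlonglongrightarrow> 0" by simp
    qed
    then show ?case by (intro tendsto_mult_left) (simp add: LIM_zero_iff)
   qed
  qed measurable
  then have "(%n. X (Suc n) i t) \<longlonglongrightarrow> F i t + rconv (k i) lborel (?F f x i) t"
   unfolding XS by (intro tendsto_intros)
  moreover have "(%n. X (Suc n) i t) \<longlonglongrightarrow> x i t" using elim by (intro LIMSEQ_Suc) auto
  ultimately show ?case by (rule LIMSEQ_unique[rotated])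
 qed
 then show ?thesis using xL by auto
qed

section \<open>Positivity of scalar resolvents\<close>

text \<open>Dyadic intervals exhaust an open set disjointly, and outer regularity passes from open sets to Borel sets.\<close>
lemma emeasure_le_if_le_on_intervals:
 fixes M N :: "real measure"
 assumes sets: "sets M = sets borel" "sets N = sets borel"
  and fin: "emeasure M UNIV < \<infinity>" "emeasure N UNIV < \<infinity>"
  and le: "!!a b. a < b ==> emeasure M {a<..b} <= emeasure N {a<..b}"
  and A: "A \<in> sets borel"
 shows "emeasure M A <= emeasure N A"
proof -
 note [measurable_cong] = sets
 have space: "space M = UNIV" "space N = UNIV"
  using sets_eq_imp_space_eq[OF sets(1)] sets_eq_imp_space_eq[OF sets(2)] by auto
 have opn: "emeasure M U <= emeasure N U" if U: "open U" for U
 proof -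
  define I where "I n j = {(real_of_int j - 1) / 2 ^ n<..real_of_int j / 2 ^ n}" for n :: nat and j
  define J where "J n = {j. I n j \<subseteq> U}" for n
  define V where "V n = (\<Union>j\<in>J n. I n j)" for n
  have in_I: "x \<in> I n j \<longleftrightarrow> j = \<lceil>x * 2 ^ n\<rceil>" for x n j
   unfolding I_def by (auto simp: field_simps; linarith)
  have disj: "disjoint_family_on (I n) (J n)" for n
   by (auto simp: disjoint_family_on_def in_I)
  have [measurable]: "I n j \<in> sets borel" for n j unfolding I_def by auto
  have [measurable]: "V n \<in> sets borel" for n unfolding V_def by auto
  have [measurable]: "U \<in> sets borel" using U by auto
  have VU: "V n \<subseteq> U" for n by (auto simp: V_def J_def)
  have Vle: "emeasure M (V n) <= emeasure N (V n)" for n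
  proof -
   have "emeasure M (V n) = (\<integral>\<^sup>+j. emeasure M (I n j) \<partial>count_space (J n))"
    unfolding V_def using disj by (intro emeasure_UN_countable) auto
   also have "... <= (\<integral>\<^sup>+j. emeasure N (I n j) \<partial>count_space (J n))"
    unfolding I_def by (intro nn_integral_mono le) (auto simp: divide_strict_right_mono)
   also have "... = emeasure N (V n)"
    unfolding V_def using disj by (intro emeasure_UN_countable[symmetric]) auto
   finally show ?thesis .
  qed
  have ev: "\<forall>\<^sub>F n in sequentially. x \<in> V n" if xU: "x \<in> U" for x
  proof -
   obtain e where e: "e > 0" "ball x e \<subseteq> U" using U xU by (meson open_contains_ball)
   have "(%n. (1/2::real) ^ n) \<longlonglongrightarrow> 0" by (intro LIMSEQ_realpow_zero) auto
   then have "\<forall>\<^sub>F n in sequentially. (1/2::real) ^ n < e" using e by (intro order_tendstoD) auto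
   then show ?thesis
   proof eventually_elim
    case (elim n)
    define j where "j = \<lceil>x * 2 ^ n\<rceil>"
    have x: "x \<in> I n j" by (simp add: in_I j_def)
    have "I n j \<subseteq> ball x e"
    proof
     fix y assume "y \<in> I n j"
     with x have "\<bar>x - y\<bar> < 1 / 2 ^ n" unfolding I_def by (auto simp: diff_divide_distrib)
     also have "1 / 2 ^ n < e" using elim by (simp add: power_one_over)
     finally show "y \<in> ball x e" by (simp add: dist_real_def)
    qed
    then show ?case using x e by (auto simp: V_def J_def)
   qed
  qed
  have "(%n. \<integral>\<^sup>+x. indicator (V n) x \<partial>M) \<longlonglongrightarrow> (\<integral>\<^sup>+x. indicator U x \<partial>M)"
  proof (rule nn_integral_dominated_convergence[where w="%_. 1"])
   show "(\<integral>\<^sup>+x. 1 \<partial>M) < \<infinity>" using fin space by simp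
   show "AE x in M. (%n. indicator (V n) x :: ennreal) \<longlonglongrightarrow> indicator U x"
   proof (intro AE_I2)
    fix x
    have "\<forall>\<^sub>F n in sequentially. (indicator (V n) x :: ennreal) = indicator U x"
    proof (cases "x \<in> U")
     case True
     show ?thesis using ev[OF True] by eventually_elim (use True in auto)
    next
     case False
     then show ?thesis using VU by (intro always_eventually) (auto split: split_indicator)
    qed
    then show "(%n. indicator (V n) x :: ennreal) \<longlonglongrightarrow> indicator U x" by (rule tendsto_eventually)
   qed
  qed (auto split: split_indicator)
  then have "(%n. emeasure M (V n)) \<longlonglongrightarrow> emeasure M U" by simp
  moreover have "emeasure M (V n) <= emeasure N U" for n
   by (rule order_trans[OF Vle]) (auto intro!: emeasure_mono VU)
  ultimately show ?thesis by (auto intro: LIMSEQ_le_const2)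
 qed
 have "emeasure M A = (INF U\<in>{U. A \<subseteq> U & open U}. emeasure M U)"
  by (rule outer_regular) (use sets fin space A in auto)
 also have "... <= (INF U\<in>{U. A \<subseteq> U & open U}. emeasure N U)"
  by (rule INF_mono) (use opn in auto)
 also have "... = emeasure N A"
  by (rule outer_regular[symmetric]) (use sets fin space A in auto)
 finally show ?thesis .
qed

lemma scalar_resolvent_exists:
 assumes k: "L2loc k"
 shows "\<exists>r. L2loc r & (AL t. r t + c * rconv k lborel r t = c * k t)"
proof -
 let ?f = "%s (x::unit=>real) i. - c * (indicator {0..} s * x i)"
 have "\<exists>x. (\<forall>i::unit. L2loc (x i)) \<and>
   (\<forall>i. AL t. x i t = c * k t + rconv k lborel (%s. ?f s (%j. x j s) i) t)"
 proof (rule Volterra_existence[where F="%_ t. c * k t" and l="%s. \<bar>c\<bar> * indicator {0..} s"])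
  show "L2loc (%s. \<bar>c\<bar> * indicator {0..} s)" by (intro L2loc_cmult L2loc_one)
  show "\<bar>?f s x i - ?f s y i\<bar> <= \<bar>c\<bar> * indicator {0..} s * (\<Sum>j\<in>UNIV. \<bar>x j - y j\<bar>)" for s x y and i :: unit
   by (cases i) (auto split: split_indicator simp: UNIV_unit abs_mult abs_minus_commute simp flip: right_diff_distrib)
 qed (auto intro: k L2loc_cmult)
 then obtain x where x: "L2loc (x ())" "AL t. x () t = c * k t + rconv k lborel (%s. ?f s (%j. x j s) ()) t"
  by auto
 have "(%s. ?f s (%j. x j s) ()) = (%s. - c * x () s)"
  using L2locD(2)[OF x(1)] by (auto simp: fun_eq_iff split: split_indicator)
 then have "AL t. x () t = c * k t - c * rconv k lborel (x ()) t"
  using x(2) lborel.rconv_cmult(1)[of k "- c" "x ()"] by simp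
 then have "AL t. x () t + c * rconv k lborel (x ()) t = c * k t"
  by eventually_elim simp
 then show ?thesis using x(1) by auto
qed

text \<open>Convolving with such functions preserves every pointwise identity, in contrast to the almost everywhere
identities for integrable functions.\<close>
definition bounded_causal :: "(real => real) => bool" where
 "bounded_causal f \<longleftrightarrow> f \<in> borel_measurable borel & (\<forall>s<0. f s = 0) & (\<forall>T. \<exists>B. \<forall>s\<le>T. \<bar>f s\<bar> <= B)"

lemma bounded_causalD:
 assumes "bounded_causal f"
 shows "f \<in> borel_measurable borel" "s < 0 ==> f s = 0"
 using assms by (auto simp: bounded_causal_def)

lemma bounded_causal_bound:
 assumes "bounded_causal f"
 obtains B where "!!s. s <= T ==> \<bar>f s\<bar> <= B" "0 <= B"
 using assms unfolding bounded_causal_def by (metis abs_ge_zero order_refl order_trans)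

context borel_sigma_finite begin

lemma rconv_integrable_bounded:
 assumes f: "bounded_causal f" and n: "Lloc M n"
 shows "integrable M (%s. f (t - s) * n s)"
proof (rule integrableI_bounded)
 let ?G = "%s. ennreal \<bar>n s\<bar> * indicator {0..t} s"
 let ?F = "\<integral>\<^sup>+s. ennreal (norm (f (t - s) * n s)) \<partial>M"
 note [measurable] = bounded_causalD(1)[OF f] LlocD(1)[OF n]
 show "(%s. f (t - s) * n s) \<in> borel_measurable M" by measurable
 obtain B where B: "!!s. s <= t ==> \<bar>f s\<bar> <= B" "0 <= B" using bounded_causal_bound[OF f] by metis
 have "?F <= (\<integral>\<^sup>+s. ennreal B * (?G s) \<partial>M)"
 proof (intro nn_integral_mono)
  fix s
  show "ennreal (norm (f (t - s) * n s)) <= ennreal B * (?G s)"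
   using B bounded_causalD(2)[OF f, of "t - s"] LlocD(2)[OF n, of s]
   by (cases "0 <= s & s <= t") (auto simp: abs_mult not_le ennreal_mult[symmetric] intro!: ennreal_leI mult_right_mono)
 qed
 also have "... = ennreal B * (\<integral>\<^sup>+s. (?G s) \<partial>M)"
  by (rule nn_integral_cmult) measurable
 also have "... < \<infinity>" using LlocD(3)[OF n, of t] by (simp add: ennreal_mult_less_top)
 finally show "?F < \<infinity>" .
qed

lemma rconv_assoc_bounded:
 assumes f: "bounded_causal f" and g: "Lloc lborel g" and n: "Lloc M n"
 shows "rconv f lborel (rconv g M n) t = rconv (rconv f lborel g) M n t"
proof (rule rconv_assoc_at)
 let ?H = "%s u. ennreal \<bar>g (s - u)\<bar> * ennreal \<bar>n u\<bar>"
 let ?F = "%s. \<integral>\<^sup>+(u::real). ennreal (\<bar>f (t - s)\<bar> * \<bar>g (s - u)\<bar> * \<bar>n u\<bar>) \<partial>M"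
 note [measurable] = bounded_causalD(1)[OF f] LlocD(1)[OF g] LlocD(1)[OF n]
 show "f \<in> borel_measurable borel" "g \<in> borel_measurable borel" "n \<in> borel_measurable borel" by measurable
 obtain B where B: "!!s. s <= t ==> \<bar>f s\<bar> <= B" "0 <= B" using bounded_causal_bound[OF f] by metis
 have "(NN s. (?F s))
   <= (NN s. ennreal B * ((\<integral>\<^sup>+u. ?H s u \<partial>M) * indicator {..t} s))"
 proof (intro nn_integral_mono)
  fix s
  let ?G = "\<integral>\<^sup>+u. ?H s u \<partial>M"
  have "(?F s) = (\<integral>\<^sup>+u. ennreal \<bar>f (t - s)\<bar> * (?H s u) \<partial>M)"
   by (simp add: ennreal_mult mult.assoc)
  also have "... = ennreal \<bar>f (t - s)\<bar> * ?G" by (rule nn_integral_cmult) measurable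
  also have "... <= ennreal B * (?G * indicator {..t} s)"
  proof (cases "0 <= s & s <= t")
   case True
   then show ?thesis using B(1)[of "t - s"] by (auto intro!: mult_right_mono ennreal_leI)
  next
   case False
   moreover have "?G = 0" if "s < 0"
   proof -
    have "(%u. ?H s u) = (%u. 0)"
    proof
     show "?H s u = 0" for u
      using that LlocD(2)[OF g, of "s - u"] LlocD(2)[OF n, of u] by (cases "u < 0") auto
    qed
    then show ?thesis by simp
   qed
   ultimately show ?thesis using bounded_causalD(2)[OF f, of "t - s"] by (cases "s < 0") auto
  qed
  finally show "(?F s) <= ennreal B * (?G * indicator {..t} s)" .
 qed
 also have "... = ennreal B * (NN s. ((\<integral>\<^sup>+u. ?H s u \<partial>M) * indicator {..t} s))"
  by (rule nn_integral_cmult) measurable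
 also have "... <= ennreal B * (nnI lborel t (%u. \<bar>g u\<bar>) * nnI M t (%s. \<bar>n s\<bar>))"
  by (intro mult_left_mono nn_conv_le) (use LlocD(2)[OF g] LlocD(2)[OF n] in auto)
 also have "... < \<infinity>"
  using LlocD(3)[OF g, of t] LlocD(3)[OF n, of t] by (simp add: ennreal_mult_less_top)
 finally show "(NN s. (?F s)) < \<infinity>" .
qed

end

text \<open>The convolution with a Lipschitz function \<open>f\<close> that vanishes on the negative half-line inherits
the Lipschitz property, so it can be evaluated pointwise.\<close>
lemma Lipschitz_rconv:
 assumes r: "Lloc lborel r" and f: "bounded_causal f" and lip: "!!x y. \<bar>f x - f y\<bar> <= \<Lambda> * \<bar>x - y\<bar>"
 shows "\<exists>L\<ge>0. \<forall>t\<le>T. \<forall>t'\<le>T. \<bar>rconv r lborel f t - rconv r lborel f t'\<bar> <= L * \<bar>t - t'\<bar>"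
proof -
 let ?G = "%t s t'. f (t - s) * r s - f (t' - s) * r s"
 let ?F = "%s. \<bar>r s\<bar> * indicator {0..T} s"
 note [measurable] = bounded_causalD(1)[OF f] LlocD(1)[OF r]
 have \<Lambda>: "0 <= \<Lambda>" using lip[of 0 1] by (auto intro: order_trans[OF abs_ge_zero])
 let ?R = "\<integral>s. ?F s \<partial>lborel"
 have R: "integrable lborel (%s. ?F s)"
 proof (rule integrableI_bounded)
  have "(NN s. ennreal (norm (?F s))) = nnI lborel T (%s. \<bar>r s\<bar>)"
   by (intro nn_integral_cong) (auto split: split_indicator)
  then show "(NN s. ennreal (norm (?F s))) < \<infinity>" using LlocD(3)[OF r, of T] by simp
 qed measurable
 have "\<bar>rconv r lborel f t - rconv r lborel f t'\<bar> <= (\<Lambda> * ?R) * \<bar>t - t'\<bar>" if "t <= T" "t' <= T" for t t'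
 proof -
  have int: "integrable lborel (%s. f (t - s) * r s)" for t
   by (rule lborel.rconv_integrable_bounded[OF f r])
  have "rconv r lborel f t - rconv r lborel f t' = (\<integral>s. ?G t s t' \<partial>lborel)"
   unfolding rconv_commute[of r f] using int by (simp add: rconv_def)
  also have "\<bar>...\<bar> <= (\<integral>s. norm (?G t s t') \<partial>lborel)"
   using integral_norm_bound[of lborel "%s. ?G t s t'"] by simp
  also have "... <= (\<integral>s. \<Lambda> * \<bar>t - t'\<bar> * (?F s) \<partial>lborel)"
  proof (rule integral_mono)
   fix s
   show "norm (?G t s t') <= \<Lambda> * \<bar>t - t'\<bar> * (?F s)"
   proof (cases "0 <= s & s <= T")
    case True
    have "norm (?G t s t') = \<bar>f (t - s) - f (t' - s)\<bar> * \<bar>r s\<bar>"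
     by (simp flip: left_diff_distrib abs_mult)
    also have "... <= (\<Lambda> * \<bar>t - t'\<bar>) * \<bar>r s\<bar>" using lip[of "t - s" "t' - s"] by (intro mult_right_mono) auto
    finally show ?thesis using True by simp
   next
    case False
    then have "s < 0 \<or> t - s < 0 & t' - s < 0" using that by auto
    then show ?thesis using LlocD(2)[OF r, of s] bounded_causalD(2)[OF f] \<Lambda> by (auto split: split_indicator)
   qed
  qed (use int R in \<open>auto intro!: integrable_norm\<close>)
  also have "... = (\<Lambda> * ?R) * \<bar>t - t'\<bar>" by simp
  finally show ?thesis .
 qed
 moreover have "0 <= \<Lambda> * ?R" using \<Lambda> by (intro mult_nonneg_nonneg integral_nonneg_AE) auto
 ultimately show ?thesis by blast
qed

text \<open>The condition on the resolvent of the first kind in the definition of admissible parameters.\<close>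
locale decreasing_shift_measure = borel_sigma_finite +
 assumes finite_Icc: "emeasure M {0..T} < \<infinity>"
  and shift_Icc: "0 <= s ==> 0 <= t ==> 0 <= h ==> emeasure M {s + h..s + h + t} <= emeasure M {s..s + t}"
begin

lemma Lloc_one: "Lloc M (indicator {0..})"
proof -
 have "nnI M T (%s. \<bar>indicator {0..} s\<bar>) = (\<integral>\<^sup>+s. indicator {0..T} s \<partial>M)" for T
  by (intro nn_integral_cong) (auto split: split_indicator)
 then show ?thesis using finite_Icc by (auto simp: Lloc_def)
qed

lemma shift_Ioc:
 assumes "0 <= a" "0 <= h"
 shows "emeasure M {a + h<..b + h} <= emeasure M {a<..b}"
proof -
 define A where "A n = {a + h + 1 / real (Suc n)..b + h}" for n
 define B where "B n = {a + 1 / real (Suc n)..b}" for n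
 have ex: "\<exists>n. c + 1 / real (Suc n) <= x" if "c < x" for c x :: real
  using reals_Archimedean[of "x - c"] that by (auto simp: inverse_eq_divide algebra_simps intro: less_imp_le)
 have "emeasure M (A n) <= emeasure M (B n)" for n
 proof (cases "a + 1 / real (Suc n) <= b")
  case True
  then show ?thesis
   using shift_Icc[of "a + 1 / real (Suc n)" "b - (a + 1 / real (Suc n))" h] assms by (simp add: A_def B_def algebra_simps)
 qed (simp add: A_def)
 also have "emeasure M (B n) <= emeasure M {a<..b}" for n
 proof (intro emeasure_mono subsetI)
  fix x assume "x \<in> B n"
  moreover have "0 < 1 / real (Suc n)" by simp
  ultimately show "x \<in> {a<..b}" unfolding B_def atLeastAtMost_iff greaterThanAtMost_iff by linarith
 qed simp
 finally have "(SUP n. emeasure M (A n)) <= emeasure M {a<..b}" by (intro SUP_least)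
 moreover have "(SUP n. emeasure M (A n)) = emeasure M (\<Union>n. A n)"
 proof (rule SUP_emeasure_incseq)
  show "incseq A"
   unfolding A_def incseq_def by (auto intro: order_trans[rotated] simp: frac_le)
 qed (auto simp: A_def)
 moreover have "(\<Union>n. A n) = {a + h<..b + h}"
 proof (intro set_eqI iffI)
  fix x assume "x \<in> (\<Union>n. A n)"
  then obtain n where "x \<in> A n" by blast
  moreover have "0 < 1 / real (Suc n)" by simp
  ultimately show "x \<in> {a + h<..b + h}" unfolding A_def atLeastAtMost_iff greaterThanAtMost_iff by linarith
 next
  fix x assume "x \<in> {a + h<..b + h}"
  then show "x \<in> (\<Union>n. A n)" using ex[of "a + h" x] by (auto simp: A_def)
 qed
 ultimately show ?thesis by simp
qed

text \<open>Monotonicity under shifts, extended from intervals to integrals of nonnegative functions.\<close>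
lemma shift_nn_integral_le:
 assumes [measurable]: "w \<in> borel_measurable borel" and h: "0 <= h"
 shows "(\<integral>\<^sup>+s. w s * indicator {h..T} s \<partial>M) <= (\<integral>\<^sup>+s. w (s + h) * indicator {0..T - h} s \<partial>M)"
proof -
 let ?F = "%s. s - h"
 define M1 where "M1 = distr (density M (indicator {h..T})) borel ?F"
 define M2 where "M2 = density M (indicator {0..T - h})"
 have sets: "sets M1 = sets borel" "sets M2 = sets borel" by (auto simp: M1_def M2_def)
 have sp: "space M = UNIV" using sets_eq_imp_space_eq[OF sets_eq_borel] by simp
 have e1: "emeasure M1 A = emeasure M (?F -` A \<inter> {h..T})" if "A \<in> sets borel" for A
 proof -
  have [measurable]: "A \<in> sets borel" "?F -` A \<in> sets borel"
   using that measurable_sets[of "%s. s - h" borel borel A] by auto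
  have "emeasure M1 A = emeasure (density M (indicator {h..T})) (?F -` A)"
   unfolding M1_def by (subst emeasure_distr) (auto simp: sp)
  also have "... = emeasure M (?F -` A \<inter> {h..T})"
   by (subst emeasure_restricted) (auto simp: Int_commute)
  finally show ?thesis .
 qed
 have e2: "emeasure M2 A = emeasure M (A \<inter> {0..T - h})" if "A \<in> sets borel" for A
  unfolding M2_def using that by (subst emeasure_restricted) (auto simp: Int_commute)
 have "emeasure M1 A <= emeasure M2 A" for A
 proof (cases "A \<in> sets borel")
  case True
  show ?thesis
  proof (rule emeasure_le_if_le_on_intervals[OF sets _ _ _ True])
   show "emeasure M1 UNIV < \<infinity>"
    using finite_Icc[of T] emeasure_mono[of "{h..T}" "{0..T}" M] h
    by (subst e1) (auto intro: order_le_less_trans)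
   show "emeasure M2 UNIV < \<infinity>"
    using finite_Icc[of "T - h"] by (subst e2) auto
   fix a b :: real assume "a < b"
   show "emeasure M1 {a<..b} <= emeasure M2 {a<..b}"
   proof (cases "a < 0")
    case True
    have "?F -` {a<..b} \<inter> {h..T} = {0 + h..0 + h + min b (T - h)}" using True by auto
    moreover have "{a<..b} \<inter> {0..T - h} = {0..0 + min b (T - h)}" using True by auto
    ultimately show ?thesis using shift_Icc[of 0 "min b (T - h)" h] h
     by (cases "0 <= min b (T - h)") (auto simp: e1 e2)
   next
    case False
    have "?F -` {a<..b} \<inter> {h..T} = {a + h<..min b (T - h) + h}" using False by auto
    moreover have "{a<..b} \<inter> {0..T - h} = {a<..min b (T - h)}" using False by auto
    ultimately show ?thesis using shift_Ioc[of a h "min b (T - h)"] h False by (simp add: e1 e2)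
   qed
  qed
 next
  case False
  then show ?thesis using sets by (simp add: emeasure_notin_sets)
 qed
 then have "M1 <= M2" using sets by (simp add: le_measure le_fun_def)
 then have "(\<integral>\<^sup>+u. w (u + h) \<partial>M1) <= (\<integral>\<^sup>+u. w (u + h) \<partial>M2)"
  using sets by (intro nn_integral_mono_measure) auto
 then show ?thesis
  unfolding M1_def M2_def
  by (subst (asm) nn_integral_distr, simp, simp) (simp add: nn_integral_density mult.commute)
qed

text \<open>A maximum principle. The function \<open>v = r * f\<close> satisfies \<open>v = k * (c (f - v))\<close>, and
convolving with the resolvent \<open>M\<close> of the first kind gives \<open>(v * M)(t) = \<integral>\<^sub>0\<^sup>t c (f - v)\<close>.
Suppose that \<open>v\<close> has a negative minimum on \<open>[0,T]\<close> at \<open>t0\<close>. Close to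
\<open>t0\<close> the integrand \<open>c (f - v)\<close> is positive and bounded away from 0, so \<open>(v * M)(t0) - (v * M)(t0 - h)\<close>
is at least a positive multiple of \<open>h\<close>. On the other hand \<open>w = v - min v\<close> is
nonnegative and vanishes at \<open>t0\<close>; since shifting decreases \<open>M\<close>, the same
difference is, up to a term that only helps, at most \<open>O(h)\<close> times the mass of \<open>M\<close>
on \<open>(0,h)\<close>. That mass tends to 0 with \<open>h\<close>, a contradiction.\<close>
lemma nonneg_rconv_Lipschitz:
 assumes k: "Lloc lborel k" and res: "AL t. rconv k M (indicator {0..}) t = indicator {0..} t"
  and lam: "0 < c" and r: "Lloc lborel r" and eq: "AL t. r t + c * rconv k lborel r t = c * k t"
  and f: "bounded_causal f" and fpos: "!!s. 0 <= f s" and lip: "!!x y. \<bar>f x - f y\<bar> <= \<Lambda> * \<bar>x - y\<bar>"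
 shows "0 <= rconv r lborel f t1"
proof (rule ccontr)
 note [measurable] = bounded_causalD(1)[OF f] LlocD(1)[OF r] LlocD(1)[OF k]
 define v where "v = rconv r lborel f"
 assume "\<not> 0 <= rconv r lborel f t1"
 then have neg: "v t1 < 0" by (simp add: v_def)
 have v0: "v t = 0" if "t <= 0" for t
 proof -
  have "(%s. f (t - s) * r s) = (%s. 0)"
  proof
   fix s
   have "f 0 = 0" proof -
    have "\<bar>f 0\<bar> <= \<Lambda> * (1 / real (Suc n))" for n
     using lip[of 0 "- 1 / real (Suc n)"] bounded_causalD(2)[OF f, of "- 1 / real (Suc n)"] by simp
    moreover have "(%n. \<Lambda> * (1 / real (Suc n))) \<longlonglongrightarrow> \<Lambda> * 0"
     by (intro tendsto_intros LIMSEQ_Suc[OF lim_1_over_n])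
    ultimately have "\<bar>f 0\<bar> <= \<Lambda> * 0" by (intro LIMSEQ_le_const) auto
    then show ?thesis by simp
   qed
   moreover have "s < 0 \<or> t - s < 0 \<or> t - s = 0" using that by linarith
   ultimately show "f (t - s) * r s = 0"
    using LlocD(2)[OF r, of s] bounded_causalD(2)[OF f, of "t - s"] by auto
  qed
  then show ?thesis unfolding v_def rconv_commute[of r f] by (simp add: rconv_def)
 qed
 define T where "T = t1"
 have T: "T > 0" using neg v0[of t1] unfolding T_def by (cases "t1 <= 0") auto
 obtain L where L: "L \<ge> 0" "!!t t'. t <= T ==> t' <= T ==> \<bar>v t - v t'\<bar> <= L * \<bar>t - t'\<bar>"
  using Lipschitz_rconv[OF r f lip, of T] unfolding v_def by blast
 have LT: "\<exists>L\<ge>0. \<forall>t\<le>T. \<forall>t'\<le>T. \<bar>v t - v t'\<bar> <= L * \<bar>t - t'\<bar>" for T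
  using Lipschitz_rconv[OF r f lip, of T] unfolding v_def by blast
 have [measurable]: "v \<in> borel_measurable borel" unfolding v_def by measurable
 have vbc: "bounded_causal v"
  unfolding bounded_causal_def
 proof (intro conjI allI impI)
  fix T :: real
  obtain L where L: "L \<ge> 0" "!!t t'. t <= max T 0 ==> t' <= max T 0 ==> \<bar>v t - v t'\<bar> <= L * \<bar>t - t'\<bar>"
   using LT[of "max T 0"] by blast
  have "\<bar>v s\<bar> <= L * max T 0" if "s <= T" for s
  proof (cases "s <= 0")
   case True then show ?thesis using L v0 by auto
  next
   case False
   have "\<bar>v s\<bar> <= L * s" using L(2)[of s 0] v0[of 0] that False by simp
   also have "... <= L * max T 0" using that L by (intro mult_left_mono) auto
   finally show ?thesis .
  qed
  then show "\<exists>B. \<forall>s\<le>T. \<bar>v s\<bar> <= B" by blast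
 qed (use v0 in auto)
 define g where "g = (%s. c * (f s - v s))"
 have gbc: "bounded_causal g"
  unfolding bounded_causal_def
 proof (intro conjI allI impI)
  fix T :: real
  obtain B1 where B1: "!!s. s <= T ==> \<bar>f s\<bar> <= B1" using bounded_causal_bound[OF f] by metis
  obtain B2 where B2: "!!s. s <= T ==> \<bar>v s\<bar> <= B2" using bounded_causal_bound[OF vbc] by metis
  have "\<bar>g s\<bar> <= c * (B1 + B2)" if "s <= T" for s
   using B1[OF that] B2[OF that] lam by (auto simp: g_def abs_mult intro!: mult_left_mono)
  then show "\<exists>B. \<forall>s\<le>T. \<bar>g s\<bar> <= B" by blast
 qed (use v0 bounded_causalD(2)[OF f] in \<open>auto simp: g_def\<close>)
 note [measurable] = bounded_causalD(1)[OF gbc]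
 have vg: "v t = rconv g lborel k t" for t
 proof -
  have i: "integrable lborel (%s. f (t - s) * k s)" "integrable lborel (%s. v (t - s) * k s)" "integrable lborel (%s. f (t - s) * r s)"
   "integrable lborel (%s. f (t - s) * rconv k lborel r s)"
   by (intro lborel.rconv_integrable_bounded f vbc k r lborel.Lloc_rconv)+
  have "rconv f lborel r t + c * rconv f lborel (rconv k lborel r) t = (\<integral>s. f (t - s) * (r s + c * rconv k lborel r s) \<partial>lborel)"
   using i by (simp add: rconv_def distrib_left mult.left_commute)
  also have "... = (\<integral>s. f (t - s) * (c * k s) \<partial>lborel)"
   by (rule integral_cong_AE, measurable, measurable) (use eq in eventually_elim, simp)
  also have "... = c * rconv f lborel k t" by (simp add: rconv_def mult.left_commute)
  finally have 1: "rconv f lborel r t + c * rconv f lborel (rconv k lborel r) t = c * rconv f lborel k t" .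
  have "rconv k lborel r = rconv r lborel k" by (rule ext) (rule rconv_commute)
  then have "rconv f lborel (rconv k lborel r) t = rconv (rconv f lborel r) lborel k t"
   using lborel.rconv_assoc_bounded[OF f r k, of t] by simp
  also have "rconv f lborel r = v" unfolding v_def by (rule ext) (rule rconv_commute)
  finally have 2: "rconv f lborel (rconv k lborel r) t = rconv v lborel k t" .
  have "rconv g lborel k t = c * (rconv f lborel k t - rconv v lborel k t)"
   using i by (simp add: g_def rconv_def left_diff_distrib mult.assoc)
  moreover have "rconv f lborel r t = v t" unfolding v_def by (rule rconv_commute)
  ultimately show ?thesis using 1 2 by (simp add: right_diff_distrib)
 qed
 \<comment> \<open>convolve with the first kind resolvent\<close>
 have conv: "(\<integral>s. v (t - s) * indicator {0..} s \<partial>M) = (\<integral>s. g s * indicator {0..t} s \<partial>lborel)" for t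
 proof -
  have "(\<integral>s. v (t - s) * indicator {0..} s \<partial>M) = rconv (rconv g lborel k) M (indicator {0..}) t"
   by (simp add: rconv_def vg[abs_def])
  also have "... = rconv g lborel (rconv k M (indicator {0..})) t"
   by (rule rconv_assoc_bounded[symmetric]) (intro gbc k Lloc_one)+
  also have "... = rconv g lborel (indicator {0..}) t"
   by (rule lborel.rconv_cong_right[OF res]) measurable
  also have "... = rconv (indicator {0..}) lborel g t" by (rule rconv_commute)
  also have "... = (\<integral>s. g s * indicator {0..t} s \<partial>lborel)"
   unfolding rconv_def
  proof (rule Bochner_Integration.integral_cong[OF refl])
   show "indicator {0..} (t - s) * g s = g s * indicator {0..t} s" for s
    using bounded_causalD(2)[OF gbc, of s] by (auto split: split_indicator)
  qed
  finally show ?thesis .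
 qed
 have cont: "continuous_on {0..T} v"
 proof (rule continuous_on_iff[THEN iffD2], intro ballI allI impI)
  fix x e :: real assume x: "x \<in> {0..T}" and e: "0 < e"
  show "\<exists>d>0. \<forall>x'\<in>{0..T}. dist x' x < d --> dist (v x') (v x) < e"
  proof (intro exI[of _ "e / (L + 1)"] conjI ballI impI)
   fix x' assume x': "x' \<in> {0..T}" "dist x' x < e / (L + 1)"
   have "\<bar>v x' - v x\<bar> <= L * \<bar>x' - x\<bar>" using x x' L by auto
   also have "... <= (L + 1) * \<bar>x' - x\<bar>" by (intro mult_right_mono) auto
   also have "... < e" using x'(2) L by (simp add: dist_real_def field_simps)
   finally show "dist (v x') (v x) < e" by (simp add: dist_real_def)
  qed (use e L in auto)
 qed
 obtain t0 where t0: "t0 \<in> {0..T}" "!!t. t \<in> {0..T} ==> v t0 <= v t"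
  using continuous_attains_inf[OF compact_Icc _ cont] T by auto
 define m where "m = - v t0"
 have m: "m > 0" using t0(2)[of t1] neg T by (simp add: m_def T_def)
 have t0pos: "t0 > 0" using t0(1) v0[of t0] m by (cases "t0 = 0") (auto simp: m_def)
 define w where "w t = (if t <= T then v t + m else 0)" for t
 have w0: "0 <= w t" for t
  using t0(2)[of t] v0[of t] m by (cases "0 <= t") (auto simp: w_def m_def)
 have [measurable]: "w \<in> borel_measurable borel" unfolding w_def by measurable
 define LM where "LM t = measure M {0..t}" for t
 have fm: "emeasure M A < \<infinity>" if "A \<subseteq> {0..t}" for A t
  using finite_Icc[of t] emeasure_mono[OF that, of M] by (auto intro: order_le_less_trans)
 have fmo: "emeasure M {0<..<h} < \<infinity>" for h
  by (rule fm[where t=h]) (rule subsetI, simp)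
 have wbd: "w s <= L * T + m" for s
 proof (cases "0 <= s & s <= T")
  case True
  have "v s <= L * s" using L(2)[of s 0] v0[of 0] True T by auto
  also have "... <= L * T" using True L by (intro mult_left_mono) auto
  finally show ?thesis using True by (simp add: w_def)
 next
  case False
  then show ?thesis using v0[of s] L T m by (auto simp: w_def)
 qed
 have intw: "integrable M (%s. w (t - s) * indicator A s)" if "A \<subseteq> {0..t'}" "A \<in> sets borel" for A t t'
 proof (rule Bochner_Integration.integrable_bound)
  show "integrable M (%s. (L * T + m) * indicator A s)"
   using that fm[OF that(1)] by (intro integrable_mult_right integrable_real_indicator) auto
  show "AE s in M. norm (w (t - s) * indicator A s) <= norm ((L * T + m) * indicator A s)"
   using w0 wbd L T m by (intro AE_I2) (auto split: split_indicator)
 qed (use that in measurable)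
 define \<Phi> where "\<Phi> t = (\<integral>s. w (t - s) * indicator {0..t} s \<partial>M)" for t
 have G: "(\<integral>s. g s * indicator {0..t} s \<partial>lborel) = \<Phi> t - m * LM t" if "t <= T" for t
 proof -
  have "(\<integral>s. v (t - s) * indicator {0..} s \<partial>M) = (\<integral>s. w (t - s) * indicator {0..t} s - m * indicator {0..t} s \<partial>M)"
  proof (rule Bochner_Integration.integral_cong[OF refl])
   show "v (t - s) * indicator {0..} s = w (t - s) * indicator {0..t} s - m * indicator {0..t} s" for s
    using that v0[of "t - s"] by (auto simp: w_def split: split_indicator)
  qed
  also have "... = \<Phi> t - m * LM t"
   using fm[of "{0..t}" t] by (subst Bochner_Integration.integral_diff) (auto simp: intw[OF order_refl] \<Phi>_def LM_def)
  finally show ?thesis using conv[of t] by simp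
 qed
 have key: "c * (m - L * h) <= L * measure M {0<..<h}" if h: "0 < h" "h < t0" for h
 proof -
  have "\<Phi> t0 <= L * h * measure M {0<..<h} + \<Phi> (t0 - h)"
  proof -
   have split: "\<Phi> t0 = (\<integral>s. w (t0 - s) * indicator {0..<h} s \<partial>M) + (\<integral>s. w (t0 - s) * indicator {h..t0} s \<partial>M)"
   proof -
    have "\<Phi> t0 = (\<integral>s. w (t0 - s) * indicator {0..<h} s + w (t0 - s) * indicator {h..t0} s \<partial>M)"
     unfolding \<Phi>_def using h by (intro Bochner_Integration.integral_cong[OF refl]) (auto split: split_indicator)
    also have "... = (\<integral>s. w (t0 - s) * indicator {0..<h} s \<partial>M) + (\<integral>s. w (t0 - s) * indicator {h..t0} s \<partial>M)"
     using h by (intro Bochner_Integration.integral_add intw[of _ t0]) auto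
    finally show ?thesis .
   qed
   have "(\<integral>s. w (t0 - s) * indicator {0..<h} s \<partial>M) <= (\<integral>s. L * h * indicator {0<..<h} s \<partial>M)"
   proof (rule integral_mono)
    show "integrable M (%s. w (t0 - s) * indicator {0..<h} s)" by (rule intw[of _ h]) auto
    show "integrable M (%s. L * h * indicator {0<..<h} s)"
     using fmo[of h] by (intro integrable_mult_right integrable_real_indicator) auto
    fix s
    show "w (t0 - s) * indicator {0..<h} s <= L * h * indicator {0<..<h} s"
    proof (cases "0 <= s & s < h")
     case True
     have le: "w (t0 - s) <= L * s" using L(2)[of "t0 - s" t0] t0(1) True by (auto simp: w_def m_def)
     also have "... <= L * h" using True L by (intro mult_left_mono) auto
     finally show ?thesis using True le by (cases "s = 0") auto
    qed auto
   qed
   also have "... = L * h * measure M {0<..<h}" by simp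
   finally have first: "(\<integral>s. w (t0 - s) * indicator {0..<h} s \<partial>M) <= L * h * measure M {0<..<h}" .
   have "ennreal (\<integral>s. w (t0 - s) * indicator {h..t0} s \<partial>M) = (\<integral>\<^sup>+s. ennreal (w (t0 - s) * indicator {h..t0} s) \<partial>M)"
    using w0 h by (intro nn_integral_eq_integral[symmetric] intw[of _ t0]) auto
   also have "... = (\<integral>\<^sup>+s. ennreal (w (t0 - s)) * indicator {h..t0} s \<partial>M)"
    by (intro nn_integral_cong) (auto split: split_indicator)
   also have "... <= nnI M (t0 - h) (%s. w (t0 - (s + h)))"
    using shift_nn_integral_le[of "%s. ennreal (w (t0 - s))" h t0] h by simp
   also have "... = (\<integral>\<^sup>+s. ennreal (w (t0 - h - s) * indicator {0..t0 - h} s) \<partial>M)"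
    by (intro nn_integral_cong) (auto split: split_indicator simp: algebra_simps)
   also have "... = ennreal (\<Phi> (t0 - h))"
    unfolding \<Phi>_def using w0 h by (intro nn_integral_eq_integral intw[of _ "t0 - h"]) auto
   finally have "(\<integral>s. w (t0 - s) * indicator {h..t0} s \<partial>M) <= \<Phi> (t0 - h)"
    using w0 by (subst (asm) ennreal_le_iff) (auto simp: \<Phi>_def intro!: integral_nonneg_AE)
   then show ?thesis using split first by linarith
  qed
  moreover have "LM (t0 - h) <= LM t0"
   unfolding LM_def measure_def using h fm[of "{0..t0}" t0]
   by (intro enn2real_mono emeasure_mono) auto
  then have "m * LM (t0 - h) <= m * LM t0" using m by (intro mult_left_mono) auto
  moreover have "(\<integral>s. g s * indicator {0..t0} s \<partial>lborel) - (\<integral>s. g s * indicator {0..t0 - h} s \<partial>lborel) \<ge> h * (c * (m - L * h))"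
  proof -
   have ig: "integrable lborel (%s. g s * indicator A s)" if "A \<subseteq> {0..t0}" "A \<in> sets borel" for A
   proof -
    obtain B where B: "!!s. s <= t0 ==> \<bar>g s\<bar> <= B" "0 <= B" using bounded_causal_bound[OF gbc] by metis
    have "emeasure lborel A <= emeasure lborel {0..t0}" using that by (intro emeasure_mono) auto
    then have fA: "emeasure lborel A < \<infinity>" by (rule order_le_less_trans) (simp add: emeasure_lborel_Icc_eq)
    show ?thesis
    proof (rule Bochner_Integration.integrable_bound)
     show "integrable lborel (%s. B * indicator A s)"
      using that fA by (intro integrable_mult_right integrable_real_indicator) auto
     show "AL s. norm (g s * indicator A s) <= norm (B * indicator A s)"
      using B that by (intro AE_I2) (auto split: split_indicator simp: subset_eq)
    qed (use that in measurable)
   qed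
   have "(\<integral>s. g s * indicator {0..t0} s \<partial>lborel) - (\<integral>s. g s * indicator {0..t0 - h} s \<partial>lborel)
     = (\<integral>s. g s * indicator {0..t0} s - g s * indicator {0..t0 - h} s \<partial>lborel)"
    using h by (intro Bochner_Integration.integral_diff[symmetric] ig) auto
   also have "... = (\<integral>s. g s * indicator {t0 - h<..t0} s \<partial>lborel)"
    using h by (intro Bochner_Integration.integral_cong[OF refl]) (auto split: split_indicator)
   also have "... \<ge> (\<integral>s. (c * (m - L * h)) * indicator {t0 - h<..t0} s \<partial>lborel)"
   proof (rule integral_mono)
    show "integrable lborel (%s. (c * (m - L * h)) * indicator {t0 - h<..t0} s)"
     using h by (intro integrable_mult_right integrable_real_indicator) auto
    show "integrable lborel (%s. g s * indicator {t0 - h<..t0} s)"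
     using h by (intro ig) auto
    fix s
    show "(c * (m - L * h)) * indicator {t0 - h<..t0} s <= g s * indicator {t0 - h<..t0} s"
    proof (cases "t0 - h < s & s <= t0")
     case True
     have "v s - v t0 <= L * \<bar>s - t0\<bar>" using L(2)[of s t0] t0(1) True by auto
     also have "... <= L * h" using True L by (intro mult_left_mono) auto
     finally have "m - L * h <= f s - v s" using fpos[of s] by (simp add: m_def)
     then show ?thesis using True lam by (simp add: g_def)
    qed auto
   qed
   also have "(\<integral>s. (c * (m - L * h)) * indicator {t0 - h<..t0} s \<partial>lborel) = h * (c * (m - L * h))"
    using h by simp
   finally show ?thesis .
  qed
  moreover have "(\<integral>s. g s * indicator {0..t0} s \<partial>lborel) - (\<integral>s. g s * indicator {0..t0 - h} s \<partial>lborel)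
    = \<Phi> t0 - m * LM t0 - (\<Phi> (t0 - h) - m * LM (t0 - h))"
   using h t0(1) by (simp add: G)
  ultimately have "h * (c * (m - L * h)) <= h * (L * measure M {0<..<h})" by (simp add: mult_ac)
  then show ?thesis using h by simp
 qed
 define h where "h n = t0 / (real n + 2)" for n
 have h: "0 < h n" "h n < t0" for n using t0pos by (auto simp: h_def field_simps intro!: add_pos_nonneg mult_nonneg_nonneg)
 have hlim: "h \<longlonglongrightarrow> 0" unfolding h_def by real_asymp
 have "(%n. measure M {0<..<h n}) \<longlonglongrightarrow> measure M (\<Inter>n. {0<..<h n})"
 proof (rule Lim_measure_decseq)
  show "decseq (%n. {0<..<h n})"
  proof (unfold decseq_def, intro allI impI subsetI)
   fix m n :: nat and x assume "m <= n" "x \<in> {0<..<h n}"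
   moreover from \<open>m <= n\<close> have "h n <= h m"
    using t0pos unfolding h_def by (intro divide_left_mono) auto
   ultimately show "x \<in> {0<..<h m}" by auto
  qed
  show "emeasure M {0<..<h n} ~= \<infinity>" for n using fmo[of "h n"] by auto
 qed auto
 moreover have "(\<Inter>n. {0<..<h n}) = {}"
 proof (rule ccontr)
  assume "(\<Inter>n. {0<..<h n}) ~= {}"
  then obtain x where "0 < x" "!!n. x < h n" by fastforce
  moreover have "\<forall>\<^sub>F n in sequentially. h n < x" using hlim \<open>0 < x\<close> by (rule order_tendstoD)
  ultimately show False by (auto simp: eventually_sequentially) (meson less_asym order_refl)
 qed
 ultimately have lim1: "(%n. L * measure M {0<..<h n}) \<longlonglongrightarrow> L * 0" by (intro tendsto_intros) simp
 have lim2: "(%n. c * (m - L * h n)) \<longlonglongrightarrow> c * (m - L * 0)" by (intro tendsto_intros hlim)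
 have "c * (m - L * 0) <= L * 0" by (rule LIMSEQ_le[OF lim2 lim1]) (use key h in auto)
 then show False using lam m by (simp add: mult_le_0_iff)
qed

text \<open>Lipschitz functions approximate indicators of intervals, so the integral of \<open>r\<close> over every
interval is nonnegative; comparing the measures with densities \<open>max 0 r\<close> and \<open>max 0 (- r)\<close>
gives the sign of \<open>r\<close>.\<close>
theorem scalar_resolvent_nonneg:
 assumes k: "Lloc lborel k" and res: "AL t. rconv k M (indicator {0..}) t = indicator {0..} t"
  and lam: "0 < c" and r: "Lloc lborel r" and eq: "AL t. r t + c * rconv k lborel r t = c * k t"
 shows "AL t. 0 <= r t"
proof (rule AE_all_upto)
 fix T :: real
 note [measurable] = LlocD(1)[OF r]
 have int_r: "integrable lborel (%s. r s * indicator {..T} s)" for T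
 proof (rule integrableI_bounded)
  have "(NN s. ennreal (norm (r s * indicator {..T} s))) = nnI lborel T (%s. \<bar>r s\<bar>)"
   using LlocD(2)[OF r] by (intro nn_integral_cong) (auto split: split_indicator)
  then show "(NN s. ennreal (norm (r s * indicator {..T} s))) < \<infinity>" using LlocD(3)[OF r, of T] by simp
 qed measurable
 have Icc: "0 <= (\<integral>s. r s * indicator {a..b} s \<partial>lborel)" if ab: "a <= b" for a b
 proof -
  define F where "F n u = max 0 (1 - real (Suc n) * infdist u {a..b})" for n u
  have F01: "0 <= F n u" "F n u <= 1" for n u by (auto simp: F_def infdist_nonneg)
  have [measurable]: "F n \<in> borel_measurable borel" for n
   unfolding F_def by (intro borel_measurable_continuous_onI continuous_intros)
  have Fzero: "F n u = 0" if "b + 1 <= u" for n u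
  proof -
   have "1 <= infdist u {a..b}"
    using ab that by (auto simp: infdist_def dist_real_def intro!: cINF_greatest)
   then have "1 * 1 <= real (Suc n) * infdist u {a..b}" by (intro mult_mono) auto
   then show ?thesis by (simp add: F_def)
  qed
  have pos: "0 <= (\<integral>s. r s * F n s \<partial>lborel)" for n
  proof -
   define f where "f s = F n (b + 1 - s)" for s
   have "0 <= rconv r lborel f (b + 1)"
   proof (rule nonneg_rconv_Lipschitz[OF k res lam r eq])
    show "bounded_causal f"
     unfolding bounded_causal_def f_def using F01 Fzero by (auto intro!: exI[of _ 1])
    show "0 <= f s" for s by (simp add: f_def F01)
    show "\<bar>f x - f y\<bar> <= real (Suc n) * \<bar>x - y\<bar>" for x y
    proof -
     have "\<bar>infdist (b + 1 - x) {a..b} - infdist (b + 1 - y) {a..b}\<bar> <= \<bar>x - y\<bar>"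
      using infdist_triangle_abs[of "b + 1 - x" "{a..b}" "b + 1 - y"] by (simp add: dist_real_def)
     then have "real (Suc n) * \<bar>infdist (b + 1 - x) {a..b} - infdist (b + 1 - y) {a..b}\<bar> <= real (Suc n) * \<bar>x - y\<bar>"
      by (intro mult_left_mono) auto
     moreover have "real (Suc n) * \<bar>infdist (b + 1 - x) {a..b} - infdist (b + 1 - y) {a..b}\<bar>
       = \<bar>real (Suc n) * infdist (b + 1 - x) {a..b} - real (Suc n) * infdist (b + 1 - y) {a..b}\<bar>"
      by (subst right_diff_distrib[symmetric]) (simp add: abs_mult)
     ultimately show ?thesis unfolding f_def F_def by linarith
    qed
   qed
   also have "rconv r lborel f (b + 1) = (\<integral>s. r s * F n s \<partial>lborel)"
    unfolding rconv_commute[of r f] by (simp add: rconv_def f_def mult.commute)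
   finally show ?thesis .
  qed
  have "(%n. \<integral>s. r s * F n s \<partial>lborel) \<longlonglongrightarrow> (\<integral>s. r s * indicator {a..b} s \<partial>lborel)"
  proof (rule integral_dominated_convergence)
   show "integrable lborel (%s. \<bar>r s * indicator {..b + 1} s\<bar>)" using int_r[of "b + 1"] by (rule integrable_abs)
   show "AL s. norm (r s * F n s) <= \<bar>r s * indicator {..b + 1} s\<bar>" for n
   proof (intro AE_I2)
    fix s
    show "norm (r s * F n s) <= \<bar>r s * indicator {..b + 1} s\<bar>"
     using F01[of n s] Fzero[of s n] by (auto simp: abs_mult split: split_indicator intro!: mult_left_le)
   qed
   show "AL s. (%n. r s * F n s) \<longlonglongrightarrow> r s * indicator {a..b} s"
   proof (intro AE_I2 tendsto_mult tendsto_const)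
    fix s
    show "(%n. F n s) \<longlonglongrightarrow> indicator {a..b} s"
    proof (cases "s \<in> {a..b}")
     case True
     then show ?thesis by (simp add: F_def)
    next
     case False
     have pos: "0 < infdist s {a..b}"
      using False ab infdist_pos_not_in_closed[of "{a..b}" s] by auto
     have "\<forall>\<^sub>F n in sequentially. 1 / infdist s {a..b} <= real n"
      using filterlim_real_sequentially by (simp add: filterlim_at_top)
     then have "\<forall>\<^sub>F n in sequentially. F n s = 0"
     proof eventually_elim
      case (elim n)
      have "1 <= real n * infdist s {a..b}" using elim pos by (simp add: field_simps)
      also have "... <= real (Suc n) * infdist s {a..b}" using pos by (intro mult_right_mono) auto
      finally show ?case by (simp add: F_def)
     qed
     then show ?thesis using False by (simp add: tendsto_eventually)
    qed
   qed
  qed measurable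
  then show ?thesis by (rule LIMSEQ_le_const) (use pos in auto)
 qed
 define N where "N c = density lborel (%s. ennreal (c * r s) * indicator {0..T} s)" for c :: real
 have N: "emeasure (N c) A = (NN s. ennreal (c * r s) * indicator ({0..T} \<inter> A) s)" if "A \<in> sets borel" for A c
  unfolding N_def using that
  by (subst emeasure_density) (auto intro!: nn_integral_cong split: split_indicator)
 have fin: "emeasure (N c) UNIV < \<infinity>" if "c = 1 \<or> c = -1" for c
 proof -
  have "emeasure (N c) UNIV <= nnI lborel T (%s. \<bar>r s\<bar>)"
   using that by (subst N) (auto intro!: nn_integral_mono ennreal_leI split: split_indicator)
  then show ?thesis using LlocD(3)[OF r, of T] by (rule order_le_less_trans)
 qed
 have "emeasure (N (-1)) {s. r s < 0} <= emeasure (N 1) {s. r s < 0}"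
 proof (rule emeasure_le_if_le_on_intervals)
  show "sets (N (-1)) = sets borel" "sets (N 1) = sets borel" by (auto simp: N_def)
  show "{s. r s < 0} \<in> sets borel" by measurable
  fix a b :: real assume "a < b"
  show "emeasure (N (-1)) {a<..b} <= emeasure (N 1) {a<..b}"
  proof (cases "max 0 a <= min T b")
   case True
   let ?J = "{max 0 a..min T b}"
   have eqJ: "emeasure (N c) {a<..b} = (NN s. ennreal (c * r s * indicator ?J s))" for c
   proof -
    have "AL s. ennreal (c * r s) * indicator ({0..T} \<inter> {a<..b}) s = ennreal (c * r s * indicator ?J s)"
     using AE_lborel_singleton[of a] by eventually_elim (auto split: split_indicator)
    then show ?thesis by (subst N) (auto intro: nn_integral_cong_AE)
   qed
   have i: "integrable lborel (%s. r s * indicator ?J s)"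
    by (rule Bochner_Integration.integrable_bound[OF int_r[of T]]) (auto split: split_indicator)
   let ?p = "%s. max 0 (r s * indicator ?J s)" and ?n = "%s. max 0 (- (r s * indicator ?J s))"
   have mx: "ennreal (max 0 x) = ennreal x" for x :: real by (auto simp: max_def ennreal_neg)
   have ip: "integrable lborel ?p" "integrable lborel ?n" using i by auto
   have "(\<integral>s. r s * indicator ?J s \<partial>lborel) = (\<integral>s. ?p s - ?n s \<partial>lborel)"
    by (intro Bochner_Integration.integral_cong) auto
   also have "... = (\<integral>s. ?p s \<partial>lborel) - (\<integral>s. ?n s \<partial>lborel)" using ip by (rule Bochner_Integration.integral_diff)
   finally have e: "(\<integral>s. r s * indicator ?J s \<partial>lborel) = (\<integral>s. ?p s \<partial>lborel) - (\<integral>s. ?n s \<partial>lborel)" .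
   have le: "(\<integral>s. ?n s \<partial>lborel) <= (\<integral>s. ?p s \<partial>lborel)"
    using Icc[OF True] by (simp only: e diff_ge_0_iff_ge)
   have "emeasure (N (-1)) {a<..b} = (NN s. ennreal (?n s))"
    unfolding eqJ mx by simp
   also have "... = ennreal (\<integral>s. ?n s \<partial>lborel)" by (rule nn_integral_eq_integral[OF ip(2)]) auto
   also have "... <= ennreal (\<integral>s. ?p s \<partial>lborel)" using le by (rule ennreal_leI)
   also have "... = (NN s. ennreal (?p s))" by (rule nn_integral_eq_integral[OF ip(1), symmetric]) auto
   also have "... = emeasure (N 1) {a<..b}"
    unfolding eqJ mx by simp
   finally show ?thesis .
  next
   case False
   then have "{0..T} \<inter> {a<..b} = {}" by auto
   then show ?thesis by (subst N) auto
  qed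
 qed (use fin in auto)
 also have "emeasure (N 1) {s. r s < 0} = (NN s. 0)"
  by (subst N, measurable) (rule nn_integral_cong, auto simp: ennreal_neg split: split_indicator)
 finally have "(NN s. ennreal (-1 * r s) * indicator ({0..T} \<inter> {s. r s < 0}) s) = 0"
  by (subst (asm) N) auto
 then have "AL s. ennreal (-1 * r s) * indicator ({0..T} \<inter> {s. r s < 0}) s = 0"
  by (subst (asm) nn_integral_0_iff_AE) auto
 then show "AL t. t <= T --> 0 <= r t"
 proof eventually_elim
  case (elim t)
  show ?case
  proof (intro impI, rule ccontr)
   assume t: "t <= T" "\<not> 0 <= r t"
   then have "\<not> t < 0" using LlocD(2)[OF r, of t] by auto
   with t have "indicator ({0..T} \<inter> {s. r s < 0}) t = (1::ennreal)" by auto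
   with elim have "ennreal (- 1 * r t) = 0" by (simp only: mult_1_right)
   then have "- 1 * r t <= 0" by (simp only: ennreal_eq_0_iff)
   then show False using t by simp
  qed
 qed
qed

end

section \<open>A comparison principle for Volterra equations\<close>

lemma sum_abs_rconv_le:
 fixes k h :: "'k::finite => real => real"
 assumes [measurable]: "!!i. k i \<in> borel_measurable borel" "!!i. h i \<in> borel_measurable borel"
  "l \<in> borel_measurable borel" "v \<in> borel_measurable borel"
  and b: "!!i. AL s. \<bar>h i s\<bar> <= \<bar>l s\<bar> * \<bar>v s\<bar>"
 shows "ennreal (\<Sum>i\<in>UNIV. \<bar>rconv (k i) lborel (h i) t\<bar>)
   <= (NN s. ennreal (\<bar>\<Sum>i\<in>UNIV. \<bar>k i (t - s)\<bar>\<bar> * \<bar>l s\<bar>) * ennreal \<bar>v s\<bar>)"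
proof -
 let ?G = "%k s. ennreal (\<bar>\<Sum>i\<in>UNIV. \<bar>k i (t - s)\<bar>\<bar> * \<bar>l s\<bar>) * ennreal \<bar>v s\<bar>"
 let ?F = "%k i s. ennreal (\<bar>k i (t - s)\<bar> * (\<bar>l s\<bar> * \<bar>v s\<bar>))"
 have "ennreal (\<Sum>i\<in>UNIV. \<bar>rconv (k i) lborel (h i) t\<bar>) = (\<Sum>i\<in>UNIV. ennreal \<bar>rconv (k i) lborel (h i) t\<bar>)"
  by (rule sum_ennreal[symmetric]) auto
 also have "... <= (\<Sum>i\<in>UNIV. NN s. ?F k i s)"
 proof (rule sum_mono)
  fix i
  have "ennreal \<bar>rconv (k i) lborel (h i) t\<bar> <= (NN s. ennreal (\<bar>k i (t - s)\<bar> * \<bar>h i s\<bar>))"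
   by (rule lborel.abs_rconv_le)
  also have "... <= (NN s. ?F k i s)"
   by (rule nn_integral_mono_AE, use b[of i] in eventually_elim) (auto intro!: ennreal_leI mult_left_mono)
  finally show "ennreal \<bar>rconv (k i) lborel (h i) t\<bar> <= (NN s. ?F k i s)" .
 qed
 also have "... = (NN s. (\<Sum>i\<in>UNIV. ?F k i s))"
  by (rule nn_integral_sum[symmetric]) measurable
 also have "... = (NN s. ?G k s)"
 proof (intro nn_integral_cong)
  fix s
  have "(\<Sum>i\<in>UNIV. ?F k i s) = ennreal (\<Sum>i\<in>UNIV. \<bar>k i (t - s)\<bar> * (\<bar>l s\<bar> * \<bar>v s\<bar>))"
   by (intro sum_ennreal) auto
  also have "(\<Sum>i\<in>UNIV. \<bar>k i (t - s)\<bar> * (\<bar>l s\<bar> * \<bar>v s\<bar>)) = \<bar>\<Sum>i\<in>UNIV. \<bar>k i (t - s)\<bar>\<bar> * \<bar>l s\<bar> * \<bar>v s\<bar>"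
   by (simp add: sum_distrib_right mult.assoc sum_nonneg)
  finally show "(\<Sum>i\<in>UNIV. ?F k i s) = ?G k s"
   by (simp add: ennreal_mult)
 qed
 finally show ?thesis .
qed

text \<open>The sum of the absolute values of the components satisfies the hypothesis of the Gronwall lemma.\<close>
lemma Volterra_uniqueness:
 fixes k D h :: "'k::finite => real => real"
 assumes k: "!!i. L2loc (k i)" and D: "!!i. L2loc (D i)" and l: "L2loc l"
  and [measurable]: "!!i. h i \<in> borel_measurable borel"
  and le: "!!i. AL t. \<bar>D i t\<bar> <= \<bar>rconv (k i) lborel (h i) t\<bar>"
  and h: "!!i. AL s. \<bar>h i s\<bar> <= l s * (\<Sum>j\<in>UNIV. \<bar>D j s\<bar>)"
 shows "AL t. \<forall>i. D i t = 0"
proof -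
 let ?F = "%k t U. NN s. ennreal (\<bar>\<Sum>i\<in>UNIV. \<bar>k i (t - s)\<bar>\<bar> * \<bar>l s\<bar>) * ennreal \<bar>U s\<bar>"
 note [measurable] = L2locD(1)[OF k] L2locD(1)[OF D] L2locD(1)[OF l]
 define U where "U t = (\<Sum>i\<in>UNIV. \<bar>D i t\<bar>)" for t
 have U0: "0 <= U t" for t unfolding U_def by (intro sum_nonneg) auto
 have UL: "L2loc U" unfolding U_def by (intro L2loc_sum L2loc_abs D)
 have \<kappa>: "L2loc (%t. \<Sum>i\<in>UNIV. \<bar>k i t\<bar>)" by (intro L2loc_sum L2loc_abs k)
 note [measurable] = L2locD(1)[OF UL]
 have b: "AL s. \<bar>h i s\<bar> <= \<bar>l s\<bar> * \<bar>U s\<bar>" for i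
  using h[of i]
 proof eventually_elim
  case (elim s)
  also have "l s * (\<Sum>j\<in>UNIV. \<bar>D j s\<bar>) <= \<bar>l s\<bar> * \<bar>U s\<bar>"
   using U0[of s] unfolding U_def[symmetric] by (intro mult_mono) auto
  finally show ?case .
 qed
 have "AL t. \<forall>i. \<bar>D i t\<bar> <= \<bar>rconv (k i) lborel (h i) t\<bar>"
  unfolding AE_all_countable using le by auto
 then have "AL t. ennreal \<bar>U t\<bar> <= (?F k t U)"
 proof eventually_elim
  case (elim t)
  have "\<bar>U t\<bar> <= (\<Sum>i\<in>UNIV. \<bar>rconv (k i) lborel (h i) t\<bar>)"
   using elim U0[of t] by (simp add: U_def sum_mono)
  then have "ennreal \<bar>U t\<bar> <= ennreal (\<Sum>i\<in>UNIV. \<bar>rconv (k i) lborel (h i) t\<bar>)" by (rule ennreal_leI)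
  also have "... <= (?F k t U)"
   by (rule sum_abs_rconv_le) (use b in auto)
  finally show ?case .
 qed
 then have "AL t. U t = 0" by (rule Volterra_Gronwall[OF UL \<kappa> l])
 then show ?thesis
  by eventually_elim (simp add: U_def sum_nonneg_eq_0_iff)
qed

text \<open>The resolvent \<open>r\<close> of the kernel \<open>c k\<close>, defined by \<open>r + c k * r = c k\<close>,
is nonnegative for every \<open>c > 0\<close>.\<close>
definition positive_kernel :: "(real => real) => bool" where
 "positive_kernel k \<longleftrightarrow> L2loc k & (\<forall>s. 0 <= k s) \<and>
   (\<forall>c>0. \<exists>r. L2loc r & (AL t. 0 <= r t) \<and>
    (AL t. r t + c * rconv k lborel r t = c * k t))"

abbreviation neg :: "real => real" where "neg x \<equiv> max 0 (- x)"

text \<open>The resolvent equation convolved with \<open>h M\<close>, in both orders. It converts convolutions with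
\<open>k\<close> into convolutions with \<open>r\<close>.\<close>
lemma (in borel_sigma_finite) AE_resolvent_rconv:
 assumes k: "L2loc k" and r: "L2loc r" and eq: "AL t. r t + c * rconv k lborel r t = c * k t"
  and h: "Lloc M h"
 shows "AL t. c * rconv r lborel (rconv k M h) t = c * rconv k M h t - rconv r M h t"
  "AL t. c * rconv k lborel (rconv r M h) t = c * rconv k M h t - rconv r M h t"
proof -
 note [measurable] = L2locD(1)[OF k] L2locD(1)[OF r] LlocD(1)[OF h]
 have kr: "Lloc lborel (rconv k lborel r)" by (intro lborel.Lloc_rconv Lloc_L2loc k r)
 have "AL t. rconv (%s. r s + c * rconv k lborel r s) M h t = rconv (%s. c * k s) M h t"
  by (rule AE_rconv_cong[OF eq]) measurable
 moreover have "AL t. rconv (%s. r s + c * rconv k lborel r s) M h t = rconv r M h t + rconv (%s. c * rconv k lborel r s) M h t"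
  by (rule AE_rconv_add_left[OF Lloc_L2loc[OF r] Lloc_cmult[OF kr sets_lborel] h])
 ultimately have *: "AL t. c * rconv (rconv k lborel r) M h t = c * rconv k M h t - rconv r M h t"
  by eventually_elim (simp add: rconv_cmult)
 show "AL t. c * rconv k lborel (rconv r M h) t = c * rconv k M h t - rconv r M h t"
  using * AE_rconv_assoc[OF Lloc_L2loc[OF k] Lloc_L2loc[OF r] h] by eventually_elim simp
 have "rconv k lborel r = rconv r lborel k" by (rule ext) (rule rconv_commute)
 with * show "AL t. c * rconv r lborel (rconv k M h) t = c * rconv k M h t - rconv r M h t"
  using AE_rconv_assoc[OF Lloc_L2loc[OF r] Lloc_L2loc[OF k] h] by (auto elim: eventually_elim2)
qed

lemma Lloc_neg: "Lloc M n ==> Lloc M (%s. neg (n s))"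
proof -
 assume n: "Lloc M n"
 note [measurable] = LlocD(1)[OF n]
 show ?thesis by (rule Lloc_bound[OF n]) auto
qed

lemma L2loc_neg: "L2loc n ==> L2loc (%s. neg (n s))"
proof -
 assume n: "L2loc n"
 note [measurable] = L2locD(1)[OF n]
 show ?thesis by (rule L2loc_bound_AE[OF n]) (use L2locD(2)[OF n] in auto)
qed

text \<open>A substitute for Kato's inequality. Writing the equation with the resolvent \<open>r\<close> of \<open>c k\<close>
gives \<open>neg v \<le> r * neg (g + c v) / c\<close>, since \<open>r\<close> is nonnegative and
nonnegative sources only help. Convolving back from \<open>r\<close> to \<open>k\<close> produces the
Yosida-type integrand below.\<close>
lemma (in borel_sigma_finite) negative_part_le_Yosida:
 assumes k: "positive_kernel k" and v: "L2loc v" and g: "Lloc lborel g" and n: "Lloc M n" "!!s. 0 <= n s"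
  and eq: "AL t. v t = rconv k M n t + rconv k lborel g t" and c: "0 < c"
 shows "AL t. neg (v t) <= rconv k lborel (%s. neg (g s + c * v s) - c * neg (v s)) t"
proof -
 from k c obtain r where r: "L2loc r" "AL t. 0 <= r t" "AL t. r t + c * rconv k lborel r t = c * k t"
  by (auto simp: positive_kernel_def)
 have kL: "L2loc k" and k0: "!!s. 0 <= k s" using k by (auto simp: positive_kernel_def)
 note kr = Lloc_L2loc[OF kL] Lloc_L2loc[OF r(1)]
 note [measurable] = LlocD(1)[OF kr(1)] LlocD(1)[OF kr(2)] L2locD(1)[OF v] LlocD(1)[OF g] LlocD(1)[OF n(1)]
 define gc where "gc s = g s + c * v s" for s
 have gcL: "Lloc lborel gc" unfolding gc_def by (intro Lloc_add g Lloc_cmult Lloc_L2loc v) auto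
 define u where "u s = neg (v s)" for s
 have uL: "Lloc lborel u" unfolding u_def by (intro Lloc_L2loc L2loc_neg v)
 define d where "d s = neg (gc s) - c * u s" for s
 have dL: "Lloc lborel d" unfolding d_def by (intro Lloc_diff Lloc_neg gcL Lloc_cmult uL) auto
 note [measurable] = LlocD(1)[OF uL] LlocD(1)[OF dL] LlocD(1)[OF gcL]
 have kn: "Lloc lborel (rconv k M n)" by (intro Lloc_rconv kr n)
 have kg: "Lloc lborel (rconv k lborel g)" by (intro lborel.Lloc_rconv kr g)
 have "rconv r lborel v t = rconv r lborel (%s. rconv k M n s + rconv k lborel g s) t" for t
  by (rule lborel.rconv_cong_right[OF eq]) measurable
 then have rv: "AL t. rconv r lborel v t = rconv r lborel (rconv k M n) t + rconv r lborel (rconv k lborel g) t"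
  using lborel.AE_rconv_add[OF kr(2) kn kg] by simp
 have rgc: "AL t. rconv r lborel gc t = rconv r lborel g t + c * rconv r lborel v t"
  using lborel.AE_rconv_add[OF kr(2) g Lloc_cmult[OF Lloc_L2loc[OF v] sets_lborel], of c]
  unfolding gc_def by eventually_elim (simp add: lborel.rconv_cmult)
 have rn: "AL t. 0 <= rconv r M n t" by (rule AE_rconv_nonneg) (use r n in auto)
 have le1: "AL t. rconv r lborel gc t <= c * v t"
  using rv rgc rn eq AE_resolvent_rconv(1)[OF kL r(1,3) n(1)] lborel.AE_resolvent_rconv(1)[OF kL r(1,3) g]
 proof eventually_elim
  case (elim t)
  have "c * rconv r lborel v t = c * v t - rconv r M n t - rconv r lborel g t"
   using elim by (simp add: algebra_simps)
  then show ?case using elim by simp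
 qed
 have "AL t. rconv r lborel (%s. - gc s) t <= rconv r lborel (%s. neg (gc s)) t"
  by (rule lborel.AE_rconv_mono_right) (use kr(2) gcL r(2) Lloc_minus Lloc_neg in auto)
 moreover have "AL t. 0 <= rconv r lborel (%s. neg (gc s)) t"
  by (rule lborel.AE_rconv_nonneg) (use r in auto)
 ultimately have le2: "AL t. c * u t <= rconv r lborel (%s. neg (gc s)) t"
  using le1
 proof eventually_elim
  case (elim t)
  have "rconv r lborel (%s. - gc s) t = - rconv r lborel gc t" by (simp add: rconv_def)
  then show ?case using elim c by (auto simp: u_def max_def)
 qed
 have "AL t. rconv r lborel (%s. d s + c * u s) t = rconv r lborel d t + c * rconv r lborel u t"
  using lborel.AE_rconv_add[OF kr(2) dL Lloc_cmult[OF uL sets_lborel], of c] by eventually_elim (simp add: lborel.rconv_cmult)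
 then have le3: "AL t. c * u t <= rconv r lborel d t + c * rconv r lborel u t"
  using le2 by eventually_elim (simp add: d_def)
 let ?rd = "rconv r lborel d" and ?ru = "rconv r lborel u"
 have L: "Lloc lborel ?rd" "Lloc lborel (%s. c * ?ru s)" "Lloc lborel (%s. c * u s)"
  by (intro lborel.Lloc_rconv Lloc_cmult kr dL uL; simp)+
 have "AL t. rconv k lborel (%s. c * u s) t <= rconv k lborel (%s. ?rd s + c * ?ru s) t"
  by (rule lborel.AE_rconv_mono_right) (use kr L k0 le3 Lloc_add in auto)
 moreover have "AL t. rconv k lborel (%s. ?rd s + c * ?ru s) t = rconv k lborel ?rd t + c * rconv k lborel ?ru t"
  using lborel.AE_rconv_add[OF kr(1) L(1,2)] by eventually_elim (simp add: lborel.rconv_cmult)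
 ultimately have "AL t. u t <= rconv k lborel d t"
  using le3 lborel.AE_resolvent_rconv(2)[OF kL r(1,3) dL] lborel.AE_resolvent_rconv(2)[OF kL r(1,3) uL]
 proof eventually_elim
  case (elim t)
  have "c * (c * rconv k lborel u t) <= c * (rconv k lborel ?rd t + c * rconv k lborel ?ru t)"
   using elim c by (intro mult_left_mono) (auto simp: lborel.rconv_cmult)
  also have "... = (c * rconv k lborel d t - ?rd t) + c * (c * rconv k lborel u t - ?ru t)"
   using elim by (simp add: distrib_left)
  finally have "?rd t + c * ?ru t <= c * rconv k lborel d t" by (simp add: algebra_simps)
  then have "c * u t <= c * rconv k lborel d t" using elim by linarith
  then show ?case using c by simp
 qed
 moreover have "d = (%s. neg (g s + c * v s) - c * neg (v s))"
  by (rule ext) (simp only: d_def gc_def u_def)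
 ultimately show ?thesis by (simp only: u_def)
qed

text \<open>The limit of the integrand as \<open>c\<close> tends to infinity: only the points where \<open>v\<close> is
not positive contribute, with the value \<open>- g\<close> where \<open>v < 0\<close>. The bound by
\<open>\<bar>g\<bar>\<close> allows dominated convergence.\<close>
lemma Yosida_part_limit:
 fixes g v :: real
 defines "d \<equiv> if v < 0 then - g else if v = 0 then neg g else 0"
 shows "(%n. neg (g + real (Suc n) * v) - real (Suc n) * neg v) \<longlonglongrightarrow> d"
  and "\<bar>neg (g + real (Suc n) * v) - real (Suc n) * neg v\<bar> <= \<bar>g\<bar>"
proof -
 have ev: "\<forall>\<^sub>F n in sequentially. \<bar>g\<bar> <= real (Suc n) * \<bar>v\<bar>" if "v ~= 0"
 proof -
  have "\<forall>\<^sub>F n in sequentially. \<bar>g\<bar> / \<bar>v\<bar> <= real n"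
   using filterlim_real_sequentially by (simp add: filterlim_at_top)
  then show ?thesis
  proof eventually_elim
   case (elim n)
   then have "\<bar>g\<bar> <= real n * \<bar>v\<bar>" using that by (simp add: field_simps)
   also have "... <= real (Suc n) * \<bar>v\<bar>" by (intro mult_right_mono) auto
   finally show ?case .
  qed
 qed
 show "(%n. neg (g + real (Suc n) * v) - real (Suc n) * neg v) \<longlonglongrightarrow> d"
 proof (cases "v = 0")
  case True
  then show ?thesis by (simp add: d_def)
 next
  case False
  have "\<forall>\<^sub>F n in sequentially. neg (g + real (Suc n) * v) - real (Suc n) * neg v = d"
   using ev[OF False]
  proof eventually_elim
   case (elim n)
   show ?case
   proof (cases "v < 0")
    case True
    then have "real (Suc n) * \<bar>v\<bar> = - (real (Suc n) * v)" "neg v = - v" by (auto simp: max_def)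
    then show ?thesis using elim True by (auto simp: d_def max_def)
   next
    case False
    with \<open>v ~= 0\<close> have "neg v = 0" "real (Suc n) * \<bar>v\<bar> = real (Suc n) * v" by (auto simp: max_def)
    moreover from this elim have "neg (g + real (Suc n) * v) = 0" by linarith
    ultimately show ?thesis using False \<open>v ~= 0\<close> by (simp add: d_def)
   qed
  qed
  then show ?thesis by (rule tendsto_eventually)
 qed
 show "\<bar>neg (g + real (Suc n) * v) - real (Suc n) * neg v\<bar> <= \<bar>g\<bar>"
 proof (cases "v < 0")
  case True
  define y where "y = real (Suc n) * v"
  have "y < 0" using True by (simp add: y_def mult_less_0_iff)
  moreover have "real (Suc n) * neg v = - y" using True by (simp add: y_def max_def)
  ultimately show ?thesis unfolding y_def[symmetric] by (simp add: max_def)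
 next
  case False
  define y where "y = real (Suc n) * v"
  have "0 <= y" using False by (simp add: y_def)
  moreover have "real (Suc n) * neg v = 0" using False by (simp add: max_def)
  ultimately show ?thesis unfolding y_def[symmetric] by (simp add: max_def)
 qed
qed

text \<open>Letting \<open>c\<close> tend to infinity in the previous inequality bounds \<open>neg v\<close> by \<open>k * (l \<Sum>j. neg v_j)\<close>,
and the Gronwall lemma makes it vanish. Components with \<open>v_i > 0\<close> impose no condition on
\<open>g_i\<close>.\<close>
theorem (in borel_sigma_finite) Volterra_comparison:
 fixes k v g n :: "'k::finite => real => real"
 assumes k: "!!i. positive_kernel (k i)" and v: "!!i. L2loc (v i)" and g: "!!i. Lloc lborel (g i)"
  and n: "!!i. Lloc M (n i)" "!!i s. 0 <= n i s"
  and eq: "!!i. AL t. v i t = rconv (k i) M (n i) t + rconv (k i) lborel (g i) t"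
  and l: "L2loc l"
  and low: "!!i. AL s. v i s <= 0 --> - (l s * (\<Sum>j\<in>UNIV. neg (v j s))) <= g i s"
  and l0: "!!s. 0 <= l s"
 shows "AL t. \<forall>i. 0 <= v i t"
proof -
 have kL: "L2loc (k i)" and k0: "0 <= k i s" for i s using k by (auto simp: positive_kernel_def)
 note [measurable] = L2locD(1)[OF kL] L2locD(1)[OF v] LlocD(1)[OF g] L2locD(1)[OF l]
 define U where "U s = (\<Sum>j\<in>UNIV. neg (v j s))" for s
 have U0: "0 <= U s" for s unfolding U_def by (intro sum_nonneg) auto
 have UL: "L2loc U" unfolding U_def by (intro L2loc_sum L2loc_neg v)
 have lU: "Lloc lborel (%s. l s * U s)" by (intro Lloc_mult_L2loc l UL)
 note [measurable] = L2locD(1)[OF UL]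
 have step: "AL t. neg (v i t) <= rconv (k i) lborel (%s. l s * U s) t" for i
 proof -
  define d where "d s = (if v i s < 0 then - g i s else if v i s = 0 then neg (g i s) else 0)" for s
  have [measurable]: "d \<in> borel_measurable borel" unfolding d_def by measurable
  have dL: "Lloc lborel d" by (rule Lloc_bound[OF g[of i]]) (auto simp: d_def)
  have 1: "AL t. rconv (k i) lborel d t <= rconv (k i) lborel (%s. l s * U s) t"
  proof (rule lborel.AE_rconv_mono_right[OF Lloc_L2loc[OF kL] dL lU])
   show "AL s. d s <= l s * U s"
    using low[of i]
   proof eventually_elim
    case (elim s)
    have "0 <= l s * U s" using l0 U0 by simp
    then show ?case using elim by (auto simp: d_def U_def max_def)
   qed
  qed (use k0 in auto)
  have 2: "AL t. \<forall>m. neg (v i t) <= rconv (k i) lborel (%s. neg (g i s + real (Suc m) * v i s) - real (Suc m) * neg (v i s)) t"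
   unfolding AE_all_countable
   by (intro allI negative_part_le_Yosida[OF k v g n eq]) simp
  show ?thesis
   using 1 2 lborel.AE_rconv_integrable[OF Lloc_L2loc[OF kL[of i]] g[of i]]
  proof eventually_elim
   case (elim t)
   have "(%m. rconv (k i) lborel (%s. neg (g i s + real (Suc m) * v i s) - real (Suc m) * neg (v i s)) t) \<longlonglongrightarrow> rconv (k i) lborel d t"
    unfolding rconv_def
   proof (rule integral_dominated_convergence)
    show "integrable lborel (%s. \<bar>k i (t - s) * g i s\<bar>)" using elim by (intro integrable_abs) auto
    show "AL s. (%m. k i (t - s) * (neg (g i s + real (Suc m) * v i s) - real (Suc m) * neg (v i s))) \<longlonglongrightarrow> k i (t - s) * d s"
     unfolding d_def by (intro AE_I2 tendsto_mult tendsto_const Yosida_part_limit)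
    show "AL s. norm (k i (t - s) * (neg (g i s + real (Suc m) * v i s) - real (Suc m) * neg (v i s))) <= \<bar>k i (t - s) * g i s\<bar>" for m
     unfolding real_norm_def abs_mult by (intro AE_I2 mult_left_mono Yosida_part_limit(2) abs_ge_zero)
   qed measurable
   then have "neg (v i t) <= rconv (k i) lborel d t"
    by (rule LIMSEQ_le_const) (use elim in auto)
   then show ?case using elim by linarith
  qed
 qed
 have "AL t. \<forall>i. neg (v i t) = 0"
 proof (rule Volterra_uniqueness[OF kL L2loc_neg[OF v] l])
  show "AL t. \<bar>neg (v i t)\<bar> <= \<bar>rconv (k i) lborel (%s. l s * U s) t\<bar>" for i
   using step[of i] by eventually_elim auto
  show "AL s. \<bar>l s * U s\<bar> <= l s * (\<Sum>j\<in>UNIV. \<bar>neg (v j s)\<bar>)" for i :: 'k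
   using l0 U0 by (intro AE_I2) (simp add: U_def abs_mult)
 qed measurable
 then show ?thesis
 proof eventually_elim
  case (elim t)
  show ?case
  proof
   fix i
   have "neg (v i t) = 0" using elim by blast
   then show "0 <= v i t" by linarith
  qed
 qed
qed

section \<open>The matrix resolvent\<close>

text \<open>Picard iteration yields \<open>r\<close> with one of the two resolvent identities. The defect
\<open>D\<close> of the other identity solves the homogeneous linear Volterra equation, so it vanishes.\<close>
lemma matrix_resolvent_exists:
 fixes k :: "'m::finite => real => real" and B :: "'m => 'm => real"
 assumes k: "!!i. L2loc (k i)"
 shows "\<exists>r. (\<forall>i j. L2loc (r i j)) \<and>
   (\<forall>i j. AL t. (\<Sum>l\<in>UNIV. rconv (%s. - (k i s * B i l)) lborel (r l j) t) = - (k i t * B i j) - r i j t) \<and>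
   (\<forall>i j. AL t. (\<Sum>l\<in>UNIV. rconv (r i l) lborel (%s. - (k l s * B l j)) t) = - (k i t * B i j) - r i j t)"
proof -
 define C where "C = (\<Sum>i\<in>UNIV. \<Sum>l\<in>UNIV. \<bar>B i l\<bar>)"
 have BC: "\<bar>B i l\<bar> <= C" for i l
 proof -
  have "\<bar>B i l\<bar> <= (\<Sum>l\<in>UNIV. \<bar>B i l\<bar>)" by (rule member_le_sum) auto
  also have "... <= C" unfolding C_def by (rule member_le_sum[of i]) (auto intro: sum_nonneg)
  finally show ?thesis .
 qed
 have C0: "0 <= C" using BC abs_ge_zero order_trans by blast
 let ?f = "%s (x::'m\<times>'m=>real) p. indicator {0..} s * (\<Sum>l\<in>UNIV. B (fst p) l * x (l, snd p))"
 have lin_bound: "\<bar>\<Sum>l\<in>UNIV. B i l * y l\<bar> <= C * (\<Sum>l\<in>UNIV. \<bar>y l\<bar>)" for i and y :: "'m => real"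
 proof -
  have "\<bar>\<Sum>l\<in>UNIV. B i l * y l\<bar> <= (\<Sum>l\<in>UNIV. \<bar>B i l * y l\<bar>)" by (rule sum_abs)
  also have "... <= (\<Sum>l\<in>UNIV. C * \<bar>y l\<bar>)" by (intro sum_mono) (auto simp: abs_mult intro!: mult_right_mono BC)
  finally show ?thesis by (simp add: sum_distrib_left)
 qed
 have sum_le: "(\<Sum>l\<in>UNIV. \<bar>y (l, j)\<bar>) <= (\<Sum>p\<in>UNIV. \<bar>y p\<bar>)" for j and y :: "'m \<times> 'm => real"
 proof -
  have "(\<Sum>l\<in>UNIV. \<bar>y (l, j)\<bar>) = (\<Sum>p\<in>(%l. (l, j)) ` UNIV. \<bar>y p\<bar>)"
   by (subst sum.reindex) (auto simp: inj_on_def)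
  also have "... <= (\<Sum>p\<in>UNIV. \<bar>y p\<bar>)" by (rule sum_mono2) auto
  finally show ?thesis .
 qed
 have "\<exists>x. (\<forall>p. L2loc (x p)) \<and>
   (\<forall>p. AL t. x p t = - B (fst p) (snd p) * k (fst p) t + rconv (k (fst p)) lborel (%s. ?f s (%q. x q s) p) t)"
 proof (rule Volterra_existence[where l="%s. C * indicator {0..} s"])
  show "L2loc (%s. C * indicator {0..} s)" by (intro L2loc_cmult L2loc_one)
  show "L2loc (%t. - B (fst p) (snd p) * k (fst p) t)" for p by (rule L2loc_cmult[OF k])
  show "\<bar>?f s x p - ?f s y p\<bar> <= C * indicator {0..} s * (\<Sum>q\<in>UNIV. \<bar>x q - y q\<bar>)" for s x y p
  proof -
   have "\<bar>\<Sum>l\<in>UNIV. B (fst p) l * (x (l, snd p) - y (l, snd p))\<bar> <= C * (\<Sum>l\<in>UNIV. \<bar>x (l, snd p) - y (l, snd p)\<bar>)"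
    by (rule lin_bound)
   also have "... <= C * (\<Sum>q\<in>UNIV. \<bar>x q - y q\<bar>)"
    using sum_le[of "%q. x q - y q" "snd p"] C0 by (intro mult_left_mono) auto
   finally show ?thesis
    by (auto split: split_indicator simp: right_diff_distrib sum_subtractf)
  qed
 qed (auto intro: k)
 then obtain x where x: "!!p. L2loc (x p)"
  "!!p. AL t. x p t = - B (fst p) (snd p) * k (fst p) t + rconv (k (fst p)) lborel (%s. ?f s (%q. x q s) p) t"
  by blast
 define r where "r i j = x (i, j)" for i j
 have rL: "L2loc (r i j)" for i j unfolding r_def by (rule x)
 note rL1 = Lloc_L2loc[OF rL] and kL1 = Lloc_L2loc[OF k]
 note [measurable] = L2locD(1)[OF rL] L2locD(1)[OF k]
 have eq: "AL t. (\<Sum>l\<in>UNIV. B i l * rconv (k i) lborel (r l j) t) = r i j t + B i j * k i t" for i j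
 proof -
  have "(%s. ?f s (%q. x q s) (i, j)) = (%s. \<Sum>l\<in>UNIV. B i l * r l j s)"
   using L2locD(2)[OF x(1)] by (auto simp: fun_eq_iff r_def split: split_indicator)
  then have "AL t. r i j t = - B i j * k i t + rconv (k i) lborel (%s. \<Sum>l\<in>UNIV. B i l * r l j s) t"
   using x(2)[of "(i, j)"] by (simp add: r_def)
  moreover have "AL t. rconv (k i) lborel (%s. \<Sum>l\<in>UNIV. B i l * r l j s) t = (\<Sum>l\<in>UNIV. rconv (k i) lborel (%s. B i l * r l j s) t)"
   by (rule lborel.AE_rconv_sum) (auto intro!: Lloc_cmult rL1 kL1)
  ultimately show ?thesis by eventually_elim (simp add: lborel.rconv_cmult)
 qed
 have neg1: "rconv (%s. - (k i s * B i l)) lborel f t = - (B i l * rconv (k i) lborel f t)" for i l f t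
  using lborel.rconv_cmult(2)[of "- B i l" "k i" f t] by (simp add: mult.commute)
 have neg2: "rconv f lborel (%s. - (k i s * B i l)) t = - (B i l * rconv f lborel (k i) t)" for i l f t
  using lborel.rconv_cmult(1)[of f "- B i l" "k i" t] by (simp add: mult.commute)
 have R1: "AL t. (\<Sum>l\<in>UNIV. rconv (%s. - (k i s * B i l)) lborel (r l j) t) = - (k i t * B i j) - r i j t" for i j
  using eq[of i j] unfolding neg1 sum_negf by eventually_elim (simp add: mult.commute)
 define D where "D p t = r (fst p) (snd p) t + B (fst p) (snd p) * k (fst p) t - (\<Sum>l\<in>UNIV. B l (snd p) * rconv (r (fst p) l) lborel (k l) t)" for p t
 have rk: "L2loc (rconv (r i l) lborel (k l))" for i l by (rule lborel.L2loc_rconv[OF rL kL1])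
 have DL: "L2loc (D p)" for p
  unfolding D_def by (intro L2loc_diff L2loc_add L2loc_sum L2loc_cmult rk rL k)
 define h where "h p s = (\<Sum>l\<in>UNIV. B (fst p) l * D (l, snd p) s)" for p s
 have [measurable]: "h p \<in> borel_measurable borel" for p
  unfolding h_def using L2locD(1)[OF DL] by measurable
 have Dh: "AL t. D (i, j) t = rconv (k i) lborel (h (i, j)) t" for i j
 proof -
  have a: "AL t. rconv (k i) lborel (h (i, j)) t = (\<Sum>l\<in>UNIV. B i l * rconv (k i) lborel (D (l, j)) t)"
   unfolding h_def fst_conv snd_conv
   using lborel.AE_rconv_sum[of "k i" UNIV "%l s. B i l * D (l, j) s"] kL1 DL
   by (simp add: Lloc_cmult Lloc_L2loc lborel.rconv_cmult)
  have b: "AL t. \<forall>l. rconv (k i) lborel (D (l, j)) t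
    = rconv (k i) lborel (r l j) t + B l j * rconv (k i) lborel (k l) t - (\<Sum>p\<in>UNIV. B p j * rconv (k i) lborel (rconv (r l p) lborel (k p)) t)"
   unfolding AE_all_countable
  proof
   fix l
   let ?S = "%t. \<Sum>p\<in>UNIV. B p j * rconv (r l p) lborel (k p) t"
   have "AL t. rconv (k i) lborel (%t. (r l j t + B l j * k l t) - ?S t) t
     = rconv (k i) lborel (%t. r l j t + B l j * k l t) t - rconv (k i) lborel ?S t"
    by (rule lborel.AE_rconv_diff) (auto intro!: kL1 Lloc_add rL1 Lloc_cmult Lloc_sum Lloc_L2loc[OF rk])
   moreover have "AL t. rconv (k i) lborel (%t. r l j t + B l j * k l t) t = rconv (k i) lborel (r l j) t + rconv (k i) lborel (%t. B l j * k l t) t"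
    by (rule lborel.AE_rconv_add) (auto intro!: kL1 rL1 Lloc_cmult)
   moreover have "AL t. rconv (k i) lborel ?S t = (\<Sum>p\<in>UNIV. rconv (k i) lborel (%t. B p j * rconv (r l p) lborel (k p) t) t)"
    by (rule lborel.AE_rconv_sum) (auto intro!: kL1 rL1 Lloc_cmult Lloc_L2loc[OF rk])
   ultimately show "AL t. rconv (k i) lborel (D (l, j)) t
    = rconv (k i) lborel (r l j) t + B l j * rconv (k i) lborel (k l) t - (\<Sum>p\<in>UNIV. B p j * rconv (k i) lborel (rconv (r l p) lborel (k p)) t)"
   proof eventually_elim
    case (elim t)
    have "D (l, j) = (%t. (r l j t + B l j * k l t) - ?S t)" by (simp add: fun_eq_iff D_def)
    with elim show ?case by (simp add: lborel.rconv_cmult)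
   qed
  qed
  have c: "AL t. \<forall>p. (\<Sum>l\<in>UNIV. B i l * rconv (k i) lborel (rconv (r l p) lborel (k p)) t)
     = rconv (r i p) lborel (k p) t + B i p * rconv (k i) lborel (k p) t"
   unfolding AE_all_countable
  proof
   fix p
   have "AL t. \<forall>l. rconv (k i) lborel (rconv (r l p) lborel (k p)) t = rconv (rconv (k i) lborel (r l p)) lborel (k p) t"
    unfolding AE_all_countable by (intro allI lborel.AE_rconv_assoc kL1 rL1)
   moreover have "AL t. rconv (%t. \<Sum>l\<in>UNIV. B i l * rconv (k i) lborel (r l p) t) lborel (k p) t = rconv (%t. r i p t + B i p * k i t) lborel (k p) t"
    by (rule lborel.AE_rconv_cong[OF eq]) measurable
   moreover have "AL t. rconv (%t. r i p t + B i p * k i t) lborel (k p) t = rconv (r i p) lborel (k p) t + rconv (%t. B i p * k i t) lborel (k p) t"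
    by (rule lborel.AE_rconv_add_left) (auto intro!: kL1 rL1 Lloc_cmult)
   moreover have "AL t. rconv (%t. \<Sum>l\<in>UNIV. B i l * rconv (k i) lborel (r l p) t) lborel (k p) t
     = (\<Sum>l\<in>UNIV. rconv (%t. B i l * rconv (k i) lborel (r l p) t) lborel (k p) t)"
    by (rule lborel.AE_rconv_sum_left) (auto intro!: kL1 rL1 Lloc_cmult lborel.Lloc_rconv)
   ultimately show "AL t. (\<Sum>l\<in>UNIV. B i l * rconv (k i) lborel (rconv (r l p) lborel (k p)) t)
     = rconv (r i p) lborel (k p) t + B i p * rconv (k i) lborel (k p) t"
    by eventually_elim (simp add: lborel.rconv_cmult)
  qed
  show ?thesis using a b c eq[of i j]
  proof eventually_elim
   case (elim t)
   have "rconv (k i) lborel (h (i, j)) t = (\<Sum>l\<in>UNIV. B i l * rconv (k i) lborel (r l j) t)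
     + (\<Sum>l\<in>UNIV. B i l * (B l j * rconv (k i) lborel (k l) t))
     - (\<Sum>l\<in>UNIV. \<Sum>p\<in>UNIV. B p j * (B i l * rconv (k i) lborel (rconv (r l p) lborel (k p)) t))"
    using elim by (simp add: distrib_left right_diff_distrib sum.distrib sum_subtractf sum_distrib_left mult.left_commute)
   also have "(\<Sum>l\<in>UNIV. \<Sum>p\<in>UNIV. B p j * (B i l * rconv (k i) lborel (rconv (r l p) lborel (k p)) t))
     = (\<Sum>p\<in>UNIV. B p j * (\<Sum>l\<in>UNIV. B i l * rconv (k i) lborel (rconv (r l p) lborel (k p)) t))"
    by (subst sum.swap) (simp add: sum_distrib_left)
   also have "... = (\<Sum>p\<in>UNIV. B p j * (rconv (r i p) lborel (k p) t + B i p * rconv (k i) lborel (k p) t))"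
    using elim by simp
   finally show ?case using elim by (simp add: D_def distrib_left sum.distrib mult_ac)
  qed
 qed
 have "AL t. \<forall>p. D p t = 0"
 proof (rule Volterra_uniqueness[where k="%p. k (fst p)" and h=h and l="%s. C * indicator {0..} s"])
  show "L2loc (%s. C * indicator {0..} s)" by (intro L2loc_cmult L2loc_one)
  show "AL t. \<bar>D p t\<bar> <= \<bar>rconv (k (fst p)) lborel (h p) t\<bar>" for p
   using Dh[of "fst p" "snd p"] by eventually_elim simp
  show "AL s. \<bar>h p s\<bar> <= C * indicator {0..} s * (\<Sum>q\<in>UNIV. \<bar>D q s\<bar>)" for p
  proof (intro AE_I2)
   fix s
   show "\<bar>h p s\<bar> <= C * indicator {0..} s * (\<Sum>q\<in>UNIV. \<bar>D q s\<bar>)"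
   proof (cases "0 <= s")
    case True
    have "\<bar>h p s\<bar> <= C * (\<Sum>l\<in>UNIV. \<bar>D (l, snd p) s\<bar>)" unfolding h_def by (rule lin_bound)
    also have "... <= C * (\<Sum>q\<in>UNIV. \<bar>D q s\<bar>)"
     using sum_le[of "%q. D q s" "snd p"] C0 by (intro mult_left_mono) auto
    finally show ?thesis using True by simp
   next
    case False
    then show ?thesis using L2locD(2)[OF DL] by (simp add: h_def)
   qed
  qed
 qed (auto intro: k DL)
 then have R2: "AL t. (\<Sum>l\<in>UNIV. rconv (r i l) lborel (%s. - (k l s * B l j)) t) = - (k i t * B i j) - r i j t" for i j
 proof eventually_elim
  case (elim t)
  then have "D (i, j) t = 0" by blast
  then show ?case unfolding neg2 sum_negf by (simp add: D_def mult.commute)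
 qed
 show ?thesis using rL R1 R2 by blast
qed

section \<open>Jordan decomposition and densities\<close>

lemma bdd_borel_subset: "A \<in> sets borel ==> A \<subseteq> {0..T} ==> A \<in> bdd_borel"
 unfolding bdd_borel_def by (auto intro: bounded_subset[of "{0..T}"])

lemma bdd_borelE:
 assumes "A \<in> bdd_borel"
 obtains T where "T > 0" "A \<in> sets borel" "A \<subseteq> {0..T}"
proof -
 from assms obtain a where a: "!!x. x \<in> A ==> \<bar>x\<bar> <= a" and A: "A \<in> sets borel" "A \<subseteq> {0..}"
  unfolding bdd_borel_def bounded_real by auto
 have "A \<subseteq> {0..max 1 a}" using a A by fastforce
 then show ?thesis using that[of "max 1 a"] A by auto
qed

lemma bdd_borel_Un: "A \<in> bdd_borel ==> B \<in> bdd_borel ==> A \<union> B \<in> bdd_borel"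
 by (auto simp: bdd_borel_def)

lemma bdd_borel_Diff: "A \<in> bdd_borel ==> B \<in> bdd_borel ==> A - B \<in> bdd_borel"
 unfolding bdd_borel_def by (auto intro: bounded_subset)

lemma bdd_borel_empty: "{} \<in> bdd_borel"
 by (auto simp: bdd_borel_def)

lemma lf_measure_sums:
 assumes "lf_measure \<nu>" "disjoint_family A" "!!n. A n \<in> sets borel" "!!n. A n \<subseteq> {0..T}"
 shows "(%n. \<nu> (A n)) sums \<nu> (\<Union>n. A n)"
proof -
 have "!!n. A n \<subseteq> {0..max 1 T}" using assms(4) by force
 then show ?thesis using assms(1-3) unfolding lf_measure_def by (metis less_max_iff_disj zero_less_one)
qed

lemma lf_measure_empty:
 assumes "lf_measure \<nu>" shows "\<nu> {} = 0"
proof -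
 have "(%n::nat. \<nu> {}) sums \<nu> {}"
  using lf_measure_sums[OF assms, of "%_. {}" 1] by (simp add: disjoint_family_on_def)
 then have "(%n::nat. \<nu> {}) \<longlonglongrightarrow> 0" using summable_LIMSEQ_zero sums_summable by blast
 then show ?thesis using LIMSEQ_unique tendsto_const by blast
qed

lemma lf_measure_Un:
 assumes \<nu>: "lf_measure \<nu>" and A: "A \<in> bdd_borel" and B: "B \<in> bdd_borel" and d: "A \<inter> B = {}"
 shows "\<nu> (A \<union> B) = \<nu> A + \<nu> B"
proof -
 from bdd_borel_Un[OF A B] obtain T where T: "A \<union> B \<subseteq> {0..T}" by (rule bdd_borelE)
 have "(%n. \<nu> (binaryset A B n)) sums \<nu> (\<Union>n. binaryset A B n)"
 proof (rule lf_measure_sums[OF \<nu>])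
  show "disjoint_family (binaryset A B)"
   using d by (auto simp: disjoint_family_on_def binaryset_def)
  show "binaryset A B n \<in> sets borel" "binaryset A B n \<subseteq> {0..T}" for n
   using A B T by (auto simp: binaryset_def bdd_borel_def)
 qed
 moreover have "(%n. \<nu> (binaryset A B n)) sums (\<nu> A + \<nu> B)"
  by (rule binaryset_sums) (rule lf_measure_empty[OF \<nu>])
 ultimately show ?thesis by (simp add: UN_binaryset_eq sums_iff)
qed

lemma lf_measure_Diff:
 fixes \<nu> :: "real set => 'a::real_normed_vector"
 assumes \<nu>: "lf_measure \<nu>" and A: "A \<in> bdd_borel" and B: "B \<in> bdd_borel" and d: "B \<subseteq> A"
 shows "\<nu> (A - B) = \<nu> A - \<nu> B"
 using lf_measure_Un[OF \<nu> bdd_borel_Diff[OF A B] B] d by (simp add: Un_absorb2 Diff_disjoint Int_commute)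

lemma lf_measure_bounded_linear:
 assumes "lf_measure \<mu>" "bounded_linear f"
 shows "lf_measure (%A. f (\<mu> A))"
 using assms unfolding lf_measure_def by (auto intro: bounded_linear.sums)

text \<open>The value that the positive part of \<open>\<nu>\<close> is meant to take on \<open>A\<close>, as a set
function.\<close>
definition jordan_sup :: "(real set => real) => real set => ennreal" where
 "jordan_sup \<nu> A = (SUP B \<in> {B \<in> bdd_borel. B \<subseteq> A}. ennreal (\<nu> B))"

lemma jordan_sup_upper: "B \<in> bdd_borel ==> B \<subseteq> A ==> ennreal (\<nu> B) <= jordan_sup \<nu> A"
 unfolding jordan_sup_def by (rule SUP_upper) auto

lemma jordan_sup_least: "(!!B. B \<in> bdd_borel ==> B \<subseteq> A ==> ennreal (\<nu> B) <= c) ==> jordan_sup \<nu> A <= c"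
 unfolding jordan_sup_def by (rule SUP_least) auto

lemma ennreal_add_le: "ennreal (a + b) <= ennreal a + ennreal b"
proof -
 have "ennreal (a + b) <= ennreal (max 0 a + max 0 b)" by (intro ennreal_leI) auto
 also have "... = ennreal (max 0 a) + ennreal (max 0 b)" by (intro ennreal_plus) auto
 also have "... = ennreal a + ennreal b" by (auto simp: max_def ennreal_neg)
 finally show ?thesis .
qed

lemma ennreal_sum_le: "finite I ==> ennreal (\<Sum>i\<in>I. f i) <= (\<Sum>i\<in>I. ennreal (f i))"
proof (induction I rule: finite_induct)
 case (insert x F)
 then show ?case using ennreal_add_le[of "f x" "sum f F"] by (auto intro: order_trans add_left_mono)
qed simp

text \<open>After replacing subsets of negative value by the empty set, unions of subsets of \<open>A\<close> and of
\<open>C\<close> compete for the supremum on the right.\<close>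
lemma jordan_sup_superadditive:
 assumes \<nu>: "lf_measure \<nu>" and d: "A \<inter> C = {}"
 shows "jordan_sup \<nu> A + jordan_sup \<nu> C <= jordan_sup \<nu> (A \<union> C)"
proof -
 have ne: "{B \<in> bdd_borel. B \<subseteq> X} ~= {}" for X using bdd_borel_empty by blast
 have pair: "ennreal (\<nu> B) + ennreal (\<nu> D) <= jordan_sup \<nu> (A \<union> C)"
  if B: "B \<in> bdd_borel" "B \<subseteq> A" and D: "D \<in> bdd_borel" "D \<subseteq> C" for B D
 proof -
  define B' where "B' = (if 0 <= \<nu> B then B else {})"
  define D' where "D' = (if 0 <= \<nu> D then D else {})"
  have B': "B' \<in> bdd_borel" "B' \<subseteq> A" "0 <= \<nu> B'" "ennreal (\<nu> B) = ennreal (\<nu> B')"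
   using B bdd_borel_empty lf_measure_empty[OF \<nu>] by (auto simp: B'_def ennreal_neg)
  have D': "D' \<in> bdd_borel" "D' \<subseteq> C" "0 <= \<nu> D'" "ennreal (\<nu> D) = ennreal (\<nu> D')"
   using D bdd_borel_empty lf_measure_empty[OF \<nu>] by (auto simp: D'_def ennreal_neg)
  have "ennreal (\<nu> B) + ennreal (\<nu> D) = ennreal (\<nu> B' + \<nu> D')" using B' D' by (simp add: ennreal_plus)
  also have "\<nu> B' + \<nu> D' = \<nu> (B' \<union> D')"
   using B' D' d by (intro lf_measure_Un[OF \<nu>, symmetric]) auto
  also have "ennreal (\<nu> (B' \<union> D')) <= jordan_sup \<nu> (A \<union> C)"
   using B' D' by (intro jordan_sup_upper bdd_borel_Un) auto
  finally show ?thesis .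
 qed
 have "jordan_sup \<nu> A + jordan_sup \<nu> C = (SUP B\<in>{B \<in> bdd_borel. B \<subseteq> A}. SUP D\<in>{B \<in> bdd_borel. B \<subseteq> C}. ennreal (\<nu> B) + ennreal (\<nu> D))"
  unfolding jordan_sup_def
  by (simp only: ennreal_SUP_add_left[OF ne, symmetric] ennreal_SUP_add_right[OF ne]) (rule SUP_commute)
 also have "... <= jordan_sup \<nu> (A \<union> C)"
  by (intro SUP_least) (use pair in auto)
 finally show ?thesis .
qed

lemma sets_jordan_pos [simp, measurable_cong]: "sets (jordan_pos \<nu>) = sets borel"
 unfolding jordan_pos_def using sets.sigma_sets_eq[of borel] by (simp add: sets_measure_of space_borel)

text \<open>The supremum is countably additive, hence it is the measure that it generates.\<close>
lemma emeasure_jordan_pos: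
 assumes \<nu>: "lf_measure \<nu>" and A: "A \<in> sets borel"
 shows "emeasure (jordan_pos \<nu>) A = jordan_sup \<nu> A"
proof -
 let ?F = "%S. \<Sum>i. jordan_sup \<nu> (S i)"
 have def: "jordan_pos \<nu> = measure_of UNIV (sets borel) (jordan_sup \<nu>)"
  by (simp add: jordan_pos_def jordan_sup_def[abs_def])
 show ?thesis
 proof (rule emeasure_measure_of[OF def])
  show "positive (sets (jordan_pos \<nu>)) (jordan_sup \<nu>)"
  proof (simp add: positive_def)
   have "jordan_sup \<nu> {} <= 0"
    by (rule jordan_sup_least) (simp add: lf_measure_empty[OF \<nu>])
   then show "jordan_sup \<nu> {} = 0" by simp
  qed
  show "countably_additive (sets (jordan_pos \<nu>)) (jordan_sup \<nu>)"
   unfolding countably_additive_def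
  proof (intro allI impI)
   fix S :: "nat => real set"
   assume S: "range S \<subseteq> sets (jordan_pos \<nu>)" "disjoint_family S" "\<Union> (range S) \<in> sets (jordan_pos \<nu>)"
   then have Sb: "S n \<in> sets borel" for n by auto
   show "(?F S) = jordan_sup \<nu> (\<Union> (range S))"
   proof (rule antisym)
    have fin: "(\<Sum>i<n. jordan_sup \<nu> (S i)) <= jordan_sup \<nu> (\<Union>i<n. S i)" for n
    proof (induction n)
     case (Suc n)
     have "S i \<inter> S n = {}" if "i < n" for i
      using S(2) that unfolding disjoint_family_on_def by simp
     then have "(\<Union>i<n. S i) \<inter> S n = {}" by blast
     then have "jordan_sup \<nu> (\<Union>i<n. S i) + jordan_sup \<nu> (S n) <= jordan_sup \<nu> ((\<Union>i<n. S i) \<union> S n)"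
      by (rule jordan_sup_superadditive[OF \<nu>])
     also have "(\<Union>i<n. S i) \<union> S n = (\<Union>i<Suc n. S i)"
      by (simp add: lessThan_Suc Un_commute)
     finally show ?case using Suc by (auto intro: order_trans add_right_mono)
    qed simp
    have "(\<Sum>i<n. jordan_sup \<nu> (S i)) <= jordan_sup \<nu> (\<Union> (range S))" for n
    proof (rule order_trans[OF fin])
     show "jordan_sup \<nu> (\<Union>i<n. S i) <= jordan_sup \<nu> (\<Union> (range S))"
      unfolding jordan_sup_def by (rule SUP_subset_mono) auto
    qed
    then show "(?F S) <= jordan_sup \<nu> (\<Union> (range S))"
     by (simp add: suminf_eq_SUP SUP_least)
    show "jordan_sup \<nu> (\<Union> (range S)) <= (?F S)"
    proof (rule jordan_sup_least)
     fix B assume B: "B \<in> bdd_borel" "B \<subseteq> \<Union> (range S)"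
     from B(1) obtain T where T: "B \<in> sets borel" "B \<subseteq> {0..T}" by (rule bdd_borelE)
     have "(%n. \<nu> (B \<inter> S n)) sums \<nu> (\<Union>n. B \<inter> S n)"
     proof (rule lf_measure_sums[OF \<nu>])
      show "disjoint_family (%n. B \<inter> S n)" using S(2) unfolding disjoint_family_on_def by blast
     qed (use T Sb in auto)
     also have "(\<Union>n. B \<inter> S n) = B" using B by auto
     finally have "(%n. \<Sum>i<n. \<nu> (B \<inter> S i)) \<longlonglongrightarrow> \<nu> B" by (simp add: sums_def)
     then have "(%n. ennreal (\<Sum>i<n. \<nu> (B \<inter> S i))) \<longlonglongrightarrow> ennreal (\<nu> B)" by (rule tendsto_ennrealI)
     moreover have "ennreal (\<Sum>i<n. \<nu> (B \<inter> S i)) <= (?F S)" for n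
     proof -
      have "ennreal (\<Sum>i<n. \<nu> (B \<inter> S i)) <= (\<Sum>i<n. ennreal (\<nu> (B \<inter> S i)))" by (rule ennreal_sum_le) simp
      also have "... <= (\<Sum>i<n. jordan_sup \<nu> (S i))"
       using T Sb by (intro sum_mono jordan_sup_upper) (auto intro!: bdd_borel_subset[of _ T])
      also have "... <= (?F S)" by (rule sum_le_suminf) auto
      finally show ?thesis .
     qed
     ultimately show "ennreal (\<nu> B) <= (?F S)"
      by (auto intro: LIMSEQ_le_const2)
    qed
   qed
  qed
 qed (use A in auto)
qed

text \<open>If it were infinite, then a set of infinite supremum would split into two parts of which one again has
infinite supremum while the other has \<open>\<bar>\<nu>\<bar> \<ge> 1\<close>. Iterating produces
infinitely many disjoint sets with \<open>\<bar>\<nu>\<bar> \<ge> 1\<close>, against the convergence of the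
series of their values.\<close>
lemma jordan_sup_finite:
 assumes \<nu>: "lf_measure \<nu>"
 shows "jordan_sup \<nu> {0..T} < \<infinity>"
proof (rule ccontr)
 assume "\<not> jordan_sup \<nu> {0..T} < \<infinity>"
 then have inf: "jordan_sup \<nu> {0..T} = \<infinity>" by (metis infinity_ennreal_def top.not_eq_extremum)
 define P where "P E \<longleftrightarrow> E \<in> sets borel & E \<subseteq> {0..T} & jordan_sup \<nu> E = \<infinity>" for E
 have step: "\<exists>E'. P E' & E' \<subseteq> E & 1 <= \<bar>\<nu> (E - E')\<bar>" if "P E" for E
 proof -
  have E: "E \<in> sets borel" "E \<subseteq> {0..T}" "jordan_sup \<nu> E = \<infinity>" using that by (auto simp: P_def)
  then have Eb: "E \<in> bdd_borel" by (intro bdd_borel_subset)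
  have "\<exists>B. B \<in> bdd_borel & B \<subseteq> E & 1 + \<bar>\<nu> E\<bar> < \<nu> B"
  proof (rule ccontr)
   assume no: "\<not> ?thesis"
   have "jordan_sup \<nu> E <= ennreal (1 + \<bar>\<nu> E\<bar>)"
   proof (rule jordan_sup_least)
    fix B assume "B \<in> bdd_borel" "B \<subseteq> E"
    then have "\<nu> B <= 1 + \<bar>\<nu> E\<bar>" using no by (auto simp: not_less)
    then show "ennreal (\<nu> B) <= ennreal (1 + \<bar>\<nu> E\<bar>)" by (rule ennreal_leI)
   qed
   then show False using E by (simp add: top_unique)
  qed
  then obtain B where B: "B \<in> bdd_borel" "B \<subseteq> E" "1 + \<bar>\<nu> E\<bar> < \<nu> B" by blast
  have Bs: "B \<in> sets borel" using B by (simp add: bdd_borel_def)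
  have D: "\<nu> (E - B) = \<nu> E - \<nu> B" by (rule lf_measure_Diff[OF \<nu> Eb B(1,2)])
  have "jordan_sup \<nu> B + jordan_sup \<nu> (E - B) = emeasure (jordan_pos \<nu>) B + emeasure (jordan_pos \<nu>) (E - B)"
   using Bs E by (simp add: emeasure_jordan_pos[OF \<nu>])
  also have "... = emeasure (jordan_pos \<nu>) (B \<union> (E - B))"
   using Bs E by (intro plus_emeasure) auto
  also have "B \<union> (E - B) = E" using B by auto
  also have "emeasure (jordan_pos \<nu>) E = \<infinity>" using E by (simp add: emeasure_jordan_pos[OF \<nu>])
  finally have "jordan_sup \<nu> B = \<infinity> \<or> jordan_sup \<nu> (E - B) = \<infinity>" by (simp add: ennreal_add_eq_top)
  then show ?thesis
  proof
   assume "jordan_sup \<nu> B = \<infinity>"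
   moreover have "1 <= \<bar>\<nu> (E - B)\<bar>" using D B by linarith
   ultimately show ?thesis using B Bs E by (intro exI[of _ B]) (auto simp: P_def)
  next
   assume "jordan_sup \<nu> (E - B) = \<infinity>"
   moreover have "E - (E - B) = B" using B by auto
   then have "1 <= \<bar>\<nu> (E - (E - B))\<bar>" using B by simp
   ultimately show ?thesis using B Bs E by (intro exI[of _ "E - B"]) (auto simp: P_def)
  qed
 qed
 have "\<exists>E. \<forall>n. P (E n) & (E (Suc n) \<subseteq> E n & 1 <= \<bar>\<nu> (E n - E (Suc n))\<bar>)"
 proof (rule dependent_nat_choice)
  show "\<exists>E. P E" using inf by (intro exI[of _ "{0..T}"]) (simp add: P_def)
  show "\<exists>E'. P E' & (E' \<subseteq> E & 1 <= \<bar>\<nu> (E - E')\<bar>)" if "P E" for E using step[OF that] by blast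
 qed
 then obtain E where E: "!!n. P (E n)" "!!n. E (Suc n) \<subseteq> E n" "!!n. 1 <= \<bar>\<nu> (E n - E (Suc n))\<bar>" by blast
 have anti: "E n \<subseteq> E m" if "m <= n" for m n using E(2) that by (rule lift_Suc_antimono_le)
 have "(%n. \<nu> (E n - E (Suc n))) sums \<nu> (\<Union>n. E n - E (Suc n))"
 proof (rule lf_measure_sums[OF \<nu>])
  show "disjoint_family (%n. E n - E (Suc n))"
   unfolding disjoint_family_on_def
  proof (intro ballI impI)
   fix m n :: nat assume "m ~= n"
   then have "Suc m <= n \<or> Suc n <= m" by auto
   then show "(E m - E (Suc m)) \<inter> (E n - E (Suc n)) = {}" using anti by blast
  qed
  show "E n - E (Suc n) \<in> sets borel" "E n - E (Suc n) \<subseteq> {0..T}" for n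
   using E(1)[of n] E(1)[of "Suc n"] by (auto simp: P_def)
 qed
 then have "(%n. \<nu> (E n - E (Suc n))) \<longlonglongrightarrow> 0" using summable_LIMSEQ_zero sums_summable by blast
 then have "\<forall>\<^sub>F n in sequentially. \<bar>\<nu> (E n - E (Suc n))\<bar> < 1"
  using order_tendstoD(2)[OF tendsto_rabs, of "%n. \<nu> (E n - E (Suc n))" 0 sequentially 1] by simp
 then show False using E(3) by (auto simp: eventually_sequentially) (meson linorder_not_less order_refl)
qed

lemma lf_measure_uminus: "lf_measure \<nu> ==> lf_measure (%A. - \<nu> A :: real)"
 using lf_measure_bounded_linear[of \<nu> uminus] bounded_linear_minus[OF bounded_linear_ident] by simp

text \<open>Both parts are finite on bounded sets, and if \<open>B\<close> competes for one of them, then \<open>A - B\<close>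
competes for the other.\<close>
lemma jordan_decomposition:
 assumes \<nu>: "lf_measure \<nu>" and A: "A \<in> bdd_borel"
 shows "\<nu> A = measure (jordan_pos \<nu>) A - measure (jordan_neg \<nu>) A"
proof -
 note \<nu>' = lf_measure_uminus[OF \<nu>]
 have As: "A \<in> sets borel" using A by (simp add: bdd_borel_def)
 have fin: "jordan_sup \<nu> A < \<infinity>" if "lf_measure \<nu>" for \<nu>
 proof -
  from A obtain T where "A \<subseteq> {0..T}" by (rule bdd_borelE)
  then have "jordan_sup \<nu> A <= jordan_sup \<nu> {0..T}"
   unfolding jordan_sup_def by (intro SUP_subset_mono) auto
  then show ?thesis using jordan_sup_finite[OF that] by (rule order_le_less_trans)
 qed
 obtain a where a: "jordan_sup \<nu> A = ennreal a" "0 <= a" using fin[OF \<nu>] by (cases "jordan_sup \<nu> A") auto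
 obtain b where b: "jordan_sup (%A. - \<nu> A) A = ennreal b" "0 <= b" using fin[OF \<nu>'] by (cases "jordan_sup (%A. - \<nu> A) A") auto
 have ua: "\<nu> B <= a" if "B \<in> bdd_borel" "B \<subseteq> A" for B
  using jordan_sup_upper[OF that, of \<nu>] a by (simp add: ennreal_le_iff)
 have ub: "- \<nu> B <= b" if "B \<in> bdd_borel" "B \<subseteq> A" for B
  using jordan_sup_upper[OF that, of "%A. - \<nu> A"] b by (simp add: ennreal_le_iff)
 have "ennreal b <= ennreal (a - \<nu> A)"
  unfolding b(1)[symmetric]
 proof (rule jordan_sup_least)
  fix B assume B: "B \<in> bdd_borel" "B \<subseteq> A"
  have "\<nu> (A - B) <= a" using B A by (intro ua bdd_borel_Diff) auto
  then show "ennreal (- \<nu> B) <= ennreal (a - \<nu> A)"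
   using lf_measure_Diff[OF \<nu> A B] by (intro ennreal_leI) simp
 qed
 then have 1: "b <= a - \<nu> A" using ua[OF A] by (simp add: ennreal_le_iff)
 have "ennreal a <= ennreal (b + \<nu> A)"
  unfolding a(1)[symmetric]
 proof (rule jordan_sup_least)
  fix B assume B: "B \<in> bdd_borel" "B \<subseteq> A"
  have "- \<nu> (A - B) <= b" using B A by (intro ub bdd_borel_Diff) auto
  then show "ennreal (\<nu> B) <= ennreal (b + \<nu> A)"
   using lf_measure_Diff[OF \<nu> A B] by (intro ennreal_leI) simp
 qed
 then have 2: "a <= b + \<nu> A" using ub[OF A] by (simp add: ennreal_le_iff)
 have "measure (jordan_pos \<nu>) A = a" "measure (jordan_neg \<nu>) A = b"
  unfolding measure_def jordan_neg_def using a b by (simp_all add: emeasure_jordan_pos As \<nu> \<nu>')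
 then show ?thesis using 1 2 by simp
qed

lemma emeasure_jordan_pos_finite:
 "lf_measure \<nu> ==> emeasure (jordan_pos \<nu>) {0..T} < \<infinity>"
 using jordan_sup_finite by (simp add: emeasure_jordan_pos)

lemma emeasure_jordan_pos_negative:
 assumes "lf_measure \<nu>" shows "emeasure (jordan_pos \<nu>) {..<0} = 0"
proof -
 have "jordan_sup \<nu> {..<0} <= 0"
 proof (rule jordan_sup_least)
  fix B assume "B \<in> bdd_borel" "B \<subseteq> {..<0::real}"
  then have "B = {}" by (force simp: bdd_borel_def)
  then show "ennreal (\<nu> B) <= 0" using lf_measure_empty[OF assms] by simp
 qed
 then show ?thesis using assms by (simp add: emeasure_jordan_pos)
qed

lemma borel_sigma_finiteI:
 fixes M :: "real measure"
 assumes [simp]: "sets M = sets borel" and fin: "!!T. emeasure M {0..T} < \<infinity>" and neg: "emeasure M {..<0} = 0"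
 shows "borel_sigma_finite M"
proof unfold_locales
 let ?A = "insert {..<0} (range (%n::nat. {0..real n}))"
 have sp: "space M = UNIV" using sets_eq_imp_space_eq[OF assms(1)] by simp
 show "\<exists>A. countable A & A \<subseteq> sets M & \<Union> A = space M & (\<forall>a\<in>A. emeasure M a ~= \<infinity>)"
 proof (intro exI[of _ ?A] conjI ballI)
  have "x \<in> \<Union> ?A" for x :: real
  proof (cases "x < 0")
   case False
   obtain n where "x <= real n" using real_arch_simple by blast
   with False have "x \<in> {0..real n}" by simp
   then show ?thesis by blast
  qed simp
  then show "\<Union> ?A = space M" unfolding sp by blast
  show "emeasure M a ~= \<infinity>" if "a \<in> ?A" for a
   using that fin neg by (auto simp: less_top)
 qed auto
qed simp

definition sum_measure :: "('i::finite => real measure) => real measure" where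
 "sum_measure N = measure_of UNIV (sets borel) (%A. \<Sum>i\<in>UNIV. emeasure (N i) A)"

lemma sets_sum_measure [simp]: "sets (sum_measure N) = sets borel"
 unfolding sum_measure_def using sets.sigma_sets_eq[of borel] by (simp add: sets_measure_of space_borel)

lemma emeasure_sum_measure:
 assumes N: "!!i. sets (N i) = sets borel" and A: "A \<in> sets borel"
 shows "emeasure (sum_measure N) A = (\<Sum>i\<in>UNIV. emeasure (N i) A)"
proof (rule emeasure_measure_of[OF sum_measure_def])
 show "positive (sets (sum_measure N)) (%A. \<Sum>i\<in>UNIV. emeasure (N i) A)" by (simp add: positive_def)
 show "countably_additive (sets (sum_measure N)) (%A. \<Sum>i\<in>UNIV. emeasure (N i) A)"
  unfolding countably_additive_def
 proof (intro allI impI)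
  fix S :: "nat => real set"
  assume S: "range S \<subseteq> sets (sum_measure N)" "disjoint_family S"
  have "(\<Sum>n. \<Sum>i\<in>UNIV. emeasure (N i) (S n)) = (\<Sum>i\<in>UNIV. \<Sum>n. emeasure (N i) (S n))"
   by (rule suminf_sum) simp
  also have "... = (\<Sum>i\<in>UNIV. emeasure (N i) (\<Union> (range S)))"
   using S N by (intro sum.cong refl suminf_emeasure) auto
  finally show "(\<Sum>n. \<Sum>i\<in>UNIV. emeasure (N i) (S n)) = (\<Sum>i\<in>UNIV. emeasure (N i) (\<Union> (range S)))" .
 qed
qed (use A in auto)

text \<open>Radon--Nikodym with respect to the sum of all the measures.\<close>
lemma common_densities:
 fixes N :: "'i::finite => real measure"
 assumes sets: "!!i. sets (N i) = sets borel" and fin: "!!i T. emeasure (N i) {0..T} < \<infinity>"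
  and neg: "!!i. emeasure (N i) {..<0} = 0"
 obtains M :: "real measure" and d where "borel_sigma_finite M" "!!i. Lloc M (d i)" "!!i s. 0 <= d i s"
  "!!i. N i = density M (%s. ennreal (d i s))" "!!T. emeasure M {0..T} < \<infinity>"
proof -
 define M where "M = sum_measure N"
 have eM: "A \<in> sets borel ==> emeasure M A = (\<Sum>i\<in>UNIV. emeasure (N i) A)" for A
  unfolding M_def by (rule emeasure_sum_measure[OF sets])
 have M: "borel_sigma_finite M"
 proof (rule borel_sigma_finiteI)
  show "sets M = sets borel" by (simp add: M_def)
  show "emeasure M {0..T} < \<infinity>" for T using fin by (simp add: eM)
  show "emeasure M {..<0} = 0" by (simp add: eM neg)
 qed
 interpret borel_sigma_finite M by (rule M)
 have "\<exists>d. Lloc M d & (\<forall>s. 0 <= d s) & N i = density M (%s. ennreal (d s))" for i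
 proof -
  have ac: "absolutely_continuous M (N i)"
   unfolding absolutely_continuous_def
  proof
   fix A assume "A \<in> null_sets M"
   then have A: "A \<in> sets borel" "emeasure M A = 0" by auto
   then have "emeasure (N i) A = 0" by (simp add: eM)
   then show "A \<in> null_sets (N i)" using A sets by auto
  qed
  from Radon_Nikodym[OF ac] sets obtain f where f[measurable]: "f \<in> borel_measurable M" and Nf: "density M f = N i" by auto
  interpret Ni: borel_sigma_finite "N i" by (rule borel_sigma_finiteI[OF sets fin neg])
  have "AE x in M. f x ~= \<infinity>"
   using sigma_finite_iff_density_finite[OF f] Ni.sigma_finite_measure_axioms Nf by simp
  define d where "d s = enn2real (f s) * indicator {0..} s" for s
  have [measurable]: "d \<in> borel_measurable borel" using f unfolding d_def by measurable
  have "AE s in M. \<not> (f s ~= 0 & s < 0)"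
  proof -
   have "(\<integral>\<^sup>+s. f s * indicator {..<0} s \<partial>M) = 0"
    using neg[of i] unfolding Nf[symmetric] by (subst (asm) emeasure_density) auto
   then have "AE s in M. f s * indicator {..<0} s = 0" by (subst (asm) nn_integral_0_iff_AE) auto
   then show ?thesis by eventually_elim (auto split: split_indicator_asm)
  qed
  with \<open>AE x in M. f x ~= \<infinity>\<close> have fd: "AE s in M. f s = ennreal (d s)"
   by eventually_elim (auto simp: d_def less_top split: split_indicator)
  have Nd: "N i = density M (%s. ennreal (d s))"
   unfolding Nf[symmetric] by (rule density_cong) (use fd in auto)
  have "Lloc M d"
   unfolding Lloc_def
  proof (intro conjI allI impI)
   fix T
   have "nnI M T (%s. \<bar>d s\<bar>) = emeasure (N i) {0..T}"
    unfolding Nd by (subst emeasure_density) (auto simp: d_def)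
   then show "nnI M T (%s. \<bar>d s\<bar>) < \<infinity>" using fin by simp
  qed (auto simp: d_def)
  moreover have "\<forall>s. 0 <= d s" by (auto simp: d_def)
  ultimately show ?thesis using Nd by blast
 qed
 then obtain d where "!!i. Lloc M (d i) & (\<forall>s. 0 <= d i s) & N i = density M (%s. ennreal (d i s))" by metis
 moreover have "emeasure M {0..T} < \<infinity>" for T using fin by (simp add: eM)
 ultimately show ?thesis using that M by blast
qed

text \<open>Approximate the density by simple functions \<open>F i\<close>. On a level set of \<open>F i\<close> the
norm of the integral of \<open>h\<close> is, up to the approximation error, the integral of the norm, and
the level sets form a finite partition of \<open>[0,T]\<close>.\<close>
lemma total_variation_ge_density:
 fixes \<mu> :: "real set => 'a::euclidean_space" and h :: "real => 'a"
 assumes sets [measurable_cong]: "sets M = sets borel"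
  and int: "set_integrable M {0..T} h"
  and \<mu>: "!!B. B \<in> sets borel ==> B \<subseteq> {0..T} ==> \<mu> B = (LINT s:B|M. h s)"
  and fin: "emeasure M {0..T} < \<infinity>"
 shows "nnI M T (%s. norm (h s)) <= total_variation \<mu> {0..T}"
proof -
 let ?H = "%H. \<integral>(s::real). norm (H s) \<partial>M"
 let ?G = "%B y. \<integral>(s::real). indicator (B y) s *\<^sub>R y \<partial>M"
 let ?F = "%H F i. \<integral>(s::real). norm (H s - F i s) \<partial>M"
 define H where "H s = indicator {0..T} s *\<^sub>R h s" for s
 have iH: "integrable M H" using int unfolding set_integrable_def H_def[abs_def] .
 then have [measurable]: "H \<in> borel_measurable M" by simp
 from borel_measurable_implies_sequence_metric[OF \<open>H \<in> borel_measurable M\<close>, of 0]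
 obtain F where F0: "\<forall>i. simple_function M (F i)" "\<forall>x\<in>space M. (%i. F i x) \<longlonglongrightarrow> H x"
   "\<forall>i. \<forall>x\<in>space M. dist (F i x) 0 <= 2 * dist (H x) 0"
  by blast
 then have F: "!!i. simple_function M (F i)" "!!x. x \<in> space M ==> (%i. F i x) \<longlonglongrightarrow> H x"
   "!!i x. x \<in> space M ==> norm (F i x) <= 2 * norm (H x)"
  by (simp_all add: dist_norm)
 have sp: "space M = UNIV" using sets_eq_imp_space_eq[OF sets] by simp
 have [measurable]: "F i \<in> borel_measurable M" for i using F(1) by (rule borel_measurable_simple_function)
 have bound: "nnI M T (%s. norm (h s))
   <= total_variation \<mu> {0..T} + ennreal (2 * (?F H F i))" for i
 proof -
  define V where "V = F i ` {0..T}"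
  define B where "B y = F i -` {y} \<inter> {0..T}" for y
  have finV: "finite V" using F(1)[of i] unfolding V_def simple_function_def sp
   by (intro finite_subset[of "F i ` {0..T}" "range (F i)"]) auto
  have Bs[measurable]: "B y \<in> sets borel" for y
  proof -
   have "F i -` {y} \<inter> space M \<in> sets M" using F(1)[of i] by (rule simple_functionD(2))
   then show ?thesis by (simp add: B_def sp)
  qed
  have iHF: "integrable M (%s. norm (H s - F i s))"
  proof (rule Bochner_Integration.integrable_bound[where f="%s. 3 * norm (H s)"])
   show "AE s in M. norm (norm (H s - F i s)) <= norm (3 * norm (H s))"
   proof (intro AE_I2)
    fix s assume "s \<in> space M"
    then show "norm (norm (H s - F i s)) <= norm (3 * norm (H s))"
     using norm_triangle_ineq4[of "H s" "F i s"] F(3)[of s i] by simp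
   qed
  qed (use iH in auto)
  have emB: "emeasure M (B y) < \<infinity>" for y
   using fin emeasure_mono[of "B y" "{0..T}" M] by (auto simp: B_def intro: order_le_less_trans)
  have iB: "integrable M (%s. indicator (B y) s *\<^sub>R H s)" for y
   using iH by (rule integrable_mult_indicator[rotated]) simp
  have iB2: "integrable M (%s. indicator (B y) s * norm (H s - F i s))" for y
   using integrable_mult_indicator[OF _ iHF, of "B y"] by simp
  have each: "(\<integral>s. indicator (B y) s * norm (H s) \<partial>M) <= norm (\<mu> (B y)) + 2 * (\<integral>s. indicator (B y) s * norm (H s - F i s) \<partial>M)" for y
  proof -
   let ?I = "\<integral>s. indicator (B y) s * norm (H s - F i s) \<partial>M"
   have c: "integrable M (%s. indicator (B y) s *\<^sub>R y)" using emB[of y] by simp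
   have my: "\<mu> (B y) = (\<integral>s. indicator (B y) s *\<^sub>R H s \<partial>M)"
    by (subst \<mu>) (auto simp: B_def set_lebesgue_integral_def H_def intro!: Bochner_Integration.integral_cong split: split_indicator)
   have "norm ((?G B y) - \<mu> (B y)) = norm (\<integral>s. indicator (B y) s *\<^sub>R y - indicator (B y) s *\<^sub>R H s \<partial>M)"
    using c iB[of y] by (simp add: my)
   also have "... <= (\<integral>s. norm (indicator (B y) s *\<^sub>R y - indicator (B y) s *\<^sub>R H s) \<partial>M)" by (rule integral_norm_bound)
   also have "... = ?I"
    by (intro Bochner_Integration.integral_cong refl) (auto simp: B_def norm_minus_commute split: split_indicator)
   finally have 1: "norm (?G B y) <= norm (\<mu> (B y)) + ?I" by (smt (verit) norm_triangle_ineq2)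
   have "(\<integral>s. indicator (B y) s * norm (H s) \<partial>M) <= (\<integral>s. indicator (B y) s *\<^sub>R norm y + indicator (B y) s * norm (H s - F i s) \<partial>M)"
   proof (rule integral_mono)
    show "integrable M (%s. indicator (B y) s * norm (H s))"
     using integrable_mult_indicator[OF _ integrable_norm[OF iH], of "B y"] by simp
    show "integrable M (%s. indicator (B y) s *\<^sub>R norm y + indicator (B y) s * norm (H s - F i s))"
     using iB2 emB[of y] by (intro Bochner_Integration.integrable_add) auto
    show "indicator (B y) s * norm (H s) <= indicator (B y) s *\<^sub>R norm y + indicator (B y) s * norm (H s - F i s)" for s
     using norm_triangle_ineq[of y "H s - y"] by (auto simp: B_def split: split_indicator)
   qed
   also have "... = (\<integral>s. indicator (B y) s *\<^sub>R norm y \<partial>M) + ?I"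
    using iB2 emB[of y] by (intro Bochner_Integration.integral_add) auto
   also have "(\<integral>s. indicator (B y) s *\<^sub>R norm y \<partial>M) = norm (?G B y)"
   proof -
    have "integrable M (indicator (B y) :: real => real)" using emB[of y] by simp
    then have "(?G B y) = (\<integral>s. indicator (B y) s \<partial>M) *\<^sub>R y"
     by simp
    then show ?thesis by (simp add: abs_mult)
   qed
   finally show ?thesis using 1 by linarith
  qed
  have split: "(\<Sum>y\<in>V. indicator (B y) s * c) = indicator {0..T} s * (c::real)" for s c
  proof (cases "s \<in> {0..T}")
   case True
   have "(\<Sum>y\<in>V. indicator (B y) s * c) = (\<Sum>y\<in>V. if y = F i s then c else 0)"
    using True by (intro sum.cong) (auto simp: B_def)
   then show ?thesis using True finV by (simp add: V_def)
  next
   case False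
   then show ?thesis by (simp add: B_def)
  qed
  have "(?H H) = (\<integral>s. (\<Sum>y\<in>V. indicator (B y) s * norm (H s)) \<partial>M)"
   unfolding split by (intro Bochner_Integration.integral_cong refl) (auto simp: H_def split: split_indicator)
  also have "... = (\<Sum>y\<in>V. \<integral>s. indicator (B y) s * norm (H s) \<partial>M)"
   using integrable_mult_indicator[OF _ integrable_norm[OF iH]] by (intro Bochner_Integration.integral_sum) simp
  also have "... <= (\<Sum>y\<in>V. norm (\<mu> (B y)) + 2 * (\<integral>s. indicator (B y) s * norm (H s - F i s) \<partial>M))"
   by (rule sum_mono) (rule each)
  also have "... = (\<Sum>y\<in>V. norm (\<mu> (B y))) + 2 * (\<Sum>y\<in>V. \<integral>s. indicator (B y) s * norm (H s - F i s) \<partial>M)"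
   by (simp add: sum.distrib sum_distrib_left)
  also have "(\<Sum>y\<in>V. \<integral>s. indicator (B y) s * norm (H s - F i s) \<partial>M) = (\<integral>s. (\<Sum>y\<in>V. indicator (B y) s * norm (H s - F i s)) \<partial>M)"
   using iB2 by (intro Bochner_Integration.integral_sum[symmetric]) simp
  also have "... <= (?F H F i)"
   unfolding split
   using iHF integrable_mult_indicator[OF _ iHF, of "{0..T}"] by (intro integral_mono) (auto split: split_indicator)
  finally have main: "(?H H) <= (\<Sum>y\<in>V. norm (\<mu> (B y))) + 2 * (?F H F i)" by simp
  have "ennreal (\<Sum>y\<in>V. norm (\<mu> (B y))) <= total_variation \<mu> {0..T}"
  proof -
   have inj: "inj_on B V"
    by (auto simp: inj_on_def B_def V_def)
   have "ennreal (\<Sum>y\<in>V. norm (\<mu> (B y))) = (\<Sum>y\<in>V. ennreal (norm (\<mu> (B y))))" by (rule sum_ennreal[symmetric]) auto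
   also have "... = (\<Sum>C\<in>B ` V. ennreal (norm (\<mu> C)))" using inj by (simp add: sum.reindex)
   also have "... <= total_variation \<mu> {0..T}"
    unfolding total_variation_def
   proof (rule SUP_upper, intro CollectI conjI)
    show "finite (B ` V)" using finV by simp
    show "partition_on {0..T} (B ` V)"
     by (rule partition_onI) (auto simp: B_def V_def disjnt_def)
    show "B ` V \<subseteq> sets borel" using Bs by auto
   qed
   finally show ?thesis .
  qed
  then have "ennreal (?H H) <= total_variation \<mu> {0..T} + ennreal (2 * (?F H F i))"
   using ennreal_leI[OF main] by (simp add: ennreal_plus sum_nonneg) (meson add_right_mono order_trans)
  also have "ennreal (?H H) = (\<integral>\<^sup>+s. ennreal (norm (H s)) \<partial>M)"
   using iH by (intro nn_integral_eq_integral[symmetric]) auto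
  also have "... = nnI M T (%s. norm (h s))"
   by (intro nn_integral_cong) (auto simp: H_def split: split_indicator)
  finally show ?thesis .
 qed
 have "(%i. \<integral>s. norm (H s - F i s) \<partial>M) \<longlonglongrightarrow> (\<integral>s. norm (H s - H s) \<partial>M)"
 proof (rule integral_dominated_convergence[where w="%s. 3 * norm (H s)"])
  show "AE s in M. (%i. norm (H s - F i s)) \<longlonglongrightarrow> norm (H s - H s)"
   by (intro AE_I2 tendsto_intros F(2))
  show "AE s in M. norm (norm (H s - F i s)) <= 3 * norm (H s)" for i
  proof (intro AE_I2)
   fix s assume "s \<in> space M"
   then show "norm (norm (H s - F i s)) <= 3 * norm (H s)"
    using norm_triangle_ineq4[of "H s" "F i s"] F(3)[of s i] by simp
  qed
 qed (use iH in auto)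
 then have "(%i. ennreal (2 * (?F H F i))) \<longlonglongrightarrow> ennreal (2 * 0)"
  by (intro tendsto_ennrealI tendsto_mult tendsto_const) simp
 then have "(%i. total_variation \<mu> {0..T} + ennreal (2 * (?F H F i))) \<longlonglongrightarrow> total_variation \<mu> {0..T} + 0"
  by (intro tendsto_add tendsto_const) simp
 then have "nnI M T (%s. norm (h s)) <= total_variation \<mu> {0..T} + 0"
  by (rule LIMSEQ_le_const) (use bound in auto)
 then show ?thesis by simp
qed

section \<open>Vector and matrix valued integrals\<close>

lemma bounded_linear_axis: "bounded_linear (axis i :: 'a::euclidean_space => 'a ^ 'n)"
 unfolding linear_conv_bounded_linear[symmetric]
 by (intro linearI) (auto simp: axis_def vec_eq_iff)

lemma vec_eq_sum_axis: "(\<chi> i. f i) = (\<Sum>i\<in>UNIV. axis i (f i))" for f :: "'n::finite => 'a::euclidean_space"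
 by (simp add: vec_eq_iff axis_def)

lemma borel_measurable_vec_lambda:
 fixes f :: "'n::finite => 'b => 'a::euclidean_space"
 assumes [measurable]: "!!i. f i \<in> borel_measurable M"
 shows "(%s. \<chi> i. f i s) \<in> borel_measurable M"
proof -
 have [measurable]: "(axis i :: 'a => 'a ^ 'n) \<in> borel_measurable borel" for i
  by (intro borel_measurable_continuous_onI linear_continuous_on bounded_linear_axis)
 show ?thesis unfolding vec_eq_sum_axis by measurable
qed

lemma integrable_vec:
 fixes h :: "'b => 'a::euclidean_space ^ 'n::finite"
 assumes "!!i. integrable M (%s. h s $ i)"
 shows "integrable M h"
proof -
 have "integrable M (%s. \<Sum>i\<in>UNIV. axis i (h s $ i))"
  by (intro Bochner_Integration.integrable_sum integrable_bounded_linear[OF bounded_linear_axis] assms)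
 then show ?thesis by (simp flip: vec_eq_sum_axis)
qed

lemma integral_vec_nth:
 fixes h :: "'b => 'a::euclidean_space ^ 'n::finite"
 assumes "integrable M h"
 shows "(\<integral>s. h s \<partial>M) $ i = (\<integral>s. h s $ i \<partial>M)"
 using integral_bounded_linear[OF bounded_linear_vec_nth assms, of i] by simp

lemma op_norm_bound: "norm (A *v x) <= op_norm A * norm x"
 unfolding op_norm_def by (rule onorm) simp

lemma op_norm_nonneg: "0 <= op_norm A"
 unfolding op_norm_def by (rule onorm_pos_le) simp

lemma component_le_op_norm: "\<bar>A $ i $ j\<bar> <= op_norm A"
 unfolding op_norm_def by (rule matrix_component_le_onorm)

text \<open>The operator norm is continuous in the entries, hence a measurable function of the kernel.\<close>
lemma op_norm_diff_le: "\<bar>op_norm A - op_norm B\<bar> <= (\<Sum>i\<in>UNIV. \<Sum>j\<in>UNIV. \<bar>A $ i $ j - B $ i $ j\<bar>)"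
proof -
 have le: "op_norm A <= op_norm B + (\<Sum>i\<in>UNIV. \<Sum>j\<in>UNIV. \<bar>A $ i $ j - B $ i $ j\<bar>)" for A B :: "real ^ 'a ^ 'b"
 proof -
  have "(*v) A = (%x. B *v x + (A - B) *v x)"
   by (simp add: fun_eq_iff matrix_vector_mult_diff_rdistrib)
  then have "op_norm A <= op_norm B + op_norm (A - B)"
   unfolding op_norm_def using onorm_triangle[of "(*v) B" "(*v) (A - B)"] by simp
  also have "op_norm (A - B) <= (\<Sum>i\<in>UNIV. \<Sum>j\<in>UNIV. \<bar>(A - B) $ i $ j\<bar>)"
   unfolding op_norm_def by (rule onorm_le_matrix_component_sum)
  finally show ?thesis by simp
 qed
 have "(\<Sum>i\<in>UNIV. \<Sum>j\<in>UNIV. \<bar>B $ i $ j - A $ i $ j\<bar>) = (\<Sum>i\<in>UNIV. \<Sum>j\<in>UNIV. \<bar>A $ i $ j - B $ i $ j\<bar>)"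
  by (simp add: abs_minus_commute)
 then show ?thesis using le[of A B] le[of B A] by linarith
qed

lemma borel_measurable_op_norm:
 fixes e :: "'m::finite => 'n::finite => 'b => real"
 assumes [measurable]: "!!i j. e i j \<in> borel_measurable M"
 shows "(%u. op_norm (\<chi> i j. e i j u)) \<in> borel_measurable M"
proof -
 let ?F = "%A. %B. \<Sum>i\<in>UNIV. \<Sum>j\<in>UNIV. \<bar>B $ i $ j - A $ i $ j\<bar>"
 have "continuous_on UNIV (op_norm :: real ^ 'n ^ 'm => real)"
 proof (rule continuous_at_imp_continuous_on, intro ballI)
  fix A :: "real ^ 'n ^ 'm"
  have "((?F A) \<longlongrightarrow> (\<Sum>i\<in>UNIV. \<Sum>j\<in>UNIV. \<bar>A $ i $ j - A $ i $ j\<bar>)) (at A)"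
   by (intro tendsto_intros)
  then have lim: "((?F A) \<longlongrightarrow> 0) (at A)" by simp
  have "((%B. op_norm B - op_norm A) \<longlongrightarrow> 0) (at A)"
  proof (rule Lim_null_comparison[OF _ lim])
   show "\<forall>\<^sub>F B in at A. norm (op_norm B - op_norm A) <= (\<Sum>i\<in>UNIV. \<Sum>j\<in>UNIV. \<bar>B $ i $ j - A $ i $ j\<bar>)"
    unfolding real_norm_def by (intro always_eventually allI op_norm_diff_le)
  qed
  then show "isCont op_norm A" by (simp add: isCont_def LIM_zero_iff)
 qed
 then have [measurable]: "(op_norm :: real ^ 'n ^ 'm => real) \<in> borel_measurable borel"
  by (rule borel_measurable_continuous_onI)
 have [measurable]: "(%u. \<chi> i j. e i j u) \<in> borel_measurable M"
  by (intro borel_measurable_vec_lambda) measurable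
 show ?thesis by measurable
qed

section \<open>Admissible kernels are positive\<close>

text \<open>The value at 0 is set to 0 because the integral in \<open>conv_measure\<close> runs over
\<open>[0,t)\<close>: a mass of \<open>\<mu>\<close> at \<open>t\<close> is not seen at time
\<open>t\<close>.\<close>
definition diag_kernel :: "(real => real ^ 'm ^ 'm) => 'm => real => real" where
 "diag_kernel K i t = (if 0 < t then K t $ i $ i else 0)"

lemma borel_measurable_causal:
 assumes "set_borel_measurable lborel {0..} f" "S \<in> sets borel" "S \<subseteq> {0..}"
 shows "(%t. if t \<in> S then f t else 0 :: real) \<in> borel_measurable borel"
proof -
 have [measurable]: "(%t. indicator {0..} t *\<^sub>R f t) \<in> borel_measurable borel"
  using assms(1) by (simp add: set_borel_measurable_def)
 have [measurable]: "S \<in> sets borel" by fact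
 have "(%t. if t \<in> S then f t else 0) = (%t. indicator S t * (indicator {0..} t *\<^sub>R f t))"
  using assms(3) by (auto simp: fun_eq_iff split: split_indicator)
 then show ?thesis by (simp only:) measurable
qed

lemma L2loc_causal:
 assumes f: "Lq_loc 2 f" and S: "S \<in> sets borel" "S \<subseteq> {0..}"
 shows "L2loc (%t. if t \<in> S then f t else 0 :: real)"
 unfolding L2loc_def
proof (intro conjI allI impI)
 show m[measurable]: "(%t. if t \<in> S then f t else 0) \<in> borel_measurable borel"
  using f S by (intro borel_measurable_causal) (auto simp: Lq_loc_def)
 show "(if s \<in> S then f s else 0) = 0" if "s < 0" for s using that S by auto
 fix T :: real
 have "nnI lborel T (%s. (if s \<in> S then f s else 0)\<^sup>2)
   <= (NN s. ennreal (norm (indicator {0..max 1 T} s *\<^sub>R (norm (f s) powr 2))))"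
  by (intro nn_integral_mono) (auto split: split_indicator)
 also have "... < \<infinity>"
 proof -
  have "integrable lborel (%s. indicator {0..max 1 T} s *\<^sub>R (norm (f s) powr 2))"
   using f unfolding Lq_loc_def set_integrable_def by (auto simp: less_max_iff_disj)
  then show ?thesis by (simp add: integrable_iff_bounded)
 qed
 finally show "nnI lborel T (%s. (if s \<in> S then f s else 0)\<^sup>2) < \<infinity>" .
qed

lemma L2loc_diag_kernel:
 assumes "admissible b \<beta> \<sigma> K"
 shows "L2loc (diag_kernel K i)"
proof -
 have "L2loc (%t. if t \<in> {0<..} then K t $ i $ i else 0)"
  using assms by (intro L2loc_causal) (auto simp: admissible_def)
 moreover have "diag_kernel K i = (%t. if t \<in> {0<..} then K t $ i $ i else 0)"
  by (auto simp: diag_kernel_def fun_eq_iff)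
 ultimately show ?thesis by simp
qed

lemma admissible_shift:
 assumes "admissible b \<beta> \<sigma> K"
 shows "kernel_shift_condition (%t. K t $ i $ i)"
proof -
 have "\<forall>i. \<forall>h\<in>{0..1}. kernel_shift_condition (%t. K (t + h) $ i $ i)"
  using assms by (simp add: admissible_def)
 from this[rule_format, of 0 i] show ?thesis by simp
qed

lemma diag_kernel_nonneg:
 assumes "admissible b \<beta> \<sigma> K"
 shows "0 <= diag_kernel K i t"
 using admissible_shift[OF assms, of i] by (auto simp: kernel_shift_condition_def diag_kernel_def)

lemma jordan_sup_nonneg_measure:
 assumes L: "lf_measure L" and pos: "!!A. A \<in> bdd_borel ==> 0 <= L A" and A: "A \<in> bdd_borel"
 shows "jordan_sup L A = ennreal (L A)"
proof (rule antisym)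
 show "jordan_sup L A <= ennreal (L A)"
 proof (rule jordan_sup_least)
  fix B assume B: "B \<in> bdd_borel" "B \<subseteq> A"
  have "L (A - B) = L A - L B" by (rule lf_measure_Diff[OF L A B])
  then show "ennreal (L B) <= ennreal (L A)"
   using pos[OF bdd_borel_Diff[OF A B(1)]] by (intro ennreal_leI) simp
 qed
 show "ennreal (L A) <= jordan_sup L A" by (rule jordan_sup_upper) (use A in auto)
qed

lemma null_jordan_pos:
 assumes L: "lf_measure L" and neg: "!!A. A \<in> bdd_borel ==> L A <= 0"
 shows "emeasure (jordan_pos L) A = 0" "AE s in jordan_pos L. P s"
proof -
 have "jordan_sup L UNIV <= 0"
  by (rule jordan_sup_least) (use neg in \<open>auto simp: ennreal_neg\<close>)
 then have "emeasure (jordan_pos L) UNIV = 0" by (simp add: emeasure_jordan_pos[OF L])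
 then have 0: "UNIV \<in> null_sets (jordan_pos L)" by (simp add: null_sets_def)
 show "AE s in jordan_pos L. P s" using AE_I'[OF 0, of P] by auto
 show "emeasure (jordan_pos L) A = 0"
 proof (cases "A \<in> sets borel")
  case True
  then show ?thesis using 0 null_sets_subset[OF 0, of A] by auto
 qed (simp add: emeasure_notin_sets)
qed

text \<open>The resolvent of the first kind is a nonnegative measure, so it coincides with its positive part, which
satisfies \<open>decreasing_shift_measure\<close>.\<close>
lemma positive_kernel_diag:
 assumes adm: "admissible b \<beta> \<sigma> K"
 shows "positive_kernel (diag_kernel K i)"
proof -
 let ?k = "diag_kernel K i"
 have kL: "L2loc ?k" by (rule L2loc_diag_kernel[OF adm])
 obtain L where L: "is_resolvent_first_kind (%t. K t $ i $ i) L" and pos: "!!A. A \<in> bdd_borel ==> 0 <= L A"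
   and anti: "!!t. 0 <= t ==> antimono_on {0..} (%s. L {s..s + t})"
  using admissible_shift[OF adm, of i] unfolding kernel_shift_condition_def by auto
 have lf: "lf_measure L" and res: "AL t. 0 <= t --> signed_integral L {0..<t} (%s. K (t - s) $ i $ i) = 1"
  using L by (auto simp: is_resolvent_first_kind_def elim: eventually_mono)
 define M where "M = jordan_pos L"
 have sM [measurable_cong]: "sets M = sets borel" by (simp add: M_def)
 have eM: "emeasure M A = ennreal (L A)" if "A \<in> bdd_borel" for A
  using that jordan_sup_nonneg_measure[OF lf pos that] unfolding M_def
  by (subst emeasure_jordan_pos[OF lf]) (auto simp: bdd_borel_def)
 interpret M: borel_sigma_finite M
  unfolding M_def by (intro borel_sigma_finiteI emeasure_jordan_pos_finite emeasure_jordan_pos_negative lf sets_jordan_pos)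
 interpret M: decreasing_shift_measure M
 proof unfold_locales
  show "emeasure M {0..T} < \<infinity>" for T unfolding M_def by (rule emeasure_jordan_pos_finite[OF lf])
  fix s t h :: real assume *: "0 <= s" "0 <= t" "0 <= h"
  have "{s + h..s + h + t} \<in> bdd_borel" "{s..s + t} \<in> bdd_borel"
   using * by (auto simp: bdd_borel_def)
  moreover have "L {s + h..s + h + t} <= L {s..s + t}"
   using monotone_onD[OF anti[of t], of s "s + h"] * by auto
  ultimately show "emeasure M {s + h..s + h + t} <= emeasure M {s..s + t}"
   by (simp add: eM ennreal_leI)
 qed
 have one: "AL t. rconv ?k M (indicator {0..}) t = indicator {0..} t"
  using res
 proof eventually_elim
  case (elim t)
  show ?case
  proof (cases "0 <= t")
   case True
   have "(LINT s:{0..<t}|jordan_neg L. K (t - s) $ i $ i) = 0"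
    unfolding jordan_neg_def set_lebesgue_integral_def
    by (rule integral_eq_zero_AE, rule null_jordan_pos) (use pos lf_measure_uminus[OF lf] in auto)
   then have "1 = (LINT s:{0..<t}|M. K (t - s) $ i $ i)"
    using elim True by (simp add: signed_integral_def M_def)
   also have "... = rconv ?k M (indicator {0..}) t"
    unfolding rconv_def set_lebesgue_integral_def
    by (intro Bochner_Integration.integral_cong refl) (auto simp: diag_kernel_def split: split_indicator)
   finally show ?thesis using True by simp
  next
   case False
   then show ?thesis by (subst M.rconv_negative) (auto simp: diag_kernel_def)
  qed
 qed
 have "\<exists>r. L2loc r & (AL t. 0 <= r t) & (AL t. r t + c * rconv ?k lborel r t = c * ?k t)" if c: "0 < c" for c
 proof -
  obtain r where r: "L2loc r" "AL t. r t + c * rconv ?k lborel r t = c * ?k t"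
   using scalar_resolvent_exists[OF kL] by blast
  then show ?thesis using M.scalar_resolvent_nonneg[OF Lloc_L2loc[OF kL] one c Lloc_L2loc[OF r(1)] r(2)] by blast
 qed
 then show ?thesis using kL diag_kernel_nonneg[OF adm] by (auto simp: positive_kernel_def)
qed

section \<open>Densities of the driving measure\<close>

lemma signed_integral_cong:
 assumes "!!s. s \<in> A ==> f s = g s"
 shows "signed_integral \<nu> A f = signed_integral \<nu> A g" "signed_integrable \<nu> A f = signed_integrable \<nu> A g"
proof -
 have "(%s. indicator A s *\<^sub>R f s) = (%s. indicator A s *\<^sub>R g s)"
  using assms by (auto simp: fun_eq_iff split: split_indicator)
 then show "signed_integral \<nu> A f = signed_integral \<nu> A g" "signed_integrable \<nu> A f = signed_integrable \<nu> A g"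
  by (simp_all add: signed_integral_def signed_integrable_def set_lebesgue_integral_def set_integrable_def)
qed

text \<open>The Jordan parts of the components of \<open>\<mu>\<close> and Lebesgue measure on the half-line as
densities of a single measure \<open>M\<close>: \<open>\<rho>\<close> represents \<open>- Re \<mu>\<close>,
\<open>\<pi> - \<upsilon>\<close> represents \<open>Im \<mu>\<close>, and \<open>d0\<close> represents
Lebesgue measure.\<close>
locale measure_densities = borel_sigma_finite M for M +
 fixes \<mu> :: "real set => complex ^ 'm" and \<rho> \<pi> \<upsilon> :: "'m => real => real" and d0 :: "real => real"
 assumes finite_M: "!!T. emeasure M {0..T} < \<infinity>"
  and Lloc_densities: "!!j. Lloc M (\<rho> j)" "!!j. Lloc M (\<pi> j)" "!!j. Lloc M (\<upsilon> j)" "Lloc M d0"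
  and densities_nonneg: "!!j s. 0 <= \<rho> j s" "!!j s. 0 <= \<pi> j s" "!!j s. 0 <= \<upsilon> j s" "!!s. 0 <= d0 s"
  and lborel_density: "density lborel (indicator {0..}) = density M (%s. ennreal (d0 s))"
  and Re_pos_null: "!!j P. AE s in jordan_pos (%B. Re (\<mu> B $ j)). P s"
  and Re_neg_density: "!!j. jordan_neg (%B. Re (\<mu> B $ j)) = density M (%s. ennreal (\<rho> j s))"
  and Im_pos_density: "!!j. jordan_pos (%B. Im (\<mu> B $ j)) = density M (%s. ennreal (\<pi> j s))"
  and Im_neg_density: "!!j. jordan_neg (%B. Im (\<mu> B $ j)) = density M (%s. ennreal (\<upsilon> j s))"
  and lf: "lf_measure \<mu>"
  and Im_zero: "Im_measure_zero \<mu> ==> AE s in M. \<forall>j. \<pi> j s = 0 & \<upsilon> j s = 0"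

lemma lf_measure_components:
 assumes "lf_measure (\<mu> :: real set => complex ^ 'm)"
 shows "lf_measure (%B. Re (\<mu> B $ j))" "lf_measure (%B. Im (\<mu> B $ j))"
 using lf_measure_bounded_linear[OF assms bounded_linear_compose[OF bounded_linear_Re bounded_linear_vec_nth]]
  lf_measure_bounded_linear[OF assms bounded_linear_compose[OF bounded_linear_Im bounded_linear_vec_nth]]
 by auto

theorem measure_densities_exist:
 fixes \<mu> :: "real set => complex ^ 'm"
 assumes \<mu>: "lf_measure_nonpos_Re \<mu>"
 shows "\<exists>M \<rho> \<pi> \<upsilon> d0. measure_densities M \<mu> \<rho> \<pi> \<upsilon> d0"
proof -
 have lf: "lf_measure \<mu>" using \<mu> by (simp add: lf_measure_nonpos_Re_def)
 note lfc = lf_measure_components[OF lf]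
 define N where "N p = (case p of None => density lborel (indicator {0..})
   | Some (j, None) => jordan_neg (%B. Re (\<mu> B $ j))
   | Some (j, Some True) => jordan_pos (%B. Im (\<mu> B $ j))
   | Some (j, Some False) => jordan_neg (%B. Im (\<mu> B $ j)))" for p :: "('m \<times> bool option) option"
 have N: "sets (N p) = sets borel & emeasure (N p) {0..T} < \<infinity> & emeasure (N p) {..<0} = 0" for p T
 proof (cases p)
  case None
  have "emeasure (density lborel (indicator {0..})) A = emeasure lborel ({0..} \<inter> A)" if "A \<in> sets borel" for A :: "real set"
   using that by (subst emeasure_restricted) auto
  moreover have "{0..} \<inter> {..<0::real} = {}" "{0..} \<inter> {0..T} = {0..T}" by auto
  ultimately show ?thesis using None by (simp add: N_def emeasure_lborel_Icc_eq)
 next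
  case (Some q)
  then show ?thesis
   using lfc lf_measure_uminus[OF lfc(1)] lf_measure_uminus[OF lfc(2)]
   by (cases q; cases "snd q")
    (auto simp: N_def jordan_neg_def split: bool.split intro: emeasure_jordan_pos_finite[unfolded infinity_ennreal_def] emeasure_jordan_pos_negative)
 qed
 obtain M d where M: "borel_sigma_finite M" and d: "!!p. Lloc M (d p)" "!!p s. 0 <= d p s"
  "!!p. N p = density M (%s. ennreal (d p s))" "!!T. emeasure M {0..T} < \<infinity>"
  using common_densities[of N] N by metis
 interpret borel_sigma_finite M by (rule M)
 note [measurable] = LlocD(1)[OF d(1)]
 have "measure_densities M \<mu> (%j. d (Some (j, None))) (%j. d (Some (j, Some True))) (%j. d (Some (j, Some False))) (d None)"
 proof unfold_locales
  show "density lborel (indicator {0..}) = density M (%s. ennreal (d None s))"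
   using d(3)[of None] by (simp add: N_def)
  show "AE s in jordan_pos (%B. Re (\<mu> B $ j)). P s" for j P
   using \<mu> by (intro null_jordan_pos lfc) (auto simp: lf_measure_nonpos_Re_def)
  show "jordan_neg (%B. Re (\<mu> B $ j)) = density M (%s. ennreal (d (Some (j, None)) s))" for j
   using d(3)[of "Some (j, None)"] by (simp add: N_def)
  show "jordan_pos (%B. Im (\<mu> B $ j)) = density M (%s. ennreal (d (Some (j, Some True)) s))" for j
   using d(3)[of "Some (j, Some True)"] by (simp add: N_def)
  show "jordan_neg (%B. Im (\<mu> B $ j)) = density M (%s. ennreal (d (Some (j, Some False)) s))" for j
   using d(3)[of "Some (j, Some False)"] by (simp add: N_def)
  show "AE s in M. \<forall>j. d (Some (j, Some True)) s = 0 & d (Some (j, Some False)) s = 0" if "Im_measure_zero \<mu>"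
  proof -
   have "AE s in M. d (Some (j, Some q)) s = 0" for j q
   proof -
    have "emeasure (N (Some (j, Some q))) UNIV = 0"
     using that lfc(2)[of j] lf_measure_uminus[OF lfc(2)[of j]]
     by (cases q) (auto simp: N_def jordan_neg_def Im_measure_zero_def intro!: null_jordan_pos)
    then have "(\<integral>\<^sup>+s. ennreal (d (Some (j, Some q)) s) \<partial>M) = 0"
     unfolding d(3) by (subst (asm) emeasure_density) (auto)
    then have "AE s in M. ennreal (d (Some (j, Some q)) s) = 0"
     by (subst (asm) nn_integral_0_iff_AE) auto
    then show ?thesis by eventually_elim (use d(2) in \<open>auto simp: ennreal_eq_0_iff order.antisym\<close>)
   qed
   then show ?thesis unfolding AE_all_countable by (auto intro: AE_conjI)
  qed
 qed (use d lf in auto)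
 then show ?thesis by blast
qed

context measure_densities begin

lemma measurable_densities [measurable]:
 "\<rho> j \<in> borel_measurable borel" "\<pi> j \<in> borel_measurable borel" "\<upsilon> j \<in> borel_measurable borel" "d0 \<in> borel_measurable borel"
 using Lloc_densities[THEN LlocD(1)] by auto

lemma signed_integral_Re:
 assumes [measurable]: "f \<in> borel_measurable borel" "A \<in> sets borel"
 shows "signed_integral (%B. Re (\<mu> B $ j)) A f = - (\<integral>s. indicator A s * f s * \<rho> j s \<partial>M)"
  "integrable M (%s. indicator A s * f s * \<rho> j s) ==> signed_integrable (%B. Re (\<mu> B $ j)) A f"
proof -
 let ?G = "\<integral>s. indicator A s * f s * \<rho> j s \<partial>M"
 let ?F = "%B. Re (\<mu> B $ j)"
 have 0: "(LINT s:A|jordan_pos ?F. f s) = 0"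
  unfolding set_lebesgue_integral_def by (rule integral_eq_zero_AE[OF Re_pos_null])
 have "(LINT s:A|jordan_neg ?F. f s) = ?G"
  unfolding set_lebesgue_integral_def Re_neg_density
  by (subst integral_density) (auto simp: densities_nonneg mult_ac)
 then show "signed_integral ?F A f = - ?G"
  by (simp add: signed_integral_def 0)
 assume i: "integrable M (%s. indicator A s * f s * \<rho> j s)"
 have "set_integrable (jordan_pos ?F) A f"
 proof -
  have "integrable (jordan_pos ?F) (%s. indicator A s *\<^sub>R f s) \<longleftrightarrow> integrable (jordan_pos ?F) (%s. 0::real)"
   by (rule integrable_cong_AE) (auto intro: Re_pos_null)
  then show ?thesis by (simp add: set_integrable_def)
 qed
 moreover have "set_integrable (jordan_neg ?F) A f"
  unfolding set_integrable_def Re_neg_density using i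
  by (subst integrable_density) (auto simp: densities_nonneg mult_ac)
 ultimately show "signed_integrable ?F A f" by (simp add: signed_integrable_def)
qed

lemma signed_integral_Im:
 assumes [measurable]: "f \<in> borel_measurable borel" "A \<in> sets borel"
 shows "signed_integral (%B. Im (\<mu> B $ j)) A f = (\<integral>s. indicator A s * f s * \<pi> j s \<partial>M) - (\<integral>s. indicator A s * f s * \<upsilon> j s \<partial>M)"
  "integrable M (%s. indicator A s * f s * \<pi> j s) ==> integrable M (%s. indicator A s * f s * \<upsilon> j s) ==> signed_integrable (%B. Im (\<mu> B $ j)) A f"
proof -
 show "signed_integral (%B. Im (\<mu> B $ j)) A f = (\<integral>s. indicator A s * f s * \<pi> j s \<partial>M) - (\<integral>s. indicator A s * f s * \<upsilon> j s \<partial>M)"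
  unfolding signed_integral_def set_lebesgue_integral_def Im_pos_density Im_neg_density
  by (subst (1 2) integral_density) (auto simp: densities_nonneg mult_ac)
 assume i: "integrable M (%s. indicator A s * f s * \<pi> j s)" "integrable M (%s. indicator A s * f s * \<upsilon> j s)"
 then show "signed_integrable (%B. Im (\<mu> B $ j)) A f"
  unfolding signed_integrable_def set_integrable_def Im_pos_density Im_neg_density
  by (subst (1 2) integrable_density) (auto simp: densities_nonneg mult_ac)
qed

definition im_density :: "'m => real => real" where "im_density j s = \<pi> j s - \<upsilon> j s"

lemma Lloc_im_density: "Lloc M (im_density j)"
 unfolding im_density_def[abs_def] by (intro Lloc_diff Lloc_densities) simp

definition density_vec :: "real => complex ^ 'm" where
 "density_vec s = (\<chi> j. Complex (- \<rho> j s) (im_density j s))"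

lemma set_integrable_Icc: "Lloc M n ==> integrable M (%s. indicator {0..T} s * n s)"
proof (rule integrableI_bounded)
 let ?F = "\<integral>\<^sup>+s. ennreal (norm (indicator {0..T} s * n s)) \<partial>M"
 assume n: "Lloc M n"
 note [measurable] = LlocD(1)[OF n]
 show "(%s. indicator {0..T} s * n s) \<in> borel_measurable M" by measurable
 have "?F = nnI M T (%s. \<bar>n s\<bar>)"
  by (intro nn_integral_cong) (auto split: split_indicator)
 then show "?F < \<infinity>" using LlocD(3)[OF n, of T] by simp
qed

text \<open>The total variation of \<open>\<mu>\<close> dominates the norm of its density, not just the componentwise
densities; the constants 1 and 2 in the norm estimate depend on this.\<close>
lemma density_vec_le_total_variation:
 "nnI M T (%s. norm (density_vec s)) <= total_variation \<mu> {0..T}"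
proof (rule total_variation_ge_density)
 let ?A = "%B n. %s. indicator B s * n s"
 let ?H = "%B s j. indicator B s * - \<rho> j s"
 let ?G = "%B s j. indicator B s * im_density j s"
 let ?F = "%B n. %s. indicator B s *\<^sub>R (indicator {0..T} s * n s)"
 have cint: "integrable M (%s. (indicator B s *\<^sub>R density_vec s) $ j)"
  if B: "B \<in> sets borel" "B \<subseteq> {0..T}" for B j
 proof -
  have ind: "integrable M (?A B n)" if "Lloc M n" for n
  proof -
   have "integrable M (?F B n)"
    using B set_integrable_Icc[OF that] by (intro integrable_mult_indicator) auto
   moreover have "(?F B n) = (?A B n)"
    using B by (auto simp: fun_eq_iff split: split_indicator)
   ultimately show ?thesis by simp
  qed
  have "(%s. (indicator B s *\<^sub>R density_vec s) $ j) = (%s. complex_of_real (?H B s j) + \<i> * complex_of_real (?G B s j))"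
   by (auto simp: fun_eq_iff density_vec_def complex_eq_iff)
  then show ?thesis
   using ind[OF Lloc_minus[OF Lloc_densities(1)[of j]]] ind[OF Lloc_im_density[of j]]
   by (simp only:) (intro Bochner_Integration.integrable_add integrable_mult_right integrable_of_real)
 qed
 have vint: "integrable M (%s. indicator B s *\<^sub>R density_vec s)" if "B \<in> sets borel" "B \<subseteq> {0..T}" for B
  using cint[OF that] by (rule integrable_vec)
 show "set_integrable M {0..T} density_vec"
  unfolding set_integrable_def by (rule vint) auto
 fix B :: "real set" assume B: "B \<in> sets borel" "B \<subseteq> {0..T}"
 have bB: "B \<in> bdd_borel" using B by (rule bdd_borel_subset)
 note lfc = lf_measure_components[OF lf]
 have meas: "measure (density M (%s. ennreal (n s))) B = (\<integral>s. indicator B s * n s \<partial>M)" if "Lloc M n" "!!s. 0 <= n s" for n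
 proof -
  note [measurable] = LlocD(1)[OF that(1)]
  have "emeasure (density M (%s. ennreal (n s))) B = (\<integral>\<^sup>+s. ennreal (indicator B s * n s) \<partial>M)"
   using B by (subst emeasure_density) (auto intro!: nn_integral_cong split: split_indicator)
  moreover have "(\<integral>s. indicator B s * n s \<partial>M) = enn2real (\<integral>\<^sup>+s. ennreal (indicator B s * n s) \<partial>M)"
   using B that(2) by (intro integral_eq_nn_integral) auto
  ultimately show ?thesis by (simp add: measure_def)
 qed
 have ind: "integrable M (?A B n)" if "Lloc M n" for n
 proof -
  have "integrable M (?F B n)"
   using B set_integrable_Icc[OF that] by (intro integrable_mult_indicator) auto
  moreover have "(?F B n) = (?A B n)"
   using B by (auto simp: fun_eq_iff split: split_indicator)
  ultimately show ?thesis by simp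
 qed
 have "emeasure (jordan_pos (%B. Re (\<mu> B $ j))) B = 0" for j
  using emeasure_eq_0_AE[OF Re_pos_null[where j=j and P="%s. \<not> s \<in> B"]] B
   sets_eq_imp_space_eq[OF sets_jordan_pos[of "%B. Re (\<mu> B $ j)"]] by simp
 then have mz: "measure (jordan_pos (%B. Re (\<mu> B $ j))) B = 0" for j by (simp add: measure_def)
 show "\<mu> B = (LINT s:B|M. density_vec s)"
 proof (subst vec_eq_iff, intro allI)
  fix j
  have "(LINT s:B|M. density_vec s) $ j = (\<integral>s. (indicator B s *\<^sub>R density_vec s) $ j \<partial>M)"
   unfolding set_lebesgue_integral_def by (rule integral_vec_nth[OF vint[OF B]])
  also have "... = (\<integral>s. complex_of_real (?H B s j) + \<i> * complex_of_real (?G B s j) \<partial>M)"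
   by (intro Bochner_Integration.integral_cong refl) (auto simp: density_vec_def complex_eq_iff)
  also have "... = (\<integral>s. complex_of_real (?H B s j) \<partial>M) + (\<integral>s. \<i> * complex_of_real (?G B s j) \<partial>M)"
   by (intro Bochner_Integration.integral_add integrable_mult_right integrable_of_real ind Lloc_minus Lloc_densities Lloc_im_density)
  also have "... = complex_of_real (\<integral>s. ?H B s j \<partial>M) + \<i> * complex_of_real (\<integral>s. ?G B s j \<partial>M)"
   by (subst integral_mult_right_zero, subst (1 2) integral_complex_of_real) simp
  finally have e: "(LINT s:B|M. density_vec s) $ j = complex_of_real (\<integral>s. ?H B s j \<partial>M) + \<i> * complex_of_real (\<integral>s. ?G B s j \<partial>M)" .
  have "Re (\<mu> B $ j) = - (\<integral>s. indicator B s * \<rho> j s \<partial>M)"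
   using jordan_decomposition[OF lfc(1) bB, of j] mz[of j]
   by (simp add: Re_neg_density meas[OF Lloc_densities(1) densities_nonneg(1)])
  moreover have "Im (\<mu> B $ j) = (\<integral>s. indicator B s * \<pi> j s \<partial>M) - (\<integral>s. indicator B s * \<upsilon> j s \<partial>M)"
   using jordan_decomposition[OF lfc(2) bB, of j]
   by (simp add: Im_neg_density Im_pos_density meas[OF Lloc_densities(2) densities_nonneg(2)] meas[OF Lloc_densities(3) densities_nonneg(3)])
  moreover have "(\<integral>s. ?G B s j \<partial>M) = (\<integral>s. indicator B s * \<pi> j s \<partial>M) - (\<integral>s. indicator B s * \<upsilon> j s \<partial>M)"
   unfolding im_density_def right_diff_distrib
   by (intro Bochner_Integration.integral_diff ind Lloc_densities)
  ultimately show "\<mu> B $ j = (LINT s:B|M. density_vec s) $ j"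
   unfolding e by (simp add: complex_eq_iff)
 qed
qed (use finite_M in auto)

lemma integral_lborel_eq:
 fixes f :: "real => real"
 assumes [measurable]: "f \<in> borel_measurable borel"
 shows "(\<integral>s. f s * indicator {0..} s \<partial>lborel) = (\<integral>s. f s * d0 s \<partial>M)"
  "integrable lborel (%s. f s * indicator {0..} s) \<longleftrightarrow> integrable M (%s. f s * d0 s)"
proof -
 have eq: "density lborel (%s. ennreal (indicator {0..} s :: real)) = density M (%s. ennreal (d0 s))"
  using lborel_density by (simp add: ennreal_indicator)
 have "(\<integral>s. f s * indicator {0..} s \<partial>lborel) = (\<integral>s. f s \<partial>density lborel (%s. ennreal (indicator {0..} s)))"
  by (subst integral_density) (auto simp: mult.commute)
 also have "... = (\<integral>s. f s * d0 s \<partial>M)"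
  unfolding eq by (subst integral_density) (auto simp: mult.commute densities_nonneg)
 finally show "(\<integral>s. f s * indicator {0..} s \<partial>lborel) = (\<integral>s. f s * d0 s \<partial>M)" .
 have "integrable lborel (%s. f s * indicator {0..} s) \<longleftrightarrow> integrable (density lborel (%s. ennreal (indicator {0..} s))) f"
  by (subst integrable_density) (auto simp: mult.commute)
 also have "... \<longleftrightarrow> integrable M (%s. f s * d0 s)"
  unfolding eq by (subst integrable_density) (auto simp: mult.commute densities_nonneg)
 finally show "integrable lborel (%s. f s * indicator {0..} s) \<longleftrightarrow> integrable M (%s. f s * d0 s)" .
qed

lemma nn_integral_lborel_eq:
 fixes f :: "real => ennreal"
 assumes [measurable]: "f \<in> borel_measurable borel"
 shows "(NN s. f s * indicator {0..} s) = (\<integral>\<^sup>+s. f s * ennreal (d0 s) \<partial>M)"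
proof -
 have "(NN s. f s * indicator {0..} s) = (\<integral>\<^sup>+s. f s \<partial>density lborel (indicator {0..}))"
  by (subst nn_integral_density) (auto simp: mult.commute)
 also have "... = (\<integral>\<^sup>+s. f s * ennreal (d0 s) \<partial>M)"
  unfolding lborel_density by (subst nn_integral_density) (auto simp: mult.commute densities_nonneg)
 finally show ?thesis .
qed

lemma Lloc_lborel_density:
 assumes q: "Lloc lborel q"
 shows "Lloc M (%s. q s * d0 s)"
 unfolding Lloc_def
proof (intro conjI allI impI)
 note [measurable] = LlocD(1)[OF q]
 show "(%s. q s * d0 s) \<in> borel_measurable borel" by measurable
 show "q s * d0 s = 0" if "s < 0" for s using LlocD(2)[OF q that] by simp
 fix T
 have "nnI M T (%s. \<bar>q s * d0 s\<bar>) = (\<integral>\<^sup>+s. ennreal \<bar>q s\<bar> * indicator {0..T} s * ennreal (d0 s) \<partial>M)"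
  by (intro nn_integral_cong) (simp add: abs_mult ennreal_mult densities_nonneg mult_ac)
 also have "... = (NN s. ennreal \<bar>q s\<bar> * indicator {0..T} s * indicator {0..} s)"
  by (rule nn_integral_lborel_eq[symmetric]) measurable
 also have "... = nnI lborel T (%s. \<bar>q s\<bar>)"
  by (intro nn_integral_cong) (auto split: split_indicator)
 finally show "nnI M T (%s. \<bar>q s * d0 s\<bar>) < \<infinity>" using LlocD(3)[OF q, of T] by simp
qed

text \<open>A function source is a special measure source. This allows treating \<open>\<mu>\<close> and
\<open>R(\<psi>) dt\<close> together.\<close>
lemma rconv_lborel_density:
 assumes [measurable]: "f \<in> borel_measurable borel" and q: "Lloc lborel q"
 shows "rconv f M (%s. q s * d0 s) t = rconv f lborel q t"
proof -
 note [measurable] = LlocD(1)[OF q]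
 have "rconv f lborel q t = (\<integral>s. (f (t - s) * q s) * indicator {0..} s \<partial>lborel)"
  unfolding rconv_def using LlocD(2)[OF q]
  by (intro Bochner_Integration.integral_cong refl) (auto split: split_indicator)
 also have "... = (\<integral>s. (f (t - s) * q s) * d0 s \<partial>M)" by (rule integral_lborel_eq(1)) measurable
 finally show ?thesis by (simp add: rconv_def mult.assoc)
qed

end

section \<open>The resolvent kernel\<close>

text \<open>The variation of constants formula. The convolution kernel of \<open>n\<close> is the entry of \<open>E = K - R_B * K\<close>.\<close>
lemma (in borel_sigma_finite) linear_Volterra_resolvent:
 fixes k n y :: "'m::finite => real => real" and c :: "'m => 'm => real => real"
 assumes k: "!!i. L2loc (k i)" and c: "!!i j. Lloc lborel (c i j)"
  and res: "!!i j. AL t. (\<Sum>l\<in>UNIV. rconv (c i l) lborel (%s. - (k l s * B l j)) t) = - (k i t * B i j) - c i j t"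
  and n: "!!i. Lloc M (n i)" and y: "!!i. L2loc (y i)"
  and eq: "!!i. AL t. y i t = rconv (k i) M (n i) t + rconv (k i) lborel (%s. \<Sum>l\<in>UNIV. B i l * y l s) t"
 shows "AL t. \<forall>i. y i t = (\<Sum>j\<in>UNIV. rconv (%t. (if i = j then k i t else 0) - rconv (c i j) lborel (k j) t) M (n j) t)"
 unfolding AE_all_countable
proof
 let ?F = "%k j l. %s. - (k j s * B j l)"
 fix i
 note kL = Lloc_L2loc[OF k] and yL = Lloc_L2loc[OF y]
 note [measurable] = L2locD(1)[OF k] L2locD(1)[OF y] LlocD(1)[OF c] LlocD(1)[OF n]
 define G where "G j = rconv (k j) M (n j)" for j
 define H where "H j l = rconv (k j) lborel (y l)" for j l
 have GL: "Lloc lborel (G j)" for j unfolding G_def by (intro Lloc_rconv kL n)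
 have HL: "Lloc lborel (H j l)" for j l unfolding H_def by (intro lborel.Lloc_rconv kL yL)
 note [measurable] = LlocD(1)[OF GL] LlocD(1)[OF HL]
 have a: "AL t. y j t = G j t + (\<Sum>l\<in>UNIV. B j l * H j l t)" for j
  using eq[of j] lborel.AE_rconv_sum[OF kL[of j], of UNIV "%l s. B j l * y l s"] yL
  by (auto simp: G_def H_def Lloc_cmult lborel.rconv_cmult elim: eventually_elim2)
 have b: "AL t. \<forall>j. rconv (c i j) lborel (y j) t = rconv (c i j) lborel (G j) t + (\<Sum>l\<in>UNIV. B j l * rconv (c i j) lborel (H j l) t)"
  unfolding AE_all_countable
 proof
  fix j
  have 1: "rconv (c i j) lborel (y j) t = rconv (c i j) lborel (%t. G j t + (\<Sum>l\<in>UNIV. B j l * H j l t)) t" for t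
   by (rule lborel.rconv_cong_right[OF a]) measurable
  have 2: "AL t. rconv (c i j) lborel (%t. G j t + (\<Sum>l\<in>UNIV. B j l * H j l t)) t
    = rconv (c i j) lborel (G j) t + rconv (c i j) lborel (%t. \<Sum>l\<in>UNIV. B j l * H j l t) t"
   by (rule lborel.AE_rconv_add) (auto intro!: c GL Lloc_sum Lloc_cmult HL)
  have 3: "AL t. rconv (c i j) lborel (%t. \<Sum>l\<in>UNIV. B j l * H j l t) t = (\<Sum>l\<in>UNIV. rconv (c i j) lborel (%t. B j l * H j l t) t)"
   by (rule lborel.AE_rconv_sum) (auto intro!: c Lloc_cmult HL)
  show "AL t. rconv (c i j) lborel (y j) t = rconv (c i j) lborel (G j) t + (\<Sum>l\<in>UNIV. B j l * rconv (c i j) lborel (H j l) t)"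
   using 2 3 by eventually_elim (simp add: 1 lborel.rconv_cmult)
 qed
 have d: "AL t. \<forall>l. (\<Sum>j\<in>UNIV. B j l * rconv (c i j) lborel (H j l) t) = B i l * H i l t + rconv (c i l) lborel (y l) t"
  unfolding AE_all_countable
 proof
  fix l
  have kB: "(?F k j l) = (%s. - B j l * k j s)" for j by (auto simp: mult.commute)
  have 1: "AL t. rconv (%t. \<Sum>j\<in>UNIV. rconv (c i j) lborel (?F k j l) t) lborel (y l) t
    = rconv (%t. - (k i t * B i l) - c i l t) lborel (y l) t"
   by (rule lborel.AE_rconv_cong[OF res]) measurable
  have 2: "AL t. rconv (%t. - (k i t * B i l) - c i l t) lborel (y l) t = rconv (%t. - (k i t * B i l)) lborel (y l) t - rconv (c i l) lborel (y l) t"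
   by (rule lborel.AE_rconv_diff_left) (auto simp: kB intro!: c yL Lloc_cmult[where c="- B i l", simplified] kL)
  have 3: "AL t. rconv (%t. \<Sum>j\<in>UNIV. rconv (c i j) lborel (?F k j l) t) lborel (y l) t
    = (\<Sum>j\<in>UNIV. rconv (rconv (c i j) lborel (?F k j l)) lborel (y l) t)"
   by (rule lborel.AE_rconv_sum_left) (auto simp: kB intro!: yL lborel.Lloc_rconv c Lloc_cmult[where c="- B j l" for j, simplified] kL)
  have 4: "AL t. \<forall>j. rconv (c i j) lborel (H j l) t = rconv (rconv (c i j) lborel (k j)) lborel (y l) t"
   unfolding AE_all_countable H_def by (intro allI lborel.AE_rconv_assoc c kL yL)
  have 5: "rconv (rconv (c i j) lborel (?F k j l)) lborel (y l) t = - B j l * rconv (rconv (c i j) lborel (k j)) lborel (y l) t" for j t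
  proof -
   have "rconv (c i j) lborel (?F k j l) = (%t. - B j l * rconv (c i j) lborel (k j) t)"
    unfolding kB by (rule ext) (rule lborel.rconv_cmult)
   then show ?thesis by (simp only: lborel.rconv_cmult)
  qed
  have 6: "rconv (%t. - (k i t * B i l)) lborel (y l) t = - B i l * H i l t" for t
   unfolding kB H_def by (rule lborel.rconv_cmult)
  show "AL t. (\<Sum>j\<in>UNIV. B j l * rconv (c i j) lborel (H j l) t) = B i l * H i l t + rconv (c i l) lborel (y l) t"
   using 1 2 3 4
  proof eventually_elim
   case (elim t)
   have "(\<Sum>j\<in>UNIV. B j l * rconv (c i j) lborel (H j l) t) = - (\<Sum>j\<in>UNIV. - B j l * rconv (rconv (c i j) lborel (k j)) lborel (y l) t)"
    using elim by (simp add: sum_negf)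
   also have "(\<Sum>j\<in>UNIV. - B j l * rconv (rconv (c i j) lborel (k j)) lborel (y l) t) = - B i l * H i l t - rconv (c i l) lborel (y l) t"
    using elim by (simp only: 5 6)
   finally show ?case by simp
  qed
 qed
 have e: "AL t. \<forall>j. rconv (%t. (if i = j then k i t else 0) - rconv (c i j) lborel (k j) t) M (n j) t = (if i = j then G i t else 0) - rconv (c i j) lborel (G j) t"
  unfolding AE_all_countable
 proof
  fix j
  have "AL t. rconv (%t. (if i = j then k i t else 0) - rconv (c i j) lborel (k j) t) M (n j) t
   = rconv (%t. if i = j then k i t else 0) M (n j) t - rconv (rconv (c i j) lborel (k j)) M (n j) t"
   by (rule AE_rconv_diff_left) (cases "i = j"; auto intro!: lborel.Lloc_rconv c kL n Lloc_zero)+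
  moreover have "AL t. rconv (c i j) lborel (G j) t = rconv (rconv (c i j) lborel (k j)) M (n j) t"
   unfolding G_def by (intro AE_rconv_assoc c kL n)
  ultimately show "AL t. rconv (%t. (if i = j then k i t else 0) - rconv (c i j) lborel (k j) t) M (n j) t = (if i = j then G i t else 0) - rconv (c i j) lborel (G j) t"
   by eventually_elim (auto simp: G_def rconv_def)
 qed
 show "AL t. y i t = (\<Sum>j\<in>UNIV. rconv (%t. (if i = j then k i t else 0) - rconv (c i j) lborel (k j) t) M (n j) t)"
  using a[of i] b d e
 proof eventually_elim
  case (elim t)
  have "(\<Sum>j\<in>UNIV. rconv (c i j) lborel (y j) t) = (\<Sum>j\<in>UNIV. rconv (c i j) lborel (G j) t) + (\<Sum>j\<in>UNIV. \<Sum>l\<in>UNIV. B j l * rconv (c i j) lborel (H j l) t)"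
   using elim by (simp add: sum.distrib)
  also have "(\<Sum>j\<in>UNIV. \<Sum>l\<in>UNIV. B j l * rconv (c i j) lborel (H j l) t) = (\<Sum>l\<in>UNIV. B i l * H i l t) + (\<Sum>l\<in>UNIV. rconv (c i l) lborel (y l) t)"
   using elim by (subst sum.swap) (simp add: sum.distrib)
  finally have "(\<Sum>l\<in>UNIV. B i l * H i l t) = - (\<Sum>j\<in>UNIV. rconv (c i j) lborel (G j) t)" by simp
  then show ?case using elim by (simp add: sum_subtractf)
 qed
qed

text \<open>The Euclidean norm of the convolution is estimated through the operator norm of the matrix, not entrywise.\<close>
lemma (in borel_sigma_finite) norm_matrix_conv_le:
 fixes e :: "'m::finite => 'm => real => real" and n :: "'m => real => real"
 assumes e: "!!i j. Lloc lborel (e i j)" and n: "!!j. Lloc M (n j)"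
 shows "AL t. ennreal (norm (\<chi> i. \<Sum>j\<in>UNIV. rconv (e i j) M (n j) t))
   <= (\<integral>\<^sup>+s. ennreal (op_norm (\<chi> i j. e i j (t - s)) * norm (\<chi> j. n j s)) \<partial>M)"
proof -
 have "AL t. \<forall>i j. integrable M (%s. e i j (t - s) * n j s)"
  unfolding AE_all_countable by (intro allI AE_rconv_integrable e n)
 then show ?thesis
 proof eventually_elim
  case (elim t)
  define v where "v s = (\<chi> i j. e i j (t - s)) *v (\<chi> j. n j s)" for s
  have vi: "v s $ i = (\<Sum>j\<in>UNIV. e i j (t - s) * n j s)" for s i
   by (simp add: v_def matrix_vector_mult_def)
  have vint: "integrable M v"
   by (rule integrable_vec) (use elim in \<open>simp add: vi\<close>)
  have "(\<chi> i. \<Sum>j\<in>UNIV. rconv (e i j) M (n j) t) = (\<integral>s. v s \<partial>M)"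
   using elim by (simp add: vec_eq_iff integral_vec_nth[OF vint] vi rconv_def)
  then have "ennreal (norm (\<chi> i. \<Sum>j\<in>UNIV. rconv (e i j) M (n j) t)) <= (\<integral>\<^sup>+s. ennreal (norm (v s)) \<partial>M)"
   using integral_norm_bound_ennreal[OF vint] by simp
  also have "... <= (\<integral>\<^sup>+s. ennreal (op_norm (\<chi> i j. e i j (t - s)) * norm (\<chi> j. n j s)) \<partial>M)"
   unfolding v_def by (intro nn_integral_mono ennreal_leI op_norm_bound)
  finally show ?case .
 qed
qed

text \<open>In contrast to \<open>diag_kernel\<close>, the value at 0 is kept: \<open>conv\<close> integrates over the
closed interval. The two agree almost everywhere.\<close>
definition causal_entry :: "(real => real ^ 'n ^ 'm) => 'm => 'n => real => real" where
 "causal_entry f i j t = (if 0 <= t then f t $ i $ j else 0)"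

lemma causal_entry_simps: "0 <= t ==> causal_entry f i j t = f t $ i $ j" "t < 0 ==> causal_entry f i j t = 0"
 by (auto simp: causal_entry_def)

lemma AE_conv_matrix:
 fixes f g :: "real => real ^ 'm ^ 'm"
 assumes f: "!!i j. Lloc lborel (causal_entry f i j)" and g: "!!i j. Lloc lborel (causal_entry g i j)"
 shows "AL t. 0 <= t --> conv_exists (**) f g t \<and>
   (\<forall>i j. conv (**) f g t $ i $ j = (\<Sum>l\<in>UNIV. rconv (causal_entry f i l) lborel (causal_entry g l j) t))"
proof -
 have "AL t. \<forall>i j l. integrable lborel (%s. causal_entry f i l (t - s) * causal_entry g l j s)"
  unfolding AE_all_countable by (intro allI lborel.AE_rconv_integrable f g)
 then show ?thesis
 proof eventually_elim
  case (elim t)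
  show ?case
  proof
   assume t: "0 <= t"
   let ?h = "%s. indicator {0..t} s *\<^sub>R (f (t - s) ** g s)"
   have ent: "?h s $ i $ j = (\<Sum>l\<in>UNIV. causal_entry f i l (t - s) * causal_entry g l j s)" for s i j
    by (auto simp: causal_entry_def matrix_matrix_mult_def split: split_indicator)
   have int: "integrable lborel ?h"
    by (intro integrable_vec) (unfold ent, use elim in auto)
   have int2: "integrable lborel (%s. ?h s $ i)" for i
    by (intro integrable_vec) (unfold ent, use elim in auto)
   have "conv (**) f g t $ i $ j = (\<integral>s. ?h s $ i $ j \<partial>lborel)" for i j
    unfolding conv_def set_lebesgue_integral_def integral_vec_nth[OF int] integral_vec_nth[OF int2] ..
   also have "(\<integral>s. ?h s $ i $ j \<partial>lborel) = (\<Sum>l\<in>UNIV. rconv (causal_entry f i l) lborel (causal_entry g l j) t)" for i j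
    unfolding ent rconv_def using elim by (intro Bochner_Integration.integral_sum) auto
   finally show "conv_exists (**) f g t \<and>
    (\<forall>i j. conv (**) f g t $ i $ j = (\<Sum>l\<in>UNIV. rconv (causal_entry f i l) lborel (causal_entry g l j) t))"
    using int by (simp add: conv_exists_def set_integrable_def)
  qed
 qed
qed

lemma Lloc_causal_entry:
 fixes r :: "real => real ^ 'n ^ 'm"
 assumes r: "Lq_loc 1 r"
 shows "Lloc lborel (causal_entry r i j)"
 unfolding Lloc_def
proof (intro conjI allI impI)
 have [measurable]: "(%t. indicator {0..} t *\<^sub>R r t) \<in> borel_measurable borel"
  using r by (simp add: Lq_loc_def set_borel_measurable_def)
 have [measurable]: "(%x::real ^ 'n ^ 'm. x $ i $ j) \<in> borel_measurable borel"
  by (intro borel_measurable_continuous_onI continuous_intros)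
 have "causal_entry r i j = (%t. (indicator {0..} t *\<^sub>R r t) $ i $ j)"
  by (auto simp: causal_entry_def fun_eq_iff split: split_indicator)
 then show "causal_entry r i j \<in> borel_measurable borel" by (simp only:) measurable
 show "causal_entry r i j s = 0" if "s < 0" for s using that by (simp add: causal_entry_def)
 fix T :: real
 have "nnI lborel T (%s. \<bar>causal_entry r i j s\<bar>)
   <= (NN s. ennreal (norm (indicator {0..max 1 T} s *\<^sub>R (norm (r s) powr 1))))"
 proof (intro nn_integral_mono)
  fix s
  have "\<bar>r s $ i $ j\<bar> <= norm (r s)"
   by (rule order_trans[OF component_le_norm_cart Finite_Cartesian_Product.norm_nth_le])
  then show "ennreal \<bar>causal_entry r i j s\<bar> * indicator {0..T} s <= ennreal (norm (indicator {0..max 1 T} s *\<^sub>R (norm (r s) powr 1)))"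
   by (auto simp: causal_entry_def split: split_indicator intro!: ennreal_leI)
 qed
 also have "... < \<infinity>"
 proof -
  have "integrable lborel (%s. indicator {0..max 1 T} s *\<^sub>R (norm (r s) powr 1))"
   using r unfolding Lq_loc_def set_integrable_def by (auto simp: less_max_iff_disj)
  then show ?thesis by (simp add: integrable_iff_bounded)
 qed
 finally show "nnI lborel T (%s. \<bar>causal_entry r i j s\<bar>) < \<infinity>" .
qed

lemma Lq_loc_1_matrix:
 fixes r :: "'m::finite => 'n::finite => real => real"
 assumes r: "!!i j. Lloc lborel (r i j)"
 shows "Lq_loc 1 (%t. \<chi> i j. r i j t)"
proof -
 note [measurable] = LlocD(1)[OF r]
 have m[measurable]: "(%t. \<chi> i j. r i j t) \<in> borel_measurable borel"
  by (intro borel_measurable_vec_lambda) measurable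
 have "set_integrable lborel {0..T} (%t. norm (\<chi> i j. r i j t) powr 1)" for T
  unfolding set_integrable_def
 proof (rule integrableI_bounded)
  have "(NN t. ennreal (norm (indicator {0..T} t *\<^sub>R norm (\<chi> i j. r i j t) powr 1)))
   <= (NN t. (\<Sum>i\<in>UNIV. \<Sum>j\<in>UNIV. ennreal \<bar>r i j t\<bar> * indicator {0..T} t))"
  proof (intro nn_integral_mono)
   fix t
   have "norm (\<chi> i j. r i j t) = L2_set (%i. norm (\<chi> j. r i j t)) UNIV"
    by (subst norm_vec_def) simp
   also have "... <= (\<Sum>i\<in>UNIV. norm (\<chi> j. r i j t))"
    by (rule L2_set_le_sum) simp
   also have "... <= (\<Sum>i\<in>UNIV. \<Sum>j\<in>UNIV. \<bar>r i j t\<bar>)"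
    by (intro sum_mono order_trans[OF norm_le_l1_cart]) simp
   finally have "ennreal (norm (\<chi> i j. r i j t)) <= ennreal (\<Sum>i\<in>UNIV. \<Sum>j\<in>UNIV. \<bar>r i j t\<bar>)" by (rule ennreal_leI)
   also have "... = (\<Sum>i\<in>UNIV. \<Sum>j\<in>UNIV. ennreal \<bar>r i j t\<bar>)" by (simp add: sum_nonneg flip: sum_ennreal)
   finally show "ennreal (norm (indicator {0..T} t *\<^sub>R norm (\<chi> i j. r i j t) powr 1)) <= (\<Sum>i\<in>UNIV. \<Sum>j\<in>UNIV. ennreal \<bar>r i j t\<bar> * indicator {0..T} t)"
    by (auto split: split_indicator)
  qed
  also have "... = (\<Sum>i\<in>UNIV. \<Sum>j\<in>UNIV. nnI lborel T (%t. \<bar>r i j t\<bar>))"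
   by (subst nn_integral_sum, measurable) (intro sum.cong refl nn_integral_sum, measurable)
  also have "... < \<infinity>" using LlocD(3)[OF r] by simp
  finally show "(NN t. ennreal (norm (indicator {0..T} t *\<^sub>R norm (\<chi> i j. r i j t) powr 1))) < \<infinity>" .
 qed measurable
 then show ?thesis using m by (simp add: Lq_loc_def set_borel_measurable_def)
qed

lemma admissible_off_diag: "admissible b \<beta> \<sigma> K ==> 0 <= t ==> i ~= j ==> K t $ i $ j = 0"
 by (auto simp: admissible_def)

lemma AE_causal_entry_kernel:
 assumes "admissible b \<beta> \<sigma> K"
 shows "AL t. causal_entry K i j t = (if i = j then diag_kernel K i t else 0)"
 using AE_lborel_singleton[of 0]
 by eventually_elim (use assms in \<open>auto simp: causal_entry_def diag_kernel_def admissible_off_diag\<close>)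

lemma Lloc_causal_kernel:
 assumes adm: "admissible b \<beta> \<sigma> K"
 shows "Lloc lborel (causal_entry K i j)"
proof (cases "i = j")
 case True
 have "L2loc (%t. if t \<in> {0..} then K t $ i $ i else 0)"
  using adm by (intro L2loc_causal) (auto simp: admissible_def)
 moreover have "causal_entry K i j = (%t. if t \<in> {0..} then K t $ i $ i else 0)"
  using True by (auto simp: causal_entry_def fun_eq_iff)
 ultimately show ?thesis by (simp add: Lloc_L2loc)
next
 case False
 then have "causal_entry K i j = (%t. 0)"
  using admissible_off_diag[OF adm] by (auto simp: causal_entry_def fun_eq_iff)
 then show ?thesis by (simp add: Lloc_zero)
qed

lemma causal_kernel_times:
 assumes adm: "admissible b \<beta> \<sigma> K"
 shows "causal_entry (kernel_times K B) i j = (%t. - B $ i $ j * causal_entry K i i t)"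
proof
 fix t
 have "(\<Sum>l\<in>UNIV. K t $ i $ l * B $ l $ j) = K t $ i $ i * B $ i $ j" if "0 <= t"
 proof -
  have "(\<Sum>l\<in>UNIV. K t $ i $ l * B $ l $ j) = (\<Sum>l\<in>UNIV. if l = i then K t $ i $ i * B $ i $ j else 0)"
   using admissible_off_diag[OF adm that] by (intro sum.cong) auto
  then show ?thesis by simp
 qed
 then show "causal_entry (kernel_times K B) i j t = - B $ i $ j * causal_entry K i i t"
  by (auto simp: causal_entry_def kernel_times_def matrix_matrix_mult_def mult.commute)
qed

lemma AE_causal_kernel_times:
 assumes adm: "admissible b \<beta> \<sigma> K"
 shows "AL t. causal_entry (kernel_times K B) i j t = - (diag_kernel K i t * B $ i $ j)"
 using AE_causal_entry_kernel[OF adm, of i i]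
 by eventually_elim (simp add: causal_kernel_times[OF adm] mult.commute)

text \<open>The choice in the definition of \<open>resolvent_R\<close> is meaningful because the matrix resolvent
exists.\<close>
lemma resolvent_R_is_resolvent:
 assumes adm: "admissible b \<beta> \<sigma> K"
 shows "is_resolvent (kernel_times K B) (resolvent_R K B)"
proof -
 let ?F = "kernel_times K B"
 let ?k = "diag_kernel K"
 have k: "L2loc (?k i)" for i by (rule L2loc_diag_kernel[OF adm])
 note [measurable] = L2locD(1)[OF k]
 obtain r where r: "!!i j. L2loc (r i j)"
  "!!i j. AL t. (\<Sum>l\<in>UNIV. rconv (%s. - (?k i s * B $ i $ l)) lborel (r l j) t) = - (?k i t * B $ i $ j) - r i j t"
  "!!i j. AL t. (\<Sum>l\<in>UNIV. rconv (r i l) lborel (%s. - (?k l s * B $ l $ j)) t) = - (?k i t * B $ i $ j) - r i j t"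
  using matrix_resolvent_exists[of ?k "%i j. B $ i $ j"] k by blast
 define R where "R t = (\<chi> i j. r i j t)" for t
 have ceR: "causal_entry R i j = r i j" for i j
  using L2locD(2)[OF r(1)] by (auto simp: causal_entry_def R_def fun_eq_iff)
 have RL: "Lloc lborel (causal_entry R i j)" for i j unfolding ceR by (intro Lloc_L2loc r)
 have kL: "Lloc lborel (causal_entry ?F i j)" for i j
  unfolding causal_kernel_times[OF adm] by (intro Lloc_cmult Lloc_causal_kernel[OF adm]) simp
 note [measurable] = LlocD(1)[OF kL] L2locD(1)[OF r(1)]
 have 1: "AL t. \<forall>i j. (\<Sum>l\<in>UNIV. rconv (causal_entry ?F i l) lborel (r l j) t) = - (?k i t * B $ i $ j) - r i j t"
  unfolding AE_all_countable
 proof (intro allI)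
  fix i j
  have "AL t. \<forall>l. rconv (causal_entry ?F i l) lborel (r l j) t = rconv (%s. - (?k i s * B $ i $ l)) lborel (r l j) t"
   unfolding AE_all_countable by (intro allI lborel.AE_rconv_cong AE_causal_kernel_times[OF adm]) measurable
  then show "AL t. (\<Sum>l\<in>UNIV. rconv (causal_entry ?F i l) lborel (r l j) t) = - (?k i t * B $ i $ j) - r i j t"
   using r(2)[of i j] by eventually_elim simp
 qed
 have 2: "AL t. \<forall>i j. (\<Sum>l\<in>UNIV. rconv (r i l) lborel (causal_entry ?F l j) t) = - (?k i t * B $ i $ j) - r i j t"
  unfolding AE_all_countable
 proof (intro allI)
  fix i j
  have "rconv (r i l) lborel (causal_entry ?F l j) t = rconv (r i l) lborel (%s. - (?k l s * B $ l $ j)) t" for l t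
   by (rule lborel.rconv_cong_right[OF AE_causal_kernel_times[OF adm]]) measurable
  then show "AL t. (\<Sum>l\<in>UNIV. rconv (r i l) lborel (causal_entry ?F l j) t) = - (?k i t * B $ i $ j) - r i j t"
   using r(3)[of i j] by simp
 qed
 have 3: "AL t. \<forall>i j. causal_entry ?F i j t = - (?k i t * B $ i $ j)"
  unfolding AE_all_countable by (intro allI AE_causal_kernel_times[OF adm])
 have "is_resolvent ?F R"
  unfolding is_resolvent_def
 proof
  show "Lq_loc 1 R" unfolding R_def[abs_def] by (intro Lq_loc_1_matrix Lloc_L2loc r)
  show "AL t. 0 <= t --> conv_exists (**) R ?F t & conv_exists (**) ?F R t \<and>
    conv (**) R ?F t = kernel_times K B t - R t & conv (**) ?F R t = kernel_times K B t - R t"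
   using AE_conv_matrix[OF RL kL] AE_conv_matrix[OF kL RL] 1 2 3
  proof eventually_elim
   case (elim t)
   show ?case
   proof (intro impI)
    assume t: "0 <= t"
    have "kernel_times K B t $ i $ j = - (?k i t * B $ i $ j)" for i j
     using elim(5) t by (simp add: causal_entry_simps)
    then show "conv_exists (**) R ?F t & conv_exists (**) ?F R t \<and>
     conv (**) R ?F t = kernel_times K B t - R t & conv (**) ?F R t = kernel_times K B t - R t"
     using elim t unfolding ceR by (simp add: vec_eq_iff R_def)
   qed
  qed
 qed
 then show ?thesis unfolding resolvent_R_def by (rule someI[where P="is_resolvent ?F"])
qed

definition E_entry :: "(real => real ^ 'm ^ 'm) => real ^ 'm ^ 'm => 'm => 'm => real => real" where
 "E_entry K B i j t = (if i = j then diag_kernel K i t else 0)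
   - rconv (causal_entry (resolvent_R K B) i j) lborel (diag_kernel K j) t"

lemma resolvent_R_entries:
 assumes adm: "admissible b \<beta> \<sigma> K"
 shows "Lloc lborel (causal_entry (resolvent_R K B) i j)"
  "AL t. (\<Sum>l\<in>UNIV. rconv (causal_entry (resolvent_R K B) i l) lborel (%s. - (diag_kernel K l s * B $ l $ j)) t)
    = - (diag_kernel K i t * B $ i $ j) - causal_entry (resolvent_R K B) i j t"
proof -
 let ?F = "kernel_times K B"
 let ?k = "diag_kernel K" and ?r = "causal_entry (resolvent_R K B)"
 have k: "L2loc (?k i)" for i by (rule L2loc_diag_kernel[OF adm])
 have res: "is_resolvent ?F (resolvent_R K B)" by (rule resolvent_R_is_resolvent[OF adm])
 have rL: "Lloc lborel (?r i j)" for i j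
  using res by (intro Lloc_causal_entry) (simp add: is_resolvent_def)
 then show "Lloc lborel (?r i j)" .
 have kL: "Lloc lborel (causal_entry ?F i j)" for i j
  unfolding causal_kernel_times[OF adm] by (intro Lloc_cmult Lloc_causal_kernel[OF adm]) simp
 note [measurable] = L2locD(1)[OF k] LlocD(1)[OF rL] LlocD(1)[OF kL]
 have eq: "rconv (?r i l) lborel (causal_entry ?F l j) t = rconv (?r i l) lborel (%s. - (?k l s * B $ l $ j)) t" for l t
  by (rule lborel.rconv_cong_right[OF AE_causal_kernel_times[OF adm]]) measurable
 have res2: "AL t. 0 <= t --> conv (**) (resolvent_R K B) ?F t = kernel_times K B t - resolvent_R K B t"
  using res by (auto simp: is_resolvent_def elim: eventually_mono)
 show "AL t. (\<Sum>l\<in>UNIV. rconv (?r i l) lborel (%s. - (?k l s * B $ l $ j)) t) = - (?k i t * B $ i $ j) - ?r i j t"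
  using AE_conv_matrix[OF rL kL] res2 AE_causal_kernel_times[OF adm, of B i j]
 proof eventually_elim
  case (elim t)
  show ?case
  proof (cases "0 <= t")
   case True
   then have "(\<Sum>l\<in>UNIV. rconv (?r i l) lborel (causal_entry ?F l j) t) = kernel_times K B t $ i $ j - resolvent_R K B t $ i $ j"
   proof -
    have "conv (**) (resolvent_R K B) ?F t $ i $ j = kernel_times K B t $ i $ j - resolvent_R K B t $ i $ j"
     using elim(2) True by simp
    moreover have "conv (**) (resolvent_R K B) ?F t $ i $ j = (\<Sum>l\<in>UNIV. rconv (?r i l) lborel (causal_entry ?F l j) t)"
     using elim(1) True by simp
    ultimately show ?thesis by simp
   qed
   then show ?thesis using elim True by (simp add: eq causal_entry_simps)
  next
   case False
   have "rconv (?r i l) lborel (%s. - (?k l s * B $ l $ j)) t = 0" for l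
    using False LlocD(2)[OF rL] L2locD(2)[OF k] by (intro lborel.rconv_negative) auto
   then show ?thesis using False L2locD(2)[OF k] by (simp add: causal_entry_simps)
  qed
 qed
qed

lemma Lloc_E_entry:
 assumes adm: "admissible b \<beta> \<sigma> K"
 shows "Lloc lborel (E_entry K B i j)"
 unfolding E_entry_def[abs_def]
 by (intro Lloc_diff lborel.Lloc_rconv resolvent_R_entries[OF adm] Lloc_L2loc L2loc_diag_kernel[OF adm])
  (cases "i = j"; auto intro: L2loc_zero Lloc_L2loc L2loc_diag_kernel[OF adm])+

text \<open>The pointwise defined \<open>resolvent_E\<close> has the entries that appear in the variation of constants
formula.\<close>
lemma AE_resolvent_E:
 assumes adm: "admissible b \<beta> \<sigma> K"
 shows "AL t. 0 <= t --> resolvent_E K B t = (\<chi> i j. E_entry K B i j t)"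
proof -
 let ?k = "diag_kernel K" and ?r = "causal_entry (resolvent_R K B)"
 have k: "L2loc (?k i)" for i by (rule L2loc_diag_kernel[OF adm])
 note rL = resolvent_R_entries(1)[OF adm, of B]
 note KL = Lloc_causal_kernel[OF adm]
 note [measurable] = L2locD(1)[OF k] LlocD(1)[OF rL] LlocD(1)[OF KL]
 have eq: "rconv (?r i l) lborel (causal_entry K l j) t = rconv (?r i l) lborel (%s. if l = j then ?k l s else 0) t" for i j l t
  by (rule lborel.rconv_cong_right[OF AE_causal_entry_kernel[OF adm]]) measurable
 have sum: "(\<Sum>l\<in>UNIV. rconv (?r i l) lborel (causal_entry K l j) t) = rconv (?r i j) lborel (?k j) t" for i j t
 proof -
  have "(\<Sum>l\<in>UNIV. rconv (?r i l) lborel (causal_entry K l j) t) = (\<Sum>l\<in>UNIV. if l = j then rconv (?r i j) lborel (?k j) t else 0)"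
   unfolding eq by (intro sum.cong) (auto simp: rconv_def)
  then show ?thesis by simp
 qed
 have all: "AL t. \<forall>i j. causal_entry K i j t = (if i = j then ?k i t else 0)"
  unfolding AE_all_countable by (intro allI AE_causal_entry_kernel[OF adm])
 show ?thesis
  using AE_conv_matrix[OF rL KL] all
 proof eventually_elim
  case (elim t)
  show ?case
  proof
   assume t: "0 <= t"
   then have "K t $ i $ j = (if i = j then ?k i t else 0)" for i j
    using elim(2)[rule_format, of i j] t by (simp add: causal_entry_simps)
   then show "resolvent_E K B t = (\<chi> i j. E_entry K B i j t)"
    using elim(1) t unfolding sum by (simp add: vec_eq_iff resolvent_E_def E_entry_def)
  qed
 qed
qed

section \<open>Convolutions of the Riccati equation in real form\<close>

context measure_densities begin

text \<open>An identity at every \<open>t\<close>, not just almost everywhere: continuity of \<open>\<psi>\<close> at a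
point needs it.\<close>
lemma conv_measure_real_form:
 assumes adm: "admissible b \<beta> \<sigma> K"
 shows "conv_measure K \<mu> t $ i = Complex (- rconv (diag_kernel K i) M (\<rho> i) t)
   (rconv (diag_kernel K i) M (\<pi> i) t - rconv (diag_kernel K i) M (\<upsilon> i) t)"
proof -
 let ?k = "diag_kernel K"
 note [measurable] = L2locD(1)[OF L2loc_diag_kernel[OF adm]]
 have ker: "K (t - s) $ i $ j = (if i = j then ?k i (t - s) else 0)" if "s \<in> {0..<t}" for s j
  using that admissible_off_diag[OF adm, of "t - s" i j] by (auto simp: diag_kernel_def)
 have sc: "signed_integral \<nu> {0..<t} (%s. K (t - s) $ i $ j) = signed_integral \<nu> {0..<t} (%s. if i = j then ?k i (t - s) else 0)" for \<nu> j
  by (rule signed_integral_cong(1)) (rule ker)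
 have to: "(\<integral>s. indicator {0..<t} s * ?k i (t - s) * n s \<partial>M) = rconv (?k i) M n t" if "Lloc M n" for n
  unfolding rconv_def using LlocD(2)[OF that]
  by (intro Bochner_Integration.integral_cong refl) (auto simp: diag_kernel_def split: split_indicator)
 have ci: "complex_integral (%A. \<mu> A $ j) {0..<t} (%s. K (t - s) $ i $ j)
   = (if i = j then Complex (- rconv (?k i) M (\<rho> i) t) (rconv (?k i) M (\<pi> i) t - rconv (?k i) M (\<upsilon> i) t) else 0)" for j
 proof (cases "i = j")
  case True
  show ?thesis
   unfolding complex_integral_def sc
   using True to[OF Lloc_densities(1)[of i]] to[OF Lloc_densities(2)[of i]] to[OF Lloc_densities(3)[of i]]
   by (simp add: signed_integral_Re(1) signed_integral_Im(1))
 next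
  case False
  show ?thesis
   unfolding complex_integral_def sc using False
   by (simp add: signed_integral_Re(1) signed_integral_Im(1) complex_eq_iff)
 qed
 show ?thesis by (simp add: conv_measure_def ci)
qed

lemma conv_measure_exists_AE:
 assumes adm: "admissible b \<beta> \<sigma> K"
 shows "AL t. conv_measure_exists K \<mu> t"
proof -
 let ?k = "diag_kernel K"
 note kL = Lloc_L2loc[OF L2loc_diag_kernel[OF adm]]
 note [measurable] = LlocD(1)[OF kL]
 have "AL t. \<forall>i. integrable M (%s. ?k i (t - s) * \<rho> i s) & integrable M (%s. ?k i (t - s) * \<pi> i s) & integrable M (%s. ?k i (t - s) * \<upsilon> i s)"
  unfolding AE_all_countable by (intro allI AE_conjI AE_rconv_integrable kL Lloc_densities)
 then show ?thesis
 proof eventually_elim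
  case (elim t)
  have ker: "K (t - s) $ i $ j = (if i = j then ?k i (t - s) else 0)" if "s \<in> {0..<t}" for s i j
   using that admissible_off_diag[OF adm, of "t - s" i j] by (auto simp: diag_kernel_def)
  have sc: "signed_integrable \<nu> {0..<t} (%s. K (t - s) $ i $ j) = signed_integrable \<nu> {0..<t} (%s. if i = j then ?k i (t - s) else 0)" for \<nu> i j
   by (rule signed_integral_cong(2)) (rule ker)
  have to: "(%s. indicator {0..<t} s * ?k i (t - s) * n s) = (%s. ?k i (t - s) * n s)" if "Lloc M n" for n i
   using LlocD(2)[OF that] by (auto simp: fun_eq_iff diag_kernel_def split: split_indicator)
  have "complex_integrable (%A. \<mu> A $ j) {0..<t} (%s. K (t - s) $ i $ j)" for i j
   unfolding complex_integrable_def sc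
   using elim by (cases "i = j") (auto intro!: signed_integral_Re(2) signed_integral_Im(2) simp: to Lloc_densities)
  then show ?case by (simp add: conv_measure_exists_def)
 qed
qed

end

lemma conv_cmat_vec_eq:
 assumes adm: "admissible b \<beta> \<sigma> K"
 shows "conv cmat_vec K h t = (\<integral>s. (\<chi> i. complex_of_real (causal_entry K i i (t - s)) * (indicator {0..} s *\<^sub>R h s $ i)) \<partial>lborel)"
  "conv_exists cmat_vec K h t \<longleftrightarrow> integrable lborel (%s. \<chi> i. complex_of_real (causal_entry K i i (t - s)) * (indicator {0..} s *\<^sub>R h s $ i))"
proof -
 let ?F = "%s. \<chi> i. complex_of_real (causal_entry K i i (t - s)) * (indicator {0..} s *\<^sub>R h s $ i)"
 have "indicator {0..t} s *\<^sub>R cmat_vec (K (t - s)) (h s) = (?F s)" for s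
 proof (cases "0 <= s & s <= t")
  case True
  have "(\<Sum>j\<in>UNIV. complex_of_real (K (t - s) $ i $ j) * h s $ j) = (\<Sum>j\<in>UNIV. if j = i then complex_of_real (K (t - s) $ i $ i) * h s $ i else 0)" for i
   using True admissible_off_diag[OF adm, of "t - s" i] by (intro sum.cong) auto
  then show ?thesis using True
   by (simp add: vec_eq_iff cmat_vec_def matrix_vector_mult_def map_matrix_def causal_entry_simps)
 next
  case False
  then show ?thesis by (auto simp: vec_eq_iff causal_entry_def split: split_indicator)
 qed
 then show "conv cmat_vec K h t = (\<integral>s. (?F s) \<partial>lborel)"
  "conv_exists cmat_vec K h t \<longleftrightarrow> integrable lborel (%s. \<chi> i. complex_of_real (causal_entry K i i (t - s)) * (indicator {0..} s *\<^sub>R h s $ i))"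
  by (simp_all add: conv_def conv_exists_def set_lebesgue_integral_def set_integrable_def)
qed

lemma conv_cmat_vec_at:
 fixes h :: "real => complex ^ 'm"
 assumes adm: "admissible b \<beta> \<sigma> K"
  and a: "!!i. a i \<in> borel_measurable borel" "!!i s. 0 <= s ==> a i s = Re (h s $ i)" "!!i s. s < 0 ==> a i s = 0"
  and c: "!!i. c i \<in> borel_measurable borel" "!!i s. 0 <= s ==> c i s = Im (h s $ i)" "!!i s. s < 0 ==> c i s = 0"
  and int: "!!i. integrable lborel (%s. diag_kernel K i (t - s) * a i s)" "!!i. integrable lborel (%s. diag_kernel K i (t - s) * c i s)"
 shows "conv_exists cmat_vec K h t"
  "conv cmat_vec K h t $ i = Complex (rconv (diag_kernel K i) lborel (a i) t) (rconv (diag_kernel K i) lborel (c i) t)"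
proof -
 let ?F = "%i s. causal_entry K i i (t - s) * c i s"
 let ?k = "diag_kernel K"
 have KL: "Lloc lborel (causal_entry K i i)" for i by (rule Lloc_causal_kernel[OF adm])
 note [measurable] = a(1) c(1) LlocD(1)[OF KL] L2locD(1)[OF L2loc_diag_kernel[OF adm]]
 let ?H = "%s. \<chi> i. complex_of_real (causal_entry K i i (t - s)) * (indicator {0..} s *\<^sub>R h s $ i)"
 have comp: "?H s $ i = complex_of_real (causal_entry K i i (t - s) * a i s) + \<i> * complex_of_real (?F i s)" for s i
  using a(2,3)[of s i] c(2,3)[of s i] by (cases "0 <= s") (auto simp: complex_eq_iff)
 have ae: "AL s. causal_entry K i i (t - s) = ?k i (t - s)" for i
  using AE_lborel_singleton[of t] by eventually_elim (auto simp: causal_entry_def diag_kernel_def)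
 have i1: "integrable lborel (%s. causal_entry K i i (t - s) * a i s)" for i
  by (rule integrable_cong_AE_imp[OF int(1)[of i]], measurable) (use ae[of i] in eventually_elim, simp)
 have i2: "integrable lborel (%s. ?F i s)" for i
  by (rule integrable_cong_AE_imp[OF int(2)[of i]], measurable) (use ae[of i] in eventually_elim, simp)
 have e1: "(\<integral>s. causal_entry K i i (t - s) * a i s \<partial>lborel) = rconv (?k i) lborel (a i) t"
  unfolding rconv_def by (rule integral_cong_AE, measurable, measurable) (use ae[of i] in eventually_elim, simp)
 have e2: "(\<integral>s. ?F i s \<partial>lborel) = rconv (?k i) lborel (c i) t"
  unfolding rconv_def by (rule integral_cong_AE, measurable, measurable) (use ae[of i] in eventually_elim, simp)
 have int: "integrable lborel ?H"
  by (rule integrable_vec) (unfold comp, intro Bochner_Integration.integrable_add integrable_mult_right integrable_of_real i1 i2)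
 then show "conv_exists cmat_vec K h t" unfolding conv_cmat_vec_eq(2)[OF adm] .
 have "conv cmat_vec K h t $ i = (\<integral>s. ?H s $ i \<partial>lborel)"
  unfolding conv_cmat_vec_eq(1)[OF adm] by (rule integral_vec_nth[OF int])
 also have "... = (\<integral>s. complex_of_real (causal_entry K i i (t - s) * a i s) \<partial>lborel) + (\<integral>s. \<i> * complex_of_real (?F i s) \<partial>lborel)"
  unfolding comp by (intro Bochner_Integration.integral_add integrable_mult_right integrable_of_real i1 i2)
 also have "... = complex_of_real (rconv (?k i) lborel (a i) t) + \<i> * complex_of_real (rconv (?k i) lborel (c i) t)"
  by (subst integral_mult_right_zero, subst (1 2) integral_complex_of_real) (simp add: e1 e2)
 finally show "conv cmat_vec K h t $ i = Complex (rconv (?k i) lborel (a i) t) (rconv (?k i) lborel (c i) t)"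
  by (simp add: complex_eq_iff)
qed

section \<open>The Riccati equation in real form\<close>

text \<open>The data of the theorem together with a choice of densities. Names: \<open>q i\<close> is the quadratic
coefficient, \<open>lin x i\<close> is the linear part of \<open>R_i\<close>, and \<open>solves i v n g\<close>
abbreviates \<open>v = k_i * (n M) + k_i * g\<close>.\<close>
locale riccati_setting = measure_densities M \<mu> \<rho> \<pi> \<upsilon> d0
 for M and \<mu> :: "real set => complex ^ 'm" and \<rho> \<pi> \<upsilon> d0 +
 fixes b \<sigma> :: "real ^ 'm" and \<beta> :: "real ^ 'm ^ 'm" and K :: "real => real ^ 'm ^ 'm"
 assumes adm: "admissible b \<beta> \<sigma> K"
begin

abbreviation k :: "'m => real => real" where "k \<equiv> diag_kernel K"

definition q :: "'m => real" where "q i = (\<sigma> $ i)\<^sup>2 / 2"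

definition lin :: "('m => real => real) => 'm => real => real" where
 "lin x i s = (\<Sum>l\<in>UNIV. \<beta> $ l $ i * x l s)"

definition solves :: "'m => (real => real) => (real => real) => (real => real) => bool" where
 "solves i v n g \<longleftrightarrow> (AL t. v t = rconv (k i) M n t + rconv (k i) lborel g t)"

definition bnd :: real where "bnd = (\<Sum>i\<in>UNIV. \<Sum>l\<in>UNIV. \<bar>\<beta> $ l $ i\<bar>)"

lemma q_nonneg: "0 <= q i" by (simp add: q_def)

lemma beta_bnd: "\<bar>\<beta> $ l $ i\<bar> <= bnd"
proof -
 have "\<bar>\<beta> $ l $ i\<bar> <= (\<Sum>l\<in>UNIV. \<bar>\<beta> $ l $ i\<bar>)" by (rule member_le_sum) auto
 also have "... <= bnd" unfolding bnd_def by (rule member_le_sum[of i]) (auto intro: sum_nonneg)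
 finally show ?thesis .
qed

lemma bnd_nonneg: "0 <= bnd"
 using beta_bnd[of undefined undefined] by linarith

lemma sum_beta_bnd: "\<bar>\<Sum>l\<in>UNIV. \<beta> $ l $ i * x l\<bar> <= bnd * (\<Sum>l\<in>UNIV. \<bar>x l\<bar>)"
proof -
 have "\<bar>\<Sum>l\<in>UNIV. \<beta> $ l $ i * x l\<bar> <= (\<Sum>l\<in>UNIV. \<bar>\<beta> $ l $ i * x l\<bar>)" by (rule sum_abs)
 also have "... <= (\<Sum>l\<in>UNIV. bnd * \<bar>x l\<bar>)" by (intro sum_mono) (auto simp: abs_mult intro!: mult_right_mono beta_bnd)
 finally show ?thesis by (simp add: sum_distrib_left)
qed

lemma k_L2loc: "L2loc (k i)" by (rule L2loc_diag_kernel[OF adm])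
lemma k_Lloc: "Lloc lborel (k i)" by (rule Lloc_L2loc[OF k_L2loc])
lemma k_measurable [measurable]: "k i \<in> borel_measurable borel" by (rule L2locD(1)[OF k_L2loc])

lemma Lloc_lin: "(!!l. L2loc (x l)) ==> Lloc lborel (lin x i)"
 unfolding lin_def[abs_def] by (intro Lloc_sum Lloc_cmult Lloc_L2loc) auto

lemma solves_add:
 assumes "solves i v n g" "solves i v' n' g'" "Lloc M n" "Lloc M n'" "Lloc lborel g" "Lloc lborel g'"
 shows "solves i (%t. v t + v' t) (%t. n t + n' t) (%t. g t + g' t)"
 using assms(1,2) AE_rconv_add[OF k_Lloc assms(3,4), of i] lborel.AE_rconv_add[OF k_Lloc assms(5,6), of i]
 unfolding solves_def by eventually_elim simp

lemma solves_uminus: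
 assumes "solves i v n g"
 shows "solves i (%t. - v t) (%t. - n t) (%t. - g t)"
 using assms unfolding solves_def by eventually_elim (simp add: rconv_def)

lemma solves_cong:
 assumes "solves i v n g" "!!t. v t = v' t" "!!t. n t = n' t" "!!t. g t = g' t"
 shows "solves i v' n' g'"
proof -
 have "v = v'" "n = n'" "g = g'" using assms(2-4) by auto
 then show ?thesis using assms(1) by simp
qed

text \<open>The comparison principle for the linear part of the Riccati equation. The off-diagonal entries of
\<open>\<beta>\<close> are nonnegative, so positive components \<open>v_l\<close> only increase \<open>lin v i\<close>,
and negative ones are controlled by \<open>bnd\<close>.\<close>
lemma solves_nonneg:
 assumes v: "!!i. L2loc (v i)" and n: "!!i. Lloc M (n i)" "!!i s. 0 <= n i s" and e: "!!i. Lloc lborel (e i)"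
  and eq: "!!i. solves i (v i) (n i) (%s. lin v i s + e i s)"
  and low: "!!i. AL s. v i s <= 0 --> 0 <= e i s"
 shows "AL t. \<forall>i. 0 <= v i t"
proof (rule Volterra_comparison[where k=k and g="%i s. lin v i s + e i s" and n=n and l="%s. bnd * indicator {0..} s"])
 let ?F = "%s. \<Sum>j\<in>UNIV. neg (v j s)"
 show "positive_kernel (k i)" for i by (rule positive_kernel_diag[OF adm])
 show "Lloc lborel (%s. lin v i s + e i s)" for i by (intro Lloc_add Lloc_lin v e) simp
 show "AL t. v i t = rconv (k i) M (n i) t + rconv (k i) lborel (%s. lin v i s + e i s) t" for i
  using eq[of i] by (simp add: solves_def)
 show "L2loc (%s. bnd * indicator {0..} s)" by (intro L2loc_cmult L2loc_one)
 show "AL s. v i s <= 0 --> - (bnd * indicator {0..} s * (?F s)) <= lin v i s + e i s" for i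
  using low[of i]
 proof eventually_elim
  case (elim s)
  show ?case
  proof
   assume vi: "v i s <= 0"
   have "- (bnd * (?F s)) <= lin v i s"
    unfolding lin_def sum_distrib_left sum_negf[symmetric]
   proof (rule sum_mono)
    fix l
    show "- (bnd * neg (v l s)) <= \<beta> $ l $ i * v l s"
    proof (cases "v l s <= 0")
     case True
     have "\<beta> $ l $ i * (- v l s) <= bnd * (- v l s)"
      using beta_bnd[of l i] True by (intro mult_right_mono) auto
     then show ?thesis using True by (simp add: max_def)
    next
     case False
     then have "l ~= i" using vi by auto
     then have "0 <= \<beta> $ l $ i" using adm by (simp add: admissible_def)
     then have "0 <= \<beta> $ l $ i * v l s" using False by simp
     then show ?thesis using False by (simp add: max_def)
    qed
   qed
   moreover have "bnd * indicator {0..} s * (?F s) = bnd * (?F s)"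
    using L2locD(2)[OF v] by (cases "s < 0") auto
   ultimately show "- (bnd * indicator {0..} s * (?F s)) <= lin v i s + e i s"
    using elim vi by linarith
  qed
 qed
 show "0 <= bnd * indicator {0..} s" for s using bnd_nonneg by (simp split: split_indicator)
qed (use v n in auto)

lemma linear_solution_exists:
 assumes n: "!!i. Lloc M (n i)" and e: "!!i. Lloc lborel (e i)"
 shows "\<exists>y. (\<forall>i. L2loc (y i)) & (\<forall>i. solves i (y i) (n i) (%s. lin y i s + e i s))"
proof -
 let ?f = "%s x i. indicator {0..} s * (\<Sum>l\<in>UNIV. \<beta> $ l $ i * x l)"
 let ?F = "%i t. rconv (k i) M (n i) t + rconv (k i) lborel (e i) t"
 have "\<exists>x. (\<forall>i. L2loc (x i)) & (\<forall>i. AL t. x i t = ?F i t + rconv (k i) lborel (%s. ?f s (%j. x j s) i) t)"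
 proof (rule Volterra_existence[where l="%s. bnd * indicator {0..} s"])
  show "L2loc (?F i)" for i by (intro L2loc_add L2loc_rconv lborel.L2loc_rconv k_L2loc n e)
  show "L2loc (%s. bnd * indicator {0..} s)" by (intro L2loc_cmult L2loc_one)
  show "\<bar>?f s x i - ?f s y i\<bar> <= bnd * indicator {0..} s * (\<Sum>j\<in>UNIV. \<bar>x j - y j\<bar>)" for s x y i
   using sum_beta_bnd[of i "%j. x j - y j"] by (auto split: split_indicator simp: right_diff_distrib sum_subtractf)
 qed (auto intro: k_L2loc)
 then obtain x where x: "!!i. L2loc (x i)" "!!i. AL t. x i t = ?F i t + rconv (k i) lborel (%s. ?f s (%j. x j s) i) t"
  by blast
 have "solves i (x i) (n i) (%s. lin x i s + e i s)" for i
 proof -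
  have "(%s. ?f s (%j. x j s) i) = lin x i"
   using L2locD(2)[OF x(1)] by (auto simp: fun_eq_iff lin_def split: split_indicator)
  then show ?thesis
   using x(2)[of i] lborel.AE_rconv_add[OF k_Lloc[of i] Lloc_lin[where x=x and i=i, OF x(1)] e[of i]]
   unfolding solves_def by (auto elim: eventually_elim2)
 qed
 then show ?thesis using x(1) by blast
qed

abbreviation g_re :: "('m => real => real) => ('m => real => real) => 'm => real => real" where
 "g_re a c i s \<equiv> lin a i s + q i * ((a i s)\<^sup>2 - (c i s)\<^sup>2)"

abbreviation g_im :: "('m => real => real) => ('m => real => real) => 'm => real => real" where
 "g_im a c i s \<equiv> lin c i s + 2 * q i * (a i s * c i s)"

lemma Lloc_g:
 assumes "!!i. L2loc (a i)" "!!i. L2loc (c i)"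
 shows "Lloc lborel (g_re a c i)" "Lloc lborel (g_im a c i)"
proof -
 have sq: "Lloc lborel (%s. (f s)\<^sup>2)" if "L2loc f" for f
  using Lloc_mult_L2loc[OF that that] by (simp add: power2_eq_square)
 show "Lloc lborel (g_re a c i)"
  by (rule Lloc_add[OF Lloc_lin[where x=a, OF assms(1)] Lloc_cmult[OF Lloc_diff[OF sq[OF assms(1)] sq[OF assms(2)] sets_lborel] sets_lborel] sets_lborel])
 show "Lloc lborel (g_im a c i)"
  by (rule Lloc_add[OF Lloc_lin[where x=c, OF assms(2)] Lloc_cmult[OF Lloc_mult_L2loc[OF assms] sets_lborel] sets_lborel])
qed

text \<open>Here \<open>ca\<close> and \<open>cc\<close> are \<open>a\<close> and \<open>c\<close> or clipped versions
of them; only the sign pattern in \<open>clip\<close> is needed. Each bound is one application of the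
comparison principle. For \<open>a \<le> 0\<close>: the perturbation of \<open>- a\<close> is \<open>q (cc\<^sup>2 - ca\<^sup>2)\<close>,
and \<open>ca = 0\<close> where \<open>a \<ge> 0\<close>. For \<open>\<bar>c\<bar> \<le> y\<close>: the
perturbations of \<open>y - c\<close> and \<open>y + c\<close> are \<open>- 2 q ca cc\<close> and \<open>2 q ca cc\<close>,
which are nonnegative where \<open>c \<ge> y\<close> and \<open>c \<le> - y\<close>, respectively, because
\<open>ca \<le> 0\<close>. Then \<open>cc\<^sup>2 \<le> y\<^sup>2\<close> gives \<open>z + a \<ge> 0\<close>.\<close>
lemma riccati_bounds:
 assumes L: "!!i. L2loc (a i)" "!!i. L2loc (c i)" "!!i. L2loc (ca i)" "!!i. L2loc (cc i)"
  and ea: "!!i. solves i (a i) (%s. - \<rho> i s) (%s. lin a i s + q i * ((ca i s)\<^sup>2 - (cc i s)\<^sup>2))"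
  and ec: "!!i. solves i (c i) (im_density i) (%s. lin c i s + 2 * q i * (ca i s * cc i s))"
  and clip: "!!i. AL s. ca i s <= 0 & (0 <= a i s --> ca i s = 0) & \<bar>cc i s\<bar> <= \<bar>c i s\<bar>
    & (0 <= c i s --> 0 <= cc i s) & (c i s <= 0 --> cc i s <= 0)"
  and y: "!!i. L2loc (y i)" "!!i. solves i (y i) (%s. \<bar>im_density i s\<bar>) (%s. lin y i s + 0)"
  and z: "!!i. L2loc (z i)" "!!i. solves i (z i) (\<rho> i) (%s. lin z i s + q i * (y i s)\<^sup>2)"
 shows "AL t. \<forall>i. a i t <= 0 & - z i t <= a i t & \<bar>c i t\<bar> <= y i t & 0 <= y i t & 0 <= z i t"
proof -
 let ?H = "%i s. (cc i s)\<^sup>2 - (ca i s)\<^sup>2"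
 let ?G = "%i s. 2 * q i * (ca i s * cc i s)"
 let ?F = "%i s. (ca i s)\<^sup>2 - (cc i s)\<^sup>2"
 have sq: "Lloc lborel (%s. (f s)\<^sup>2)" if "L2loc f" for f
  using Lloc_mult_L2loc[OF that that] by (simp add: power2_eq_square)
 have e1: "Lloc lborel (%s. q i * (?F i s))" for i by (intro Lloc_cmult Lloc_diff sq L) auto
 have e2: "Lloc lborel (%s. 2 * q i * (ca i s * cc i s))" for i by (intro Lloc_cmult Lloc_mult_L2loc L) auto
 have e3: "Lloc lborel (%s. q i * (y i s)\<^sup>2)" for i by (intro Lloc_cmult sq y) auto
 note nL = Lloc_densities Lloc_im_density Lloc_abs[OF Lloc_im_density] Lloc_minus[OF Lloc_densities(1)]
 have linneg: "lin (%i s. - x i s) i s = - lin x i s" for x i s by (simp add: lin_def sum_negf)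
 have linadd: "lin (%i s. x i s + x' i s) i s = lin x i s + lin x' i s" for x x' i s
  by (simp add: lin_def distrib_left sum.distrib)
 have lindiff: "lin (%i s. x i s - x' i s) i s = lin x i s - lin x' i s" for x x' i s
  by (simp add: lin_def right_diff_distrib sum_subtractf)
 have G: "Lloc lborel (%s. lin a i s + q i * (?F i s))"
  "Lloc lborel (%s. lin c i s + 2 * q i * (ca i s * cc i s))"
  "Lloc lborel (%s. lin y i s + 0)" "Lloc lborel (%s. lin z i s + q i * (y i s)\<^sup>2)" for i
  by (intro Lloc_add Lloc_lin L y z e1 e2 e3 Lloc_zero; simp)+
 have A: "AL t. \<forall>i. 0 <= - a i t"
 proof (rule solves_nonneg[where n=\<rho> and e="%i s. q i * (?H i s)"])
  show "solves i (%t. - a i t) (\<rho> i) (%s. lin (%i t. - a i t) i s + q i * (?H i s))" for i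
   by (rule solves_cong[OF solves_uminus[OF ea[of i]]]) (auto simp: linneg algebra_simps)
  show "Lloc lborel (%s. q i * (?H i s))" for i by (intro Lloc_cmult Lloc_diff sq L) auto
  show "AL s. - a i s <= 0 --> 0 <= q i * (?H i s)" for i
   using clip[of i] by eventually_elim (auto simp: q_nonneg)
 qed (auto intro: L2loc_minus L nL densities_nonneg)
 have Y: "AL t. \<forall>i. 0 <= y i t"
  by (rule solves_nonneg[where n="%i s. \<bar>im_density i s\<bar>" and e="%i s. 0"])
   (auto intro: y(1) y(2)[simplified] nL Lloc_zero)
 have Yi: "AL t. 0 <= y i t" for i using Y by eventually_elim auto
 have C1: "AL t. \<forall>i. 0 <= y i t + - c i t"
 proof (rule solves_nonneg[where n="%i s. \<bar>im_density i s\<bar> + - im_density i s" and e="%i s. - (?G i s)"])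
  show "solves i (%t. y i t + - c i t) (%s. \<bar>im_density i s\<bar> + - im_density i s) (%s. lin (%i t. y i t + - c i t) i s + - (?G i s))" for i
   by (rule solves_cong[OF solves_add[OF y(2)[of i] solves_uminus[OF ec[of i]] Lloc_abs[OF Lloc_im_density]
      Lloc_minus[OF Lloc_im_density] G(3) Lloc_minus[OF G(2)]]]) (auto simp: lindiff)
  show "AL s. y i s + - c i s <= 0 --> 0 <= - (?G i s)" for i
   using clip[of i] Yi[of i]
  proof eventually_elim
   case (elim s)
   show ?case
   proof
    assume "y i s + - c i s <= 0"
    then have "0 <= cc i s" "ca i s <= 0" using elim by auto
    then have "ca i s * cc i s <= 0" by (rule mult_nonpos_nonneg[rotated])
    then have "2 * q i * (ca i s * cc i s) <= 0" using q_nonneg[of i] by (intro mult_nonneg_nonpos[of "2 * q i" "ca i s * cc i s"]) auto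
    then show "0 <= - (?G i s)" by simp
   qed
  qed
 qed (auto intro!: L2loc_add L2loc_diff L2loc_minus y L Lloc_add Lloc_diff nL Lloc_minus e2)
 have C2: "AL t. \<forall>i. 0 <= y i t + c i t"
 proof (rule solves_nonneg[where n="%i s. \<bar>im_density i s\<bar> + im_density i s" and e="%i s. (?G i s)"])
  show "solves i (%t. y i t + c i t) (%s. \<bar>im_density i s\<bar> + im_density i s) (%s. lin (%i t. y i t + c i t) i s + (?G i s))" for i
   by (rule solves_cong[OF solves_add[OF y(2)[of i] ec[of i] Lloc_abs[OF Lloc_im_density] Lloc_im_density G(3,2)]])
    (auto simp: linadd)
  show "AL s. y i s + c i s <= 0 --> 0 <= (?G i s)" for i
   using clip[of i] Yi[of i]
  proof eventually_elim
   case (elim s)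
   show ?case
   proof
    assume "y i s + c i s <= 0"
    then have "cc i s <= 0" "ca i s <= 0" using elim by auto
    then have "0 <= ca i s * cc i s" by (simp add: mult_nonpos_nonpos)
    then show "0 <= 2 * q i * (ca i s * cc i s)" using q_nonneg[of i] by simp
   qed
  qed
 qed (auto intro!: L2loc_add L2loc_diff L2loc_minus y L Lloc_add Lloc_diff nL Lloc_minus e2)
 have Z: "AL t. \<forall>i. 0 <= z i t"
  by (rule solves_nonneg[where n=\<rho> and e="%i s. q i * (y i s)\<^sup>2"])
   (auto intro: z nL densities_nonneg e3 simp: q_nonneg)
 have ZA: "AL t. \<forall>i. 0 <= z i t + a i t"
 proof (rule solves_nonneg[where n="%i s. 0" and e="%i s. q i * (y i s)\<^sup>2 + q i * (?F i s)"])
  show "solves i (%t. z i t + a i t) (%s. 0) (%s. lin (%i t. z i t + a i t) i s + (q i * (y i s)\<^sup>2 + q i * (?F i s)))" for i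
   by (rule solves_cong[OF solves_add[OF z(2)[of i] ea[of i] Lloc_densities(1) Lloc_minus[OF Lloc_densities(1)] G(4,1)]])
    (auto simp: linadd)
  show "AL s. z i s + a i s <= 0 --> 0 <= q i * (y i s)\<^sup>2 + q i * (?F i s)" for i
   using clip[of i] C1 C2
  proof eventually_elim
   case (elim s)
   have "\<bar>c i s\<bar> <= y i s" using elim(2,3) by (smt (verit))
   then have "\<bar>cc i s\<bar> <= \<bar>y i s\<bar>" using elim by linarith
   then have "(cc i s)\<^sup>2 <= (y i s)\<^sup>2" by (simp add: abs_le_square_iff)
   then have "0 <= (y i s)\<^sup>2 + (?F i s)" using zero_le_power2[of "ca i s"] by linarith
   then have "0 <= q i * ((y i s)\<^sup>2 + (?F i s))" using q_nonneg[of i] by (rule mult_nonneg_nonneg[rotated])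
   then show ?case by (simp add: distrib_left)
  qed
 qed (auto intro!: L2loc_add z L Lloc_add Lloc_zero e1 e3)
 show ?thesis using A Y C1 C2 Z ZA
 proof eventually_elim
  case (elim t)
  show ?case
  proof
   fix i
   show "a i t <= 0 & - z i t <= a i t & \<bar>c i t\<bar> <= y i t & 0 <= y i t & 0 <= z i t"
    using elim(1)[rule_format, of i] elim(2)[rule_format, of i] elim(3)[rule_format, of i]
     elim(4)[rule_format, of i] elim(5)[rule_format, of i] elim(6)[rule_format, of i]
    by linarith
  qed
 qed
qed

text \<open>The majorants \<open>y\<close> of \<open>\<bar>c\<bar>\<close> and \<open>z\<close> of \<open>- a\<close>
solve linear equations. They do not depend on the solution that they bound.\<close>
lemma majorants_exist:
 "\<exists>y z. (\<forall>i. L2loc (y i)) & (\<forall>i. solves i (y i) (%s. \<bar>im_density i s\<bar>) (%s. lin y i s + 0)) \<and>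
   (\<forall>i. L2loc (z i)) & (\<forall>i. solves i (z i) (\<rho> i) (%s. lin z i s + q i * (y i s)\<^sup>2))"
proof -
 obtain y where y: "!!i. L2loc (y i)" "!!i. solves i (y i) (%s. \<bar>im_density i s\<bar>) (%s. lin y i s + 0)"
  using linear_solution_exists[of "%i s. \<bar>im_density i s\<bar>" "%i s. 0"] Lloc_abs[OF Lloc_im_density] Lloc_zero by blast
 have "Lloc lborel (%s. q i * (y i s)\<^sup>2)" for i
  using Lloc_mult_L2loc[OF y(1) y(1), of i i] by (intro Lloc_cmult) (auto simp: power2_eq_square)
 then obtain z where "!!i. L2loc (z i)" "!!i. solves i (z i) (\<rho> i) (%s. lin z i s + q i * (y i s)\<^sup>2)"
  using linear_solution_exists[of \<rho> "%i s. q i * (y i s)\<^sup>2"] Lloc_densities by blast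
 with y show ?thesis by blast
qed

text \<open>The quadratic nonlinearity is Lipschitz with the factor \<open>2 q h\<close> on arguments bounded by
\<open>h\<close>. With \<open>h\<close> a square integrable function this is the kind of Lipschitz factor
that \<open>Volterra_existence\<close> admits.\<close>
lemma quadratic_part_Lipschitz:
 fixes h dT dF :: real
 assumes h: "\<bar>A\<bar> <= h" "\<bar>C\<bar> <= h" "\<bar>A'\<bar> <= h" "\<bar>C'\<bar> <= h" and d: "\<bar>A - A'\<bar> <= dT" "\<bar>C - C'\<bar> <= dF"
 shows "\<bar>q i * (A\<^sup>2 - C\<^sup>2) - q i * (A'\<^sup>2 - C'\<^sup>2)\<bar> <= 2 * (q i * h) * (dT + dF)"
  "\<bar>2 * q i * (A * C) - 2 * q i * (A' * C')\<bar> <= 2 * (q i * h) * (dT + dF)"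
proof -
 have h0: "0 <= h" using h(1) by linarith
 have q2: "\<bar>q i * v\<bar> <= 2 * (q i * h) * (dT + dF)" if "\<bar>v\<bar> <= 2 * h * (dT + dF)" for v
  unfolding abs_mult abs_of_nonneg[OF q_nonneg] using mult_left_mono[OF that q_nonneg[of i]] by (simp only: mult_ac)
 have "\<bar>(A + A') * (A - A')\<bar> <= (2 * h) * dT" "\<bar>(C + C') * (C - C')\<bar> <= (2 * h) * dF"
  unfolding abs_mult using h d h0 by (intro mult_mono; linarith)+
 moreover have "(A\<^sup>2 - C\<^sup>2) - (A'\<^sup>2 - C'\<^sup>2) = (A + A') * (A - A') - (C + C') * (C - C')"
  by (simp add: power2_eq_square algebra_simps)
 ultimately have "\<bar>(A\<^sup>2 - C\<^sup>2) - (A'\<^sup>2 - C'\<^sup>2)\<bar> <= 2 * h * (dT + dF)" unfolding distrib_left by linarith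
 from q2[OF this] show "\<bar>q i * (A\<^sup>2 - C\<^sup>2) - q i * (A'\<^sup>2 - C'\<^sup>2)\<bar> <= 2 * (q i * h) * (dT + dF)"
  by (simp only: right_diff_distrib)
 have "\<bar>C * (A - A')\<bar> <= h * dT" "\<bar>A' * (C - C')\<bar> <= h * dF"
  unfolding abs_mult using h d h0 by (intro mult_mono; linarith)+
 moreover have "2 * (A * C) - 2 * (A' * C') = 2 * (C * (A - A')) + 2 * (A' * (C - C'))" by (simp add: algebra_simps)
 ultimately have "\<bar>2 * (A * C) - 2 * (A' * C')\<bar> <= 2 * h * (dT + dF)" unfolding distrib_left by linarith
 from q2[OF this] show "\<bar>2 * q i * (A * C) - 2 * q i * (A' * C')\<bar> <= 2 * (q i * h) * (dT + dF)"
  by (simp add: algebra_simps)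
qed

lemma member_le_sum_pair:
 fixes g :: "'m \<times> bool => real"
 assumes "!!p. 0 <= g p"
 shows "g (i, True) + g (i, False) <= (\<Sum>p\<in>UNIV. g p)" "(\<Sum>l\<in>UNIV. g (l, \<tau>)) <= (\<Sum>p\<in>UNIV. g p)"
proof -
 have "g (i, True) + g (i, False) = (\<Sum>p\<in>{(i, True), (i, False)}. g p)" by simp
 also have "... <= (\<Sum>p\<in>UNIV. g p)" by (rule sum_mono2) (use assms in auto)
 finally show "g (i, True) + g (i, False) <= (\<Sum>p\<in>UNIV. g p)" .
 have "(\<Sum>l\<in>UNIV. g (l, \<tau>)) = (\<Sum>p\<in>(%l. (l, \<tau>)) ` UNIV. g p)"
  by (subst sum.reindex) (auto simp: inj_on_def)
 also have "... <= (\<Sum>p\<in>UNIV. g p)" by (rule sum_mono2) (use assms in auto)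
 finally show "(\<Sum>l\<in>UNIV. g (l, \<tau>)) <= (\<Sum>p\<in>UNIV. g p)" .
qed

text \<open>Solve the equation with \<open>a\<close> clipped to \<open>[- h, 0]\<close> and \<open>c\<close> clipped to
\<open>[- h, h]\<close> for \<open>h = \<bar>y\<bar> + \<bar>z\<bar>\<close>. The bounds show that the
clipping does not change the solution. Real and imaginary parts form one system indexed by pairs, with
\<open>True\<close> for the real part.\<close>
theorem real_riccati_exists:
 "\<exists>a c. (\<forall>i. L2loc (a i)) & (\<forall>i. L2loc (c i)) & (AL t. \<forall>i. a i t <= 0) \<and>
   (\<forall>i. solves i (a i) (%s. - \<rho> i s) (g_re a c i)) \<and>
   (\<forall>i. solves i (c i) (im_density i) (g_im a c i))"
proof -
 obtain y z where y: "!!i. L2loc (y i)" "!!i. solves i (y i) (%s. \<bar>im_density i s\<bar>) (%s. lin y i s + 0)"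
  and z: "!!i. L2loc (z i)" "!!i. solves i (z i) (\<rho> i) (%s. lin z i s + q i * (y i s)\<^sup>2)"
  using majorants_exist by blast
 define h where "h i s = \<bar>y i s\<bar> + \<bar>z i s\<bar>" for i s
 have hL: "L2loc (h i)" for i unfolding h_def by (intro L2loc_add L2loc_abs y z)
 have h0: "0 <= h i s" for i s by (simp add: h_def)
 note [measurable] = L2locD(1)[OF hL]
 define ra where "ra i s v = max (- h i s) (min 0 v)" for i s v
 define rc where "rc i s v = max (- h i s) (min (h i s) v)" for i s v
 have ra: "\<bar>ra i s v\<bar> <= h i s" "\<bar>ra i s v - ra i s w\<bar> <= \<bar>v - w\<bar>" "ra i s 0 = 0" for i s v w
  using h0[of i s] by (auto simp: ra_def max_def min_def)
 have rc: "\<bar>rc i s v\<bar> <= h i s" "\<bar>rc i s v - rc i s w\<bar> <= \<bar>v - w\<bar>" "rc i s 0 = 0" for i s v w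
  using h0[of i s] by (auto simp: rc_def max_def min_def)
 let ?R = "%s x i. q i * ((ra i s (x (i, True)))\<^sup>2 - (rc i s (x (i, False)))\<^sup>2)"
 let ?I = "%s x i. 2 * q i * (ra i s (x (i, True)) * rc i s (x (i, False)))"
 let ?f = "%s (x :: 'm \<times> bool => real) p. indicator {0..} s * (\<Sum>l\<in>UNIV. \<beta> $ l $ (fst p) * x (l, snd p))
   + (if snd p then ?R s x (fst p) else ?I s x (fst p))"
 let ?F = "%p t. if snd p then - rconv (k (fst p)) M (\<rho> (fst p)) t else rconv (k (fst p)) M (im_density (fst p)) t"
 let ?Q = "\<Sum>i\<in>UNIV. q i"
 have qQ: "q i <= ?Q" for i by (rule member_le_sum) (auto simp: q_nonneg)
 define H where "H s = (\<Sum>i\<in>UNIV. h i s)" for s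
 have hH: "h i s <= H s" for i s unfolding H_def by (rule member_le_sum) (auto simp: h0)
 have HL: "L2loc H" unfolding H_def by (intro L2loc_sum hL)
 define l where "l s = bnd * indicator {0..} s + 2 * ?Q * H s" for s
 have "\<exists>x. (\<forall>p. L2loc (x p)) & (\<forall>p. AL t. x p t = ?F p t + rconv (k (fst p)) lborel (%s. ?f s (%r. x r s) p) t)"
 proof (rule Volterra_existence)
  show "L2loc l" unfolding l_def by (intro L2loc_add L2loc_cmult L2loc_one HL)
  show "L2loc (?F p)" for p
   using L2loc_minus[OF L2loc_rconv[OF k_L2loc Lloc_densities(1)]] L2loc_rconv[OF k_L2loc Lloc_im_density]
   by (cases "snd p") auto
  show "(%s. ?f s (%j. x j s) p) \<in> borel_measurable borel" if [measurable]: "!!j. x j \<in> borel_measurable borel" for x p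
   unfolding ra_def rc_def by measurable
  show "?f s (%_. 0) p = 0" for s p by (simp add: ra rc)
  show "\<bar>?f s x p - ?f s y p\<bar> <= l s * (\<Sum>j\<in>UNIV. \<bar>x j - y j\<bar>)" for s x y p
  proof -
   let ?i = "fst p"
   let ?S = "\<Sum>j\<in>UNIV. \<bar>x j - y j\<bar>"
   have S0: "0 <= ?S" by (intro sum_nonneg) auto
   have lin: "\<bar>indicator {0..} s * (\<Sum>l\<in>UNIV. \<beta> $ l $ ?i * x (l, snd p)) - indicator {0..} s * (\<Sum>l\<in>UNIV. \<beta> $ l $ ?i * y (l, snd p))\<bar>
     <= bnd * indicator {0..} s * ?S"
   proof -
    have "\<bar>\<Sum>l\<in>UNIV. \<beta> $ l $ ?i * (x (l, snd p) - y (l, snd p))\<bar> <= bnd * (\<Sum>l\<in>UNIV. \<bar>x (l, snd p) - y (l, snd p)\<bar>)"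
     by (rule sum_beta_bnd)
    also have "... <= bnd * ?S"
     using member_le_sum_pair(2)[of "%p. \<bar>x p - y p\<bar>" "snd p"] bnd_nonneg by (intro mult_left_mono) auto
    finally show ?thesis by (auto split: split_indicator simp: right_diff_distrib sum_subtractf)
   qed
   define dT where "dT = \<bar>x (?i, True) - y (?i, True)\<bar>"
   define dF where "dF = \<bar>x (?i, False) - y (?i, False)\<bar>"
   have dS: "dT + dF <= ?S"
    unfolding dT_def dF_def using member_le_sum_pair(1)[of "%p. \<bar>x p - y p\<bar>" ?i] by simp
   have QH: "q ?i * h ?i s <= ?Q * H s"
    by (intro mult_mono qQ hH h0 sum_nonneg q_nonneg)
   have fin: "2 * (q ?i * h ?i s) * (dT + dF) <= 2 * ?Q * H s * ?S"
   proof -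
    have "0 <= q ?i * h ?i s" by (intro mult_nonneg_nonneg q_nonneg h0)
    then have "0 <= ?Q * H s" using QH by linarith
    then have "2 * (q ?i * h ?i s) * (dT + dF) <= 2 * (?Q * H s) * ?S"
     using QH dS by (intro mult_mono[of "2 * (q ?i * h ?i s)" "2 * (?Q * H s)" "dT + dF" ?S]) (auto simp: dT_def dF_def)
    then show ?thesis by (simp add: mult.assoc)
   qed
   have "\<bar>?R s x ?i - ?R s y ?i\<bar> <= 2 * (q ?i * h ?i s) * (dT + dF)" "\<bar>?I s x ?i - ?I s y ?i\<bar> <= 2 * (q ?i * h ?i s) * (dT + dF)"
    unfolding dT_def dF_def by (intro quadratic_part_Lipschitz ra rc)+
   then have "\<bar>(if snd p then ?R s x ?i else ?I s x ?i) - (if snd p then ?R s y ?i else ?I s y ?i)\<bar> <= 2 * ?Q * H s * ?S"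
    using fin by (cases "snd p") auto
   then show ?thesis using lin by (simp add: l_def distrib_right)
  qed
 qed (rule k_L2loc)
 then obtain x where x: "!!p. L2loc (x p)" "!!p. AL t. x p t = ?F p t + rconv (k (fst p)) lborel (%s. ?f s (%r. x r s) p) t"
  by blast
 define a where "a i = x (i, True)" for i
 define c where "c i = x (i, False)" for i
 define ca where "ca i s = ra i s (a i s)" for i s
 define cc where "cc i s = rc i s (c i s)" for i s
 have aL: "L2loc (a i)" and cL: "L2loc (c i)" for i by (auto simp: a_def c_def x)
 note [measurable] = L2locD(1)[OF aL] L2locD(1)[OF cL]
 have caL: "L2loc (ca i)" and ccL: "L2loc (cc i)" for i
 proof -
  have [measurable]: "ca i \<in> borel_measurable borel" "cc i \<in> borel_measurable borel"
   unfolding ca_def ra_def cc_def rc_def by measurable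
  have h00: "h i s = 0" if "s < 0" for s using L2locD(2)[OF hL that] .
  show "L2loc (ca i)"
   by (rule L2loc_bound_AE[OF hL[of i]]) (use ra h0 h00 in \<open>auto simp: ca_def ra_def\<close>)
  show "L2loc (cc i)"
   by (rule L2loc_bound_AE[OF hL[of i]]) (use rc h0 h00 in \<open>auto simp: cc_def rc_def\<close>)
 qed
 have indl: "indicator {0..} s * (\<Sum>l\<in>UNIV. \<beta> $ l $ i * u l s) = lin u i s" if "!!l. L2loc (u l)" for s i u
  using L2locD(2)[OF that] by (auto simp: lin_def split: split_indicator)
 have ea: "solves i (a i) (%s. - \<rho> i s) (%s. lin a i s + q i * ((ca i s)\<^sup>2 - (cc i s)\<^sup>2))" for i
 proof -
  have "rconv (k i) M (%s. - \<rho> i s) t = - rconv (k i) M (\<rho> i) t" for t by (simp add: rconv_def)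
  then show ?thesis using x(2)[of "(i, True)"]
   by (simp add: solves_def indl aL a_def[symmetric] c_def[symmetric] ca_def[symmetric] cc_def[symmetric])
 qed
 have ec: "solves i (c i) (im_density i) (%s. lin c i s + 2 * q i * (ca i s * cc i s))" for i
  using x(2)[of "(i, False)"]
  by (simp add: solves_def indl cL a_def[symmetric] c_def[symmetric] ca_def[symmetric] cc_def[symmetric])
 have bnds: "AL t. \<forall>i. a i t <= 0 & - z i t <= a i t & \<bar>c i t\<bar> <= y i t & 0 <= y i t & 0 <= z i t"
 proof (rule riccati_bounds[OF aL cL caL ccL ea ec _ y z])
  show "AL s. ca i s <= 0 & (0 <= a i s --> ca i s = 0) & \<bar>cc i s\<bar> <= \<bar>c i s\<bar>
    & (0 <= c i s --> 0 <= cc i s) & (c i s <= 0 --> cc i s <= 0)" for i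
  proof (intro AE_I2)
   fix s
   show "ca i s <= 0 & (0 <= a i s --> ca i s = 0) & \<bar>cc i s\<bar> <= \<bar>c i s\<bar>
    & (0 <= c i s --> 0 <= cc i s) & (c i s <= 0 --> cc i s <= 0)"
    using h0[of i s] by (auto simp: ca_def cc_def ra_def rc_def max_def min_def)
  qed
 qed
 have eq: "AL s. \<forall>i. ca i s = a i s & cc i s = c i s"
  using bnds
 proof eventually_elim
  case (elim s)
  show ?case
  proof
   fix i
   from elim have e: "a i s <= 0" "- z i s <= a i s" "\<bar>c i s\<bar> <= y i s" "0 <= y i s" "0 <= z i s" by auto
   then have "- h i s <= a i s" "\<bar>c i s\<bar> <= h i s" by (auto simp: h_def)
   then show "ca i s = a i s & cc i s = c i s" using e by (auto simp: ca_def cc_def ra_def rc_def)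
  qed
 qed
 note [measurable] = L2locD(1)[OF caL] L2locD(1)[OF ccL]
 have ml: "lin a i \<in> borel_measurable borel" "lin c i \<in> borel_measurable borel" for i
  by (auto intro!: LlocD(1)[OF Lloc_lin] aL cL)
 note [measurable] = ml
 have "solves i (a i) (%s. - \<rho> i s) (g_re a c i)" for i
 proof -
  have "rconv (k i) lborel (%s. lin a i s + q i * ((ca i s)\<^sup>2 - (cc i s)\<^sup>2)) t = rconv (k i) lborel (g_re a c i) t" for t
   by (rule lborel.rconv_cong_right, use eq in eventually_elim) simp_all
  then show ?thesis using ea[of i] by (simp add: solves_def)
 qed
 moreover have "solves i (c i) (im_density i) (g_im a c i)" for i
 proof -
  have "rconv (k i) lborel (%s. lin c i s + 2 * q i * (ca i s * cc i s)) t = rconv (k i) lborel (g_im a c i) t" for t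
   by (rule lborel.rconv_cong_right, use eq in eventually_elim) simp_all
  then show ?thesis using ec[of i] by (simp add: solves_def)
 qed
 moreover have "AL t. \<forall>i. a i t <= 0" using bnds by eventually_elim auto
 ultimately show ?thesis using aL cL by blast
qed

text \<open>The difference of two solutions solves a linear inequality whose factor \<open>l\<close> is affine in the
absolute values of the solutions, hence locally square integrable.\<close>
theorem real_riccati_unique:
 assumes L: "!!i. L2loc (a i)" "!!i. L2loc (c i)" "!!i. L2loc (a' i)" "!!i. L2loc (c' i)"
  and ea: "!!i. solves i (a i) (%s. - \<rho> i s) (g_re a c i)"
  and ec: "!!i. solves i (c i) (im_density i) (g_im a c i)"
  and ea': "!!i. solves i (a' i) (%s. - \<rho> i s) (g_re a' c' i)"
  and ec': "!!i. solves i (c' i) (im_density i) (g_im a' c' i)"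
 shows "AL t. \<forall>i. a i t = a' i t & c i t = c' i t"
proof -
 note [measurable] = L[THEN L2locD(1)]
 define h where "h i s = \<bar>a i s\<bar> + \<bar>a' i s\<bar> + \<bar>c i s\<bar> + \<bar>c' i s\<bar>" for i s
 have h0: "0 <= h i s" for i s by (simp add: h_def)
 let ?Q = "\<Sum>i\<in>UNIV. q i"
 have qQ: "q i <= ?Q" for i by (rule member_le_sum) (auto simp: q_nonneg)
 define H where "H s = (\<Sum>i\<in>UNIV. h i s)" for s
 have hH: "h i s <= H s" for i s unfolding H_def by (rule member_le_sum) (auto simp: h0)
 have HL: "L2loc H" unfolding H_def h_def by (intro L2loc_sum L2loc_add L2loc_abs L)
 define l where "l s = bnd * indicator {0..} s + 2 * ?Q * H s" for s
 define D where "D p s = (if snd p then a (fst p) s - a' (fst p) s else c (fst p) s - c' (fst p) s)" for p s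
 have DL: "L2loc (D p)" for p unfolding D_def by (cases "snd p") (auto intro!: L2loc_diff L)
 define g where "g p = (if snd p then g_re a c (fst p) else g_im a c (fst p))" for p
 define g' where "g' p = (if snd p then g_re a' c' (fst p) else g_im a' c' (fst p))" for p
 have gL: "Lloc lborel (g p)" "Lloc lborel (g' p)" for p
  using Lloc_g[of a c, OF L(1,2)] Lloc_g[of a' c', OF L(3,4)] by (simp_all add: g_def g'_def)
 note [measurable] = LlocD(1)[OF gL(1)] LlocD(1)[OF gL(2)]
 have "AL t. \<forall>p. D p t = 0"
 proof (rule Volterra_uniqueness[where k="%p. k (fst p)" and h="%p s. g p s - g' p s" and l=l])
  show "L2loc l" unfolding l_def by (intro L2loc_add L2loc_cmult L2loc_one HL)
  show "AL t. \<bar>D p t\<bar> <= \<bar>rconv (k (fst p)) lborel (%s. g p s - g' p s) t\<bar>" for p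
  proof -
   have "AL t. rconv (k (fst p)) lborel (%s. g p s - g' p s) t = rconv (k (fst p)) lborel (g p) t - rconv (k (fst p)) lborel (g' p) t"
    by (rule lborel.AE_rconv_diff[OF k_Lloc gL])
   moreover have "AL t. D p t = rconv (k (fst p)) lborel (g p) t - rconv (k (fst p)) lborel (g' p) t"
   proof (cases "snd p")
    case True
    show ?thesis using ea[of "fst p"] ea'[of "fst p"] unfolding solves_def
     by eventually_elim (simp add: D_def g_def g'_def True)
   next
    case False
    show ?thesis using ec[of "fst p"] ec'[of "fst p"] unfolding solves_def
     by eventually_elim (simp add: D_def g_def g'_def False)
   qed
   ultimately show ?thesis by eventually_elim simp
  qed
  show "AL s. \<bar>g p s - g' p s\<bar> <= l s * (\<Sum>j\<in>UNIV. \<bar>D j s\<bar>)" for p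
  proof (intro AE_I2)
   fix s
   let ?i = "fst p" and ?S = "\<Sum>j\<in>UNIV. \<bar>D j s\<bar>"
   have linb: "\<bar>lin (%l. if snd p then a l else c l) ?i s - lin (%l. if snd p then a' l else c' l) ?i s\<bar> <= bnd * indicator {0..} s * ?S"
   proof -
    have e: "lin (%l. if snd p then a l else c l) ?i s - lin (%l. if snd p then a' l else c' l) ?i s = (\<Sum>l\<in>UNIV. \<beta> $ l $ ?i * D (l, snd p) s)"
     unfolding lin_def sum_subtractf[symmetric] by (intro sum.cong refl) (auto simp: D_def right_diff_distrib)
    have "\<bar>\<Sum>l\<in>UNIV. \<beta> $ l $ ?i * D (l, snd p) s\<bar> <= bnd * (\<Sum>l\<in>UNIV. \<bar>D (l, snd p) s\<bar>)" by (rule sum_beta_bnd)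
    also have "... <= bnd * ?S"
     using member_le_sum_pair(2)[of "%p. \<bar>D p s\<bar>" "snd p"] bnd_nonneg by (intro mult_left_mono) auto
    finally show ?thesis unfolding e using L2locD(2)[OF DL] by (cases "s < 0") auto
   qed
   define dT where "dT = \<bar>a ?i s - a' ?i s\<bar>"
   define dF where "dF = \<bar>c ?i s - c' ?i s\<bar>"
   have dS: "dT + dF <= ?S"
    unfolding dT_def dF_def using member_le_sum_pair(1)[of "%p. \<bar>D p s\<bar>" ?i] by (simp add: D_def)
   have fin: "2 * (q ?i * h ?i s) * (dT + dF) <= 2 * ?Q * H s * ?S"
   proof -
    have QH: "q ?i * h ?i s <= ?Q * H s" by (intro mult_mono qQ hH h0 sum_nonneg q_nonneg)
    have "0 <= q ?i * h ?i s" by (intro mult_nonneg_nonneg q_nonneg h0)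
    then have "0 <= ?Q * H s" using QH by linarith
    then have "2 * (q ?i * h ?i s) * (dT + dF) <= 2 * (?Q * H s) * ?S"
     using QH dS by (intro mult_mono[of "2 * (q ?i * h ?i s)" "2 * (?Q * H s)" "dT + dF" ?S]) (auto simp: dT_def dF_def)
    then show ?thesis by (simp add: mult.assoc)
   qed
   have R: "\<bar>q ?i * ((a ?i s)\<^sup>2 - (c ?i s)\<^sup>2) - q ?i * ((a' ?i s)\<^sup>2 - (c' ?i s)\<^sup>2)\<bar> <= 2 * (q ?i * h ?i s) * (dT + dF)"
    and I: "\<bar>2 * q ?i * (a ?i s * c ?i s) - 2 * q ?i * (a' ?i s * c' ?i s)\<bar> <= 2 * (q ?i * h ?i s) * (dT + dF)"
    unfolding dT_def dF_def by (intro quadratic_part_Lipschitz; simp add: h_def)+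
   show "\<bar>g p s - g' p s\<bar> <= l s * ?S"
   proof (cases "snd p")
    case True
    have "\<bar>lin a ?i s - lin a' ?i s\<bar> <= bnd * indicator {0..} s * ?S" using linb True by simp
    then show ?thesis using R fin True by (simp add: g_def g'_def l_def distrib_right)
   next
    case False
    have "\<bar>lin c ?i s - lin c' ?i s\<bar> <= bnd * indicator {0..} s * ?S" using linb False by simp
    then show ?thesis using I fin False by (simp add: g_def g'_def l_def distrib_right)
   qed
  qed
 qed (auto intro: k_L2loc DL)
 then show ?thesis
 proof eventually_elim
  case (elim t)
  show ?case
  proof
   fix i
   show "a i t = a' i t & c i t = c' i t"
    using elim[rule_format, of "(i, True)"] elim[rule_format, of "(i, False)"] by (simp add: D_def)
  qed
 qed
qed

end

section \<open>Existence and uniqueness\<close>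

lemma L2loc_component:
 fixes \<psi> :: "real => complex ^ 'm" and f :: "complex => real"
 assumes \<psi>: "Lq_loc 2 \<psi>" and f: "f = Re \<or> f = Im"
 shows "L2loc (%t. if 0 <= t then f (\<psi> t $ i) else 0)"
 unfolding L2loc_def
proof (intro conjI allI impI)
 have fcont: "continuous_on UNIV f" using f by (auto intro: continuous_intros)
 have [measurable]: "(%t. indicator {0..} t *\<^sub>R \<psi> t) \<in> borel_measurable borel"
  using \<psi> by (simp add: Lq_loc_def set_borel_measurable_def)
 have [measurable]: "(%x::complex ^ 'm. f (x $ i)) \<in> borel_measurable borel"
  by (intro borel_measurable_continuous_onI continuous_on_compose2[OF fcont] continuous_intros) auto
 have "(%t. if 0 <= t then f (\<psi> t $ i) else 0) = (%t. f ((indicator {0..} t *\<^sub>R \<psi> t) $ i))"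
  using f by (auto simp: fun_eq_iff split: split_indicator)
 then show "(%t. if 0 <= t then f (\<psi> t $ i) else 0) \<in> borel_measurable borel"
  by (simp only:) measurable
 show "(if 0 <= s then f (\<psi> s $ i) else 0) = 0" if "s < 0" for s using that by simp
 fix T :: real
 have "nnI lborel T (%s. (if 0 <= s then f (\<psi> s $ i) else 0)\<^sup>2)
   <= (NN s. ennreal (norm (indicator {0..max 1 T} s *\<^sub>R (norm (\<psi> s) powr 2))))"
 proof (intro nn_integral_mono)
  fix s
  have "\<bar>f (\<psi> s $ i)\<bar> <= norm (\<psi> s $ i)" using f abs_Re_le_cmod abs_Im_le_cmod by auto
  also have "... <= norm (\<psi> s)" by (rule Finite_Cartesian_Product.norm_nth_le)
  finally have "(f (\<psi> s $ i))\<^sup>2 <= (norm (\<psi> s))\<^sup>2" by (simp add: abs_le_square_iff[symmetric])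
  then show "ennreal ((if 0 <= s then f (\<psi> s $ i) else 0)\<^sup>2) * indicator {0..T} s <= ennreal (norm (indicator {0..max 1 T} s *\<^sub>R (norm (\<psi> s) powr 2)))"
   by (auto split: split_indicator intro!: ennreal_leI)
 qed
 also have "... < \<infinity>"
 proof -
  have "integrable lborel (%s. indicator {0..max 1 T} s *\<^sub>R (norm (\<psi> s) powr 2))"
   using \<psi> unfolding Lq_loc_def set_integrable_def by (auto simp: less_max_iff_disj)
  then show ?thesis by (simp add: integrable_iff_bounded)
 qed
 finally show "nnI lborel T (%s. (if 0 <= s then f (\<psi> s $ i) else 0)\<^sup>2) < \<infinity>" .
qed

definition re_part :: "(real => complex ^ 'm) => 'm => real => real" where
 "re_part \<psi> i t = (if 0 <= t then Re (\<psi> t $ i) else 0)"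

definition im_part :: "(real => complex ^ 'm) => 'm => real => real" where
 "im_part \<psi> i t = (if 0 <= t then Im (\<psi> t $ i) else 0)"

lemma norm_complex_vec_le: "norm (x :: complex ^ 'm) <= norm (\<chi> i. Re (x $ i)) + norm (\<chi> i. Im (x $ i))"
proof -
 have "norm x = L2_set (%i. norm (x $ i)) UNIV" by (simp add: norm_vec_def)
 also have "... <= L2_set (%i. \<bar>Re (x $ i)\<bar> + \<bar>Im (x $ i)\<bar>) UNIV"
  by (intro L2_set_mono cmod_le) auto
 also have "... <= L2_set (%i. \<bar>Re (x $ i)\<bar>) UNIV + L2_set (%i. \<bar>Im (x $ i)\<bar>) UNIV"
  by (rule L2_set_triangle_ineq)
 finally show ?thesis by (simp add: norm_vec_def)
qed

context riccati_setting begin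

lemma riccati_R_parts:
 "Re (riccati_R \<beta> \<sigma> u $ i) = (\<Sum>l\<in>UNIV. \<beta> $ l $ i * Re (u $ l)) + q i * ((Re (u $ i))\<^sup>2 - (Im (u $ i))\<^sup>2)"
 "Im (riccati_R \<beta> \<sigma> u $ i) = (\<Sum>l\<in>UNIV. \<beta> $ l $ i * Im (u $ l)) + 2 * q i * (Re (u $ i) * Im (u $ i))"
 by (simp_all add: riccati_R_def pairing_def column_def q_def mult.commute power2_eq_square)

text \<open>At almost every \<open>t\<close> all integrals converge, and the complex equation splits into its parts.\<close>
lemma solution_real_form:
 assumes sol: "riccati_solution \<beta> \<sigma> K \<mu> \<psi>"
 shows "L2loc (re_part \<psi> i)" "L2loc (im_part \<psi> i)" "AL t. \<forall>i. re_part \<psi> i t <= 0"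
  "solves i (re_part \<psi> i) (%s. - \<rho> i s) (g_re (re_part \<psi>) (im_part \<psi>) i)"
  "solves i (im_part \<psi> i) (im_density i) (g_im (re_part \<psi>) (im_part \<psi>) i)"
proof -
 let ?a = "re_part \<psi>" and ?c = "im_part \<psi>"
 have L2: "Lq_loc 2 \<psi>" using sol unfolding riccati_solution_def by blast
 have aL: "L2loc (?a i)" for i
  unfolding re_part_def[abs_def] using L2loc_component[OF L2, of Re] by simp
 have cL: "L2loc (?c i)" for i
  unfolding im_part_def[abs_def] using L2loc_component[OF L2, of Im] by simp
 show "L2loc (?a i)" "L2loc (?c i)" by (rule aL, rule cL)
 have "AL t. 0 <= t --> (\<forall>i. Re (\<psi> t $ i) <= 0)" using sol unfolding riccati_solution_def by blast
 then show "AL t. \<forall>i. re_part \<psi> i t <= 0" by eventually_elim (auto simp: re_part_def)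
 note gL = Lloc_g[of ?a ?c, OF aL cL]
 have all: "AL t. \<forall>i. integrable lborel (%s. k i (t - s) * g_re ?a ?c i s) & integrable lborel (%s. k i (t - s) * g_im ?a ?c i s)"
  unfolding AE_all_countable by (intro allI AE_conjI lborel.AE_rconv_integrable k_Lloc gL)
 have eqs: "AL t. 0 <= t --> (\<forall>i. \<psi> t $ i = conv_measure K \<mu> t $ i + Complex (rconv (k i) lborel (g_re ?a ?c i) t) (rconv (k i) lborel (g_im ?a ?c i) t))"
  using all
 proof eventually_elim
  case (elim t)
  show ?case
  proof (intro impI allI)
   fix i assume t: "0 <= t"
   have "\<psi> t = conv_measure K \<mu> t + conv cmat_vec K (%s. riccati_R \<beta> \<sigma> (\<psi> s)) t"
    using sol t unfolding riccati_solution_def by blast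
   moreover have "conv cmat_vec K (%s. riccati_R \<beta> \<sigma> (\<psi> s)) t $ i = Complex (rconv (k i) lborel (g_re ?a ?c i) t) (rconv (k i) lborel (g_im ?a ?c i) t)"
   proof (rule conv_cmat_vec_at(2)[OF adm])
    show "g_re ?a ?c i s = Re (riccati_R \<beta> \<sigma> (\<psi> s) $ i)" "g_im ?a ?c i s = Im (riccati_R \<beta> \<sigma> (\<psi> s) $ i)" if "0 <= s" for i s
     using that by (simp_all add: riccati_R_parts lin_def re_part_def im_part_def)
   qed (use elim gL[THEN LlocD(1)] gL[THEN LlocD(2)] in auto)
   ultimately show "\<psi> t $ i = conv_measure K \<mu> t $ i + Complex (rconv (k i) lborel (g_re ?a ?c i) t) (rconv (k i) lborel (g_im ?a ?c i) t)"
    by simp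
  qed
 qed
 have neg: "rconv (k i) M n t = 0" "rconv (k i) lborel g t = 0" if "t < 0" "Lloc M n" "Lloc lborel g" for n g t i
  using that L2locD(2)[OF k_L2loc] LlocD(2)[OF that(2)] LlocD(2)[OF that(3)]
  by (auto intro!: rconv_negative lborel.rconv_negative)
 show "solves i (re_part \<psi> i) (%s. - \<rho> i s) (g_re ?a ?c i)"
  unfolding solves_def using eqs
 proof eventually_elim
  case (elim t)
  show ?case
  proof (cases "0 <= t")
   case True
   then show ?thesis using elim[rule_format, of i] by (simp add: re_part_def conv_measure_real_form[OF adm]) (simp add: rconv_def)
  next
   case False
   then show ?thesis using neg[OF _ Lloc_minus[OF Lloc_densities(1)] gL(1)] by (simp add: re_part_def)
  qed
 qed
 have im: "AL t. rconv (k i) M (im_density i) t = rconv (k i) M (\<pi> i) t - rconv (k i) M (\<upsilon> i) t"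
  unfolding im_density_def[abs_def] by (intro AE_rconv_diff k_Lloc Lloc_densities)
 show "solves i (im_part \<psi> i) (im_density i) (g_im ?a ?c i)"
  unfolding solves_def using eqs im
 proof eventually_elim
  case (elim t)
  show ?case
  proof (cases "0 <= t")
   case True
   then show ?thesis using elim(1)[rule_format, of i] elim(2) by (simp add: im_part_def conv_measure_real_form[OF adm])
  next
   case False
   then show ?thesis using neg[OF _ Lloc_im_density gL(2)] by (simp add: im_part_def)
  qed
 qed
qed

text \<open>A solution of the real system fixes \<open>\<psi>\<close> almost everywhere; the representative is the
right-hand side of the equation, evaluated at every \<open>t\<close>. It does not change if the system is
replaced by \<open>\<psi>\<close> inside the integral.\<close>
lemma solution_from_real_form:
 assumes aL: "!!i. L2loc (a i)" and cL: "!!i. L2loc (c i)" and neg: "AL t. \<forall>i. a i t <= 0"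
  and ea: "!!i. solves i (a i) (%s. - \<rho> i s) (g_re a c i)" and ec: "!!i. solves i (c i) (im_density i) (g_im a c i)"
 shows "\<exists>\<psi>. riccati_solution \<beta> \<sigma> K \<mu> \<psi>"
proof -
 let ?A = "%s x i. indicator {0..} s *\<^sub>R riccati_R \<beta> \<sigma> (x s) $ i"
 let ?G = "%\<psi>. %s. riccati_R \<beta> \<sigma> (\<psi> s)"
 let ?F = "%x. %s. riccati_R \<beta> \<sigma> (x s)"
 note [measurable] = L2locD(1)[OF aL] L2locD(1)[OF cL]
 note gL = Lloc_g[of a c, OF aL cL]
 define x where "x s = (\<chi> i. Complex (a i s) (c i s))" for s
 have cplx: "Complex u v = complex_of_real u + \<i> * complex_of_real v" for u v by (simp add: complex_eq_iff)
 have [measurable]: "x \<in> borel_measurable borel"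
  unfolding x_def cplx by (intro borel_measurable_vec_lambda) measurable
 define \<psi> where "\<psi> t = conv_measure K \<mu> t + conv cmat_vec K (?F x) t" for t
 have gx: "g_re a c i s = Re (riccati_R \<beta> \<sigma> (x s) $ i)" "g_im a c i s = Im (riccati_R \<beta> \<sigma> (x s) $ i)" for i s
  by (simp_all add: riccati_R_parts lin_def x_def)
 have all: "AL t. \<forall>i. integrable lborel (%s. k i (t - s) * g_re a c i s) & integrable lborel (%s. k i (t - s) * g_im a c i s)"
  unfolding AE_all_countable by (intro allI AE_conjI lborel.AE_rconv_integrable k_Lloc gL)
 have at: "conv_exists cmat_vec K (?F x) t & conv cmat_vec K (?F x) t $ i = Complex (rconv (k i) lborel (g_re a c i) t) (rconv (k i) lborel (g_im a c i) t)"
  if "\<forall>i. integrable lborel (%s. k i (t - s) * g_re a c i s) & integrable lborel (%s. k i (t - s) * g_im a c i s)" for t i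
  by (intro conjI conv_cmat_vec_at[OF adm, where a="g_re a c" and c="g_im a c"])
   (use that gL[THEN LlocD(1)] gL[THEN LlocD(2)] gx in auto)
 have im: "AL t. \<forall>i. rconv (k i) M (im_density i) t = rconv (k i) M (\<pi> i) t - rconv (k i) M (\<upsilon> i) t"
  unfolding im_density_def[abs_def] AE_all_countable by (intro allI AE_rconv_diff k_Lloc Lloc_densities)
 have "AL t. \<forall>i. a i t = rconv (k i) M (%s. - \<rho> i s) t + rconv (k i) lborel (g_re a c i) t"
   "AL t. \<forall>i. c i t = rconv (k i) M (im_density i) t + rconv (k i) lborel (g_im a c i) t"
  unfolding AE_all_countable using ea ec by (auto simp: solves_def)
 then have \<psi>x: "AL t. \<psi> t = x t"
  using all im
 proof eventually_elim
  case (elim t)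
  have "\<psi> t $ i = x t $ i" for i
   using elim at[of t i] by (simp add: \<psi>_def x_def conv_measure_real_form[OF adm] complex_eq_iff) (simp add: rconv_def)
  then show ?case by (simp add: vec_eq_iff)
 qed
 have \<psi>m: "\<psi> \<in> borel_measurable borel"
 proof -
  have "conv_measure K \<mu> = (%t. \<chi> i. complex_of_real (- rconv (k i) M (\<rho> i) t) + \<i> * complex_of_real (rconv (k i) M (\<pi> i) t - rconv (k i) M (\<upsilon> i) t))"
   by (simp add: fun_eq_iff vec_eq_iff conv_measure_real_form[OF adm] complex_eq_iff)
  then have [measurable]: "conv_measure K \<mu> \<in> borel_measurable borel"
   by (simp only:) (intro borel_measurable_vec_lambda, measurable)
  have [measurable]: "causal_entry K i i \<in> borel_measurable borel" for i by (rule LlocD(1)[OF Lloc_causal_kernel[OF adm]])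
  have gm: "(%s. g_re a c i s) \<in> borel_measurable borel" "(%s. g_im a c i s) \<in> borel_measurable borel" for i
   using gL[THEN LlocD(1)] by auto
  have "(%(t, s). \<chi> i. complex_of_real (causal_entry K i i (t - s)) * (?A s x i)) \<in> borel_measurable (borel \<Otimes>\<^sub>M lborel)"
  proof -
   note [measurable] = gm
   have e: "(%(t, s). \<chi> i. complex_of_real (causal_entry K i i (t - s)) * (?A s x i))
     = (%p. \<chi> i. complex_of_real (causal_entry K i i (fst p - snd p)) * (complex_of_real (indicator {0..} (snd p)) * (complex_of_real (g_re a c i (snd p)) + \<i> * complex_of_real (g_im a c i (snd p)))))"
    unfolding gx by (auto simp: fun_eq_iff vec_eq_iff complex_eq_iff split: split_indicator)
   show ?thesis unfolding e by (intro borel_measurable_vec_lambda) measurable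
  qed
  then have "(%t. \<integral>s. (\<chi> i. complex_of_real (causal_entry K i i (t - s)) * (?A s x i)) \<partial>lborel) \<in> borel_measurable borel"
   by (rule lborel.borel_measurable_lebesgue_integral)
  then have [measurable]: "(%t. conv cmat_vec K (?F x) t) \<in> borel_measurable borel"
   by (simp only: conv_cmat_vec_eq[OF adm])
  show ?thesis unfolding \<psi>_def by measurable
 qed
 note [measurable] = \<psi>m
 have conv_eq: "conv cmat_vec K (?G \<psi>) t = conv cmat_vec K (?F x) t"
  "conv_exists cmat_vec K (?G \<psi>) t = conv_exists cmat_vec K (?F x) t" for t
 proof -
  let ?H = "%y s. \<chi> i. complex_of_real (causal_entry K i i (t - s)) * (indicator {0..} s *\<^sub>R riccati_R \<beta> \<sigma> (y s) $ i)"
  have [measurable]: "causal_entry K i i \<in> borel_measurable borel" for i by (rule LlocD(1)[OF Lloc_causal_kernel[OF adm]])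
  have Rm: "(%u. riccati_R \<beta> \<sigma> u $ i) \<in> borel_measurable borel" for i
  proof -
   have "(%u. riccati_R \<beta> \<sigma> u $ i) = (%u. (\<Sum>l\<in>UNIV. u $ l * complex_of_real (\<beta> $ l $ i)) + complex_of_real ((\<sigma> $ i)\<^sup>2 / 2) * (u $ i)\<^sup>2)"
    by (simp add: riccati_R_def pairing_def column_def)
   moreover have "... \<in> borel_measurable borel"
    by (intro borel_measurable_continuous_onI continuous_intros)
   ultimately show ?thesis by simp
  qed
  have m: "?H y \<in> borel_measurable lborel" if [measurable]: "y \<in> borel_measurable borel" for y
  proof -
   have [measurable]: "(%s. riccati_R \<beta> \<sigma> (y s) $ i) \<in> borel_measurable borel" for i
    using measurable_compose[OF that Rm[of i]] .
   show ?thesis by (intro borel_measurable_vec_lambda) measurable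
  qed
  have ae: "AL s. ?H \<psi> s = ?H x s" using \<psi>x by eventually_elim simp
  show "conv cmat_vec K (?G \<psi>) t = conv cmat_vec K (?F x) t"
   unfolding conv_cmat_vec_eq(1)[OF adm] by (intro integral_cong_AE m ae) measurable
  show "conv_exists cmat_vec K (?G \<psi>) t = conv_exists cmat_vec K (?F x) t"
   unfolding conv_cmat_vec_eq(2)[OF adm] by (intro integrable_cong_AE m ae) measurable
 qed
 have "riccati_solution \<beta> \<sigma> K \<mu> \<psi>"
  unfolding riccati_solution_def
 proof (intro conjI allI impI)
  show "\<psi> t = conv_measure K \<mu> t + conv cmat_vec K (?G \<psi>) t" for t
   unfolding conv_eq by (rule \<psi>_def)
  show "AL t. 0 <= t --> (\<forall>i. Re (\<psi> t $ i) <= 0)"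
   using neg \<psi>x by eventually_elim (simp add: x_def)
  show "AL t. 0 <= t --> conv_measure_exists K \<mu> t & conv_exists cmat_vec K (?G \<psi>) t"
   using conv_measure_exists_AE[OF adm] all by eventually_elim (simp add: conv_eq at)
  show "Lq_loc 2 \<psi>"
   unfolding Lq_loc_def
  proof (intro conjI allI impI)
   show "set_borel_measurable lborel {0..} \<psi>" unfolding set_borel_measurable_def by measurable
   fix T :: real assume "T > 0"
   define w where "w s = (\<Sum>i\<in>UNIV. \<bar>a i s\<bar> + \<bar>c i s\<bar>)" for s
   have wL: "L2loc w" unfolding w_def by (intro L2loc_sum L2loc_add L2loc_abs aL cL)
   have le: "norm (x s) <= \<bar>w s\<bar>" for s
   proof -
    have "norm (x s) <= (\<Sum>i\<in>UNIV. norm (x s $ i))"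
     unfolding norm_vec_def by (rule L2_set_le_sum) simp
    also have "... <= w s" unfolding w_def x_def by (intro sum_mono order_trans[OF cmod_le]) simp
    finally show ?thesis by simp
   qed
   show "set_integrable lborel {0..T} (%t. norm (\<psi> t) powr 2)"
    unfolding set_integrable_def
   proof (rule integrableI_bounded)
    have "(NN s. ennreal (norm (indicator {0..T} s *\<^sub>R norm (\<psi> s) powr 2))) <= nnI lborel T (%s. (w s)\<^sup>2)"
    proof (rule nn_integral_mono_AE, use \<psi>x in eventually_elim)
     case (elim s)
     have "(norm (x s))\<^sup>2 <= (w s)\<^sup>2" using le[of s] by (simp add: abs_le_square_iff[symmetric])
     then show ?case using elim by (auto split: split_indicator intro!: ennreal_leI)
    qed
    then show "(NN s. ennreal (norm (indicator {0..T} s *\<^sub>R norm (\<psi> s) powr 2))) < \<infinity>"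
     by (rule order_le_less_trans[OF _ L2locD(3)[OF wL]])
   qed measurable
  qed
 qed
 then show ?thesis by blast
qed

theorem riccati_exists: "\<exists>\<psi>. riccati_solution \<beta> \<sigma> K \<mu> \<psi>"
proof -
 obtain a c where "!!i. L2loc (a i)" "!!i. L2loc (c i)" "AL t. \<forall>i. a i t <= 0"
  "!!i. solves i (a i) (%s. - \<rho> i s) (g_re a c i)" "!!i. solves i (c i) (im_density i) (g_im a c i)"
  using real_riccati_exists by blast
 then show ?thesis by (rule solution_from_real_form)
qed

theorem riccati_unique:
 assumes "riccati_solution \<beta> \<sigma> K \<mu> \<psi>" "riccati_solution \<beta> \<sigma> K \<mu> \<phi>"
 shows "AL t. 0 <= t --> \<phi> t = \<psi> t"
proof -
 note s1 = solution_real_form[OF assms(1)] and s2 = solution_real_form[OF assms(2)]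
 have "AL t. \<forall>i. re_part \<phi> i t = re_part \<psi> i t & im_part \<phi> i t = im_part \<psi> i t"
  by (rule real_riccati_unique) (intro s1 s2)+
 then show ?thesis
  by eventually_elim (auto simp: vec_eq_iff complex_eq_iff re_part_def im_part_def)
qed

end

section \<open>The norm estimate\<close>

lemma ennroot_mono: "0 < r ==> x <= y ==> ennroot r x <= ennroot r y"
 unfolding ennroot_def by (auto simp: top_unique intro!: ennreal_leI powr_mono2 enn2real_mono simp: less_top)

lemma ennroot_cmult:
 assumes "0 < r" "0 <= A"
 shows "ennroot r (ennreal (A powr r) * x) = ennreal A * ennroot r x"
proof (cases x)
 case (real y)
 then have "ennreal (A powr r) * x = ennreal (A powr r * y)" using assms by (simp add: ennreal_mult)
 then show ?thesis using real assms
  by (simp add: ennroot_def powr_mult powr_powr flip: ennreal_mult)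
next
 case top
 show ?thesis
 proof (cases "A = 0")
  case True then show ?thesis by (simp add: ennroot_def)
 next
  case False
  then have "ennreal (A powr r) * x = \<infinity>" "ennreal A * ennroot r x = \<infinity>"
   using assms top by (auto simp: ennroot_def ennreal_mult_top)
  then show ?thesis by (simp add: ennroot_def)
 qed
qed

lemma ennroot_2_square: "(ennroot 2 x)\<^sup>2 = x"
proof (cases x)
 case (real y)
 then show ?thesis by (simp add: ennroot_def ennreal_power powr_half_sqrt)
qed (simp add: ennroot_def power2_eq_square)

lemma sqrt_sum_mono_norm: "(!!i. \<bar>x $ i\<bar> <= \<bar>y $ i\<bar>) ==> norm (x :: real ^ 'm) <= norm (y :: real ^ 'm)"
 unfolding norm_vec_def by (intro L2_set_mono) auto

lemma (in borel_sigma_finite) Lloc_vec_norm: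
 fixes n :: "'m::finite => real => real"
 assumes "!!j. Lloc M (n j)"
 shows "Lloc M (%s. norm (\<chi> j. n j s))"
proof (rule Lloc_bound)
 note [measurable] = LlocD(1)[OF assms]
 show "Lloc M (%s. \<Sum>j\<in>UNIV. \<bar>n j s\<bar>)" by (intro Lloc_sum Lloc_abs assms) simp
 have [measurable]: "(%s. \<chi> j. n j s) \<in> borel_measurable borel" by (intro borel_measurable_vec_lambda) measurable
 show "(%s. norm (\<chi> j. n j s)) \<in> borel_measurable borel" by measurable
 show "\<bar>norm (\<chi> j. n j s)\<bar> <= \<bar>\<Sum>j\<in>UNIV. \<bar>n j s\<bar>\<bar>" for s
  using norm_le_l1_cart[of "\<chi> j. n j s"] by simp
qed

context riccati_setting begin

abbreviation E :: "'m => 'm => real => real" where "E \<equiv> E_entry K (transpose \<beta>)"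
text \<open>The operator norm of the kernel \<open>E\<close>, extended by 0.\<close>
definition Eop :: "real => real" where "Eop u = (if 0 <= u then op_norm (\<chi> i j. E i j u) else 0)"

lemma E_Lloc: "Lloc lborel (E i j)" by (rule Lloc_E_entry[OF adm])

lemma Eop_props: "Eop \<in> borel_measurable borel" "0 <= Eop u" "u < 0 ==> Eop u = 0"
proof -
 have [measurable]: "(%u. op_norm (\<chi> i j. E i j u)) \<in> borel_measurable borel"
  by (intro borel_measurable_op_norm LlocD(1)[OF E_Lloc])
 show "Eop \<in> borel_measurable borel" unfolding Eop_def[abs_def] by measurable
qed (auto simp: Eop_def op_norm_nonneg)

lemma op_norm_E: "op_norm (\<chi> i j. E i j u) = Eop u"
proof (cases "0 <= u")
 case False
 then have "(\<chi> i j. E i j u) = 0" using LlocD(2)[OF E_Lloc] by (simp add: vec_eq_iff)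
 moreover have "op_norm (0 :: real ^ 'm ^ 'm) = 0"
 proof -
  have "(*v) (0 :: real ^ 'm ^ 'm) = (%x. 0)" by (simp add: fun_eq_iff)
  then show ?thesis unfolding op_norm_def by (simp only: onorm_zero)
 qed
 ultimately show ?thesis using False by (simp add: Eop_def)
qed (simp add: Eop_def)

lemma Lp_power_E: "Lp_power r T (%t. op_norm (resolvent_E K (transpose \<beta>) t)) = nnI lborel T (%u. Eop u powr r)"
 unfolding Lp_power_def
 by (rule nn_integral_cong_AE, use AE_resolvent_E[OF adm, of "transpose \<beta>"] in eventually_elim)
  (auto split: split_indicator simp: op_norm_E)

lemma linear_solution_norm:
 assumes n: "!!i. Lloc M (n i)" and y: "!!i. L2loc (y i)" and eq: "!!i. solves i (y i) (n i) (lin y i)"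
 shows "AL t. ennreal (norm (\<chi> i. y i t)) <= (\<integral>\<^sup>+s. ennreal (Eop (t - s) * norm (\<chi> j. n j s)) \<partial>M)"
proof -
 have "AL t. \<forall>i. y i t = (\<Sum>j\<in>UNIV. rconv (E i j) M (n j) t)"
  unfolding E_entry_def[abs_def]
 proof (rule linear_Volterra_resolvent[where B="%i l. transpose \<beta> $ i $ l"])
  show "AL t. y i t = rconv (k i) M (n i) t + rconv (k i) lborel (%s. \<Sum>l\<in>UNIV. transpose \<beta> $ i $ l * y l s) t" for i
   using eq[of i] by (simp add: solves_def lin_def[abs_def] transpose_def)
 qed (intro k_L2loc resolvent_R_entries[OF adm] n y)+
 then show ?thesis using norm_matrix_conv_le[where e=E and n=n, OF E_Lloc n]
  by eventually_elim (simp add: op_norm_E)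
qed

text \<open>By \<open>riccati_bounds\<close> the norm of \<open>\<psi>\<close> is at most the sum of the norms of
\<open>z\<close> and \<open>y\<close>. These are convolutions with \<open>E\<close> of sources of total mass
at most \<open>\<bar>\<mu>\<bar> + \<Sum>q_i \<parallel>y\<parallel>\<^sup>2\<close> and
\<open>\<bar>\<mu>\<bar>\<close>, where \<open>\<parallel>y\<parallel>\<^sub>2 \<le> \<bar>\<mu>\<bar> \<parallel>E\<parallel>\<^sub>2\<close>
by the same argument. If \<open>Im \<mu> = 0\<close>, then \<open>y = 0\<close>, and the mass is at most
\<open>\<bar>\<mu>\<bar>\<close>.\<close>
theorem Lp_norm_bound:
 assumes sol: "riccati_solution \<beta> \<sigma> K \<mu> \<psi>" and T: "0 < T" and r: "1 <= r"
 shows "Lp_norm r T \<psi>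
     <= 2 * total_variation \<mu> {0..T} * Lp_norm_mat r T (resolvent_E K (transpose \<beta>))
      + ennreal (\<Sum>i\<in>UNIV. (\<sigma> $ i)\<^sup>2 / 2) * (total_variation \<mu> {0..T})\<^sup>2
       * Lp_norm_mat r T (resolvent_E K (transpose \<beta>))
       * (Lp_norm_mat 2 T (resolvent_E K (transpose \<beta>)))\<^sup>2" (is ?thesis1)
  and "Im_measure_zero \<mu> ==> Lp_norm r T \<psi> <= total_variation \<mu> {0..T} * Lp_norm_mat r T (resolvent_E K (transpose \<beta>))" (is "_ ==> ?thesis2")
proof -
 let ?B = "%t N. \<integral>\<^sup>+(s::real). ennreal (Eop (t - s) * N s) \<partial>M"
 let ?A = "resolvent_E K (transpose \<beta>)"
 let ?H = "%y s. norm (\<chi> i. y i s)"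
 let ?G = "%s. \<chi> j. \<rho> j s"
 let ?F = "%y s. ennreal ((?H y s)\<^sup>2) * indicator {0..T} s * ennreal (d0 s)"
 let ?a = "re_part \<psi>" and ?c = "im_part \<psi>" and ?TV = "total_variation \<mu> {0..T}"
 note s = solution_real_form[OF sol]
 obtain y z where y: "!!i. L2loc (y i)" "!!i. solves i (y i) (%s. \<bar>im_density i s\<bar>) (%s. lin y i s + 0)"
  and z: "!!i. L2loc (z i)" "!!i. solves i (z i) (\<rho> i) (%s. lin z i s + q i * (y i s)\<^sup>2)"
  using majorants_exist by blast
 note [measurable] = L2locD(1)[OF y(1)] LlocD(1)[OF Lloc_im_density]
 have bnds: "AL t. \<forall>i. ?a i t <= 0 & - z i t <= ?a i t & \<bar>?c i t\<bar> <= y i t & 0 <= y i t & 0 <= z i t"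
 proof (rule riccati_bounds[OF s(1,2,1,2,4,5) _ y z])
  show "AL s. ?a i s <= 0 & (0 <= ?a i s --> ?a i s = 0) & \<bar>?c i s\<bar> <= \<bar>?c i s\<bar>
    & (0 <= ?c i s --> 0 <= ?c i s) & (?c i s <= 0 --> ?c i s <= 0)" for i
   using s(3)
  proof eventually_elim
   case (elim t)
   show ?case using elim[rule_format, of i] by simp
  qed
 qed
 have qy: "Lloc lborel (%s. q i * (y i s)\<^sup>2)" for i
  using Lloc_mult_L2loc[OF y(1) y(1), of i i] by (intro Lloc_cmult) (auto simp: power2_eq_square)
 define nz where "nz i s = \<rho> i s + q i * (y i s)\<^sup>2 * d0 s" for i s
 have nzL: "Lloc M (nz i)" for i
  unfolding nz_def using Lloc_lborel_density[OF qy[of i]] by (intro Lloc_add Lloc_densities) auto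
 have nz0: "0 <= nz i s" for i s
  unfolding nz_def by (intro add_nonneg_nonneg mult_nonneg_nonneg densities_nonneg q_nonneg) auto
 have zeq: "solves i (z i) (nz i) (lin z i)" for i
 proof -
  have "AL t. rconv (k i) lborel (%s. lin z i s + q i * (y i s)\<^sup>2) t = rconv (k i) lborel (lin z i) t + rconv (k i) lborel (%s. q i * (y i s)\<^sup>2) t"
   by (rule lborel.AE_rconv_add[OF k_Lloc Lloc_lin[where x=z, OF z(1)] qy])
  moreover have "rconv (k i) lborel (%s. q i * (y i s)\<^sup>2) t = rconv (k i) M (%s. q i * (y i s)\<^sup>2 * d0 s) t" for t
   by (rule rconv_lborel_density[symmetric]) (use qy in auto)
  moreover have "AL t. rconv (k i) M (nz i) t = rconv (k i) M (\<rho> i) t + rconv (k i) M (%s. q i * (y i s)\<^sup>2 * d0 s) t"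
   unfolding nz_def by (rule AE_rconv_add[OF k_Lloc Lloc_densities(1) Lloc_lborel_density[OF qy]])
  ultimately show ?thesis using z(2)[of i] unfolding solves_def by (auto elim: eventually_elim2)
 qed
 let ?ni = "%s. norm (\<chi> j. \<bar>im_density j s\<bar>)" and ?nz = "%s. norm (\<chi> j. nz j s)"
 have niL: "Lloc M ?ni" by (intro Lloc_vec_norm Lloc_abs Lloc_im_density)
 have nznL: "Lloc M ?nz" by (intro Lloc_vec_norm nzL)
 have yn: "AL t. ennreal (norm (\<chi> i. y i t)) <= (\<integral>\<^sup>+s. ennreal (Eop (t - s) * ?ni s) \<partial>M)"
  by (rule linear_solution_norm[OF Lloc_abs[OF Lloc_im_density] y(1)]) (use y(2) in simp)
 have zn: "AL t. ennreal (norm (\<chi> i. z i t)) <= (\<integral>\<^sup>+s. ennreal (Eop (t - s) * ?nz s) \<partial>M)"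
  by (rule linear_solution_norm[OF nzL z(1) zeq])
 note [measurable] = LlocD(1)[OF niL] LlocD(1)[OF nznL] Eop_props(1)
 define N where "N s = ?ni s + ?nz s" for s
 have NL: "Lloc M N" unfolding N_def by (intro Lloc_add niL nznL) simp
 have \<psi>n: "AL t. 0 <= t --> t <= T --> ennreal (norm (\<psi> t)) <= (?B t N)"
  using yn zn bnds
 proof eventually_elim
  case (elim t)
  show ?case
  proof (intro impI)
   assume t: "0 <= t"
   have "norm (\<psi> t) <= norm (\<chi> i. Re (\<psi> t $ i)) + norm (\<chi> i. Im (\<psi> t $ i))" by (rule norm_complex_vec_le)
   also have "... <= norm (\<chi> i. z i t) + norm (\<chi> i. y i t)"
   proof (intro add_mono sqrt_sum_mono_norm)
    fix i
    have "?a i t = Re (\<psi> t $ i)" "?c i t = Im (\<psi> t $ i)" using t by (auto simp: re_part_def im_part_def)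
    then show "\<bar>(\<chi> i. Re (\<psi> t $ i)) $ i\<bar> <= \<bar>(\<chi> i. z i t) $ i\<bar>" "\<bar>(\<chi> i. Im (\<psi> t $ i)) $ i\<bar> <= \<bar>(\<chi> i. y i t) $ i\<bar>"
     using elim(3)[rule_format, of i] by auto
   qed
   finally have "ennreal (norm (\<psi> t)) <= ennreal (norm (\<chi> i. z i t) + norm (\<chi> i. y i t))" by (rule ennreal_leI)
   also have "... = ennreal (norm (\<chi> i. y i t)) + ennreal (norm (\<chi> i. z i t))" by (simp add: add.commute)
   also have "... <= (\<integral>\<^sup>+s. ennreal (Eop (t - s) * ?ni s) \<partial>M) + (\<integral>\<^sup>+s. ennreal (Eop (t - s) * ?nz s) \<partial>M)"
    using elim by (intro add_mono) auto
   also have "... = (\<integral>\<^sup>+s. ennreal (Eop (t - s) * ?ni s) + ennreal (Eop (t - s) * ?nz s) \<partial>M)"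
    by (rule nn_integral_add[symmetric]) measurable
   also have "... = (?B t N)"
    unfolding N_def distrib_left by (intro nn_integral_cong ennreal_plus[symmetric]) (auto simp: Eop_props)
   finally show "ennreal (norm (\<psi> t)) <= (?B t N)" .
  qed
 qed
 let ?X = "%r. nnI lborel T (%u. Eop u powr r)"
 have N0: "0 <= N s" for s by (simp add: N_def)
 obtain A where A: "nnI M T N = ennreal A" "0 <= A"
  using LlocD(3)[OF NL, of T] N0 by (cases "nnI M T N") auto
 have "Lp_power r T (%t. norm (\<psi> t)) <= ennreal (A powr r) * ?X r"
  unfolding Lp_power_def
  by (rule Young_conv_powr[OF Eop_props NL N0 _ \<psi>n r A]) auto
 then have "Lp_norm r T \<psi> <= ennroot r (ennreal (A powr r) * ?X r)"
  unfolding Lp_norm_def using r by (intro ennroot_mono) auto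
 also have "... = ennreal A * Lp_norm_mat r T ?A"
  unfolding Lp_norm_mat_def Lp_power_E using r A by (intro ennroot_cmult) auto
 finally have main: "Lp_norm r T \<psi> <= ennreal A * Lp_norm_mat r T ?A" .
 obtain I where I: "nnI M T (%s. ?ni s) = ennreal I" "0 <= I"
  using LlocD(3)[OF niL, of T] by (cases "nnI M T (%s. ?ni s)") auto
 have Y2: "nnI lborel T (%t. (norm (\<chi> i. y i t))\<^sup>2) <= ennreal (I\<^sup>2) * ?X 2"
 proof -
  have "nnI lborel T (%t. norm (\<chi> i. y i t) powr 2) <= ennreal (I powr 2) * ?X 2"
   by (rule Young_conv_powr[OF Eop_props niL _ _ _ _ I]) (use yn in \<open>auto elim: eventually_mono\<close>)
  then show ?thesis using I by simp
 qed
 let ?Q = "\<Sum>i\<in>UNIV. (\<sigma> $ i)\<^sup>2 / 2"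
 have nz_le: "?nz s <= norm (?G s) + ?Q * (?H y s)\<^sup>2 * d0 s" for s
 proof -
  have "(\<chi> j. nz j s) = (?G s) + (\<chi> j. q j * (y j s)\<^sup>2 * d0 s)" by (simp add: vec_eq_iff nz_def)
  then have "?nz s <= norm (?G s) + norm (\<chi> j. q j * (y j s)\<^sup>2 * d0 s)" by (simp only: norm_triangle_ineq)
  also have "norm (\<chi> j. q j * (y j s)\<^sup>2 * d0 s) <= (\<Sum>j\<in>UNIV. q j * (y j s)\<^sup>2 * d0 s)"
   using norm_le_l1_cart[of "\<chi> j. q j * (y j s)\<^sup>2 * d0 s"] by (simp add: abs_mult q_nonneg densities_nonneg)
  also have "... <= (\<Sum>j\<in>UNIV. q j * (?H y s)\<^sup>2 * d0 s)"
  proof (intro sum_mono mult_right_mono mult_left_mono q_nonneg densities_nonneg)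
   fix j
   have "\<bar>y j s\<bar> <= norm (\<chi> i. y i s)" using component_le_norm_cart[of "\<chi> i. y i s" j] by simp
   then show "(y j s)\<^sup>2 <= (?H y s)\<^sup>2" by (simp add: abs_le_square_iff[symmetric])
  qed
  also have "... = ?Q * (?H y s)\<^sup>2 * d0 s" by (simp add: q_def sum_distrib_right)
  finally show ?thesis by simp
 qed
 have [measurable]: "(%s. norm (\<chi> i. y i s)) \<in> borel_measurable borel" "(%s. norm (\<chi> i. \<rho> i s)) \<in> borel_measurable borel"
  by (intro measurable_compose[OF _ borel_measurable_norm] borel_measurable_vec_lambda; measurable)+
 have Q0: "0 <= ?Q" by (intro sum_nonneg) auto
 have R: "nnI M T (%s. norm (?G s)) <= ?TV"
 proof (rule order_trans[OF _ density_vec_le_total_variation], intro nn_integral_mono mult_right_mono ennreal_leI)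
  show "norm (?G s) <= norm (density_vec s)" for s
   unfolding norm_vec_def density_vec_def
  proof (intro L2_set_mono)
   show "norm ((?G s) $ i) <= norm ((\<chi> j. Complex (- \<rho> j s) (im_density j s)) $ i)" for i
    using abs_Re_le_cmod[of "Complex (- \<rho> i s) (im_density i s)"] by simp
  qed simp
 qed simp
 have ITV: "ennreal I <= ?TV"
  unfolding I(1)[symmetric]
 proof (rule order_trans[OF _ density_vec_le_total_variation], intro nn_integral_mono mult_right_mono ennreal_leI)
  show "?ni s <= norm (density_vec s)" for s
   unfolding norm_vec_def density_vec_def
  proof (intro L2_set_mono)
   show "norm ((\<chi> j. \<bar>im_density j s\<bar>) $ i) <= norm ((\<chi> j. Complex (- \<rho> j s) (im_density j s)) $ i)" for i
    using abs_Im_le_cmod[of "Complex (- \<rho> i s) (im_density i s)"] by simp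
  qed simp
 qed simp
 have Abound: "ennreal A <= ennreal I + ?TV + ennreal ?Q * (ennreal (I\<^sup>2) * ?X 2)"
 proof -
  have "ennreal A <= (\<integral>\<^sup>+s. ennreal (?ni s) * indicator {0..T} s + (ennreal (norm (?G s)) * indicator {0..T} s
    + ennreal ?Q * (?F y s)) \<partial>M)"
   unfolding A(1)[symmetric]
  proof (intro nn_integral_mono)
   fix s
   have "ennreal (N s) <= ennreal (?ni s + (norm (?G s) + ?Q * (?H y s)\<^sup>2 * d0 s))"
    unfolding N_def using nz_le[of s] by (intro ennreal_leI) simp
   also have "... = ennreal (?ni s) + (ennreal (norm (?G s)) + ennreal ?Q * (ennreal ((?H y s)\<^sup>2) * ennreal (d0 s)))"
    using Q0 densities_nonneg(4)[of s]
    by (simp add: ennreal_plus ennreal_mult mult.assoc)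
   finally show "ennreal (N s) * indicator {0..T} s <= ennreal (?ni s) * indicator {0..T} s + (ennreal (norm (?G s)) * indicator {0..T} s
    + ennreal ?Q * (?F y s))"
    by (auto split: split_indicator)
  qed
  also have "... = ennreal I + (nnI M T (%s. norm (?G s))
    + ennreal ?Q * (\<integral>\<^sup>+s. ?F y s \<partial>M))"
   by (subst nn_integral_add, simp, simp, subst nn_integral_add, simp, simp) (simp add: I nn_integral_cmult)
  also have "(\<integral>\<^sup>+s. ?F y s \<partial>M)
    = (NN s. ennreal ((?H y s)\<^sup>2) * indicator {0..T} s * indicator {0..} s)"
   by (rule nn_integral_lborel_eq[symmetric]) measurable
  also have "... = nnI lborel T (%s. (?H y s)\<^sup>2)"
   by (intro nn_integral_cong) (auto split: split_indicator)
  finally have "ennreal A <= ennreal I + (nnI M T (%s. norm (?G s))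
    + ennreal ?Q * nnI lborel T (%s. (?H y s)\<^sup>2))" .
  also have "... <= ennreal I + (?TV + ennreal ?Q * (ennreal (I\<^sup>2) * ?X 2))"
   by (intro add_mono mult_left_mono R Y2) auto
  finally show ?thesis by (simp add: add.assoc)
 qed
 have X2: "(Lp_norm_mat 2 T ?A)\<^sup>2 = ?X 2"
  unfolding Lp_norm_mat_def ennroot_2_square Lp_power_E ..
 have I2: "ennreal (I\<^sup>2) = (ennreal I)\<^sup>2" using I by (simp add: ennreal_power)
 let ?P = "Lp_norm_mat r T ?A"
 have "ennreal A <= ?TV + ?TV + ennreal ?Q * (?TV\<^sup>2 * ?X 2)"
  by (rule order_trans[OF Abound], intro add_mono mult_left_mono mult_right_mono ITV)
   (auto simp: I2 intro!: power_mono_ennreal ITV)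
 then have "ennreal A * ?P <= (?TV + ?TV + ennreal ?Q * (?TV\<^sup>2 * ?X 2)) * ?P" by (rule mult_right_mono) simp
 also have "... = 2 * ?TV * ?P + ennreal ?Q * ?TV\<^sup>2 * ?P * ?X 2"
  by (simp add: distrib_right distrib_left mult_ac mult_2)
 finally show ?thesis1 using main unfolding X2 by (rule order_trans[rotated])
 assume "Im_measure_zero \<mu>"
 then have "AE s in M. \<forall>j. \<pi> j s = 0 & \<upsilon> j s = 0" by (rule Im_zero)
 then have "AE s in M. ennreal (?ni s) * indicator {0..T} s = 0"
 proof eventually_elim
  case (elim s)
  then have "(\<chi> j. \<bar>im_density j s\<bar>) = (0 :: real ^ 'm)" by (simp add: vec_eq_iff im_density_def)
  then show ?case by simp
 qed
 then have "ennreal I = 0" unfolding I(1)[symmetric] by (subst nn_integral_0_iff_AE) auto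
 then have "I = 0" using I by simp
 then have "ennreal A <= ?TV" using Abound by simp
 then have "ennreal A * ?P <= ?TV * ?P" by (rule mult_right_mono) simp
 then show ?thesis2 using main by (rule order_trans[rotated])
qed

end

section \<open>The Sobolev--Slobodeckij estimate\<close>

lemma ennroot_add_le:
 assumes "1 <= r"
 shows "ennroot r (x + y) <= ennroot r x + ennroot r y"
proof (cases "x = \<infinity> \<or> y = \<infinity>")
 case True
 then show ?thesis by (auto simp: ennroot_def)
next
 case False
 define u v where "u = enn2real x" and "v = enn2real y"
 have uv: "x = ennreal u" "y = ennreal v" "0 <= u" "0 <= v"
  using False by (auto simp: u_def v_def less_top)
 define U V where "U = u powr (1 / r)" and "V = v powr (1 / r)"
 have UV: "0 <= U" "0 <= V" "U powr r = u" "V powr r = v"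
  using assms uv by (auto simp: U_def V_def powr_powr)
 \<comment> \<open>on \<open>[0,1]\<close> the power function of exponent \<open>r \<ge> 1\<close> lies below the identity\<close>
 have scaled: "z powr r <= z * (U + V) powr (r - 1)" if "0 <= z" "z <= U + V" for z
 proof (cases "z = 0")
  case False
  then have "z powr r = z * z powr (r - 1)" using that by (simp add: powr_mult_base)
  also have "... <= z * (U + V) powr (r - 1)"
   using that assms by (intro mult_left_mono powr_mono2) auto
  finally show ?thesis .
 qed simp
 have "u + v <= (U + V) * (U + V) powr (r - 1)"
  using scaled[of U] scaled[of V] UV by (simp add: distrib_right)
 also have "... = (U + V) powr r" using UV by (simp add: powr_mult_base)
 finally have "(u + v) powr (1 / r) <= ((U + V) powr r) powr (1 / r)"
  using assms uv by (intro powr_mono2) auto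
 also have "... = U + V" using UV assms by (simp add: powr_powr)
 finally have "ennreal ((u + v) powr (1 / r)) <= ennreal U + ennreal V"
  using UV by (simp add: ennreal_plus[symmetric] ennreal_leI del: ennreal_plus)
 moreover have "ennroot r (x + y) = ennreal ((u + v) powr (1 / r))"
  using uv by (simp add: ennroot_def flip: ennreal_plus)
 moreover have "ennroot r x = ennreal U" "ennroot r y = ennreal V" using uv by (simp_all add: ennroot_def U_def V_def)
 ultimately show ?thesis by simp
qed

lemma nn_integral_negative_tail:
 assumes x: "0 < x" and r: "0 < r"
 shows "(NN y. ennreal (1 / (x - y) powr (1 + r)) * indicator {..0} y) = ennreal (x powr (- r) / r)"
proof -
 let ?F = "%y. - ((x + y) powr (- r) / r)"
 have "(NN y. ennreal (1 / (x - y) powr (1 + r)) * indicator {..0} y)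
   = (NN y. ennreal (1 / (x + y) powr (1 + r)) * indicator {0..} y)"
  by (subst nn_integral_translate_reflect(2)[symmetric, of _ 0]) (auto intro!: nn_integral_cong split: split_indicator)
 also have "... = ennreal (0 - ?F 0)"
 proof (rule nn_integral_FTC_atLeast)
  show "DERIV ?F y :> 1 / (x + y) powr (1 + r)" if "0 <= y" for y
  proof -
   have "DERIV ?F y :> - ((- r) * (x + y) powr (- r - 1) / r)"
    using that x by (auto intro!: derivative_eq_intros)
   moreover have "- ((- r) * (x + y) powr (- r - 1) / r) = 1 / (x + y) powr (1 + r)"
   proof -
    have "- r - 1 = - (1 + r)" by simp
    then show ?thesis using r by (simp only: powr_minus_divide) simp
   qed
   ultimately show ?thesis by simp
  qed
  have "filterlim (%y. x + y) at_top at_top" by (rule filterlim_tendsto_add_at_top[OF tendsto_const filterlim_ident])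
  then have "((%y. (x + y) powr (- r)) \<longlongrightarrow> 0) at_top" using r by (intro tendsto_neg_powr) auto
  then have "((%y. - ((x + y) powr (- r) / r)) \<longlongrightarrow> - (0 / r)) at_top" using r by (intro tendsto_intros) auto
  then show "(?F \<longlongrightarrow> 0) at_top" by simp
 qed auto
 finally show ?thesis by simp
qed

text \<open>Jensen in \<open>u\<close> for fixed \<open>t\<close> and \<open>s\<close>, then Fubini and a translation of
both variables by \<open>u\<close>, under which \<open>\<bar>t - s\<bar>\<close> is invariant. The shifted
variables range over negative numbers too, hence the integrals over \<open>{..T}\<close> on the right.\<close>
lemma (in borel_sigma_finite) gagliardo_conv_le:
 fixes \<kappa> D :: "real => real => real" and N :: "real => real"
 assumes \<kappa>: "(%(x, y). \<kappa> x y) \<in> borel_measurable borel" "!!x y. 0 <= \<kappa> x y"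
  "!!x y. x <= 0 ==> y <= 0 ==> \<kappa> x y = 0"
  and N: "Lloc M N" "!!s. 0 <= N s" and p: "1 <= p"
  and D: "!!t s. 0 <= D t s"
   "AL t. AL s. 0 <= t --> 0 <= s --> ennreal (D t s) <= (\<integral>\<^sup>+u. ennreal (\<kappa> (t - u) (s - u) * N u) \<partial>M)"
  and C: "nnI M T N = ennreal C" "0 <= C"
 shows "gagliardo_power \<eta> p T D
   <= ennreal (C powr p) * (NN x. (NN y. ennreal (\<kappa> x y powr p / \<bar>x - y\<bar> powr (1 + \<eta> * p)) * indicator {..T} y) * indicator {..T} x)"
proof -
 let ?A = "%J t. NN s. J t s * indicator {0..T} s * indicator {0..T} t"
 let ?H = "%J t. NN s. ennreal (C powr (p - 1)) * J t s * indicator {0..T} s"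
 let ?F = "%D t s. D t s powr p / \<bar>t - s\<bar> powr (1 + \<eta> * p)"
 note [measurable] = LlocD(1)[OF N(1)]
 have [measurable]: "(%z. \<kappa> (f z) (g z)) \<in> borel_measurable L"
  if [measurable]: "f \<in> borel_measurable L" "g \<in> borel_measurable L" for f g and L :: "'z measure"
 proof -
  have "(%z. (f z, g z)) \<in> L \<rightarrow>\<^sub>M borel \<Otimes>\<^sub>M borel" by measurable
  then show ?thesis using measurable_compose[OF _ \<kappa>(1), of "%z. (f z, g z)" L] by (simp add: borel_prod)
 qed
 define W where "W x y = \<kappa> x y powr p / \<bar>x - y\<bar> powr (1 + \<eta> * p)" for x y
 define \<Gamma> where "\<Gamma> = (NN x. (NN y. ennreal (W x y) * indicator {..T} y) * indicator {..T} x)"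
 let ?n = "%u. N u * indicator {0..T} u"
 have [measurable]: "(%z. W (f z) (g z)) \<in> borel_measurable L"
  if [measurable]: "f \<in> borel_measurable L" "g \<in> borel_measurable L" for f g and L :: "'z measure"
  unfolding W_def by measurable
 have W0: "0 <= W x y" for x y by (simp add: W_def)
 have Cn: "(\<integral>\<^sup>+u. ennreal (?n u) \<partial>M) = ennreal C"
  unfolding C(1)[symmetric] by (intro nn_integral_cong) (auto split: split_indicator)
 interpret P: pair_sigma_finite lborel M ..
 have "gagliardo_power \<eta> p T D
   <= (NN t. (NN s. ennreal (C powr (p - 1)) * (\<integral>\<^sup>+u. ennreal (W (t - u) (s - u)) * ennreal (?n u) \<partial>M) * indicator {0..T} s) * indicator {0..T} t)"
  unfolding gagliardo_power_def
 proof (rule nn_integral_mono_AE, use D(2) in eventually_elim)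
  case (elim t)
  have "(\<integral>\<^sup>+s\<in>{0..T}. ennreal (?F D t s) \<partial>lborel)
   <= (NN s. ennreal (C powr (p - 1)) * (\<integral>\<^sup>+u. ennreal (W (t - u) (s - u)) * ennreal (?n u) \<partial>M) * indicator {0..T} s)" if t: "0 <= t" "t <= T"
  proof (rule nn_integral_mono_AE, use elim in eventually_elim)
   case (elim s)
   have "ennreal (?F D t s) <= ennreal (C powr (p - 1)) * (\<integral>\<^sup>+u. ennreal (W (t - u) (s - u)) * ennreal (?n u) \<partial>M)" if s: "0 <= s" "s <= T"
   proof -
    let ?c = "1 / \<bar>t - s\<bar> powr (1 + \<eta> * p)"
    have "ennreal (D t s) <= (\<integral>\<^sup>+u. ennreal (\<kappa> (t - u) (s - u) * N u) \<partial>M)" using elim t s by simp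
    also have "... = (\<integral>\<^sup>+u. ennreal (\<kappa> (t - u) (s - u) * ?n u) \<partial>M)"
     using t s \<kappa>(3) LlocD(2)[OF N(1)] by (intro nn_integral_cong) (auto split: split_indicator)
    finally have "ennreal (D t s powr p) <= ennreal (C powr (p - 1)) * (\<integral>\<^sup>+u. ennreal (\<kappa> (t - u) (s - u) powr p * ?n u) \<partial>M)"
     by (intro Jensen_nn_integral_powr \<kappa> D C Cn p) (auto simp: N)
    then have "ennreal (D t s powr p) * ennreal ?c <= ennreal (C powr (p - 1)) * (\<integral>\<^sup>+u. ennreal (\<kappa> (t - u) (s - u) powr p * ?n u) \<partial>M) * ennreal ?c"
     by (rule mult_right_mono) simp
    also have "... = ennreal (C powr (p - 1)) * (\<integral>\<^sup>+u. ennreal (W (t - u) (s - u)) * ennreal (?n u) \<partial>M)"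
    proof -
     have "(\<integral>\<^sup>+u. ennreal (\<kappa> (t - u) (s - u) powr p * ?n u) \<partial>M) * ennreal ?c = (\<integral>\<^sup>+u. ennreal (\<kappa> (t - u) (s - u) powr p * ?n u) * ennreal ?c \<partial>M)"
      by (rule nn_integral_multc[symmetric]) measurable
     also have "... = (\<integral>\<^sup>+u. ennreal (W (t - u) (s - u)) * ennreal (?n u) \<partial>M)"
     proof (intro nn_integral_cong)
      fix u
      have "W (t - u) (s - u) * ?n u = \<kappa> (t - u) (s - u) powr p * ?n u * ?c" by (simp add: W_def)
      moreover have "0 <= ?n u" using N(2) by simp
      ultimately show "ennreal (\<kappa> (t - u) (s - u) powr p * ?n u) * ennreal ?c = ennreal (W (t - u) (s - u)) * ennreal (?n u)"
       using W0 by (metis divide_nonneg_nonneg ennreal_mult' ennreal_mult'' powr_ge_zero zero_le_one)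
     qed
     finally show ?thesis by (simp add: mult.assoc)
    qed
    also have "ennreal (D t s powr p) * ennreal ?c = ennreal (?F D t s)"
     by (simp flip: ennreal_mult)
    finally show ?thesis .
   qed
   then show ?case by (auto split: split_indicator)
  qed
  then show ?case by (auto split: split_indicator)
 qed
 also have "... = ennreal (C powr (p - 1)) * (NN t. (NN s. (\<integral>\<^sup>+u. ennreal (W (t - u) (s - u)) * ennreal (?n u) * indicator {0..T} s * indicator {0..T} t \<partial>M)))"
 proof -
  define J where "J t s = (\<integral>\<^sup>+u. ennreal (W (t - u) (s - u)) * ennreal (?n u) \<partial>M)" for t s
  have [measurable]: "(%(t, s). J t s) \<in> borel_measurable (borel \<Otimes>\<^sub>M borel)" unfolding J_def by measurable
  have mJ [measurable]: "J t \<in> borel_measurable borel" for t unfolding J_def by measurable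
  have J: "(\<integral>\<^sup>+u. ennreal (W (t - u) (s - u)) * ennreal (?n u) * indicator {0..T} s * indicator {0..T} t \<partial>M) = J t s * indicator {0..T} s * indicator {0..T} t" for t s
   unfolding J_def by (simp add: nn_integral_multc)
  have "(?H J t) = ennreal (C powr (p - 1)) * (NN s. J t s * indicator {0..T} s)" for t
   by (simp add: nn_integral_cmult mult.assoc)
  moreover have "(?A J t) = (NN s. J t s * indicator {0..T} s) * indicator {0..T} t" for t
   by (intro nn_integral_multc) measurable
  ultimately have "(NN t. (?H J t) * indicator {0..T} t)
    = ennreal (C powr (p - 1)) * (NN t. (?A J t))"
   by (simp add: nn_integral_cmult mult.assoc)
  then show ?thesis unfolding J by (simp only: J_def)
 qed
 also have "(NN t. (NN s. (\<integral>\<^sup>+u. ennreal (W (t - u) (s - u)) * ennreal (?n u) * indicator {0..T} s * indicator {0..T} t \<partial>M)))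
   = (NN t. (\<integral>\<^sup>+u. (NN s. ennreal (W (t - u) (s - u)) * ennreal (?n u) * indicator {0..T} s * indicator {0..T} t) \<partial>M))"
  by (intro nn_integral_cong, rule P.Fubini'[symmetric]) measurable
 also have "... = (\<integral>\<^sup>+u. (NN t. (NN s. ennreal (W (t - u) (s - u)) * ennreal (?n u) * indicator {0..T} s * indicator {0..T} t)) \<partial>M)"
  by (rule P.Fubini'[symmetric]) measurable
 also have "... <= (\<integral>\<^sup>+u. ennreal (?n u) * \<Gamma> \<partial>M)"
 proof (intro nn_integral_mono)
  fix u
  let ?G = "%x. NN y. ennreal (W x y) * indicator {..T} y"
  show "(NN t. (NN s. ennreal (W (t - u) (s - u)) * ennreal (?n u) * indicator {0..T} s * indicator {0..T} t)) <= ennreal (?n u) * \<Gamma>"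
  proof (cases "0 <= u")
   case True
   have "(NN t. (NN s. ennreal (W (t - u) (s - u)) * ennreal (?n u) * indicator {0..T} s * indicator {0..T} t))
     <= (NN t. (NN s. ennreal (?n u) * (ennreal (W (t - u) (s - u)) * indicator {..T} (s - u)) * indicator {..T} (t - u)))"
    using True by (intro nn_integral_mono) (auto split: split_indicator simp: mult.commute)
   also have "... = (NN t. ennreal (?n u) * (?G (t - u) * indicator {..T} (t - u)))"
   proof (intro nn_integral_cong)
    fix t
    have "(NN s. ennreal (W (t - u) (s - u)) * indicator {..T} (s - u)) = ?G (t - u)"
     using nn_integral_translate_reflect(1)[of "%y. ennreal (W (t - u) y) * indicator {..T} y" u] by simp
    then show "(NN s. ennreal (?n u) * (ennreal (W (t - u) (s - u)) * indicator {..T} (s - u)) * indicator {..T} (t - u)) = ennreal (?n u) * (?G (t - u) * indicator {..T} (t - u))"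
     by (subst nn_integral_multc, measurable, subst nn_integral_cmult, measurable) (simp add: mult.assoc)
   qed
   also have "... = ennreal (?n u) * (NN t. ?G (t - u) * indicator {..T} (t - u))"
    by (intro nn_integral_cmult) measurable
   also have "(NN t. ?G (t - u) * indicator {..T} (t - u)) = \<Gamma>"
    using nn_integral_translate_reflect(1)[of "%x. ?G x * indicator {..T} x" u] unfolding \<Gamma>_def by simp
   finally show ?thesis .
  qed (simp add: LlocD(2)[OF N(1)])
 qed
 also have "... = ennreal C * \<Gamma>" by (subst nn_integral_multc) (auto simp: Cn)
 finally have step: "(!!x y :: ennreal. x <= y ==> ennreal (C powr (p - 1)) * x <= ennreal (C powr (p - 1)) * y) ==>
  gagliardo_power \<eta> p T D <= ennreal (C powr (p - 1)) * (ennreal C * \<Gamma>)" .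
 have "gagliardo_power \<eta> p T D <= ennreal (C powr (p - 1)) * (ennreal C * \<Gamma>)"
  by (rule step) (rule mult_left_mono, auto)
 also have "... = ennreal (C powr p) * \<Gamma>"
 proof -
  have "C powr (p - 1) * C = C powr p" using C(2) by (cases "C = 0") (simp_all add: powr_mult_base mult.commute)
  then show ?thesis using C(2) by (simp add: mult.assoc[symmetric] flip: ennreal_mult)
 qed
 finally show ?thesis unfolding \<Gamma>_def W_def .
qed

text \<open>The kernel, extended by 0, jumps at 0. The region \<open>y \<le> 0 < x\<close> contributes \<open>k x powr p\<close>
times the integral of \<open>(x - y) powr (- 1 - \<eta> p)\<close> over \<open>y \<le> 0\<close>, that is,
the weight \<open>x powr (- \<eta> p) / (\<eta> p)\<close>; the region \<open>x \<le> 0 < y\<close> is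
symmetric.\<close>
lemma kernel_difference_power_le:
 fixes k :: "'m::finite => real => real" and A :: "real => real" and B :: "real => real => real"
 assumes k [measurable]: "!!j. k j \<in> borel_measurable borel" and k0: "!!j x. x <= 0 ==> k j x = 0"
  and A: "!!j x. 0 < x ==> \<bar>k j x\<bar> <= A x" and B: "!!j x y. 0 < x ==> 0 < y ==> \<bar>k j x - k j y\<bar> <= B x y"
  and mA [measurable]: "A \<in> borel_measurable borel" and mB: "(%(x, y). B x y) \<in> borel_measurable borel"
  and p: "1 <= p" and \<eta>: "0 < \<eta>"
 shows "(NN x. (NN y. ennreal ((\<Sum>j\<in>UNIV. \<bar>k j x - k j y\<bar>) powr p / \<bar>x - y\<bar> powr (1 + \<eta> * p)) * indicator {..T} y) * indicator {..T} x)
   <= ennreal (real CARD('m) powr p) * (gagliardo_power \<eta> p T B + ennreal (2 / (\<eta> * p)) * (\<integral>\<^sup>+t\<in>{0..T}. ennreal (t powr (- \<eta> * p) * A t powr p) \<partial>lborel))"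
proof -
 let ?I = "%B x y. ennreal (B x y powr p / \<bar>x - y\<bar> powr (1 + \<eta> * p)) * indicator {0..T} y * indicator {0..T} x"
 let ?E = "%W x y. ennreal (W x y) * indicator {..0} y * indicator {0<..T} x + ennreal (W y x) * indicator {0<..T} y * indicator {..0} x"
 let ?D = "%W. NN x. (NN y. ennreal (W x y) * indicator {..T} y) * indicator {..T} x"
 let ?C = "%k x y. \<Sum>j\<in>UNIV. \<bar>k j x - k j y\<bar>"
 let ?B = "%W. NN x. (NN y. ennreal (W x y) * indicator {..0} y * indicator {0<..T} x)"
 let ?A = "%W y x. ennreal (W y x) * indicator {0<..T} y * indicator {..0} x"
 let ?H = "%Z. NN x. Z x * indicator {0<..T} x"
 let ?G = "%A. \<integral>\<^sup>+t\<in>{0..T}. ennreal (t powr (- \<eta> * p) * A t powr p) \<partial>lborel"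
 let ?F = "%W. NN x. (NN y. ennreal (W x y) * indicator {0<..T} y * indicator {0<..T} x)"
 let ?m = "real CARD('m)" and ?r = "\<eta> * p"
 define W where "W x y = (?C k x y) powr p / \<bar>x - y\<bar> powr (1 + \<eta> * p)" for x y
 have [measurable]: "(%z. W (f z) (g z)) \<in> borel_measurable L"
  if [measurable]: "f \<in> borel_measurable L" "g \<in> borel_measurable L" for f g and L :: "'z measure"
  unfolding W_def by measurable
 have [measurable]: "(%z. B (f z) (g z)) \<in> borel_measurable L"
  if [measurable]: "f \<in> borel_measurable L" "g \<in> borel_measurable L" for f g and L :: "'z measure"
 proof -
  have "(%z. (f z, g z)) \<in> L \<rightarrow>\<^sub>M borel \<Otimes>\<^sub>M borel" by measurable
  then show ?thesis using measurable_compose[OF _ mB, of "%z. (f z, g z)" L] by (simp add: borel_prod)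
 qed
 have sym: "W x y = W y x" for x y by (simp add: W_def abs_minus_commute)
 have r: "0 < ?r" using p \<eta> by simp
 have m0: "0 <= ?m" by simp
 have A0: "0 <= A x" if "0 < x" for x using A[OF that, of undefined] by linarith
 have both: "ennreal (W x y) * indicator {0<..T} y * indicator {0<..T} x <= ennreal (?m powr p) * (?I B x y)" for x y
 proof -
  have "W x y <= ?m powr p * (B x y powr p / \<bar>x - y\<bar> powr (1 + \<eta> * p))" if "0 < x" "0 < y"
  proof -
   have "(?C k x y) <= ?m * B x y" using B[OF that] sum_bounded_above[of UNIV "%j. \<bar>k j x - k j y\<bar>" "B x y"] by simp
   moreover have "0 <= B x y" using B[OF that, of undefined] by linarith
   ultimately have "(?C k x y) powr p <= ?m powr p * B x y powr p"
    using p by (subst powr_mult[symmetric]) (auto intro!: powr_mono2 sum_nonneg)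
   then show ?thesis unfolding W_def times_divide_eq_right by (rule divide_right_mono) simp
  qed
  then show ?thesis by (auto split: split_indicator simp flip: ennreal_mult' intro!: ennreal_leI)
 qed
 define Z where "Z x = (NN y. ennreal (W x y) * indicator {..0} y)" for x
 have [measurable]: "Z \<in> borel_measurable borel" unfolding Z_def[abs_def] by measurable
 have one: "Z x * indicator {0<..T} x <= ennreal (?m powr p / ?r) * (ennreal (x powr (- \<eta> * p) * A x powr p) * indicator {0..T} x)" for x
 proof (cases "0 < x & x <= T")
  case True
  have "Z x <= (NN y. ennreal (?m powr p * A x powr p) * (ennreal (1 / (x - y) powr (1 + ?r)) * indicator {..0} y))"
   unfolding Z_def
  proof (intro nn_integral_mono)
   fix y
   have "W x y <= ?m powr p * A x powr p * (1 / (x - y) powr (1 + ?r))" if "y <= 0"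
   proof -
    have "(?C k x y) <= ?m * A x" using A[of x] True sum_bounded_above[of UNIV "%j. \<bar>k j x - k j y\<bar>" "A x"] k0[OF that] by simp
    then have "(?C k x y) powr p <= ?m powr p * A x powr p"
     using p A0 True by (subst powr_mult[symmetric]) (auto intro!: powr_mono2 sum_nonneg)
    then show ?thesis unfolding W_def using True that by (simp add: divide_right_mono)
   qed
   then show "ennreal (W x y) * indicator {..0} y <= ennreal (?m powr p * A x powr p) * (ennreal (1 / (x - y) powr (1 + ?r)) * indicator {..0} y)"
    by (auto split: split_indicator simp flip: ennreal_mult' intro!: ennreal_leI)
  qed
  also have "... = ennreal (?m powr p * A x powr p) * ennreal (x powr (- ?r) / ?r)"
   using True r by (subst nn_integral_cmult) (auto simp: nn_integral_negative_tail)
  also have "... = ennreal (?m powr p / ?r) * ennreal (x powr (- \<eta> * p) * A x powr p)"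
   using r by (simp add: mult_ac flip: ennreal_mult)
  finally show ?thesis using True by simp
 qed auto
 have split: "ennreal (W x y) * indicator {..T} y * indicator {..T} x <= ennreal (W x y) * indicator {0<..T} y * indicator {0<..T} x
   + (?E W x y)" for x y
 proof (cases "x <= 0 & y <= 0")
  case True
  then have "W x y = 0" using k0 by (simp add: W_def)
  then show ?thesis by simp
 next
  case False
  then show ?thesis using sym[of x y] by (auto split: split_indicator)
 qed
 have Zint: "(?H Z) <= ennreal (?m powr p / ?r) * (?G A)"
  by (subst nn_integral_cmult[symmetric], measurable, intro nn_integral_mono one)
 have "(?D W)
   = (NN x. (NN y. ennreal (W x y) * indicator {..T} y * indicator {..T} x))"
  by (simp add: nn_integral_multc)
 also have "... <= (NN x. (NN y. ennreal (W x y) * indicator {0<..T} y * indicator {0<..T} x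
   + (?E W x y)))"
  by (intro nn_integral_mono split)
 also have "... = (?F W)
   + ((?B W)
   + (NN x. (NN y. ?A W y x)))"
  by (simp add: nn_integral_add)
 also have "(NN x. (NN y. ?A W y x))
   = (NN y. (NN x. ?A W y x))"
  by (rule lborel_pair.Fubini') measurable
 also have "... = (?H Z)"
 proof (intro nn_integral_cong)
  fix y
  have "(NN x. ?A W y x) = (NN x. ennreal (W y x) * indicator {..0} x * indicator {0<..T} y)"
   by (intro nn_integral_cong) (simp add: mult_ac)
  also have "... = Z y * indicator {0<..T} y" unfolding Z_def by (rule nn_integral_multc) measurable
  finally show "(NN x. ?A W y x) = Z y * indicator {0<..T} y" .
 qed
 also have "(?B W) = (?H Z)"
  unfolding Z_def by (simp add: nn_integral_multc)
 finally have "(?D W)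
   <= (?F W)
    + ((?H Z) + (?H Z))" .
 also have "... <= ennreal (?m powr p) * gagliardo_power \<eta> p T B
   + (ennreal (?m powr p / ?r) * (?G A)
   + ennreal (?m powr p / ?r) * (?G A))"
 proof (intro add_mono Zint)
  show "(?F W) <= ennreal (?m powr p) * gagliardo_power \<eta> p T B"
  proof -
   have "(?F W)
     <= (NN x. (NN y. ennreal (?m powr p) * (?I B x y)))"
    by (intro nn_integral_mono both)
   also have "... = ennreal (?m powr p) * gagliardo_power \<eta> p T B"
    unfolding gagliardo_power_def by (simp add: nn_integral_cmult nn_integral_multc)
   finally show ?thesis .
  qed
 qed
 also have "... = ennreal (?m powr p) * (gagliardo_power \<eta> p T B + ennreal (2 / ?r) * (?G A))"
 proof -
  have "ennreal (?m powr p) * ennreal (2 / ?r) = ennreal (?m powr p / ?r) + ennreal (?m powr p / ?r)"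
   using r by (simp flip: ennreal_mult ennreal_plus add: field_simps)
  then show ?thesis by (simp add: distrib_left distrib_right mult.assoc[symmetric])
 qed
 finally show ?thesis unfolding W_def by simp
qed

text \<open>The first line is the \<open>p\<close>-th root of the constant of \<open>kernel_increments_le\<close>, the
second one that of \<open>src_total_le\<close>.\<close>
definition Sobolev_constant :: "real ^ 'm ^ 'm => real ^ 'm => real => real => real => real" where
 "Sobolev_constant \<beta> \<sigma> \<eta> p T = real CARD('m) * (1 + 2 / (\<eta> * p)) powr (1 / p) *
   (2 * real CARD('m) + (\<Sum>i\<in>UNIV. 2 * real CARD('m) * (\<Sum>j\<in>UNIV. \<Sum>l\<in>UNIV. \<bar>\<beta> $ l $ j\<bar>) + (\<sigma> $ i)\<^sup>2) * (1 + T))"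

context riccati_setting begin

text \<open>The densities of the real and imaginary parts of the measure \<open>\<mu> + R(\<psi>) dt\<close> with
respect to \<open>M\<close>.\<close>
definition src_re :: "(real => complex ^ 'm) => 'm => real => real" where
 "src_re \<psi> i s = - \<rho> i s + g_re (re_part \<psi>) (im_part \<psi>) i s * d0 s"

definition src_im :: "(real => complex ^ 'm) => 'm => real => real" where
 "src_im \<psi> i s = im_density i s + g_im (re_part \<psi>) (im_part \<psi>) i s * d0 s"

definition src_total :: "(real => complex ^ 'm) => real => real" where
 "src_total \<psi> s = (\<Sum>i\<in>UNIV. \<bar>src_re \<psi> i s\<bar> + \<bar>src_im \<psi> i s\<bar>)"

lemma solves_single_source:
 assumes v: "solves i v n g" and n: "Lloc M n" and g: "Lloc lborel g"
 shows "AL t. v t = rconv (k i) M (%s. n s + g s * d0 s) t"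
proof -
 have "AL t. rconv (k i) M (%s. n s + g s * d0 s) t = rconv (k i) M n t + rconv (k i) M (%s. g s * d0 s) t"
  by (rule AE_rconv_add[OF k_Lloc n Lloc_lborel_density[OF g]])
 then show ?thesis using v unfolding solves_def
  by eventually_elim (simp add: rconv_lborel_density g)
qed

lemma solution_single_source:
 assumes sol: "riccati_solution \<beta> \<sigma> K \<mu> \<psi>"
 shows "Lloc M (src_re \<psi> i)" "Lloc M (src_im \<psi> i)"
  "AL t. re_part \<psi> i t = rconv (k i) M (src_re \<psi> i) t"
  "AL t. im_part \<psi> i t = rconv (k i) M (src_im \<psi> i) t"
proof -
 note s = solution_real_form[OF sol]
 note gL = Lloc_g[of "re_part \<psi>" "im_part \<psi>", OF s(1) s(2)]
 show "Lloc M (src_re \<psi> i)" "Lloc M (src_im \<psi> i)"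
  unfolding src_re_def[abs_def] src_im_def[abs_def]
  by (intro Lloc_add Lloc_lborel_density gL Lloc_im_density Lloc_minus Lloc_densities sets_eq_borel)+
 show "AL t. re_part \<psi> i t = rconv (k i) M (src_re \<psi> i) t"
  unfolding src_re_def[abs_def] by (rule solves_single_source[OF s(4) Lloc_minus[OF Lloc_densities(1)] gL(1)])
 show "AL t. im_part \<psi> i t = rconv (k i) M (src_im \<psi> i) t"
  unfolding src_im_def[abs_def] by (rule solves_single_source[OF s(5) Lloc_im_density gL(2)])
qed

lemma Lloc_src_total: "riccati_solution \<beta> \<sigma> K \<mu> \<psi> ==> Lloc M (src_total \<psi>)"
 unfolding src_total_def[abs_def] by (intro Lloc_sum Lloc_add Lloc_abs solution_single_source) auto

lemma g_le:
 assumes s: "0 <= s"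
 shows "\<bar>g_re (re_part \<psi>) (im_part \<psi>) i s\<bar> + \<bar>g_im (re_part \<psi>) (im_part \<psi>) i s\<bar>
   <= (2 * real CARD('m) * bnd + 2 * q i) * (1 + (norm (\<psi> s))\<^sup>2)"
proof -
 let ?a = "re_part \<psi>" and ?c = "im_part \<psi>" and ?n = "norm (\<psi> s)"
 have n1: "?n <= 1 + ?n\<^sup>2" using sum_power2_ge_zero[of "?n - 1/2" 0] by (simp add: power2_eq_square algebra_simps)
 have comp: "norm (\<psi> s $ l) <= ?n" for l by (rule Finite_Cartesian_Product.norm_nth_le)
 have al: "\<bar>?a l s\<bar> <= 1 + ?n\<^sup>2" "\<bar>?c l s\<bar> <= 1 + ?n\<^sup>2" for l
  using order_trans[OF abs_Re_le_cmod comp[of l]] order_trans[OF abs_Im_le_cmod comp[of l]] n1 s by (auto simp: re_part_def im_part_def)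
 have sums: "(\<Sum>l\<in>UNIV. \<bar>?a l s\<bar>) <= real CARD('m) * (1 + ?n\<^sup>2)" "(\<Sum>l\<in>UNIV. \<bar>?c l s\<bar>) <= real CARD('m) * (1 + ?n\<^sup>2)"
  using sum_bounded_above[of UNIV "%l. \<bar>?a l s\<bar>" "1 + ?n\<^sup>2"] sum_bounded_above[of UNIV "%l. \<bar>?c l s\<bar>" "1 + ?n\<^sup>2"] al by auto
 have lins: "\<bar>lin ?a i s\<bar> <= bnd * (real CARD('m) * (1 + ?n\<^sup>2))" "\<bar>lin ?c i s\<bar> <= bnd * (real CARD('m) * (1 + ?n\<^sup>2))"
  unfolding lin_def using sum_beta_bnd[of i "%l. ?a l s"] sum_beta_bnd[of i "%l. ?c l s"] mult_left_mono[OF sums(1) bnd_nonneg] mult_left_mono[OF sums(2) bnd_nonneg] by linarith+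
 have sq: "(?a i s)\<^sup>2 + (?c i s)\<^sup>2 <= ?n\<^sup>2"
  using comp[of i] s by (simp add: re_part_def im_part_def cmod_power2[symmetric] power_mono)
 have "\<bar>(?a i s)\<^sup>2 - (?c i s)\<^sup>2\<bar> <= ?n\<^sup>2" using sq zero_le_power2[of "?a i s"] zero_le_power2[of "?c i s"] by linarith
 then have q1: "\<bar>q i * ((?a i s)\<^sup>2 - (?c i s)\<^sup>2)\<bar> <= q i * ?n\<^sup>2" using q_nonneg[of i] by (simp add: abs_mult mult_left_mono)
 have "2 * \<bar>?a i s * ?c i s\<bar> <= ?n\<^sup>2" using sq sum_squares_bound[of "\<bar>?a i s\<bar>" "\<bar>?c i s\<bar>"] by (simp add: abs_mult)
 then have "q i * (2 * \<bar>?a i s * ?c i s\<bar>) <= q i * ?n\<^sup>2" using q_nonneg[of i] by (intro mult_left_mono)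
 moreover have "\<bar>2 * q i * (?a i s * ?c i s)\<bar> = q i * (2 * \<bar>?a i s * ?c i s\<bar>)" using q_nonneg[of i] by (simp add: abs_mult)
 ultimately have "\<bar>g_re ?a ?c i s\<bar> + \<bar>g_im ?a ?c i s\<bar> <= 2 * (bnd * (real CARD('m) * (1 + ?n\<^sup>2))) + 2 * (q i * ?n\<^sup>2)"
  using lins q1 by linarith
 also have "... <= 2 * (bnd * (real CARD('m) * (1 + ?n\<^sup>2))) + 2 * (q i * (1 + ?n\<^sup>2))"
  using q_nonneg[of i] by (simp add: mult_left_mono)
 finally show ?thesis by (simp add: algebra_simps)
qed

lemma solution_increment_le:
 assumes sol: "riccati_solution \<beta> \<sigma> K \<mu> \<psi>"
 shows "AL t. AL s. 0 <= t --> 0 <= s --> ennreal (norm (\<psi> t - \<psi> s))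
  <= (\<integral>\<^sup>+u. ennreal ((\<Sum>j\<in>UNIV. \<bar>k j (t - u) - k j (s - u)\<bar>) * src_total \<psi> u) \<partial>M)"
proof -
 let ?F = "%t s. \<integral>\<^sup>+(u::real). ennreal ((\<Sum>j\<in>UNIV. \<bar>k j (t - u) - k j (s - u)\<bar>) * src_total \<psi> u) \<partial>M"
 note L = solution_single_source(1,2)[OF sol]
 define good where "good t \<longleftrightarrow> (\<forall>i. integrable M (%u. k i (t - u) * src_re \<psi> i u) & integrable M (%u. k i (t - u) * src_im \<psi> i u) \<and>
   re_part \<psi> i t = rconv (k i) M (src_re \<psi> i) t & im_part \<psi> i t = rconv (k i) M (src_im \<psi> i) t)" for t
 have good: "AL t. good t"
  unfolding good_def AE_all_countable
  by (intro allI AE_conjI AE_rconv_integrable k_Lloc L solution_single_source(3,4)[OF sol])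
 have le: "ennreal (norm (\<psi> t - \<psi> s)) <= (?F t s)"
  if t: "good t" "0 <= t" and s: "good s" "0 <= s" for t s
 proof -
  have comp: "ennreal \<bar>x t - x s\<bar> <= (\<integral>\<^sup>+u. ennreal (\<bar>k i (t - u) - k i (s - u)\<bar> * \<bar>n u\<bar>) \<partial>M)"
   if "integrable M (%u. k i (t - u) * n u)" "integrable M (%u. k i (s - u) * n u)" "x t = rconv (k i) M n t" "x s = rconv (k i) M n s" for x n i
  proof -
   have "x t - x s = (\<integral>u. k i (t - u) * n u - k i (s - u) * n u \<partial>M)" unfolding that(3,4) rconv_def by (rule Bochner_Integration.integral_diff[symmetric]) (rule that)+
   then show ?thesis
    using integral_norm_bound_ennreal[OF Bochner_Integration.integrable_diff[OF that(1,2)]] by (simp add: abs_mult flip: left_diff_distrib)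
  qed
  note [measurable] = LlocD(1)[OF L(1)] LlocD(1)[OF L(2)]
  have "norm (\<psi> t - \<psi> s) <= (\<Sum>i\<in>UNIV. norm ((\<psi> t - \<psi> s) $ i))" unfolding norm_vec_def by (rule L2_set_le_sum) simp
  also have "... <= (\<Sum>i\<in>UNIV. \<bar>re_part \<psi> i t - re_part \<psi> i s\<bar> + \<bar>im_part \<psi> i t - im_part \<psi> i s\<bar>)"
   using t s by (intro sum_mono order_trans[OF cmod_le]) (simp add: re_part_def im_part_def)
  finally have "ennreal (norm (\<psi> t - \<psi> s)) <= (\<Sum>i\<in>UNIV. ennreal \<bar>re_part \<psi> i t - re_part \<psi> i s\<bar> + ennreal \<bar>im_part \<psi> i t - im_part \<psi> i s\<bar>)"
   by (simp add: sum_ennreal ennreal_leI flip: ennreal_plus)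
  also have "... <= (\<Sum>i\<in>UNIV. (\<integral>\<^sup>+u. ennreal (\<bar>k i (t - u) - k i (s - u)\<bar> * \<bar>src_re \<psi> i u\<bar>) \<partial>M) + (\<integral>\<^sup>+u. ennreal (\<bar>k i (t - u) - k i (s - u)\<bar> * \<bar>src_im \<psi> i u\<bar>) \<partial>M))"
   using t(1) s(1) unfolding good_def by (intro sum_mono add_mono comp) auto
  also have "... = (\<integral>\<^sup>+u. (\<Sum>i\<in>UNIV. ennreal (\<bar>k i (t - u) - k i (s - u)\<bar> * \<bar>src_re \<psi> i u\<bar>) + ennreal (\<bar>k i (t - u) - k i (s - u)\<bar> * \<bar>src_im \<psi> i u\<bar>)) \<partial>M)"
   by (simp add: nn_integral_sum nn_integral_add)
  also have "... <= (?F t s)"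
  proof (intro nn_integral_mono)
   fix u
   let ?\<Delta> = "%i. \<bar>k i (t - u) - k i (s - u)\<bar>"
   have "(\<Sum>i\<in>UNIV. ?\<Delta> i * \<bar>src_re \<psi> i u\<bar> + ?\<Delta> i * \<bar>src_im \<psi> i u\<bar>) <= (\<Sum>i\<in>UNIV. (\<Sum>j\<in>UNIV. ?\<Delta> j) * (\<bar>src_re \<psi> i u\<bar> + \<bar>src_im \<psi> i u\<bar>))"
    unfolding distrib_left[symmetric] by (intro sum_mono mult_right_mono member_le_sum) auto
   also have "... = (\<Sum>j\<in>UNIV. ?\<Delta> j) * src_total \<psi> u" by (simp add: src_total_def sum_distrib_left)
   finally show "(\<Sum>i\<in>UNIV. ennreal (?\<Delta> i * \<bar>src_re \<psi> i u\<bar>) + ennreal (?\<Delta> i * \<bar>src_im \<psi> i u\<bar>)) <= ennreal ((\<Sum>j\<in>UNIV. ?\<Delta> j) * src_total \<psi> u)"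
    by (simp add: sum_ennreal ennreal_leI flip: ennreal_plus)
  qed
  finally show ?thesis .
 qed
 show ?thesis
  using good
 proof eventually_elim
  case (elim t)
  note t = elim
  show ?case using good by eventually_elim (use le t in blast)
 qed
qed

lemma kernel_increments_le:
 assumes p: "1 <= p" and \<eta>: "0 < \<eta>"
 shows "(NN x. (NN y. ennreal ((\<Sum>j\<in>UNIV. \<bar>k j x - k j y\<bar>) powr p / \<bar>x - y\<bar> powr (1 + \<eta> * p)) * indicator {..T} y) * indicator {..T} x)
   <= ennreal (real CARD('m) powr p * (1 + 2 / (\<eta> * p))) * ((\<integral>\<^sup>+t\<in>{0..T}. ennreal (t powr (- \<eta> * p) * op_norm (K t) powr p) \<partial>lborel)
        + gagliardo_power \<eta> p T (%t s. op_norm (K t - K s)))"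
proof -
 note [measurable] = LlocD(1)[OF Lloc_causal_kernel[OF adm]]
 let ?A = "%x. op_norm (\<chi> i j. causal_entry K i j x)" and ?B = "%x y. op_norm (\<chi> i j. causal_entry K i j x - causal_entry K i j y)"
 let ?X = "\<integral>\<^sup>+t\<in>{0..T}. ennreal (t powr (- \<eta> * p) * op_norm (K t) powr p) \<partial>lborel" and ?Y = "gagliardo_power \<eta> p T (%t s. op_norm (K t - K s))"
 have K: "(\<chi> i j. causal_entry K i j x) = K x" "(\<chi> i j. causal_entry K i j x - causal_entry K i j y) = K x - K y" if "0 <= x" "0 <= y" for x y
  using that by (simp_all add: vec_eq_iff causal_entry_simps)
 have "(NN x. (NN y. ennreal ((\<Sum>j\<in>UNIV. \<bar>k j x - k j y\<bar>) powr p / \<bar>x - y\<bar> powr (1 + \<eta> * p)) * indicator {..T} y) * indicator {..T} x)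
   <= ennreal (real CARD('m) powr p) * (gagliardo_power \<eta> p T ?B + ennreal (2 / (\<eta> * p)) * (\<integral>\<^sup>+t\<in>{0..T}. ennreal (t powr (- \<eta> * p) * ?A t powr p) \<partial>lborel))"
 proof (rule kernel_difference_power_le[OF k_measurable _ _ _ _ _ p \<eta>])
  show "k j x = 0" if "x <= 0" for j x using that by (simp add: diag_kernel_def)
  show "\<bar>k j x\<bar> <= ?A x" if "0 < x" for j x
   using that component_le_op_norm[of "K x" j j] K(1)[of x x] by (simp add: diag_kernel_def)
  show "\<bar>k j x - k j y\<bar> <= ?B x y" if "0 < x" "0 < y" for j x y
   using that component_le_op_norm[of "K x - K y" j j] K(2)[of x y] by (simp add: diag_kernel_def)
  show "?A \<in> borel_measurable borel" by (intro borel_measurable_op_norm) measurable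
  have "(%z. op_norm (\<chi> i j. causal_entry K i j (fst z) - causal_entry K i j (snd z))) \<in> borel_measurable (borel \<Otimes>\<^sub>M borel)"
   by (intro borel_measurable_op_norm) measurable
  then show "(%(x, y). ?B x y) \<in> borel_measurable borel" by (simp add: borel_prod case_prod_unfold)
 qed
 also have "gagliardo_power \<eta> p T ?B = ?Y"
  unfolding gagliardo_power_def by (intro nn_integral_cong) (auto split: split_indicator simp: K intro!: nn_integral_cong)
 also have "(\<integral>\<^sup>+t\<in>{0..T}. ennreal (t powr (- \<eta> * p) * ?A t powr p) \<partial>lborel) = ?X"
  by (intro nn_integral_cong) (auto split: split_indicator simp: K)
 also have "?Y + ennreal (2 / (\<eta> * p)) * ?X <= ennreal (1 + 2 / (\<eta> * p)) * (?X + ?Y)"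
 proof -
  have c: "0 <= 2 / (\<eta> * p)" using p \<eta> by simp
  have "?Y + ennreal (2 / (\<eta> * p)) * ?X <= (?X + ?Y) + ennreal (2 / (\<eta> * p)) * (?X + ?Y)"
   by (intro add_mono mult_left_mono) (auto intro: add_increasing add_increasing2)
  also have "... = ennreal (1 + 2 / (\<eta> * p)) * (?X + ?Y)" using c by (simp add: distrib_right ennreal_plus)
  finally show ?thesis .
 qed
 finally have step: "(!!x y :: ennreal. x <= y ==> ennreal (real CARD('m) powr p) * x <= ennreal (real CARD('m) powr p) * y) ==>
  ?thesis" using p \<eta> by (simp add: ennreal_mult mult.assoc)
 show ?thesis by (rule step) (rule mult_left_mono, auto)
qed

text \<open>The nonlinearity grows at most quadratically, so the total mass of \<open>\<mu> + R(\<psi>) dt\<close> is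
controlled by \<open>\<bar>\<mu>\<bar>\<close> and the square of the \<open>L\<^sup>2\<close> norm of
\<open>\<psi>\<close>.\<close>
lemma src_total_le:
 assumes sol: "riccati_solution \<beta> \<sigma> K \<mu> \<psi>" and T: "0 < T"
 shows "nnI M T (%u. src_total \<psi> u)
   <= ennreal (2 * real CARD('m) + (\<Sum>i\<in>UNIV. 2 * real CARD('m) * bnd + 2 * q i) * (1 + T)) * (1 + total_variation \<mu> {0..T} + (Lp_norm 2 T \<psi>)\<^sup>2)"
proof -
 let ?G = "%n2 u. ennreal (1 + n2 u) * indicator {0..T} u * ennreal (d0 u)"
 let ?F = "Lp_norm 2 T \<psi>"
 let ?m = "real CARD('m)" and ?TV = "total_variation \<mu> {0..T}"
 define c where "c = (\<Sum>i\<in>UNIV. 2 * ?m * bnd + 2 * q i)"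
 have c0: "0 <= c" unfolding c_def by (intro sum_nonneg) (simp add: bnd_nonneg q_nonneg)
 note s = solution_real_form[OF sol]
 define n2 where "n2 s = (\<Sum>i\<in>UNIV. (re_part \<psi> i s)\<^sup>2 + (im_part \<psi> i s)\<^sup>2)" for s
 have n2: "n2 s = (norm (\<psi> s))\<^sup>2" if "0 <= s" for s
  using that by (simp add: n2_def norm_vec_def L2_set_def sum_nonneg re_part_def im_part_def cmod_power2)
 have n20: "0 <= n2 s" for s unfolding n2_def by (intro sum_nonneg) auto
 note [measurable] = L2locD(1)[OF s(1)] L2locD(1)[OF s(2)]
 have [measurable]: "n2 \<in> borel_measurable borel" unfolding n2_def[abs_def] by measurable
 have [measurable]: "(%s. norm (density_vec s)) \<in> borel_measurable borel"
 proof -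
  note [measurable] = LlocD(1)[OF Lloc_im_density]
  have "density_vec = (%s. \<chi> j. complex_of_real (- \<rho> j s) + \<i> * complex_of_real (im_density j s))"
   by (simp add: fun_eq_iff vec_eq_iff density_vec_def complex_eq_iff)
  moreover have "... \<in> borel_measurable borel" by (intro borel_measurable_vec_lambda) measurable
  ultimately show ?thesis by simp
 qed
 have pt: "src_total \<psi> u <= 2 * ?m * norm (density_vec u) + c * (1 + n2 u) * d0 u" if u: "0 <= u" for u
 proof -
  have "\<bar>src_re \<psi> i u\<bar> + \<bar>src_im \<psi> i u\<bar> <= 2 * norm (density_vec u) + (2 * ?m * bnd + 2 * q i) * (1 + n2 u) * d0 u" for i
  proof -
   have "norm (density_vec u $ i) <= norm (density_vec u)" by (rule Finite_Cartesian_Product.norm_nth_le)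
   then have "\<bar>\<rho> i u\<bar> <= norm (density_vec u)" "\<bar>im_density i u\<bar> <= norm (density_vec u)"
    using abs_Re_le_cmod[of "density_vec u $ i"] abs_Im_le_cmod[of "density_vec u $ i"] by (auto simp: density_vec_def)
   moreover have "(\<bar>g_re (re_part \<psi>) (im_part \<psi>) i u\<bar> + \<bar>g_im (re_part \<psi>) (im_part \<psi>) i u\<bar>) * d0 u <= (2 * ?m * bnd + 2 * q i) * (1 + n2 u) * d0 u"
    unfolding n2[OF u] by (intro mult_right_mono g_le[OF u] densities_nonneg)
   moreover have "\<bar>src_re \<psi> i u\<bar> <= \<bar>\<rho> i u\<bar> + \<bar>g_re (re_part \<psi>) (im_part \<psi>) i u\<bar> * d0 u"
    unfolding src_re_def using abs_triangle_ineq[of "- \<rho> i u" "g_re (re_part \<psi>) (im_part \<psi>) i u * d0 u"] by (simp add: abs_mult densities_nonneg)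
   moreover have "\<bar>src_im \<psi> i u\<bar> <= \<bar>im_density i u\<bar> + \<bar>g_im (re_part \<psi>) (im_part \<psi>) i u\<bar> * d0 u"
    unfolding src_im_def using abs_triangle_ineq[of "im_density i u" "g_im (re_part \<psi>) (im_part \<psi>) i u * d0 u"] by (simp add: abs_mult densities_nonneg)
   ultimately show ?thesis unfolding distrib_right[of "\<bar>_\<bar>" "\<bar>_\<bar>" "d0 u"] by linarith
  qed
  then have "src_total \<psi> u <= (\<Sum>i\<in>(UNIV::'m set). 2 * norm (density_vec u) + (2 * ?m * bnd + 2 * q i) * (1 + n2 u) * d0 u)"
   unfolding src_total_def by (intro sum_mono)
  then show ?thesis by (simp add: sum.distrib c_def sum_distrib_right distrib_right)
 qed
 have N2: "nnI lborel T n2 = ?F\<^sup>2"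
  unfolding Lp_norm_def ennroot_2_square Lp_power_def
  by (intro nn_integral_cong) (auto split: split_indicator simp: n2)
 have "nnI M T (%u. src_total \<psi> u)
  <= (\<integral>\<^sup>+u. ennreal (2 * ?m) * (ennreal (norm (density_vec u)) * indicator {0..T} u) + ennreal c * (?G n2 u) \<partial>M)"
 proof (intro nn_integral_mono)
  fix u
  have "ennreal (src_total \<psi> u) <= ennreal (2 * ?m) * ennreal (norm (density_vec u)) + ennreal c * (ennreal (1 + n2 u) * ennreal (d0 u))" if "0 <= u"
  proof -
   have "ennreal (src_total \<psi> u) <= ennreal (2 * ?m * norm (density_vec u) + c * (1 + n2 u) * d0 u)" by (rule ennreal_leI[OF pt[OF that]])
   also have "... = ennreal (2 * ?m) * ennreal (norm (density_vec u)) + ennreal c * (ennreal (1 + n2 u) * ennreal (d0 u))"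
    using n20[of u] c0 densities_nonneg(4)[of u] by (simp add: ennreal_mult mult.assoc ennreal_plus del: ennreal_plus[symmetric])
   finally show ?thesis .
  qed
  then show "ennreal (src_total \<psi> u) * indicator {0..T} u <= ennreal (2 * ?m) * (ennreal (norm (density_vec u)) * indicator {0..T} u) + ennreal c * (?G n2 u)"
   by (auto split: split_indicator)
 qed
 also have "... = ennreal (2 * ?m) * nnI M T (%u. norm (density_vec u)) + ennreal c * (\<integral>\<^sup>+u. ?G n2 u \<partial>M)"
  by (subst nn_integral_add, measurable, subst nn_integral_cmult, measurable, subst nn_integral_cmult, measurable)
 also have "(\<integral>\<^sup>+u. ?G n2 u \<partial>M) = (NN u. ennreal (1 + n2 u) * indicator {0..T} u * indicator {0..} u)"
  by (rule nn_integral_lborel_eq[symmetric]) measurable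
 also have "... = (NN u. indicator {0..T} u + ennreal (n2 u) * indicator {0..T} u)"
  by (intro nn_integral_cong) (auto split: split_indicator simp: n20 ennreal_plus)
 also have "... = ennreal T + ?F\<^sup>2" using T by (subst nn_integral_add) (auto simp: N2)
 also have "ennreal (2 * ?m) * nnI M T (%u. norm (density_vec u)) + ennreal c * (ennreal T + ?F\<^sup>2)
   <= ennreal (2 * ?m) * ?TV + ennreal c * (ennreal T + ?F\<^sup>2)"
  by (intro add_mono mult_left_mono density_vec_le_total_variation) auto
 also have "... <= ennreal (2 * ?m) * (1 + ?TV + ?F\<^sup>2) + ennreal (c * (1 + T)) * (1 + ?TV + ?F\<^sup>2)"
 proof (intro add_mono mult_left_mono)
  have "ennreal T + ?F\<^sup>2 <= ennreal (1 + T) * (1 + ?F\<^sup>2)"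
   using T by (simp add: distrib_left distrib_right ennreal_plus add_increasing add_increasing2 add_mono)
  also have "... <= ennreal (1 + T) * (1 + ?TV + ?F\<^sup>2)" by (intro mult_left_mono add_mono) auto
  finally have "ennreal c * (ennreal T + ?F\<^sup>2) <= ennreal c * (ennreal (1 + T) * (1 + ?TV + ?F\<^sup>2))" by (rule mult_left_mono) simp
  then show "ennreal c * (ennreal T + ?F\<^sup>2) <= ennreal (c * (1 + T)) * (1 + ?TV + ?F\<^sup>2)"
   using c0 T by (simp add: ennreal_mult mult.assoc)
  show "?TV <= 1 + ?TV + ?F\<^sup>2" by (simp add: add_increasing add_increasing2)
 qed simp
 also have "... = ennreal (2 * ?m + c * (1 + T)) * (1 + ?TV + ?F\<^sup>2)"
  using c0 T by (simp add: distrib_right ennreal_plus)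
 finally show ?thesis unfolding c_def .
qed

theorem Sobolev_bound:
 assumes sol: "riccati_solution \<beta> \<sigma> K \<mu> \<psi>" and T: "0 < T" and p: "1 <= p" and \<eta>: "0 < \<eta>"
 shows "W_norm \<eta> p T \<psi> <= Lp_norm p T \<psi> + ennreal (Sobolev_constant \<beta> \<sigma> \<eta> p T) * (1 + kernel_norm \<eta> p T K)
       * (1 + total_variation \<mu> {0..T} + (Lp_norm 2 T \<psi>)\<^sup>2)"
proof -
 let ?H = "1 + kernel_norm \<eta> p T K"
 let ?G = "%t s. norm (\<psi> t - \<psi> s)"
 let ?F = "1 + 2 / (\<eta> * p)"
 let ?S = "1 + total_variation \<mu> {0..T} + (Lp_norm 2 T \<psi>)\<^sup>2" and ?m = "real CARD('m)"
 let ?X = "(\<integral>\<^sup>+t\<in>{0..T}. ennreal (t powr (- \<eta> * p) * op_norm (K t) powr p) \<partial>lborel) + gagliardo_power \<eta> p T (%t s. op_norm (K t - K s))"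
 define c where "c = 2 * ?m + (\<Sum>i\<in>UNIV. 2 * ?m * bnd + 2 * q i) * (1 + T)"
 have c0: "0 <= c" unfolding c_def using T by (intro add_nonneg_nonneg mult_nonneg_nonneg sum_nonneg) (auto simp: bnd_nonneg q_nonneg)
 define e where "e = ?m * ?F powr (1 / p)"
 have e0: "0 <= e" unfolding e_def by simp
 have const: "Sobolev_constant \<beta> \<sigma> \<eta> p T = e * c" by (simp add: Sobolev_constant_def e_def c_def bnd_def q_def)
 have N0: "0 <= src_total \<psi> u" for u unfolding src_total_def by (intro sum_nonneg) auto
 obtain C where C: "nnI M T (%u. src_total \<psi> u) = ennreal C" "0 <= C"
  using LlocD(3)[OF Lloc_src_total[OF sol], of T] N0 by (cases "nnI M T (%u. src_total \<psi> u)") auto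
 have "gagliardo_power \<eta> p T ?G
   <= ennreal (C powr p) * (NN x. (NN y. ennreal ((\<Sum>j\<in>UNIV. \<bar>k j x - k j y\<bar>) powr p / \<bar>x - y\<bar> powr (1 + \<eta> * p)) * indicator {..T} y) * indicator {..T} x)"
 proof (rule gagliardo_conv_le[OF _ _ _ Lloc_src_total[OF sol] N0 p _ _ C])
  have "(%z. \<Sum>j\<in>UNIV. \<bar>k j (fst z) - k j (snd z)\<bar>) \<in> borel_measurable (borel \<Otimes>\<^sub>M borel)" by measurable
  then show "(%(x, y). \<Sum>j\<in>UNIV. \<bar>k j x - k j y\<bar>) \<in> borel_measurable borel" by (simp add: borel_prod case_prod_unfold)
  show "0 <= (\<Sum>j\<in>UNIV. \<bar>k j x - k j y\<bar>)" for x y by (intro sum_nonneg) auto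
  show "(\<Sum>j\<in>UNIV. \<bar>k j x - k j y\<bar>) = 0" if "x <= 0" "y <= 0" for x y using that by (simp add: diag_kernel_def)
 qed (use solution_increment_le[OF sol] in auto)
 also have "... <= ennreal (C powr p) * (ennreal (?m powr p * ?F) * ?X)"
  by (intro mult_left_mono kernel_increments_le[OF p \<eta>]) auto
 also have "... = ennreal ((C * e) powr p) * ?X"
 proof -
  have "?F = (?F powr (1 / p)) powr p" using p \<eta> by (simp add: powr_powr)
  then have "?m powr p * ?F = e powr p" unfolding e_def by (simp add: powr_mult)
  then show ?thesis using C(2) e0 by (simp add: powr_mult ennreal_mult mult.assoc)
 qed
 finally have G: "gagliardo_power \<eta> p T ?G <= ennreal ((C * e) powr p) * ?X" .
 have "W_norm \<eta> p T \<psi> <= Lp_norm p T \<psi> + ennroot p (gagliardo_power \<eta> p T ?G)"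
  unfolding W_norm_def Lp_norm_def by (rule ennroot_add_le[OF p])
 also have "... <= Lp_norm p T \<psi> + ennroot p (ennreal ((C * e) powr p) * ?X)"
  using p by (intro add_left_mono ennroot_mono G) auto
 also have "ennroot p (ennreal ((C * e) powr p) * ?X) = ennreal (C * e) * kernel_norm \<eta> p T K"
  unfolding kernel_norm_def using p C e0 by (intro ennroot_cmult) auto
 also have "... = ennreal C * (ennreal e * kernel_norm \<eta> p T K)" using C e0 by (simp add: ennreal_mult mult.assoc)
 also have "Lp_norm p T \<psi> + ... <= Lp_norm p T \<psi> + (ennreal c * ?S) * (ennreal e * ?H)"
  using src_total_le[OF sol T] unfolding C(1) c_def[symmetric] by (intro add_left_mono mult_mono) (auto simp: add_increasing)
 also have "(ennreal c * ?S) * (ennreal e * ?H) = ennreal (Sobolev_constant \<beta> \<sigma> \<eta> p T) * ?H * ?S"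
  unfolding const using c0 e0 by (simp add: ennreal_mult mult_ac)
 finally show ?thesis .
qed

end

section \<open>Continuity\<close>

abbreviation Lploc :: "real => (real => real) => bool" where "Lploc \<equiv> Lp lborel"

text \<open>The parameter \<open>d\<close> trades the two factors against each other.\<close>
lemma Young_three: "0 <= (a::real) ==> 0 <= b ==> 0 < d ==> a * b <= a powr 3 / (3 * d powr 3) + d powr (3/2) * b powr (3/2)"
proof -
 assume ab: "0 <= a" "0 <= b" "0 < (d::real)"
 have "a * b = (a / d) * (d * b)" using ab by simp
 also have "... <= (a / d) powr 3 / 3 + (d * b) powr (3/2) / (3/2)" using ab by (intro Youngs_inequality) auto
 also have "... <= (a / d) powr 3 / 3 + (d * b) powr (3/2)" by (simp add: field_simps)
 also have "... = a powr 3 / (3 * d powr 3) + d powr (3/2) * b powr (3/2)" using ab by (simp add: powr_divide powr_mult)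
 finally show ?thesis .
qed

lemma small_scaling:
 assumes e: "0 < e" and G: "0 <= (G::real)"
 shows "\<exists>d>0. d powr (3/2) * G < e / 2"
proof -
 have "d powr (3/2) * G < e / 2" if "d = (e / (2 * (G + 1))) powr (2/3)" for d
 proof -
  have "d powr (3/2) = e / (2 * (G + 1))" using that e G by (simp add: powr_powr)
  moreover have "e / (2 * (G + 1)) * G < e / 2" using e G by (simp add: field_simps)
  ultimately show ?thesis by simp
 qed
 then show ?thesis using e G by (intro exI[of _ "(e / (2 * (G + 1))) powr (2/3)"]) auto
qed

text \<open>Replacing \<open>k\<close> by \<open>k (max u \<epsilon>)\<close> removes its singularity; the convolution
with this bounded kernel, continuous except for a jump at 0, is continuous by dominated convergence. The
error is at most \<open>\<integral> k (t - s) \<bar>g s\<bar>\<close> over \<open>0 < t - s \<le> \<epsilon>\<close>.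
By Young's inequality it is small uniformly in \<open>t\<close>: first choose \<open>d\<close>, then
\<open>\<epsilon>\<close>.\<close>
lemma rconv_L3_continuous_global:
 fixes k g :: "real => real"
 assumes k: "Lploc 3 k" "!!u. 0 <= k u" "k 0 = 0" "antimono_on {0<..} k" "continuous_on {0<..} k"
  and g: "integrable lborel g" "!!s. s < 0 ==> g s = 0" "integrable lborel (%s. \<bar>g s\<bar> powr (3/2))"
 shows "integrable lborel (%s. k (t - s) * g s)" "continuous_on UNIV (rconv k lborel g)"
proof -
 have k0: "k u = 0" if "u <= 0" for u using LpD(2)[OF k(1), of u] k(3) that by (cases "u = 0") auto
 have [measurable]: "g \<in> borel_measurable borel" using borel_measurable_integrable[OF g(1)] by simp
 note [measurable] = LpD(1)[OF k(1)]
 have k3: "integrable lborel (%u. k u powr 3 * indicator {0..T} u)" for T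
 proof (rule integrableI_bounded)
  have "(NN u. ennreal (norm (k u powr 3 * indicator {0..T} u))) = nnI lborel T (%u. \<bar>k u\<bar> powr 3)"
   by (intro nn_integral_cong) (auto split: split_indicator simp: k(2))
  then show "(NN u. ennreal (norm (k u powr 3 * indicator {0..T} u))) < \<infinity>" using LpD(3)[OF k(1), of T] by simp
 qed measurable
 have refl: "integrable lborel (%s. f (t - s))" "(\<integral>s. f (t - s) \<partial>lborel) = (\<integral>u. f u \<partial>lborel)" if "integrable lborel f" for f :: "real => real" and t
  using lborel_integrable_real_affine[OF that, of "-1" t] lborel_integral_real_affine[of "-1" f t] by simp_all
 have int: "integrable lborel (%s. k (t - s) * g s)" for t
 proof (rule Bochner_Integration.integrable_bound)
  show "integrable lborel (%s. k (t - s) powr 3 * indicator {0..t} (t - s) + \<bar>g s\<bar> powr (3/2))"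
   by (intro Bochner_Integration.integrable_add g refl(1)[OF k3])
  show "AL s. norm (k (t - s) * g s) <= norm (k (t - s) powr 3 * indicator {0..t} (t - s) + \<bar>g s\<bar> powr (3/2))"
  proof (intro AE_I2)
   fix s
   show "norm (k (t - s) * g s) <= norm (k (t - s) powr 3 * indicator {0..t} (t - s) + \<bar>g s\<bar> powr (3/2))"
   proof (cases "0 <= s & s <= t")
    case True
    have "k (t - s) * \<bar>g s\<bar> <= k (t - s) powr 3 / (3 * 1 powr 3) + 1 powr (3/2) * \<bar>g s\<bar> powr (3/2)" by (rule Young_three) (auto simp: k(2))
    also have "... <= k (t - s) powr 3 + \<bar>g s\<bar> powr (3/2)" by simp
    finally show ?thesis using True by (simp add: abs_mult k(2))
   next
    case False
    then have "k (t - s) * g s = 0" using g(2)[of s] k0[of "t - s"] by (cases "s < 0") auto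
    then show ?thesis by (auto split: split_indicator)
   qed
  qed
 qed measurable
 show "integrable lborel (%s. k (t - s) * g s)" by (rule int)
 \<comment> \<open>truncation of the singularity of \<open>k\<close> at 0\<close>
 define \<epsilon> where "\<epsilon> n = 1 / real (Suc n)" for n
 have \<epsilon>: "0 < \<epsilon> n" "\<epsilon> n <= 1" for n by (auto simp: \<epsilon>_def)
 define kn where "kn n u = (if 0 < u then k (max u (\<epsilon> n)) else 0)" for n u
 have knm [measurable]: "kn n \<in> borel_measurable borel" for n unfolding kn_def[abs_def] by measurable
 have anti: "k v <= k u" if "0 < u" "u <= v" for u v using k(4) that by (auto simp: monotone_on_def)
 have kn: "0 <= kn n u" "kn n u <= k (\<epsilon> n)" "kn n u <= k u" "\<epsilon> n < u ==> kn n u = k u" for n u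
  using \<epsilon>[of n] k(2) by (auto simp: kn_def intro!: anti)
 have intn: "integrable lborel (%s. kn n (t - s) * g s)" for n t
  by (rule Bochner_Integration.integrable_bound[OF int[of t]], measurable, intro AE_I2) (auto simp: abs_mult kn k(2) intro!: mult_right_mono)
 have contn: "continuous_on UNIV (rconv (kn n) lborel g)" for n
 proof (intro continuous_at_imp_continuous_on ballI continuous_at_sequentiallyI)
  fix t :: real and u :: "nat => real" assume u: "u \<longlonglongrightarrow> t"
  show "(%m. rconv (kn n) lborel g (u m)) \<longlonglongrightarrow> rconv (kn n) lborel g t"
   unfolding rconv_def
  proof (rule integral_dominated_convergence)
   show "integrable lborel (%s. k (\<epsilon> n) * \<bar>g s\<bar>)" using g(1) by (intro integrable_mult_right integrable_abs)
   show "AL s. (%m. kn n (u m - s) * g s) \<longlonglongrightarrow> kn n (t - s) * g s"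
    using AE_lborel_singleton[of t]
   proof eventually_elim
    case (elim s)
    have lim: "(%m. u m - s) \<longlonglongrightarrow> t - s" by (intro tendsto_intros u)
    have "(%m. kn n (u m - s)) \<longlonglongrightarrow> kn n (t - s)"
    proof (cases "s < t")
     case True
     have ev: "\<forall>\<^sub>F m in sequentially. 0 < u m - s" using order_tendstoD(1)[OF lim, of 0] True by simp
     have "isCont k (max (t - s) (\<epsilon> n))" using k(5) True by (auto simp: continuous_on_eq_continuous_at)
     then have "(%m. k (max (u m - s) (\<epsilon> n))) \<longlonglongrightarrow> k (max (t - s) (\<epsilon> n))"
      by (rule isCont_tendsto_compose) (intro tendsto_intros lim)
     moreover have "\<forall>\<^sub>F m in sequentially. kn n (u m - s) = k (max (u m - s) (\<epsilon> n))" using ev by eventually_elim (simp add: kn_def)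
     ultimately show ?thesis using True by (simp add: kn_def tendsto_cong)
    next
     case False
     then have "t - s < 0" using elim by simp
     then have "\<forall>\<^sub>F m in sequentially. u m - s < 0" by (rule order_tendstoD(2)[OF lim])
     then have "\<forall>\<^sub>F m in sequentially. kn n (u m - s) = 0" by eventually_elim (simp add: kn_def)
     then show ?thesis using \<open>t - s < 0\<close> by (simp add: kn_def tendsto_eventually)
    qed
    then show ?case by (intro tendsto_intros)
   qed
   show "AL s. norm (kn n (u m - s) * g s) <= k (\<epsilon> n) * \<bar>g s\<bar>" for m
    by (intro AE_I2) (auto simp: abs_mult kn intro!: mult_right_mono)
  qed (use borel_measurable_integrable[OF intn] in auto)
 qed
 define H where "H n = (\<integral>u. k u powr 3 * indicator {0<..\<epsilon> n} u \<partial>lborel)" for n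
 have Hint: "integrable lborel (%u. k u powr 3 * indicator {0<..\<epsilon> n} u)" for n
  by (rule Bochner_Integration.integrable_bound[OF k3[of 1]], measurable, intro AE_I2) (use \<epsilon>[of n] in \<open>auto split: split_indicator\<close>)
 have H: "H \<longlonglongrightarrow> 0"
 proof -
  have "H \<longlonglongrightarrow> (\<integral>u. (0::real) \<partial>(lborel :: real measure))"
   unfolding H_def
  proof (rule integral_dominated_convergence[where w="%u. k u powr 3 * indicator {0..1} u"])
   show "integrable lborel (%u. k u powr 3 * indicator {0..1} u)" by (rule k3)
   show "AL u. (%n. k u powr 3 * indicator {0<..\<epsilon> n} u) \<longlonglongrightarrow> 0"
   proof (intro AE_I2)
    fix u
    show "(%n. k u powr 3 * indicator {0<..\<epsilon> n} u) \<longlonglongrightarrow> 0"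
    proof (cases "0 < u")
     case True
     have "\<epsilon> \<longlonglongrightarrow> 0" unfolding \<epsilon>_def by (rule LIMSEQ_inverse_real_of_nat[unfolded inverse_eq_divide])
     then have "\<forall>\<^sub>F n in sequentially. \<epsilon> n < u" by (rule order_tendstoD(2)[OF _ True])
     then have "\<forall>\<^sub>F n in sequentially. k u powr 3 * indicator {0<..\<epsilon> n} u = 0" by eventually_elim (auto split: split_indicator)
     then show ?thesis by (rule tendsto_eventually)
    qed simp
   qed
   show "AL u. norm (k u powr 3 * indicator {0<..\<epsilon> n} u) <= k u powr 3 * indicator {0..1} u" for n
    using \<epsilon>[of n] by (intro AE_I2) (auto split: split_indicator)
  qed measurable
  then show ?thesis by simp
 qed
 let ?G = "\<integral>s. \<bar>g s\<bar> powr (3/2) \<partial>lborel"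
 have diff: "\<bar>rconv (kn n) lborel g t - rconv k lborel g t\<bar> <= H n / (3 * d powr 3) + d powr (3/2) * ?G" if d: "0 < d" for n t d
 proof -
  have eq: "rconv (kn n) lborel g t - rconv k lborel g t = (\<integral>s. kn n (t - s) * g s - k (t - s) * g s \<partial>lborel)"
   unfolding rconv_def by (rule Bochner_Integration.integral_diff[symmetric]) (rule intn int)+
  have "\<bar>rconv (kn n) lborel g t - rconv k lborel g t\<bar> <= (\<integral>s. k (t - s) powr 3 * indicator {0<..\<epsilon> n} (t - s) / (3 * d powr 3) + d powr (3/2) * \<bar>g s\<bar> powr (3/2) \<partial>lborel)"
   unfolding eq real_norm_def[symmetric]
  proof (rule Bochner_Integration.integral_norm_bound_integral)
   show "integrable lborel (%s. kn n (t - s) * g s - k (t - s) * g s)" by (intro Bochner_Integration.integrable_diff intn int)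
   show "integrable lborel (%s. k (t - s) powr 3 * indicator {0<..\<epsilon> n} (t - s) / (3 * d powr 3) + d powr (3/2) * norm (g s) powr (3/2))"
    using refl(1)[OF Hint[of n], of t] g(3) by (intro Bochner_Integration.integrable_add integrable_mult_right integrable_divide_zero) auto
   fix s
   have e: "norm (kn n (t - s) * g s - k (t - s) * g s) = (k (t - s) - kn n (t - s)) * \<bar>g s\<bar>"
    using kn(3)[of n "t - s"] by (simp add: abs_mult flip: left_diff_distrib)
   show "norm (kn n (t - s) * g s - k (t - s) * g s) <= k (t - s) powr 3 * indicator {0<..\<epsilon> n} (t - s) / (3 * d powr 3) + d powr (3/2) * norm (g s) powr (3/2)"
   proof (cases "0 < t - s & t - s <= \<epsilon> n")
    case True
    have "(k (t - s) - kn n (t - s)) * \<bar>g s\<bar> <= k (t - s) * \<bar>g s\<bar>" using kn(1) by (intro mult_right_mono) auto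
    also have "... <= k (t - s) powr 3 / (3 * d powr 3) + d powr (3/2) * \<bar>g s\<bar> powr (3/2)" by (rule Young_three) (auto simp: k(2) d)
    finally show ?thesis unfolding e using True by simp
   next
    case False
    then have "k (t - s) = kn n (t - s)" using kn(4)[of n "t - s"] k0[of "t - s"] by (cases "0 < t - s") (auto simp: kn_def)
    then show ?thesis by (simp add: d)
   qed
  qed
  also have "... = H n / (3 * d powr 3) + d powr (3/2) * ?G"
   using refl[OF Hint[of n], of t] g(3) by (simp add: H_def)
  finally show ?thesis .
 qed
 show "continuous_on UNIV (rconv k lborel g)"
 proof (rule uniform_limit_theorem[where F=sequentially])
  show "\<forall>\<^sub>F n in sequentially. continuous_on UNIV (rconv (kn n) lborel g)" by (simp add: contn)
  show "uniform_limit UNIV (%n. rconv (kn n) lborel g) (rconv k lborel g) sequentially"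
  proof (rule uniform_limitI)
   fix e :: real assume e: "0 < e"
   have G0: "0 <= ?G" by (intro integral_nonneg_AE) auto
   obtain d where d: "0 < d" and dG: "d powr (3/2) * ?G < e / 2" using small_scaling[OF e G0] by blast
   have "0 < e / 2 * (3 * d powr 3)" using e d by simp
   then have "\<forall>\<^sub>F n in sequentially. H n < e / 2 * (3 * d powr 3)" by (rule order_tendstoD(2)[OF H])
   then show "\<forall>\<^sub>F n in sequentially. \<forall>x\<in>UNIV. dist (rconv (kn n) lborel g x) (rconv k lborel g x) < e"
   proof eventually_elim
    case (elim n)
    have "H n / (3 * d powr 3) < e / 2" using elim d by (simp add: field_simps)
    then have "H n / (3 * d powr 3) + d powr (3/2) * ?G < e" using dG by linarith
    then show ?case unfolding dist_real_def using order_le_less_trans[OF diff[OF d]] by blast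
   qed
  qed
 qed simp
qed

lemma rconv_L3_continuous:
 fixes k g :: "real => real"
 assumes k: "Lploc 3 k" "!!u. 0 <= k u" "k 0 = 0" "antimono_on {0<..} k" "continuous_on {0<..} k"
  and g: "Lploc (3/2) g"
 shows "integrable lborel (%s. k (t - s) * g s)" "isCont (rconv k lborel g) t"
proof -
 let ?F = "%h. NN s. ennreal (norm (\<bar>h s\<bar> powr (3/2)))"
 note [measurable] = LpD(1)[OF g] LpD(1)[OF k(1)]
 define h where "h s = indicator {0..t + 1} s * g s" for s
 have i: "integrable lborel (%s. \<bar>h s\<bar> powr (3/2))"
 proof (rule integrableI_bounded)
  show "(%s. \<bar>h s\<bar> powr (3/2)) \<in> borel_measurable lborel" unfolding h_def by measurable
  have "(?F h) = nnI lborel (t + 1) (%s. \<bar>g s\<bar> powr (3/2))"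
   by (intro nn_integral_cong) (auto split: split_indicator simp: h_def)
  then show "(?F h) < \<infinity>" using LpD(3)[OF g] by simp
 qed
 have h: "integrable lborel h"
 proof (rule Bochner_Integration.integrable_bound)
  show "integrable lborel (%s. indicator {0..t + 1} s + \<bar>h s\<bar> powr (3/2))"
   by (intro Bochner_Integration.integrable_add i) (simp add: emeasure_lborel_Icc_eq)
  show "h \<in> borel_measurable lborel" unfolding h_def by measurable
  have le: "x <= 1 + x powr (3/2)" if "0 <= x" for x :: real
  proof (cases "x <= 1")
   case False
   then have "x powr 1 <= x powr (3/2)" by (intro powr_mono) auto
   then show ?thesis using False by simp
  qed (simp add: add_increasing2)
  show "AL s. norm (h s) <= norm (indicator {0..t + 1} s + \<bar>h s\<bar> powr (3/2))"
   using le by (intro AE_I2) (auto simp: h_def split: split_indicator)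
 qed
 have eq: "(%s. k (u - s) * g s) = (%s. k (u - s) * h s)" if "u < t + 1" for u
  using that LpD(2)[OF k(1)] LpD(2)[OF g] by (auto simp: fun_eq_iff h_def split: split_indicator)
 note glob = rconv_L3_continuous_global[OF k h _ i]
 have hneg: "h s = 0" if "s < 0" for s using that by (simp add: h_def)
 show "integrable lborel (%s. k (t - s) * g s)" using glob(1)[OF hneg] eq[of t] by simp
 have "isCont (rconv k lborel h) t" using glob(2)[OF hneg] by (simp add: continuous_on_eq_continuous_at)
 moreover have "\<forall>\<^sub>F u in nhds t. rconv k lborel g u = rconv k lborel h u"
  using eventually_nhds_in_open[of "{..<t + 1}" t] by (auto elim!: eventually_mono simp: rconv_def eq)
 ultimately show "isCont (rconv k lborel g) t" by (subst isCont_cong)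
qed

context riccati_setting begin

text \<open>The weighted norm of the kernel contains the factor \<open>t powr (- \<eta> p)\<close>, which is bounded
below on \<open>(0,T]\<close>, so it controls the \<open>L\<^sup>p\<close> norm and for \<open>p \<ge> 3\<close>
also the local \<open>L\<^sup>3\<close> norm.\<close>
lemma Lploc_kernel:
 assumes fin: "!!T. 0 < T ==> kernel_norm \<eta> p T K < \<infinity>" and p: "3 <= p" and \<eta>: "0 < \<eta>"
 shows "Lploc 3 (k i)"
 unfolding Lp_def
proof (intro conjI allI impI)
 show "k i \<in> borel_measurable borel" by measurable
 show "k i s = 0" if "s < 0" for s using that by (simp add: diag_kernel_def)
 fix T0 :: real
 define T where "T = max T0 1"
 have T: "0 < T" by (simp add: T_def)
 note [measurable] = LlocD(1)[OF Lloc_causal_kernel[OF adm]]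
 let ?o = "%t. op_norm (\<chi> i j. causal_entry K i j t)"
 have [measurable]: "?o \<in> borel_measurable borel" by (intro borel_measurable_op_norm) measurable
 have o: "?o t = op_norm (K t)" if "0 <= t" for t
 proof -
  have "(\<chi> i j. causal_entry K i j t) = K t" using that by (simp add: vec_eq_iff causal_entry_simps)
  then show ?thesis by simp
 qed
 define w where "w t = t powr (- \<eta> * p) * ?o t powr p" for t
 have [measurable]: "w \<in> borel_measurable borel" unfolding w_def[abs_def] by measurable
 have w0: "0 <= w t" for t by (simp add: w_def)
 have wfin: "nnI lborel T w < \<infinity>"
 proof -
  have "(\<integral>\<^sup>+t\<in>{0..T}. ennreal (t powr (- \<eta> * p) * op_norm (K t) powr p) \<partial>lborel) < \<infinity>"
   using fin[OF T] unfolding kernel_norm_def ennroot_def by (auto split: if_splits simp: less_top)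
  moreover have "nnI lborel T w = (\<integral>\<^sup>+t\<in>{0..T}. ennreal (t powr (- \<eta> * p) * op_norm (K t) powr p) \<partial>lborel)"
   by (intro nn_integral_cong) (auto split: split_indicator simp: o w_def)
  ultimately show ?thesis by simp
 qed
 have "\<bar>k i s\<bar> powr 3 <= 1 + T powr (\<eta> * p) * w s" if s: "0 < s" "s <= T" for s
 proof -
  have "\<bar>k i s\<bar> <= ?o s" using s component_le_op_norm[of "K s" i i] by (simp add: diag_kernel_def o)
  then have "\<bar>k i s\<bar> powr 3 <= ?o s powr 3" by (intro powr_mono2) auto
  also have "... <= 1 + ?o s powr p"
  proof (cases "?o s <= 1")
   case True
   then have "?o s powr 3 <= 1 powr 3" by (intro powr_mono2) (auto simp: op_norm_nonneg)
   then show ?thesis by (simp add: add_increasing2)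
  next
   case False
   then have "?o s powr 3 <= ?o s powr p" using p by (intro powr_mono) auto
   then show ?thesis by simp
  qed
  also have "?o s powr p <= T powr (\<eta> * p) * w s"
  proof -
   have "1 <= (T / s) powr (\<eta> * p)" using s p \<eta> by (intro ge_one_powr_ge_zero) auto
   also have "... = T powr (\<eta> * p) * s powr (- \<eta> * p)" using s by (simp add: powr_divide powr_minus_divide)
   finally have "1 * ?o s powr p <= T powr (\<eta> * p) * s powr (- \<eta> * p) * ?o s powr p" by (rule mult_right_mono) simp
   then show ?thesis by (simp add: mult.assoc w_def)
  qed
  finally show ?thesis by simp
 qed
 moreover have "k i 0 = 0" by (simp add: diag_kernel_def)
 ultimately have le: "\<bar>k i s\<bar> powr 3 <= 1 + T powr (\<eta> * p) * w s" if "0 <= s" "s <= T" for s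
  using that w0[of 0] by (cases "s = 0") auto
 have "nnI lborel T0 (%s. \<bar>k i s\<bar> powr 3)
  <= (NN s. indicator {0..T} s + ennreal (T powr (\<eta> * p)) * (ennreal (w s) * indicator {0..T} s))"
 proof (intro nn_integral_mono)
  fix s
  have "ennreal (\<bar>k i s\<bar> powr 3) <= 1 + ennreal (T powr (\<eta> * p)) * ennreal (w s)" if "0 <= s" "s <= T"
  proof -
   have "ennreal (\<bar>k i s\<bar> powr 3) <= ennreal (1 + T powr (\<eta> * p) * w s)" by (rule ennreal_leI[OF le[OF that]])
   also have "... = 1 + ennreal (T powr (\<eta> * p)) * ennreal (w s)" by (simp add: ennreal_plus ennreal_mult w0)
   finally show ?thesis .
  qed
  then show "ennreal (\<bar>k i s\<bar> powr 3) * indicator {0..T0} s <= indicator {0..T} s + ennreal (T powr (\<eta> * p)) * (ennreal (w s) * indicator {0..T} s)"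
   by (auto split: split_indicator simp: T_def)
 qed
 also have "... = ennreal T + ennreal (T powr (\<eta> * p)) * nnI lborel T w"
  using T by (simp add: nn_integral_add nn_integral_cmult)
 also have "... < \<infinity>" using wfin by (simp add: ennreal_mult_less_top)
 finally show "nnI lborel T0 (%s. \<bar>k i s\<bar> powr 3) < \<infinity>" .
qed

lemma Lploc_measure_conv:
 assumes k3: "Lploc 3 (k i)" and n: "Lloc M n" and v: "v \<in> borel_measurable borel" "!!s. s < 0 ==> v s = 0"
  and eq: "AL t. v t = rconv (k i) M n t"
 shows "Lploc 3 v"
 unfolding Lp_def
proof (intro conjI allI impI)
 fix T
 obtain C where C: "nnI M T (%s. \<bar>n s\<bar>) = ennreal C" "0 <= C"
  using LlocD(3)[OF n, of T] by (cases "nnI M T (%s. \<bar>n s\<bar>)") auto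
 have "nnI lborel T (%t. \<bar>v t\<bar> powr 3) <= ennreal (C powr 3) * nnI lborel T (%u. k i u powr 3)"
 proof (rule Young_conv_powr[OF k_measurable _ _ Lloc_abs[OF n] _ _ _ _ C])
  show "AL t. 0 <= t --> t <= T --> ennreal \<bar>v t\<bar> <= (\<integral>\<^sup>+s. ennreal (k i (t - s) * \<bar>n s\<bar>) \<partial>M)"
   using eq
  proof eventually_elim
   case (elim t)
   show ?case using abs_rconv_le[of "k i" n t] by (simp add: elim abs_of_nonneg diag_kernel_nonneg[OF adm])
  qed
  show "0 <= k i u" for u by (rule diag_kernel_nonneg[OF adm])
  show "k i u = 0" if "u < 0" for u using that by (simp add: diag_kernel_def)
 qed auto
 also have "... < \<infinity>" using LpD(3)[OF k3, of T] by (simp add: ennreal_mult_less_top diag_kernel_nonneg[OF adm])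
 finally show "nnI lborel T (%t. \<bar>v t\<bar> powr 3) < \<infinity>" .
qed (use v in auto)

text \<open>\<open>\<psi>\<close> is a convolution of the kernel with a measure and inherits its local integrability;
the nonlinearity is at most quadratic.\<close>
lemma Lploc_nonlinearity:
 assumes sol: "riccati_solution \<beta> \<sigma> K \<mu> \<psi>" and k3: "!!i. Lploc 3 (k i)"
 shows "Lploc (3/2) (g_re (re_part \<psi>) (im_part \<psi>) i)" "Lploc (3/2) (g_im (re_part \<psi>) (im_part \<psi>) i)"
proof -
 let ?a = "re_part \<psi>" and ?c = "im_part \<psi>"
 note s = solution_real_form[OF sol] and src = solution_single_source[OF sol]
 note gL = Lloc_g[of ?a ?c, OF s(1) s(2)]
 have ac: "Lploc 3 (?a i)" "Lploc 3 (?c i)" for i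
  by (rule Lploc_measure_conv[OF k3 src(1) L2locD(1)[OF s(1)] L2locD(2)[OF s(1)] src(3)], assumption)
   (rule Lploc_measure_conv[OF k3 src(2) L2locD(1)[OF s(2)] L2locD(2)[OF s(2)] src(4)])
 define S where "S s = indicator {0..} s + (\<Sum>l\<in>UNIV. \<bar>?a l s\<bar> + \<bar>?c l s\<bar>)" for s
 have S3: "Lploc 3 S" unfolding S_def by (intro Lp_add Lp_indicator Lp_sum Lp_abs ac) auto
 note [measurable] = LpD(1)[OF S3]
 have S0: "0 <= S s" for s unfolding S_def by (intro add_nonneg_nonneg sum_nonneg) auto
 let ?C = "2 * real CARD('m) * bnd + 2 * q i"
 have C0: "0 <= ?C" by (intro add_nonneg_nonneg mult_nonneg_nonneg) (auto simp: bnd_nonneg q_nonneg)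
 have bound: "\<bar>g_re ?a ?c i s\<bar> + \<bar>g_im ?a ?c i s\<bar> <= ?C * (S s)\<^sup>2" if s: "0 <= s" for s
 proof -
  let ?R = "\<Sum>l\<in>UNIV. \<bar>?a l s\<bar> + \<bar>?c l s\<bar>"
  have R0: "0 <= ?R" by (intro sum_nonneg) auto
  have "norm (\<psi> s) <= (\<Sum>l\<in>UNIV. norm (\<psi> s $ l))" unfolding norm_vec_def by (rule L2_set_le_sum) simp
  also have "... <= ?R" using s by (intro sum_mono order_trans[OF cmod_le]) (simp add: re_part_def im_part_def)
  finally have nR: "(norm (\<psi> s))\<^sup>2 <= ?R\<^sup>2" by (intro power_mono) auto
  have "(S s)\<^sup>2 = 1 + (?R\<^sup>2 + 2 * ?R)" using s by (simp add: S_def power2_sum)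
  then have "1 + (norm (\<psi> s))\<^sup>2 <= (S s)\<^sup>2" using nR R0 by linarith
  then have "?C * (1 + (norm (\<psi> s))\<^sup>2) <= ?C * (S s)\<^sup>2" using C0 by (rule mult_left_mono)
  then show ?thesis using g_le[OF s, of \<psi> i] by linarith
 qed
 have main: "Lploc (3/2) g" if g: "g \<in> borel_measurable borel" "!!s. s < 0 ==> g s = 0" and le: "!!s. 0 <= s ==> \<bar>g s\<bar> <= ?C * (S s)\<^sup>2" for g
  unfolding Lp_def
 proof (intro conjI allI impI)
  fix T
  have "nnI lborel T (%s. \<bar>g s\<bar> powr (3/2)) <= (NN s. ennreal (?C powr (3/2)) * (ennreal (\<bar>S s\<bar> powr 3) * indicator {0..T} s))"
  proof (intro nn_integral_mono)
   fix s
   have "ennreal (\<bar>g s\<bar> powr (3/2)) <= ennreal (?C powr (3/2)) * ennreal (\<bar>S s\<bar> powr 3)" if "0 <= s"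
   proof -
    have "\<bar>g s\<bar> powr (3/2) <= (?C * (S s)\<^sup>2) powr (3/2)" using le[OF that] by (intro powr_mono2) auto
    also have "... = ?C powr (3/2) * ((S s)\<^sup>2) powr (3/2)" using C0 by (simp add: powr_mult)
    also have "((S s)\<^sup>2) powr (3/2) = (S s powr 2) powr (3/2)" using S0[of s] by simp
    also have "... = \<bar>S s\<bar> powr 3" using S0[of s] unfolding powr_powr by simp
    finally show ?thesis by (simp add: ennreal_leI flip: ennreal_mult)
   qed
   then show "ennreal (\<bar>g s\<bar> powr (3/2)) * indicator {0..T} s <= ennreal (?C powr (3/2)) * (ennreal (\<bar>S s\<bar> powr 3) * indicator {0..T} s)"
    by (auto split: split_indicator)
  qed
  also have "... = ennreal (?C powr (3/2)) * nnI lborel T (%s. \<bar>S s\<bar> powr 3)" by (rule nn_integral_cmult) measurable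
  also have "... < \<infinity>" using LpD(3)[OF S3, of T] by (simp add: ennreal_mult_less_top)
  finally show "nnI lborel T (%s. \<bar>g s\<bar> powr (3/2)) < \<infinity>" .
 qed (use g in auto)
 show "Lploc (3/2) (g_re ?a ?c i)"
 proof (rule main[OF LlocD(1)[OF gL(1)] LlocD(2)[OF gL(1)]])
  show "\<bar>g_re ?a ?c i s\<bar> <= ?C * (S s)\<^sup>2" if "0 <= s" for s using bound[OF that] by linarith
 qed
 show "Lploc (3/2) (g_im ?a ?c i)"
 proof (rule main[OF LlocD(1)[OF gL(2)] LlocD(2)[OF gL(2)]])
  show "\<bar>g_im ?a ?c i s\<bar> <= ?C * (S s)\<^sup>2" if "0 <= s" for s using bound[OF that] by linarith
 qed
qed

theorem solution_continuous:
 assumes sol: "riccati_solution \<beta> \<sigma> K \<mu> \<psi>" and fin: "!!T. 0 < T ==> kernel_norm \<eta> p T K < \<infinity>" and p: "3 <= p" and \<eta>: "0 < \<eta>"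
  and t0: "0 <= t0" "continuous (at t0 within {0..}) (conv_measure K \<mu>)"
 shows "continuous (at t0 within {0..}) \<psi>"
proof -
 let ?F = "%s. riccati_R \<beta> \<sigma> (\<psi> s)"
 let ?a = "re_part \<psi>" and ?c = "im_part \<psi>"
 note s = solution_real_form[OF sol]
 note gL = Lloc_g[of ?a ?c, OF s(1) s(2)]
 have k3: "Lploc 3 (k i)" for i by (rule Lploc_kernel[OF fin p \<eta>])
 have anti: "antimono_on {0<..} (k i)" and cont: "continuous_on {0<..} (k i)" for i
 proof -
  have a: "antimono_on {0<..} (%t. K t $ i $ i)" and c: "continuous_on {0<..} (%t. K t $ i $ i)"
   using admissible_shift[OF adm, of i] by (auto simp: kernel_shift_condition_def)
  show "antimono_on {0<..} (k i)" using a by (auto simp: monotone_on_def diag_kernel_def)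
  show "continuous_on {0<..} (k i)" by (rule continuous_on_eq[OF c]) (simp add: diag_kernel_def)
 qed
 have k0: "k i 0 = 0" for i by (simp add: diag_kernel_def)
 have gre: "integrable lborel (%s. k i (t - s) * g_re ?a ?c i s)" "isCont (rconv (k i) lborel (g_re ?a ?c i)) t" for i t
  by (rule rconv_L3_continuous[OF k3 diag_kernel_nonneg[OF adm] k0 anti cont Lploc_nonlinearity(1)[OF sol k3]])+
 have gim: "integrable lborel (%s. k i (t - s) * g_im ?a ?c i s)" "isCont (rconv (k i) lborel (g_im ?a ?c i)) t" for i t
  by (rule rconv_L3_continuous[OF k3 diag_kernel_nonneg[OF adm] k0 anti cont Lploc_nonlinearity(2)[OF sol k3]])+
 define F where "F t = (\<chi> i. complex_of_real (rconv (k i) lborel (g_re ?a ?c i) t) + \<i> * complex_of_real (rconv (k i) lborel (g_im ?a ?c i) t))" for t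
 have "((%t. F t $ i) \<longlongrightarrow> F t0 $ i) (at t0)" for i
  unfolding F_def using gre(2)[of t0 i] gim(2)[of t0 i] by (auto simp: isCont_def intro!: tendsto_intros)
 then have "(F \<longlongrightarrow> F t0) (at t0)" by (rule vec_tendstoI)
 then have "isCont F t0" by (simp only: isCont_def)
 then have "continuous (at t0 within {0..}) F" by (rule continuous_at_imp_continuous_at_within)
 then have sum: "continuous (at t0 within {0..}) (%t. conv_measure K \<mu> t + F t)" by (rule continuous_add[OF t0(2)])
 have eq: "conv_measure K \<mu> t + F t = \<psi> t" if t: "0 <= t" for t
 proof -
  have "conv cmat_vec K ?F t $ i = F t $ i" for i
  proof -
   have "conv cmat_vec K ?F t $ i = Complex (rconv (k i) lborel (g_re ?a ?c i) t) (rconv (k i) lborel (g_im ?a ?c i) t)"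
   proof (rule conv_cmat_vec_at(2)[OF adm])
    show "g_re ?a ?c i s = Re (riccati_R \<beta> \<sigma> (\<psi> s) $ i)" "g_im ?a ?c i s = Im (riccati_R \<beta> \<sigma> (\<psi> s) $ i)" if "0 <= s" for i s
     using that by (simp_all add: riccati_R_parts lin_def re_part_def im_part_def)
   qed (use gre(1) gim(1) gL[THEN LlocD(1)] gL[THEN LlocD(2)] in auto)
   then show ?thesis by (simp add: F_def complex_eq_iff)
  qed
  then have "conv cmat_vec K ?F t = F t" by (simp add: vec_eq_iff)
  moreover have "\<psi> t = conv_measure K \<mu> t + conv cmat_vec K ?F t"
   using sol t unfolding riccati_solution_def by blast
  ultimately show ?thesis by simp
 qed
 show ?thesis
 proof (rule continuous_transform_within[OF sum zero_less_one])
  show "t0 \<in> {0..}" using t0(1) by simp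
  show "conv_measure K \<mu> t + F t = \<psi> t" if "t \<in> {0..}" for t using that by (intro eq) simp
 qed
qed

end

theorem theorem3p8:
  fixes b \<sigma> :: "real ^ 'm" and \<beta> :: "real ^ 'm ^ 'm"
    and K :: "real \<Rightarrow> real ^ 'm ^ 'm" and p \<eta> :: real
  assumes "admissible b \<beta> \<sigma> K"
    and "2 \<le> p" and "0 < \<eta>" and "\<eta> < 1"
    and "\<And>T. 0 < T \<Longrightarrow> kernel_norm \<eta> p T K < \<infinity>"
  shows
    "(\<forall>\<mu>. lf_measure_nonpos_Re \<mu> \<longrightarrow>
        (\<exists>\<psi>. riccati_solution \<beta> \<sigma> K \<mu> \<psi> \<and>
          (\<forall>\<phi>. riccati_solution \<beta> \<sigma> K \<mu> \<phi> \<longrightarrow> (AE t in lborel. 0 \<le> t \<longrightarrow> \<phi> t = \<psi> t)))) \<and>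
     (\<forall>T>0. \<forall>q\<in>{1..p}. \<forall>\<mu> \<psi>.
        lf_measure_nonpos_Re \<mu> \<longrightarrow> riccati_solution \<beta> \<sigma> K \<mu> \<psi> \<longrightarrow>
        Lp_norm q T \<psi>
          \<le> 2 * total_variation \<mu> {0..T} * Lp_norm_mat q T (resolvent_E K (transpose \<beta>))
            + ennreal (\<Sum>i\<in>UNIV. (\<sigma> $ i)\<^sup>2 / 2) * (total_variation \<mu> {0..T})\<^sup>2
              * Lp_norm_mat q T (resolvent_E K (transpose \<beta>))
              * (Lp_norm_mat 2 T (resolvent_E K (transpose \<beta>)))\<^sup>2 \<and>
        (Im_measure_zero \<mu> \<longrightarrow>
          Lp_norm q T \<psi>
            \<le> total_variation \<mu> {0..T} * Lp_norm_mat q T (resolvent_E K (transpose \<beta>)))) \<and>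
     (\<forall>T>0. \<exists>C\<ge>0. \<forall>\<mu> \<psi>.
        lf_measure_nonpos_Re \<mu> \<longrightarrow> riccati_solution \<beta> \<sigma> K \<mu> \<psi> \<longrightarrow>
        W_norm \<eta> p T \<psi>
          \<le> Lp_norm p T \<psi>
            + ennreal C * (1 + kernel_norm \<eta> p T K)
              * (1 + total_variation \<mu> {0..T} + (Lp_norm 2 T \<psi>)\<^sup>2)) \<and>
     (3 \<le> p \<longrightarrow>
        (\<forall>\<mu> \<psi>. lf_measure_nonpos_Re \<mu> \<longrightarrow> riccati_solution \<beta> \<sigma> K \<mu> \<psi> \<longrightarrow>
          (\<forall>t\<^sub>0\<ge>0. continuous (at t\<^sub>0 within {0..}) (conv_measure K \<mu>) \<longrightarrow>
                   continuous (at t\<^sub>0 within {0..}) \<psi>)))"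
proof -
 have setting: "\<exists>M \<rho> \<pi> \<upsilon> d0. riccati_setting M \<mu> \<rho> \<pi> \<upsilon> d0 b \<sigma> \<beta> K" if "lf_measure_nonpos_Re \<mu>" for \<mu>
  using measure_densities_exist[OF that] assms(1) by (auto simp: riccati_setting_def riccati_setting_axioms_def)
 show ?thesis
 proof (intro conjI allI impI ballI, goal_cases)
  case (1 \<mu>)
  then obtain M \<rho> \<pi> \<upsilon> d0 where "riccati_setting M \<mu> \<rho> \<pi> \<upsilon> d0 b \<sigma> \<beta> K" using setting by blast
  then interpret riccati_setting M \<mu> \<rho> \<pi> \<upsilon> d0 b \<sigma> \<beta> K .
  show ?case using riccati_exists riccati_unique by blast
 next
  case (2 T r \<mu> \<psi>)
  then obtain M \<rho> \<pi> \<upsilon> d0 where "riccati_setting M \<mu> \<rho> \<pi> \<upsilon> d0 b \<sigma> \<beta> K" using setting by blast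
  then interpret riccati_setting M \<mu> \<rho> \<pi> \<upsilon> d0 b \<sigma> \<beta> K .
  show ?case using 2 by (intro Lp_norm_bound(1)) auto
 next
  case (3 T r \<mu> \<psi>)
  then obtain M \<rho> \<pi> \<upsilon> d0 where "riccati_setting M \<mu> \<rho> \<pi> \<upsilon> d0 b \<sigma> \<beta> K" using setting by blast
  then interpret riccati_setting M \<mu> \<rho> \<pi> \<upsilon> d0 b \<sigma> \<beta> K .
  show ?case using 3 by (intro Lp_norm_bound(2)) auto
 next
  case (4 T)
  show ?case
  proof (intro exI[of _ "Sobolev_constant \<beta> \<sigma> \<eta> p T"] conjI allI impI, goal_cases)
   case 1
   show ?case
    unfolding Sobolev_constant_def using 4 by (intro mult_nonneg_nonneg add_nonneg_nonneg sum_nonneg) auto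
  next
   case (2 \<mu> \<psi>)
   then obtain M \<rho> \<pi> \<upsilon> d0 where "riccati_setting M \<mu> \<rho> \<pi> \<upsilon> d0 b \<sigma> \<beta> K" using setting by blast
   then interpret riccati_setting M \<mu> \<rho> \<pi> \<upsilon> d0 b \<sigma> \<beta> K .
   show ?case using assms(2,3) by (intro Sobolev_bound 2 4) auto
  qed
 next
  case (5 \<mu> \<psi> t0)
  then obtain M \<rho> \<pi> \<upsilon> d0 where "riccati_setting M \<mu> \<rho> \<pi> \<upsilon> d0 b \<sigma> \<beta> K" using setting by blast
  then interpret riccati_setting M \<mu> \<rho> \<pi> \<upsilon> d0 b \<sigma> \<beta> K .
  show ?case by (rule solution_continuous[OF 5(3) assms(5) 5(1) assms(3) 5(4,5)])
 qed
qed

end
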